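(* Let $T$ be a cluster tilting object in $\mathrm{GP}\,B$ and let $i\in Q_0$ be a mutable (interior) vertex. If $M\in\mathrm{CM}\,B$ has a generic $\mathrm{add}\,T$-presentation, then $$\boldsymbol\kappa(\mu_i(T),M)=\mathsf L_i\,\boldsymbol\kappa(T,M).$$
   Context: Fix integers $0<k<n$. Let $R=\mathbb C[[t]]$. $C=C(k,n)$ is the path $R$-algebra of the quiver with vertex set $\mathbb Z/n$ and arrows $x_i\colon i-1\to i$, $y_i\colon i\to i-1$ ($i\in\mathbb Z/n$), modulo the relations $xy=t=yx$ and $x^k=y^{n-k}$ starting at every vertex; $e_i$ are the vertex idempotents and $C[t^{-1}]\cong M_n(R[t^{-1}])$. $B$ is an $R$-order with $C\subseteq B\subseteq C[t^{-1}]$, rigid as a left $C$-module ($\mathrm{Ext}^1_C(B,B)=0$). $\mathrm{CM}\,B$ is the category of finitely generated left $B$-modules free over $R$; $\mathrm{GP}\,B=\{M\in\mathrm{CM}\,B:\mathrm{Ext}^i_B(M,B)=0\ \forall i>0\}$, a Frobenius $2$-Calabi--Yau category with a cluster structure (mutation of cluster tilting objects reflects Fomin--Zelevinsky quiver mutation; no loops or 2-cycles at mutable vertices). A cluster tilting object $T$ has $\mathrm{add}\,T=\{X\in\mathrm{GP}\,B:\mathrm{Ext}^1_B(T,X)=0\}$; $B$ is a summand of $T$, the non-projective indecomposable summands are multiplicity free, and $T_i$ ($i\in Q_0$) are its non-isomorphic indecomposable summands. $Q$ is the Gabriel quiver of $A=\mathrm{End}_B(T)^{\mathrm{op}}$: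 arrows $i\to j$ correspond to irreducible maps $T_j\to T_i$ in $\mathrm{add}\,T$. $i$ is mutable (interior) if $T_i$ is not projective; then $\mu_i(T)=(T/T_i)\oplus T_i^*$, with $T_i^*\not\cong T_i$ the unique other indecomposable complement, fitting into exchange sequences $0\to T_i^*\to E_i\to T_i\to0$ and $0\to T_i\to F_i\to T_i^*\to0$ with $E_i=\bigoplus_{j\leftarrow i}T_j$, $F_i=\bigoplus_{j\to i}T_j$. Fix a vertex $*$ of the quiver of $C$. For $M\in\mathrm{CM}\,B$, $\mathsf JM=\mathrm{Hom}_R(e_*B,e_*M)$ with natural embedding $\epsilon_M\colon M\to\mathsf JM$. For $N,M\in\mathrm{CM}\,B$, $\kappa(N,M)$ is the (finite) dimension of the cokernel of $\mathrm{Hom}_B(N,M)\to\mathrm{Hom}_B(N,\mathsf JM)$ induced by $\epsilon_M$, and $\boldsymbol\kappa(T,M)=(\kappa(T_j,M))_{j\in Q_0}\in\mathbb Z^{Q_0}\cong K(\mathrm{fd}\,A)$. For $T'=\mu_i(T)$ and $A'=\mathrm{End}_B(T')^{\mathrm{op}}$, $K(\mathrm{fd}\,A')$ is identified with the same $\mathbb Z^{Q_0}$ (with $T'_i=T_i^*$). An $\mathrm{add}\,T$-presentation of $M$ is a short exact sequence $0\to X\to Y\to M\to0$ with $X,Y\in\mathrm{add}\,T$; it is generic if no indecomposable summand of $T$ is a summand of both $X$ and $Y$. Tropical $\mathbb A$-mutation is the map $\mathsf L_i\colon K(\mathrm{fd}\,A)\to K(\mathrm{fd}\,A')$, $(v_j)\mapsto(v'_j)$,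 with $v'_j=v_j$ for $j\ne i$ and $$v'_i=\min\Bigl\{\sum_{j\leftarrow i}v_j,\ \sum_{j\to i}v_j\Bigr\}-v_i,$$ sums over arrows of $Q$. *)

theory Defs
  imports "HOL-Computational_Algebra.Formal_Power_Series"
    "HOL-Algebra.Module" "HOL-Algebra.QuotRing" "HOL-Algebra.Subrings"
begin

section \<open>The algebra \<open>C(k,n)\<close> over \<open>R = \<complex>[[t]]\<close>\<close>

text \<open>
  \<open>R\<close> is the type \<^typ>\<open>complex fps\<close> with \<open>t\<close> = \<^term>\<open>fps_X\<close>. The vertices \<open>\<int>/n\<close> are
  represented by \<open>{0..<n}\<close>. \<open>Xarr i\<close> is the arrow \<open>x\<^sub>i : i-1 \<rightarrow> i\<close> and \<open>Yarr i\<close> is the arrow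
  \<open>y\<^sub>i : i \<rightarrow> i-1\<close>.
\<close>

datatype arrow = Xarr nat | Yarr nat

fun index :: "arrow \<Rightarrow> nat" where
  "index (Xarr i) = i"
| "index (Yarr i) = i"

fun source :: "nat \<Rightarrow> arrow \<Rightarrow> nat" where
  "source n (Xarr i) = (i + n - 1) mod n"
| "source n (Yarr i) = i"

fun target :: "nat \<Rightarrow> arrow \<Rightarrow> nat" where
  "target n (Xarr i) = i"
| "target n (Yarr i) = (i + n - 1) mod n"

text \<open>A path is its start vertex together with its arrows in the order in which they are traversed.\<close>

type_synonym path = "nat \<times> arrow list"

fun is_walk :: "nat \<Rightarrow> nat \<Rightarrow> arrow list \<Rightarrow> bool" where
  "is_walk n v [] \<longleftrightarrow> v < n"
| "is_walk n v (a # as) \<longleftrightarrow> index a < n \<and> source n a = v \<and> is_walk n (target n a) as"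

fun end_vertex :: "nat \<Rightarrow> nat \<Rightarrow> arrow list \<Rightarrow> nat" where
  "end_vertex n v [] = v"
| "end_vertex n v (a # as) = end_vertex n (target n a) as"

definition scalar :: "nat \<Rightarrow> complex fps \<Rightarrow> path \<Rightarrow> complex fps" where
  "scalar n r = (\<lambda>(v, w). if v < n \<and> w = [] then r else 0)"

definition path_term :: "path \<Rightarrow> complex fps \<Rightarrow> path \<Rightarrow> complex fps" where
  "path_term p r = (\<lambda>q. if q = p then r else 0)"

text \<open>
  Paths are composed like functions (as appropriate for left modules): the product of two paths
  \<open>q p\<close> is ``first \<open>p\<close>, then \<open>q\<close>'' if \<open>p\<close> ends where \<open>q\<close> starts, and \<open>0\<close> otherwise. The sum
  below runs over all ways of splitting the path \<open>(v, w)\<close> accordingly.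
\<close>

definition path_algebra :: "nat \<Rightarrow> (path \<Rightarrow> complex fps) ring" where
  "path_algebra n =
     \<lparr>carrier = {f. finite {p. f p \<noteq> 0} \<and> (\<forall>v w. f (v, w) \<noteq> 0 \<longrightarrow> is_walk n v w)},
      mult = (\<lambda>f g (v, w). \<Sum>l\<le>length w.
                 f (end_vertex n v (take l w), drop l w) * g (v, take l w)),
      one = scalar n 1,
      zero = (\<lambda>_. 0),
      add = (\<lambda>f g p. f p + g p)\<rparr>"

text \<open>At each vertex \<open>v\<close>: \<open>x y = t\<close>, \<open>y x = t\<close> and \<open>x\<^sup>k = y\<^sup>n\<^sup>-\<^sup>k\<close>.\<close>

definition relations :: "nat \<Rightarrow> nat \<Rightarrow> (path \<Rightarrow> complex fps) set" where
  "relations k n = (\<Union>v\<in>{..<n}.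
     {path_term (v, [Yarr v, Xarr v]) 1 \<ominus>\<^bsub>path_algebra n\<^esub> path_term (v, []) fps_X,
      path_term (v, [Xarr ((v + 1) mod n), Yarr ((v + 1) mod n)]) 1
        \<ominus>\<^bsub>path_algebra n\<^esub> path_term (v, []) fps_X,
      path_term (v, map (\<lambda>j. Xarr ((v + j) mod n)) [1..<Suc k]) 1
        \<ominus>\<^bsub>path_algebra n\<^esub> path_term (v, map (\<lambda>j. Yarr ((v + n - j) mod n)) [0..<n - k]) 1})"

definition C_ideal :: "nat \<Rightarrow> nat \<Rightarrow> (path \<Rightarrow> complex fps) set" where
  "C_ideal k n = genideal (path_algebra n) (relations k n)"

definition C_alg :: "nat \<Rightarrow> nat \<Rightarrow> (path \<Rightarrow> complex fps) set ring" where
  "C_alg k n = path_algebra n Quot C_ideal k n"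

definition C_scalar :: "nat \<Rightarrow> nat \<Rightarrow> complex fps \<Rightarrow> (path \<Rightarrow> complex fps) set" where
  "C_scalar k n r = C_ideal k n +>\<^bsub>path_algebra n\<^esub> scalar n r"

definition C_idem :: "nat \<Rightarrow> nat \<Rightarrow> nat \<Rightarrow> (path \<Rightarrow> complex fps) set" where
  "C_idem k n v = C_ideal k n +>\<^bsub>path_algebra n\<^esub> path_term (v, []) 1"

text \<open>
  \<open>\<phi> : A \<rightarrow> D\<close> exhibits \<open>D\<close> as the localisation \<open>A[s\<^sup>-\<^sup>1]\<close> at the powers of a central element \<open>s\<close>.
\<close>

definition is_localisation ::
    "('c, 'x) ring_scheme \<Rightarrow> 'c \<Rightarrow> ('d, 'y) ring_scheme \<Rightarrow> ('c \<Rightarrow> 'd) \<Rightarrow> bool" where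
  "is_localisation A s D \<phi> \<longleftrightarrow>
     ring D \<and> \<phi> \<in> ring_hom A D \<and> \<phi> s \<in> Units D \<and>
     (\<forall>d\<in>carrier D. \<exists>a\<in>carrier A. \<exists>m::nat. d \<otimes>\<^bsub>D\<^esub> (\<phi> s [^]\<^bsub>D\<^esub> m) = \<phi> a) \<and>
     (\<forall>a\<in>carrier A. \<phi> a = \<zero>\<^bsub>D\<^esub> \<longrightarrow> (\<exists>m::nat. a \<otimes>\<^bsub>A\<^esub> (s [^]\<^bsub>A\<^esub> m) = \<zero>\<^bsub>A\<^esub>))"

text \<open>
  \<open>S\<close> is (the carrier of) an \<open>R\<close>-order with \<open>C \<subseteq> S \<subseteq> D = C[t\<^sup>-\<^sup>1]\<close>: a subring that is finitely
  generated over \<open>R\<close>. That \<open>S\<close> spans \<open>D\<close> over \<open>R[t\<^sup>-\<^sup>1]\<close> is automatic, as \<open>C \<subseteq> S\<close>.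
\<close>

definition order_over_C ::
    "nat \<Rightarrow> nat \<Rightarrow> 'd ring \<Rightarrow> ((path \<Rightarrow> complex fps) set \<Rightarrow> 'd) \<Rightarrow> 'd set \<Rightarrow> bool" where
  "order_over_C k n D \<phi> S \<longleftrightarrow>
     subring S D \<and> \<phi> ` carrier (C_alg k n) \<subseteq> S \<and>
     (\<exists>G. finite G \<and> G \<subseteq> S \<and>
        (\<forall>b\<in>S. \<exists>c. b = finsum D (\<lambda>g. \<phi> (C_scalar k n (c g)) \<otimes>\<^bsub>D\<^esub> g) G))"


section \<open>Left modules\<close>

text \<open>
  The library locale \<^locale>\<open>module\<close> requires a commutative ring. Its record type is reused here;
  the fields \<open>mult\<close> and \<open>one\<close> play no role.
\<close>

locale left_module = B?: ring B + M?: abelian_group M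
    for B :: "('a, 'x) ring_scheme" and M :: "('a, 'b, 'y) module_scheme" (structure) +
  assumes smult_closed:
      "\<lbrakk>a \<in> carrier B; x \<in> carrier M\<rbrakk> \<Longrightarrow> a \<odot>\<^bsub>M\<^esub> x \<in> carrier M"
    and smult_l_distr:
      "\<lbrakk>a \<in> carrier B; b \<in> carrier B; x \<in> carrier M\<rbrakk> \<Longrightarrow>
       (a \<oplus>\<^bsub>B\<^esub> b) \<odot>\<^bsub>M\<^esub> x = a \<odot>\<^bsub>M\<^esub> x \<oplus>\<^bsub>M\<^esub> b \<odot>\<^bsub>M\<^esub> x"
    and smult_r_distr:
      "\<lbrakk>a \<in> carrier B; x \<in> carrier M; y \<in> carrier M\<rbrakk> \<Longrightarrow>
       a \<odot>\<^bsub>M\<^esub> (x \<oplus>\<^bsub>M\<^esub> y) = a \<odot>\<^bsub>M\<^esub> x \<oplus>\<^bsub>M\<^esub> a \<odot>\<^bsub>M\<^esub> y"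
    and smult_assoc:
      "\<lbrakk>a \<in> carrier B; b \<in> carrier B; x \<in> carrier M\<rbrakk> \<Longrightarrow>
       (a \<otimes>\<^bsub>B\<^esub> b) \<odot>\<^bsub>M\<^esub> x = a \<odot>\<^bsub>M\<^esub> (b \<odot>\<^bsub>M\<^esub> x)"
    and smult_one:
      "x \<in> carrier M \<Longrightarrow> \<one>\<^bsub>B\<^esub> \<odot>\<^bsub>M\<^esub> x = x"

text \<open>The ring \<open>B\<close> as a left \<open>A\<close>-module along \<open>\<psi> : A \<rightarrow> B\<close>.\<close>

definition ring_as_module :: "('a \<Rightarrow> 'b) \<Rightarrow> 'b ring \<Rightarrow> ('a, 'b) module" where
  "ring_as_module \<psi> B =
     \<lparr>carrier = carrier B, mult = mult B, one = one B, zero = zero B, add = add B,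
      smult = (\<lambda>a b. \<psi> a \<otimes>\<^bsub>B\<^esub> b)\<rparr>"

abbreviation regular :: "'b ring \<Rightarrow> ('b, 'b) module" where
  "regular B \<equiv> ring_as_module (\<lambda>b. b) B"

text \<open>Homomorphisms are taken to be undefined outside the carrier, so that equality is equality of maps.\<close>

definition lhom :: "'b ring \<Rightarrow> ('b, 'm) module \<Rightarrow> ('b, 'n) module \<Rightarrow> ('m \<Rightarrow> 'n) set" where
  "lhom B M N = {f \<in> carrier M \<rightarrow>\<^sub>E carrier N.
     (\<forall>x\<in>carrier M. \<forall>y\<in>carrier M. f (x \<oplus>\<^bsub>M\<^esub> y) = f x \<oplus>\<^bsub>N\<^esub> f y) \<and>
     (\<forall>b\<in>carrier B. \<forall>x\<in>carrier M. f (b \<odot>\<^bsub>M\<^esub> x) = b \<odot>\<^bsub>N\<^esub> f x)}"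

definition lm_iso :: "'b ring \<Rightarrow> ('b, 'm) module \<Rightarrow> ('b, 'n) module \<Rightarrow> bool" where
  "lm_iso B M N \<longleftrightarrow> (\<exists>f\<in>lhom B M N. bij_betw f (carrier M) (carrier N))"

text \<open>
  Direct sum of a finite family, indexed by a set \<open>I\<close>. Multiplicities are expressed by index sets
  \<open>SIGMA j:J. {..<m j}\<close>, so that \<open>dsum (SIGMA j:J. {..<m j}) (M \<circ> fst)\<close> is \<open>\<Oplus>\<^sub>j M\<^sub>j\<^bsup>m j\<^esup>\<close>.
\<close>

definition dsum :: "'i set \<Rightarrow> ('i \<Rightarrow> ('b, 'm) module) \<Rightarrow> ('b, 'i \<Rightarrow> 'm) module" where
  "dsum I F =
     \<lparr>carrier = (\<Pi>\<^sub>E i\<in>I. carrier (F i)), mult = undefined, one = undefined,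
      zero = (\<lambda>i\<in>I. \<zero>\<^bsub>F i\<^esub>),
      add = (\<lambda>x y. \<lambda>i\<in>I. x i \<oplus>\<^bsub>F i\<^esub> y i),
      smult = (\<lambda>b x. \<lambda>i\<in>I. b \<odot>\<^bsub>F i\<^esub> x i)\<rparr>"

definition multiples :: "'i set \<Rightarrow> ('i \<Rightarrow> nat) \<Rightarrow> ('i \<Rightarrow> ('b, 'm) module)
    \<Rightarrow> ('b, 'i \<times> nat \<Rightarrow> 'm) module" where
  "multiples J m F = dsum (SIGMA j:J. {..<m j}) (F \<circ> fst)"

abbreviation power_module :: "('b, 'm) module \<Rightarrow> nat \<Rightarrow> ('b, nat \<Rightarrow> 'm) module" where
  "power_module M m \<equiv> dsum {..<m} (\<lambda>_. M)"

abbreviation free_module :: "'b ring \<Rightarrow> nat \<Rightarrow> ('b, nat \<Rightarrow> 'b) module" where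
  "free_module B m \<equiv> power_module (regular B) m"

text \<open>
  \<open>X\<close> is isomorphic to a direct summand of \<open>Y\<close>, i.e. there is a split monomorphism \<open>s : X \<rightarrow> Y\<close>;
  the complement is the kernel of the retraction \<open>r\<close>.
\<close>

definition is_summand :: "'b ring \<Rightarrow> ('b, 'm) module \<Rightarrow> ('b, 'n) module \<Rightarrow> bool" where
  "is_summand B X Y \<longleftrightarrow> (\<exists>s\<in>lhom B X Y. \<exists>r\<in>lhom B Y X. \<forall>x\<in>carrier X. r (s x) = x)"

definition indecomposable :: "'b ring \<Rightarrow> ('b, 'm) module \<Rightarrow> bool" where
  "indecomposable B M \<longleftrightarrow>
     left_module B M \<and> carrier M \<noteq> {\<zero>\<^bsub>M\<^esub>} \<and>
     (\<forall>U V. submodule U B M \<and> submodule V B M \<and> U \<inter> V = {\<zero>\<^bsub>M\<^esub>} \<and> set_add M U V = carrier M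
        \<longrightarrow> U = {\<zero>\<^bsub>M\<^esub>} \<or> V = {\<zero>\<^bsub>M\<^esub>})"

text \<open>Finitely generated projective modules.\<close>

definition fg_projective :: "'b ring \<Rightarrow> ('b, 'm) module \<Rightarrow> bool" where
  "fg_projective B M \<longleftrightarrow> left_module B M \<and> (\<exists>m. is_summand B M (free_module B m))"

definition fin_generated :: "'b ring \<Rightarrow> ('b, 'm) module \<Rightarrow> bool" where
  "fin_generated B M \<longleftrightarrow> (\<exists>G. finite G \<and> G \<subseteq> carrier M \<and>
     (\<forall>x\<in>carrier M. \<exists>c\<in>G \<rightarrow> carrier B. x = finsum M (\<lambda>g. c g \<odot>\<^bsub>M\<^esub> g) G))"

definition short_exact :: "'b ring \<Rightarrow> ('b, 'x) module \<Rightarrow> ('b, 'y) module \<Rightarrow> ('b, 'z) module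
    \<Rightarrow> ('x \<Rightarrow> 'y) \<Rightarrow> ('y \<Rightarrow> 'z) \<Rightarrow> bool" where
  "short_exact B X Y Z f g \<longleftrightarrow>
     left_module B X \<and> left_module B Y \<and> left_module B Z \<and>
     f \<in> lhom B X Y \<and> g \<in> lhom B Y Z \<and>
     inj_on f (carrier X) \<and> f ` carrier X = {y \<in> carrier Y. g y = \<zero>\<^bsub>Z\<^esub>} \<and>
     g ` carrier Y = carrier Z"


section \<open>Ext\<close>

text \<open>
  A resolution \<open>\<dots> \<rightarrow> B\<^bsup>r 2\<^esup> \<rightarrow> B\<^bsup>r 1\<^esup> \<rightarrow> B\<^bsup>r 0\<^esup> \<rightarrow> M \<rightarrow> 0\<close> with differentials
  \<open>d j : B\<^bsup>r (j+1)\<^esup> \<rightarrow> B\<^bsup>r j\<^esup>\<close>. Finitely generated modules over Noetherian rings, such as orders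
  over \<open>R\<close>, have resolutions by finitely generated free modules.
\<close>

definition free_resolution :: "'b ring \<Rightarrow> ('b, 'm) module \<Rightarrow> (nat \<Rightarrow> nat)
    \<Rightarrow> (nat \<Rightarrow> (nat \<Rightarrow> 'b) \<Rightarrow> nat \<Rightarrow> 'b) \<Rightarrow> ((nat \<Rightarrow> 'b) \<Rightarrow> 'm) \<Rightarrow> bool" where
  "free_resolution B M r d \<epsilon> \<longleftrightarrow>
     \<epsilon> \<in> lhom B (free_module B (r 0)) M \<and>
     (\<forall>j. d j \<in> lhom B (free_module B (r (Suc j))) (free_module B (r j))) \<and>
     \<epsilon> ` carrier (free_module B (r 0)) = carrier M \<and>
     d 0 ` carrier (free_module B (r 1)) = {x \<in> carrier (free_module B (r 0)). \<epsilon> x = \<zero>\<^bsub>M\<^esub>} \<and>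
     (\<forall>j. d (Suc j) ` carrier (free_module B (r (Suc (Suc j)))) =
          {x \<in> carrier (free_module B (r (Suc j))). d j x = \<zero>\<^bsub>free_module B (r j)\<^esub>})"

definition ext_cocycles :: "'b ring \<Rightarrow> (nat \<Rightarrow> nat) \<Rightarrow> (nat \<Rightarrow> (nat \<Rightarrow> 'b) \<Rightarrow> nat \<Rightarrow> 'b)
    \<Rightarrow> ('b, 'n) module \<Rightarrow> nat \<Rightarrow> ((nat \<Rightarrow> 'b) \<Rightarrow> 'n) set" where
  "ext_cocycles B r d N i = {f \<in> lhom B (free_module B (r i)) N.
     \<forall>x\<in>carrier (free_module B (r (Suc i))). f (d i x) = \<zero>\<^bsub>N\<^esub>}"

definition ext_coboundaries :: "'b ring \<Rightarrow> (nat \<Rightarrow> nat) \<Rightarrow> (nat \<Rightarrow> (nat \<Rightarrow> 'b) \<Rightarrow> nat \<Rightarrow> 'b)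
    \<Rightarrow> ('b, 'n) module \<Rightarrow> nat \<Rightarrow> ((nat \<Rightarrow> 'b) \<Rightarrow> 'n) set" where
  "ext_coboundaries B r d N i = (case i of
       0 \<Rightarrow> {\<lambda>x\<in>carrier (free_module B (r 0)). \<zero>\<^bsub>N\<^esub>}
     | Suc j \<Rightarrow> (\<lambda>g. compose (carrier (free_module B (r i))) g (d j)) `
                 lhom B (free_module B (r j)) N)"

text \<open>\<open>Ext\<^bsup>i\<^esup>\<^sub>B(M, N) = 0\<close>, computed as cohomology of \<open>Hom\<^sub>B(P\<^sub>\<bullet>, N)\<close> for a resolution \<open>P\<^sub>\<bullet>\<close> of \<open>M\<close>.\<close>

definition ext_vanishes :: "'b ring \<Rightarrow> nat \<Rightarrow> ('b, 'm) module \<Rightarrow> ('b, 'n) module \<Rightarrow> bool" where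
  "ext_vanishes B i M N \<longleftrightarrow> (\<exists>r d \<epsilon>. free_resolution B M r d \<epsilon> \<and>
     ext_cocycles B r d N i = ext_coboundaries B r d N i)"


section \<open>Homomorphism modules and dimensions\<close>

text \<open>
  From here on \<open>B\<close> is an \<open>R\<close>-algebra with structure map \<open>\<rho> : R \<rightarrow> B\<close> (landing in the centre), so
  that \<open>Hom\<^sub>B(M, N)\<close> is an \<open>R\<close>-module.
\<close>

definition hom_module :: "'b ring \<Rightarrow> (complex fps \<Rightarrow> 'b) \<Rightarrow> ('b, 'm) module \<Rightarrow> ('b, 'n) module
    \<Rightarrow> (complex fps, 'm \<Rightarrow> 'n) module" where
  "hom_module B \<rho> M N =
     \<lparr>carrier = lhom B M N, mult = undefined, one = undefined,
      zero = (\<lambda>x\<in>carrier M. \<zero>\<^bsub>N\<^esub>),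
      add = (\<lambda>f g. \<lambda>x\<in>carrier M. f x \<oplus>\<^bsub>N\<^esub> g x),
      smult = (\<lambda>a f. \<lambda>x\<in>carrier M. \<rho> a \<odot>\<^bsub>N\<^esub> f x)\<rparr>"

definition quot_module :: "('a, 'v) module \<Rightarrow> 'v set \<Rightarrow> ('a, 'v set) module" where
  "quot_module V W =
     \<lparr>carrier = a_rcosets\<^bsub>V\<^esub> W, mult = undefined, one = undefined,
      zero = W, add = set_add V,
      smult = (\<lambda>a A. \<Union>v\<in>A. W +>\<^bsub>V\<^esub> (a \<odot>\<^bsub>V\<^esub> v))\<rparr>"

text \<open>Dimension over \<open>\<complex> \<subseteq> R\<close> of an \<open>R\<close>-module that is finite-dimensional over \<open>\<complex>\<close>.\<close>

definition is_basis :: "(complex fps, 'v) module \<Rightarrow> nat \<Rightarrow> (nat \<Rightarrow> 'v) \<Rightarrow> bool" where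
  "is_basis V d b \<longleftrightarrow> (\<forall>l<d. b l \<in> carrier V) \<and>
     (\<forall>v\<in>carrier V. \<exists>!c. c \<in> {..<d} \<rightarrow>\<^sub>E (UNIV :: complex set) \<and>
        v = finsum V (\<lambda>l. fps_const (c l) \<odot>\<^bsub>V\<^esub> b l) {..<d})"

definition cdim :: "(complex fps, 'v) module \<Rightarrow> nat" where
  "cdim V = (THE d. \<exists>b. is_basis V d b)"


section \<open>\<open>CM B\<close>, \<open>GP B\<close> and cluster tilting objects\<close>

definition CM :: "'b ring \<Rightarrow> (complex fps \<Rightarrow> 'b) \<Rightarrow> ('b, 'm) module set" where
  "CM B \<rho> = {M. left_module B M \<and> fin_generated B M \<and>
     (\<exists>d b. (\<forall>l<d. b l \<in> carrier M) \<and>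
        (\<forall>x\<in>carrier M. \<exists>!c. c \<in> {..<d::nat} \<rightarrow>\<^sub>E UNIV \<and>
           x = finsum M (\<lambda>l. \<rho> (c l) \<odot>\<^bsub>M\<^esub> b l) {..<d}))}"

definition GP :: "'b ring \<Rightarrow> (complex fps \<Rightarrow> 'b) \<Rightarrow> ('b, 'm) module set" where
  "GP B \<rho> = {M \<in> CM B \<rho>. \<forall>i>0. ext_vanishes B i M (regular B)}"

text \<open>
  Where one quantifies over all objects of \<open>CM B\<close>, modules are taken with carrier inside
  \<^typ>\<open>nat \<Rightarrow> complex fps\<close>. Every object of \<open>CM B\<close> is isomorphic to such a module, since it is
  isomorphic to some \<open>R\<^sup>d\<close> over \<open>R\<close>.
\<close>

type_synonym univ = "nat \<Rightarrow> complex fps"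

definition addcat :: "'b ring \<Rightarrow> ('b, univ) module \<Rightarrow> ('b, univ) module set" where
  "addcat B T = {X. left_module B X \<and> (\<exists>m. is_summand B X (power_module T m))}"

definition cluster_tilting :: "'b ring \<Rightarrow> (complex fps \<Rightarrow> 'b) \<Rightarrow> ('b, univ) module \<Rightarrow> bool" where
  "cluster_tilting B \<rho> T \<longleftrightarrow>
     T \<in> GP B \<rho> \<and> is_summand B (regular B) T \<and>
     addcat B T = {X \<in> GP B \<rho>. ext_vanishes B 1 T X}"

text \<open>
  \<open>T \<cong> \<Oplus>\<^sub>j\<^sub>\<in>\<^sub>Q\<^sub>0 T\<^sub>j\<^bsup>m j\<^esup>\<close> with pairwise non-isomorphic indecomposable \<open>T\<^sub>j\<close>, the non-projective ones
  occurring with multiplicity one.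
\<close>

definition decomposition :: "'b ring \<Rightarrow> ('b, univ) module \<Rightarrow> 'q set \<Rightarrow> ('q \<Rightarrow> nat)
    \<Rightarrow> ('q \<Rightarrow> ('b, univ) module) \<Rightarrow> bool" where
  "decomposition B T Q0 m Ts \<longleftrightarrow>
     finite Q0 \<and>
     (\<forall>j\<in>Q0. indecomposable B (Ts j) \<and> 0 < m j \<and> (\<not> fg_projective B (Ts j) \<longrightarrow> m j = 1)) \<and>
     (\<forall>j\<in>Q0. \<forall>l\<in>Q0. j \<noteq> l \<longrightarrow> \<not> lm_iso B (Ts j) (Ts l)) \<and>
     lm_iso B T (multiples Q0 m Ts)"

text \<open>The radical of the category of \<open>B\<close>-modules, and the square of the radical of \<open>add T\<close>.\<close>

definition rad :: "'b ring \<Rightarrow> ('b, 'm) module \<Rightarrow> ('b, 'n) module \<Rightarrow> ('m \<Rightarrow> 'n) set" where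
  "rad B X Y = {f \<in> lhom B X Y. \<forall>g\<in>lhom B Y X.
     bij_betw (\<lambda>x. x \<ominus>\<^bsub>X\<^esub> g (f x)) (carrier X) (carrier X)}"

definition rad2 :: "'b ring \<Rightarrow> ('b, univ) module \<Rightarrow> ('b, univ) module \<Rightarrow> ('b, univ) module
    \<Rightarrow> (univ \<Rightarrow> univ) set" where
  "rad2 B T X Y = {compose (carrier X) g f | Z f g. Z \<in> addcat B T \<and> f \<in> rad B X Z \<and> g \<in> rad B Z Y}"

text \<open>
  Number of arrows \<open>i \<rightarrow> j\<close> in the Gabriel quiver of \<open>End\<^sub>B(T)\<^sup>o\<^sup>p\<close>: the dimension of the space
  \<open>rad(T\<^sub>j, T\<^sub>i) / rad\<^sup>2(T\<^sub>j, T\<^sub>i)\<close> of irreducible maps \<open>T\<^sub>j \<rightarrow> T\<^sub>i\<close> in \<open>add T\<close>.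
\<close>

definition arrows :: "'b ring \<Rightarrow> (complex fps \<Rightarrow> 'b) \<Rightarrow> ('b, univ) module
    \<Rightarrow> ('q \<Rightarrow> ('b, univ) module) \<Rightarrow> 'q \<Rightarrow> 'q \<Rightarrow> nat" where
  "arrows B \<rho> T Ts i j =
     cdim (quot_module (hom_module B \<rho> (Ts j) (Ts i)\<lparr>carrier := rad B (Ts j) (Ts i)\<rparr>)
                       (rad2 B T (Ts j) (Ts i)))"

text \<open>
  \<open>T' = \<mu>\<^sub>i(T) = (T/T\<^sub>i) \<oplus> T\<^sub>i\<^sup>*\<close>, where \<open>T\<^sub>i\<^sup>*\<close> is the other complement of \<open>T/T\<^sub>i\<close>, with its
  exchange sequences \<open>0 \<rightarrow> T\<^sub>i\<^sup>* \<rightarrow> E\<^sub>i \<rightarrow> T\<^sub>i \<rightarrow> 0\<close> and \<open>0 \<rightarrow> T\<^sub>i \<rightarrow> F\<^sub>i \<rightarrow> T\<^sub>i\<^sup>* \<rightarrow> 0\<close>; the middle terms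
  are sums over the arrows \<open>i \<rightarrow> j\<close>, respectively \<open>j \<rightarrow> i\<close>.
\<close>

definition mutation :: "'b ring \<Rightarrow> (complex fps \<Rightarrow> 'b) \<Rightarrow> ('b, univ) module \<Rightarrow> 'q set
    \<Rightarrow> ('q \<Rightarrow> nat) \<Rightarrow> ('q \<Rightarrow> ('b, univ) module) \<Rightarrow> 'q
    \<Rightarrow> ('b, univ) module \<Rightarrow> ('b, univ) module \<Rightarrow> bool" where
  "mutation B \<rho> T Q0 m Ts i T' Tstar \<longleftrightarrow>
     cluster_tilting B \<rho> T' \<and> decomposition B T' Q0 m (Ts(i := Tstar)) \<and>
     \<not> lm_iso B Tstar (Ts i) \<and>
     (\<exists>f g. short_exact B Tstar (multiples Q0 (\<lambda>j. arrows B \<rho> T Ts i j) Ts) (Ts i) f g) \<and>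
     (\<exists>f g. short_exact B (Ts i) (multiples Q0 (\<lambda>j. arrows B \<rho> T Ts j i) Ts) Tstar f g)"

definition generic_presentation :: "'b ring \<Rightarrow> ('b, univ) module \<Rightarrow> ('b, univ) module
    \<Rightarrow> ('b, univ) module \<Rightarrow> ('b, 'm) module \<Rightarrow> (univ \<Rightarrow> univ) \<Rightarrow> (univ \<Rightarrow> 'm) \<Rightarrow> bool" where
  "generic_presentation B T X Y M f g \<longleftrightarrow>
     X \<in> addcat B T \<and> Y \<in> addcat B T \<and> short_exact B X Y M f g \<and>
     (\<forall>Z :: ('b, univ) module. indecomposable B Z \<and> is_summand B Z T \<longrightarrow>
        \<not> (is_summand B Z X \<and> is_summand B Z Y))"


section \<open>The invariant \<open>\<kappa>\<close> and tropical mutation\<close>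

text \<open>
  \<open>e\<close> is the idempotent \<open>e\<^sub>*\<close>. The left \<open>B\<close>-action on \<open>J M = Hom\<^sub>R(e\<^sub>* B, e\<^sub>* M)\<close> comes from right
  multiplication on \<open>e\<^sub>* B\<close>, and \<open>\<epsilon>\<^sub>M\<close> sends \<open>m\<close> to \<open>x \<mapsto> x m\<close>.
\<close>

definition corner :: "'b ring \<Rightarrow> 'b \<Rightarrow> 'b set" where
  "corner B e = (\<lambda>b. e \<otimes>\<^bsub>B\<^esub> b) ` carrier B"

definition J_module :: "'b ring \<Rightarrow> (complex fps \<Rightarrow> 'b) \<Rightarrow> 'b \<Rightarrow> ('b, 'm) module
    \<Rightarrow> ('b, 'b \<Rightarrow> 'm) module" where
  "J_module B \<rho> e M =
     \<lparr>carrier = {f \<in> corner B e \<rightarrow>\<^sub>E (\<lambda>x. e \<odot>\<^bsub>M\<^esub> x) ` carrier M.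
        (\<forall>x\<in>corner B e. \<forall>y\<in>corner B e. f (x \<oplus>\<^bsub>B\<^esub> y) = f x \<oplus>\<^bsub>M\<^esub> f y) \<and>
        (\<forall>a. \<forall>x\<in>corner B e. f (\<rho> a \<otimes>\<^bsub>B\<^esub> x) = \<rho> a \<odot>\<^bsub>M\<^esub> f x)},
      mult = undefined, one = undefined,
      zero = (\<lambda>x\<in>corner B e. \<zero>\<^bsub>M\<^esub>),
      add = (\<lambda>f g. \<lambda>x\<in>corner B e. f x \<oplus>\<^bsub>M\<^esub> g x),
      smult = (\<lambda>b f. \<lambda>x\<in>corner B e. f (x \<otimes>\<^bsub>B\<^esub> b))\<rparr>"

definition J_embed :: "'b ring \<Rightarrow> 'b \<Rightarrow> ('b, 'm) module \<Rightarrow> 'm \<Rightarrow> 'b \<Rightarrow> 'm" where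
  "J_embed B e M = (\<lambda>m\<in>carrier M. \<lambda>x\<in>corner B e. x \<odot>\<^bsub>M\<^esub> m)"

definition kappa :: "'b ring \<Rightarrow> (complex fps \<Rightarrow> 'b) \<Rightarrow> 'b \<Rightarrow> ('b, 'n) module \<Rightarrow> ('b, 'm) module
    \<Rightarrow> nat" where
  "kappa B \<rho> e N M =
     cdim (quot_module (hom_module B \<rho> N (J_module B \<rho> e M))
                       ((\<lambda>f. compose (carrier N) (J_embed B e M) f) ` lhom B N M))"

definition kappa_vec :: "'b ring \<Rightarrow> (complex fps \<Rightarrow> 'b) \<Rightarrow> 'b \<Rightarrow> 'q set
    \<Rightarrow> ('q \<Rightarrow> ('b, 'n) module) \<Rightarrow> ('b, 'm) module \<Rightarrow> 'q \<Rightarrow> int" where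
  "kappa_vec B \<rho> e Q0 Ts M = (\<lambda>j\<in>Q0. int (kappa B \<rho> e (Ts j) M))"

text \<open>Here \<open>q i j\<close> is the number of arrows \<open>i \<rightarrow> j\<close>.\<close>

definition tropical_mutation :: "'q set \<Rightarrow> ('q \<Rightarrow> 'q \<Rightarrow> nat) \<Rightarrow> 'q \<Rightarrow> ('q \<Rightarrow> int) \<Rightarrow> 'q \<Rightarrow> int" where
  "tropical_mutation Q0 q i v =
     v(i := min (\<Sum>j\<in>Q0. int (q i j) * v j) (\<Sum>j\<in>Q0. int (q j i) * v j) - v i)"

end

theory Submission
  imports Defs "HOL-Library.Function_Algebras" "HOL-Number_Theory.Cong"
    "HOL-Computational_Algebra.Polynomial"
begin

text \<open>
  Over \<open>R\<close>, a map \<open>N \<rightarrow> J M\<close> is the same as an \<open>R\<close>-linear map \<open>e N \<rightarrow> e M\<close>, so \<open>\<kappa>(N, M)\<close> is the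
  codimension of \<open>Hom\<^sub>B(N, M)\<close> in \<open>Hom\<^sub>R(e N, e M)\<close>. It is finite because, after inverting \<open>t\<close>, the
  order \<open>B\<close> is a matrix algebra. As \<open>Hom\<^sub>R(e -, e M)\<close> is exact on sequences that split over \<open>R\<close>
  while \<open>Hom\<^sub>B(-, M)\<close> is only left exact, a sequence \<open>0 \<rightarrow> U \<rightarrow> V \<rightarrow> W \<rightarrow> 0\<close> gives
  \<open>\<kappa>(U, M) + \<kappa>(W, M) \<le> \<kappa>(V, M)\<close>, with equality if every map \<open>U \<rightarrow> M\<close> extends to \<open>V\<close>. Applied to
  the two exchange sequences this bounds \<open>\<kappa>(T\<^sub>i, M) + \<kappa>(T\<^sub>i\<^sup>*, M)\<close> by both sums in the tropical
  mutation.

  By genericity \<open>T\<^sub>i\<close> is not a summand of \<open>T\<^sub>1\<close> or not a summand of \<open>T\<^sub>0\<close>, in the presentation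
  \<open>0 \<rightarrow> T\<^sub>1 \<rightarrow> T\<^sub>0 \<rightarrow> M \<rightarrow> 0\<close>. In the first case \<open>T\<^sub>1\<close> is in \<open>add T'\<close>, so \<open>Ext\<^sup>1(T\<^sub>i\<^sup>*, T\<^sub>1) = 0\<close>: maps
  \<open>T\<^sub>i\<^sup>* \<rightarrow> M\<close> lift to \<open>T\<^sub>0\<close>, and the lifts extend to \<open>E\<^sub>i\<close> because \<open>Ext\<^sup>1(T\<^sub>i, T\<^sub>0) = 0\<close>; hence equality
  for the first sequence. The second case gives equality for the other one. That a module in \<open>add T\<close>
  without the summand \<open>T\<^sub>i\<close> lies in \<open>add T'\<close> follows from the locality of \<open>End\<^sub>B(T\<^sub>i)\<close>, which comes from
  Fitting's lemma over the complete ring \<open>R\<close>.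
\<close>

section \<open>Dimensions of quotients\<close>

text \<open>Two facts about \<open>e\<close> carry the finiteness and the exactness:
  \<open>e B e\<close> is \<open>R e\<close> up to powers of \<open>t\<close>, and
  \<open>t^n\<close> is a sum of products that pass through \<open>e\<close>. Hence an R-linear map
  from eN to eM becomes the restriction of a B-linear map once multiplied by \<open>t^n\<close>, and
  a B-linear map into M is determined by its values on eN. The exponent n is a uniform price: going
  along l arrows \<open>x\<close> and back costs \<open>t^l\<close>, and padding by
  \<open>t^(n-l)\<close> makes all vertices cost the same.

  The obstacle is the encoding. \<open>cdim\<close> is a definite description over bases of a
  quotient record, whereas counting dimensions along exact sequences wants genuine vector spaces.
  Homomorphisms are therefore recorded as functions into vectors of power series, and the
  codimension of one space of functions in another is a relation that also asserts finiteness.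

  To discard \<open>T_i\<close> from a module of add T, its identity is written as a sum of maps
  through indecomposables. By locality either the term through \<open>T_i\<close> splits off
  \<open>T_i\<close>, or it can be subtracted and the remaining sum is still invertible.\<close>

lemma homogeneous_system_solution:
  fixes a :: "'j \<Rightarrow> nat \<Rightarrow> 'f::field"
  assumes "finite J" "d < card J"
  shows "\<exists>c. (\<exists>j\<in>J. c j \<noteq> 0) \<and> (\<forall>l<d. (\<Sum>j\<in>J. c j * a j l) = 0)"
  using assms
proof (induction d arbitrary: J a)
  case 0
  then have "J \<noteq> {}" by auto
  then show ?case by (auto intro!: exI[of _ "\<lambda>_. 1"])
next
  case (Suc d)
  show ?case
  proof (cases "\<forall>j\<in>J. a j d = 0")
    case True
    obtain c where "\<exists>j\<in>J. c j \<noteq> 0" "\<forall>l<d. (\<Sum>j\<in>J. c j * a j l) = 0"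
      using Suc.IH[of J a] Suc.prems by auto
    then show ?thesis using True by (auto intro!: exI[of _ c] simp: less_Suc_eq)
  next
    case False
    then obtain j0 where j0: "j0 \<in> J" "a j0 d \<noteq> 0" by auto
    \<comment> \<open>A row operation with pivot row j0: it clears column d and leaves fewer rows
      for the first d columns. The coefficient of the pivot row is recovered in \<open>c\<close>
      below.\<close>
    define a' where "a' j l = a j l - (a j d / a j0 d) * a j0 l" for j l
    obtain c' where c': "\<exists>j\<in>J - {j0}. c' j \<noteq> 0" "\<forall>l<d. (\<Sum>j\<in>J - {j0}. c' j * a' j l) = 0"
      using Suc.IH[where J = "J - {j0}" and a = a'] Suc.prems j0 by (auto simp: less_diff_conv)
    define c where "c j = (if j = j0 then - (\<Sum>j\<in>J - {j0}. c' j * (a j d / a j0 d)) else c' j)" for j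
    have eq: "(\<Sum>j\<in>J. c j * a j l) = (\<Sum>j\<in>J - {j0}. c' j * a' j l)" for l
    proof -
      have "(\<Sum>j\<in>J. c j * a j l) = c j0 * a j0 l + (\<Sum>j\<in>J - {j0}. c j * a j l)"
        using Suc.prems j0 by (simp add: sum.remove)
      also have "(\<Sum>j\<in>J - {j0}. c j * a j l) = (\<Sum>j\<in>J - {j0}. c' j * a j l)"
        by (rule sum.cong) (auto simp: c_def)
      also have "c j0 * a j0 l + \<dots> = (\<Sum>j\<in>J - {j0}. c' j * a' j l)"
        by (simp add: c_def a'_def sum_distrib_left right_diff_distrib sum_subtractf mult_ac)
      finally show ?thesis .
    qed
    have "a' j d = 0" for j using j0 by (simp add: a'_def)
    with c' eq have "\<forall>l<Suc d. (\<Sum>j\<in>J. c j * a j l) = 0" by (auto simp: less_Suc_eq)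
    moreover have "\<exists>j\<in>J. c j \<noteq> 0" using c'(1) by (auto simp: c_def)
    ultimately show ?thesis by blast
  qed
qed

lemma sum_lessThan_add:
  fixes m n :: nat
  shows "(\<Sum>l<m + n. F l) = (\<Sum>l<m. F l) + (\<Sum>l<n. F (m + l))"
  by (induction n) (simp_all add: add.assoc)

section \<open>Linear algebra modulo a subspace\<close>

definition spans_mod :: "('f::field \<Rightarrow> 'w::ab_group_add \<Rightarrow> 'w) \<Rightarrow> 'w set \<Rightarrow> 'w set \<Rightarrow> nat \<Rightarrow> (nat \<Rightarrow> 'w) \<Rightarrow> bool" where
  "spans_mod s L H d b \<longleftrightarrow> (\<forall>l<d. b l \<in> L) \<and> (\<forall>v\<in>L. \<exists>c. v - (\<Sum>l<d. s (c l) (b l)) \<in> H)"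

definition indep_mod :: "('f::field \<Rightarrow> 'w::ab_group_add \<Rightarrow> 'w) \<Rightarrow> 'w set \<Rightarrow> nat \<Rightarrow> (nat \<Rightarrow> 'w) \<Rightarrow> bool" where
  "indep_mod s H d b \<longleftrightarrow> (\<forall>c. (\<Sum>l<d. s (c l) (b l)) \<in> H \<longrightarrow> (\<forall>l<d. c l = 0))"

text \<open>The dimension of L/H, without forming the quotient. As a relation it asserts finiteness
  together with the value, so no default number can stand for an infinite dimension.\<close>

definition codim :: "('f::field \<Rightarrow> 'w::ab_group_add \<Rightarrow> 'w) \<Rightarrow> 'w set \<Rightarrow> 'w set \<Rightarrow> nat \<Rightarrow> bool" where
  "codim s L H d \<longleftrightarrow> (\<exists>b. spans_mod s L H d b \<and> indep_mod s H d b)"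

context vector_space
begin

text \<open>Steinitz modulo H: more than d expansions in a spanning family of length d have
  coefficient rows with a nontrivial relation, and that relation puts a combination of the b' into
  H.\<close>

lemma indep_le_spans:
  assumes H: "subspace H" and b: "spans_mod scale L H d b"
    and b': "\<forall>l<d'. b' l \<in> L" "indep_mod scale H d' b'"
  shows "d' \<le> d"
proof (rule ccontr)
  assume "\<not> d' \<le> d"
  have "\<exists>c. b' j - (\<Sum>l<d. scale (c l) (b l)) \<in> H" if "j < d'" for j
    using that b b' by (auto simp: spans_mod_def)
  then obtain a where a: "b' j - (\<Sum>l<d. scale (a j l) (b l)) \<in> H" if "j < d'" for j
    by metis
  obtain c where c: "\<exists>j\<in>{..<d'}. c j \<noteq> 0" "\<forall>l<d. (\<Sum>j<d'. c j * a j l) = 0"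
    using homogeneous_system_solution[of "{..<d'}" d a] \<open>\<not> d' \<le> d\<close> by auto
  have "(\<Sum>j<d'. scale (c j) (b' j - (\<Sum>l<d. scale (a j l) (b l)))) \<in> H"
    using a by (intro subspace_sum[OF H] subspace_scale[OF H]) auto
  also have "(\<Sum>j<d'. scale (c j) (b' j - (\<Sum>l<d. scale (a j l) (b l)))) =
      (\<Sum>j<d'. scale (c j) (b' j)) - (\<Sum>j<d'. \<Sum>l<d. scale (c j * a j l) (b l))"
    by (simp add: scale_right_diff_distrib sum_subtractf scale_sum_right)
  also have "(\<Sum>j<d'. \<Sum>l<d. scale (c j * a j l) (b l)) = (\<Sum>l<d. scale (\<Sum>j<d'. c j * a j l) (b l))"
    by (subst sum.swap) (simp add: scale_sum_left)
  also have "\<dots> = 0" using c(2) by simp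
  finally have "(\<Sum>j<d'. scale (c j) (b' j)) \<in> H" by simp
  with b'(2) c(1) show False by (auto simp: indep_mod_def)
qed

lemma codim_unique:
  assumes "subspace H" "codim scale L H d" "codim scale L H d'"
  shows "d = d'"
  using assms indep_le_spans[OF assms(1)] unfolding codim_def
  by (meson le_antisym spans_mod_def)

text \<open>A shortest spanning family is independent, since a relation modulo H would express one
  member through the others.\<close>

lemma codim_exists:
  assumes H: "subspace H" and "spans_mod scale L H d b"
  shows "\<exists>d. codim scale L H d"
proof -
  define d0 where "d0 = (LEAST d. \<exists>b. spans_mod scale L H d b)"
  have "\<exists>b. spans_mod scale L H d0 b"
    unfolding d0_def by (rule LeastI[of _ d]) (use assms in auto)
  then obtain b where b: "spans_mod scale L H d0 b" by auto
  have "indep_mod scale H d0 b"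
    unfolding indep_mod_def
  proof (intro allI impI, rule ccontr)
    fix c j assume c: "(\<Sum>l<d0. scale (c l) (b l)) \<in> H" and j: "j < d0" "c j \<noteq> 0"
    then obtain d1 where d1: "d0 = Suc d1" by (cases d0) auto
    \<comment> \<open>The transposition of j and the last index d1. After it, dropping member j is
      mere truncation of the family.\<close>
    define f where "f l = (if l = j then d1 else if l = d1 then j else l)" for l
    have f: "bij_betw f {..<d0} {..<d0}"
      by (rule bij_betw_byWitness[where f' = f]) (use j d1 in \<open>auto simp: f_def\<close>)
    have re: "(\<Sum>l<d0. scale (c' l) (b l)) = (\<Sum>l<d1. scale (c' (f l)) (b (f l))) + scale (c' j) (b j)" for c'
    proof -
      have "(\<Sum>l<d0. scale (c' l) (b l)) = (\<Sum>l<d0. scale (c' (f l)) (b (f l)))"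
        by (rule sum.reindex_bij_betw[OF f, symmetric])
      then show ?thesis using d1 by (simp add: f_def[of d1])
    qed
    have "spans_mod scale L H d1 (b \<circ> f)"
      unfolding spans_mod_def
    proof (intro conjI ballI allI impI)
      fix l assume "l < d1"
      then have "f l < d0" using bij_betwE[OF f] d1 by auto
      then show "(b \<circ> f) l \<in> L" using b by (auto simp: spans_mod_def)
    next
      fix v assume "v \<in> L"
      then obtain a where a: "v - (\<Sum>l<d0. scale (a l) (b l)) \<in> H" using b by (auto simp: spans_mod_def)
      \<comment> \<open>Subtracting r times the relation makes the coefficient of \<open>b j\<close>
        vanish.\<close>
      define r where "r = a j / c j"
      have "v - (\<Sum>l<d0. scale (a l) (b l)) + scale r (\<Sum>l<d0. scale (c l) (b l)) \<in> H"
        by (intro subspace_add[OF H] subspace_scale[OF H] a c)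
      also have "v - (\<Sum>l<d0. scale (a l) (b l)) + scale r (\<Sum>l<d0. scale (c l) (b l)) =
        v - (\<Sum>l<d0. scale (a l - r * c l) (b l))"
        by (simp add: scale_sum_right scale_left_diff_distrib sum_subtractf)
      also have "\<dots> = v - (\<Sum>l<d1. scale (a (f l) - r * c (f l)) ((b \<circ> f) l))"
        using j unfolding re[of "\<lambda>l. a l - r * c l"] by (simp add: r_def)
      finally show "\<exists>c. v - (\<Sum>l<d1. scale (c l) ((b \<circ> f) l)) \<in> H" by (rule exI[of _ "\<lambda>l. a (f l) - r * c (f l)"])
    qed
    then have "d0 \<le> d1" unfolding d0_def by (intro Least_le) auto
    with d1 show False by simp
  qed
  with b show ?thesis by (auto simp: codim_def)
qed

end

text \<open>For a short exact sequence U, V, W of modules, L stands for R-linear and H for B-linear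
  maps into M. Both are contravariant, so q goes from W to V and p from V to U. The assumption
  \<open>qH\<close> makes LW/HW embed in LV/HV. That p maps HV only into HU is the failure of right
  exactness, and it is what leaves an inequality between the dimensions.\<close>

locale quotient_sequence =
  U: vector_space sU + V: vector_space sV + W: vector_space sW
  for sU :: "'f::field \<Rightarrow> 'u::ab_group_add \<Rightarrow> 'u" and sV :: "'f \<Rightarrow> 'v::ab_group_add \<Rightarrow> 'v"
    and sW :: "'f \<Rightarrow> 'w::ab_group_add \<Rightarrow> 'w" +
  fixes LU HU LV HV LW HW p q
  assumes HU: "U.subspace HU" and HV: "V.subspace HV" and HW: "W.subspace HW"
    and LU: "U.subspace LU" and LV: "V.subspace LV" and LW: "W.subspace LW"
    and HLU: "HU \<subseteq> LU" and HLV: "HV \<subseteq> LV" and HLW: "HW \<subseteq> LW"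
    and p: "module_hom sV sU p" and q: "module_hom sW sV q"
    and p_onto: "p ` LV = LU" and q_into: "q ` LW \<subseteq> LV"
    and exact: "\<And>v. v \<in> LV \<Longrightarrow> p v = 0 \<Longrightarrow> v \<in> q ` LW" "\<And>w. w \<in> LW \<Longrightarrow> p (q w) = 0"
    and pH: "p ` HV \<subseteq> HU" and qH: "\<And>w. w \<in> LW \<Longrightarrow> q w \<in> HV \<longleftrightarrow> w \<in> HW"
begin

interpretation p: module_hom sV sU p by (rule p)
interpretation q: module_hom sW sV q by (rule q)

text \<open>Lift a basis of LU/HU along p and append the q-image of a basis of LW/HW. Independence
  needs only p(HV) inside HU; spanning needs equality.\<close>

lemma independent_family:
  assumes "codim sU LU HU dU" "codim sW LW HW dW"
  obtains b where "\<forall>l<dU + dW. b l \<in> LV" "indep_mod sV HV (dU + dW) b"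
    "p ` HV = HU \<Longrightarrow> spans_mod sV LV HV (dU + dW) b"
proof -
  obtain bU where bU: "spans_mod sU LU HU dU bU" "indep_mod sU HU dU bU"
    using assms by (auto simp: codim_def)
  obtain bW where bW: "spans_mod sW LW HW dW bW" "indep_mod sW HW dW bW"
    using assms by (auto simp: codim_def)
  have "\<exists>v. v \<in> LV \<and> p v = bU l" if "l < dU" for l
    using that bU(1) p_onto by (force simp: spans_mod_def)
  then obtain b' where b': "\<And>l. l < dU \<Longrightarrow> b' l \<in> LV" "\<And>l. l < dU \<Longrightarrow> p (b' l) = bU l" by metis
  define b where "b l = (if l < dU then b' l else q (bW (l - dU)))" for l
  have sum: "(\<Sum>l<dU + dW. sV (c l) (b l)) =
      (\<Sum>l<dU. sV (c l) (b' l)) + q (\<Sum>l<dW. sW (c (dU + l)) (bW l))" for c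
    by (simp add: sum_lessThan_add b_def q.sum q.scale)
  have bWL: "(\<Sum>l<dW. sW (c l) (bW l)) \<in> LW" for c
    using bW by (intro W.subspace_sum[OF LW] W.subspace_scale[OF LW]) (auto simp: spans_mod_def)
  have psum: "p (\<Sum>l<dU. sV (c l) (b' l)) = (\<Sum>l<dU. sU (c l) (bU l))" for c
    by (simp add: p.sum p.scale b')
  have b'L: "(\<Sum>l<dU. sV (c l) (b' l)) \<in> LV" for c
    using b' by (intro V.subspace_sum[OF LV] V.subspace_scale[OF LV]) auto
  have 1: "\<forall>l<dU + dW. b l \<in> LV"
    using b' q_into bW(1) by (auto simp: b_def spans_mod_def image_subset_iff)
  have 2: "indep_mod sV HV (dU + dW) b"
    unfolding indep_mod_def
  proof (rule allI, rule impI)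
    fix c assume c: "(\<Sum>l<dU + dW. sV (c l) (b l)) \<in> HV"
    then have "p (\<Sum>l<dU + dW. sV (c l) (b l)) \<in> HU" using pH by auto
    then have "(\<Sum>l<dU. sU (c l) (bU l)) \<in> HU"
      unfolding sum p.add psum using exact(2)[OF bWL, of "\<lambda>l. c (dU + l)"] by simp
    then have c0: "\<forall>l<dU. c l = 0" using bU(2) by (auto simp: indep_mod_def)
    then have "(\<Sum>l<dU. sV (c l) (b' l)) = 0" by simp
    with c sum have "q (\<Sum>l<dW. sW (c (dU + l)) (bW l)) \<in> HV" by simp
    then have "(\<Sum>l<dW. sW (c (dU + l)) (bW l)) \<in> HW" using qH[OF bWL] by simp
    then have "\<forall>l<dW. c (dU + l) = 0" using bW(2) unfolding indep_mod_def by (elim allE[of _ "\<lambda>l. c (dU + l)"]) auto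
    with c0 show "\<forall>l<dU + dW. c l = 0"
      by (metis add_diff_inverse_nat add_less_cancel_left)
  qed
  have 3: "spans_mod sV LV HV (dU + dW) b" if onto: "p ` HV = HU"
    unfolding spans_mod_def
  proof (intro conjI ballI 1)
    fix v assume v: "v \<in> LV"
    then have "p v \<in> LU" using p_onto by auto
    then obtain c where c: "p v - (\<Sum>l<dU. sU (c l) (bU l)) \<in> HU"
      using bU(1) by (auto simp: spans_mod_def)
    then obtain h where h: "h \<in> HV" "p v - (\<Sum>l<dU. sU (c l) (bU l)) = p h"
      using onto by (metis imageE)
    \<comment> \<open>Subtracting h as well makes the remainder vanish under p exactly, not just
      modulo HU, so that it comes from W.\<close>
    let ?v = "v - (\<Sum>l<dU. sV (c l) (b' l)) - h"
    have "p ?v = 0" using h psum by (simp add: p.diff)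
    moreover have "?v \<in> LV" using v b'L h HLV by (intro V.subspace_diff[OF LV]) auto
    ultimately obtain w where w: "w \<in> LW" "?v = q w" using exact(1) by blast
    then obtain c' where c': "w - (\<Sum>l<dW. sW (c' l) (bW l)) \<in> HW"
      using bW(1) by (auto simp: spans_mod_def)
    have "q (w - (\<Sum>l<dW. sW (c' l) (bW l))) \<in> HV"
      by (rule qH[THEN iffD2]) (use w c' bWL LW W.subspace_diff in auto)
    then have "q (w - (\<Sum>l<dW. sW (c' l) (bW l))) + h \<in> HV" using h HV V.subspace_add by auto
    also have "q (w - (\<Sum>l<dW. sW (c' l) (bW l))) + h =
      v - (\<Sum>l<dU + dW. sV (if l < dU then c l else c' (l - dU)) (b l))"
      unfolding sum[of "\<lambda>l. if l < dU then c l else c' (l - dU)"] using w(2) by (simp add: q.diff algebra_simps)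
    finally show "\<exists>c. v - (\<Sum>l<dU + dW. sV (c l) (b l)) \<in> HV" by (rule exI[of _ "\<lambda>l. if l < dU then c l else c' (l - dU)"])
  qed
  from 1 2 3 show ?thesis by (rule that)
qed

lemma codim_le:
  assumes "codim sU LU HU dU" "codim sW LW HW dW" "codim sV LV HV dV"
  shows "dU + dW \<le> dV"
proof -
  obtain b where "\<forall>l<dU + dW. b l \<in> LV" "indep_mod sV HV (dU + dW) b"
    using independent_family[OF assms(1,2)] by metis
  then show ?thesis using assms(3) V.indep_le_spans[OF HV] by (auto simp: codim_def)
qed

lemma codim_add:
  assumes "codim sU LU HU dU" "codim sW LW HW dW" "p ` HV = HU"
  shows "codim sV LV HV (dU + dW)"
  using independent_family[OF assms(1,2)] assms(3) unfolding codim_def by metis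

end

section \<open>Reading \<open>cdim\<close> of a quotient record as a codimension\<close>

lemma ex1_eqI: "\<exists>!x. P x \<Longrightarrow> P a \<Longrightarrow> P b \<Longrightarrow> a = b"
  by blast

text \<open>\<open>\<theta>\<close> embeds a record module into a vector space of the type class.
  Only the constants of R have to act compatibly, because \<open>cdim\<close> counts over the
  complex numbers.\<close>

locale quotient_coordinates = vector_space s + V: abelian_group V
  for s :: "complex \<Rightarrow> 'w::ab_group_add \<Rightarrow> 'w" and V :: "(complex fps, 'v) module" +
  fixes W :: "'v set" and \<theta> :: "'v \<Rightarrow> 'w"
  assumes smult_closed: "x \<in> carrier V \<Longrightarrow> fps_const c \<odot>\<^bsub>V\<^esub> x \<in> carrier V"
    and add: "x \<in> carrier V \<Longrightarrow> y \<in> carrier V \<Longrightarrow> \<theta> (x \<oplus>\<^bsub>V\<^esub> y) = \<theta> x + \<theta> y"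
    and scale: "x \<in> carrier V \<Longrightarrow> \<theta> (fps_const c \<odot>\<^bsub>V\<^esub> x) = s c (\<theta> x)"
    and inj: "inj_on \<theta> (carrier V)"
    and W: "W \<subseteq> carrier V" "subspace (\<theta> ` W)"
begin

lemma theta_zero: "\<theta> \<zero>\<^bsub>V\<^esub> = 0"
  using add[of "\<zero>\<^bsub>V\<^esub>" "\<zero>\<^bsub>V\<^esub>"] by simp

lemma theta_minus: "x \<in> carrier V \<Longrightarrow> \<theta> (\<ominus>\<^bsub>V\<^esub> x) = - \<theta> x"
  using add[of "\<ominus>\<^bsub>V\<^esub> x" x] by (simp add: theta_zero V.l_neg eq_neg_iff_add_eq_0)

lemma mem_W_iff: "x \<in> carrier V \<Longrightarrow> x \<in> W \<longleftrightarrow> \<theta> x \<in> \<theta> ` W"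
  using inj W(1) by (auto dest: inj_onD)

sublocale W: abelian_subgroup W V
proof (rule abelian_subgroupI3)
  show "additive_subgroup W V"
  proof (rule additive_subgroup.intro, rule subgroup.intro, simp_all)
    show "W \<subseteq> carrier V" by (rule W)
    show "\<zero>\<^bsub>V\<^esub> \<in> W" using mem_W_iff[of "\<zero>\<^bsub>V\<^esub>"] theta_zero subspace_0[OF W(2)] by simp
    fix x assume x: "x \<in> W"
    have "\<theta> (\<ominus>\<^bsub>V\<^esub> x) \<in> \<theta> ` W" using x W theta_minus[of x] subspace_neg[OF W(2)] by auto
    then have "\<ominus>\<^bsub>V\<^esub> x \<in> W" using mem_W_iff[of "\<ominus>\<^bsub>V\<^esub> x"] x W(1) by auto
    then show "inv\<^bsub>add_monoid V\<^esub> x \<in> W" by (simp add: a_inv_def)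
    fix y assume y: "y \<in> W"
    have "\<theta> (x \<oplus>\<^bsub>V\<^esub> y) \<in> \<theta> ` W"
      using subspace_add[OF W(2) imageI[OF x] imageI[OF y]] x y W(1) by (simp add: add subset_iff)
    then show "x \<oplus>\<^bsub>V\<^esub> y \<in> W" using mem_W_iff[of "x \<oplus>\<^bsub>V\<^esub> y"] x y W(1) by auto
  qed
qed (rule V.abelian_group_axioms)

lemma coset_eq_iff:
  assumes "x \<in> carrier V" "y \<in> carrier V"
  shows "W +>\<^bsub>V\<^esub> x = W +>\<^bsub>V\<^esub> y \<longleftrightarrow> \<theta> x - \<theta> y \<in> \<theta> ` W"
proof -
  have "W +>\<^bsub>V\<^esub> x = W +>\<^bsub>V\<^esub> y \<longleftrightarrow> x \<in> W +>\<^bsub>V\<^esub> y"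
    using assms W.a_rcos_self W.a_repr_independence' by blast
  also have "\<dots> \<longleftrightarrow> x \<ominus>\<^bsub>V\<^esub> y \<in> W"
    using W.a_rcos_module[of y x] assms by (simp add: a_minus_def)
  also have "\<dots> \<longleftrightarrow> \<theta> x - \<theta> y \<in> \<theta> ` W"
    using assms mem_W_iff[of "x \<ominus>\<^bsub>V\<^esub> y"] by (simp add: a_minus_def add theta_minus)
  finally show ?thesis .
qed

sublocale Q: abelian_group "quot_module V W"
proof -
  interpret F: comm_group "V A_Mod W" by (rule W.a_factorgroup_is_comm_group)
  have eq: "carrier (V A_Mod W) = a_rcosets\<^bsub>V\<^esub> W" "mult (V A_Mod W) = set_add V" "one (V A_Mod W) = W"
    by (simp_all add: A_FactGroup_def FactGroup_def A_RCOSETS_def set_add_def fun_eq_iff)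
  show "abelian_group (quot_module V W)"
    using F.m_closed F.one_closed F.m_assoc F.m_comm F.l_one F.l_inv_ex
    by (intro abelian_groupI) (simp_all add: quot_module_def eq)
qed

lemma quot_smult:
  assumes "x \<in> carrier V"
  shows "fps_const c \<odot>\<^bsub>quot_module V W\<^esub> (W +>\<^bsub>V\<^esub> x) = W +>\<^bsub>V\<^esub> (fps_const c \<odot>\<^bsub>V\<^esub> x)"
proof -
  have "W +>\<^bsub>V\<^esub> (fps_const c \<odot>\<^bsub>V\<^esub> y) = W +>\<^bsub>V\<^esub> (fps_const c \<odot>\<^bsub>V\<^esub> x)" if "y \<in> W +>\<^bsub>V\<^esub> x" for y
  proof -
    have y: "y \<in> carrier V" using that assms W.a_elemrcos_carrier by blast
    have "W +>\<^bsub>V\<^esub> y = W +>\<^bsub>V\<^esub> x" using that W.a_repr_independence' assms by blast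
    then have "\<theta> y - \<theta> x \<in> \<theta> ` W" using coset_eq_iff assms y by simp
    then have "s c (\<theta> y - \<theta> x) \<in> \<theta> ` W" using subspace_scale[OF W(2)] by simp
    then show ?thesis using assms y by (simp add: coset_eq_iff smult_closed scale scale_right_diff_distrib)
  qed
  moreover have "x \<in> W +>\<^bsub>V\<^esub> x" using assms W.a_rcos_self by blast
  ultimately have "(\<Union>y\<in>W +>\<^bsub>V\<^esub> x. W +>\<^bsub>V\<^esub> (fps_const c \<odot>\<^bsub>V\<^esub> y)) = W +>\<^bsub>V\<^esub> (fps_const c \<odot>\<^bsub>V\<^esub> x)"
    by (metis (no_types, lifting) SUP_eq_const empty_iff)
  then show ?thesis by (simp add: quot_module_def)
qed

lemma theta_finsum:
  "finite A \<Longrightarrow> v \<in> A \<rightarrow> carrier V \<Longrightarrow> \<theta> (finsum V v A) = (\<Sum>l\<in>A. \<theta> (v l))"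
  by (induction A rule: finite_induct) (auto simp: theta_zero add Pi_iff)

lemma coset_closed: "x \<in> carrier V \<Longrightarrow> W +>\<^bsub>V\<^esub> x \<in> carrier (quot_module V W)"
  using V.a_rcosetsI[OF W(1)] by (simp add: quot_module_def)

lemma quot_finsum:
  "finite A \<Longrightarrow> v \<in> A \<rightarrow> carrier V \<Longrightarrow>
    finsum (quot_module V W) (\<lambda>l. W +>\<^bsub>V\<^esub> v l) A = W +>\<^bsub>V\<^esub> finsum V v A"
proof (induction A rule: finite_induct)
  case empty
  have "\<zero>\<^bsub>quot_module V W\<^esub> = W" by (simp add: quot_module_def)
  then show ?case using V.a_coset_add_zero[OF W(1)] by simp
next
  case (insert a A)
  have "add (quot_module V W) = set_add V" by (simp add: quot_module_def)
  with insert show ?case using coset_closed by (auto simp: Pi_iff W.a_rcos_sum)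
qed

lemma quot_combination:
  fixes d :: nat
  assumes "\<forall>l<d. b l \<in> carrier V" "v \<in> carrier V"
  shows "W +>\<^bsub>V\<^esub> v = finsum (quot_module V W)
      (\<lambda>l. fps_const (c l) \<odot>\<^bsub>quot_module V W\<^esub> (W +>\<^bsub>V\<^esub> b l)) {..<d} \<longleftrightarrow>
    \<theta> v - (\<Sum>l<d. s (c l) (\<theta> (b l))) \<in> \<theta> ` W"
proof -
  have "finsum (quot_module V W) (\<lambda>l. fps_const (c l) \<odot>\<^bsub>quot_module V W\<^esub> (W +>\<^bsub>V\<^esub> b l)) {..<d} =
      finsum (quot_module V W) (\<lambda>l. W +>\<^bsub>V\<^esub> (fps_const (c l) \<odot>\<^bsub>V\<^esub> b l)) {..<d}"
    by (rule Q.finsum_cong') (use assms in \<open>auto simp: quot_smult intro!: coset_closed smult_closed\<close>)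
  also have "\<dots> = W +>\<^bsub>V\<^esub> finsum V (\<lambda>l. fps_const (c l) \<odot>\<^bsub>V\<^esub> b l) {..<d}"
    by (rule quot_finsum) (use assms in \<open>auto intro!: smult_closed\<close>)
  finally have eq: "finsum (quot_module V W) (\<lambda>l. fps_const (c l) \<odot>\<^bsub>quot_module V W\<^esub> (W +>\<^bsub>V\<^esub> b l)) {..<d} =
    W +>\<^bsub>V\<^esub> finsum V (\<lambda>l. fps_const (c l) \<odot>\<^bsub>V\<^esub> b l) {..<d}" .
  have "\<theta> (finsum V (\<lambda>l. fps_const (c l) \<odot>\<^bsub>V\<^esub> b l) {..<d}) = (\<Sum>l<d. s (c l) (\<theta> (b l)))"
    by (subst theta_finsum) (use assms in \<open>auto intro!: smult_closed sum.cong simp: scale\<close>)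
  moreover have "finsum V (\<lambda>l. fps_const (c l) \<odot>\<^bsub>V\<^esub> b l) {..<d} \<in> carrier V"
    by (rule V.finsum_closed) (use assms in \<open>auto intro!: smult_closed\<close>)
  ultimately show ?thesis unfolding eq using coset_eq_iff assms(2) by simp
qed

text \<open>Existence of coefficients is spanning, uniqueness is independence; both are read on
  representatives instead of cosets.\<close>

lemma is_basis_iff:
  assumes b: "\<forall>l<d. b l \<in> carrier V"
  shows "is_basis (quot_module V W) d (\<lambda>l. W +>\<^bsub>V\<^esub> b l) \<longleftrightarrow>
    spans_mod s (\<theta> ` carrier V) (\<theta> ` W) d (\<theta> \<circ> b) \<and> indep_mod s (\<theta> ` W) d (\<theta> \<circ> b)"
proof -
  let ?P = "\<lambda>v c. \<theta> v - (\<Sum>l<d. s (c l) (\<theta> (b l))) \<in> \<theta> ` W"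
  \<comment> \<open>\<open>is_basis\<close> quantifies over coefficient functions that are undefined
    from d on. Passing to the restriction does not change the combination.\<close>
  have cong: "?P v (restrict c {..<d}) = ?P v c" for v c
    by simp
  have "carrier (quot_module V W) = (\<lambda>v. W +>\<^bsub>V\<^esub> v) ` carrier V"
    unfolding quot_module_def A_RCOSETS_def' by auto
  then have 1: "is_basis (quot_module V W) d (\<lambda>l. W +>\<^bsub>V\<^esub> b l) \<longleftrightarrow>
      (\<forall>v\<in>carrier V. \<exists>!c. c \<in> {..<d} \<rightarrow>\<^sub>E UNIV \<and> ?P v c)"
    unfolding is_basis_def using b by (auto simp: quot_combination[OF b])
  also have "\<dots> \<longleftrightarrow>
    spans_mod s (\<theta> ` carrier V) (\<theta> ` W) d (\<theta> \<circ> b) \<and> indep_mod s (\<theta> ` W) d (\<theta> \<circ> b)" (is "?L \<longleftrightarrow> ?S \<and> ?I")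
  proof (intro iffI conjI)
    assume L: ?L
    then show ?S using b unfolding spans_mod_def by fastforce
    show ?I unfolding indep_mod_def
    proof (intro allI impI)
      fix c l assume "(\<Sum>l<d. s (c l) ((\<theta> \<circ> b) l)) \<in> \<theta> ` W" and l: "l < d"
      then have "- (\<Sum>l<d. s (c l) ((\<theta> \<circ> b) l)) \<in> \<theta> ` W" using subspace_neg[OF W(2)] by blast
      \<comment> \<open>A relation and the zero family are two expansions of the zero vector, so
        uniqueness identifies them.\<close>
      then have "?P \<zero>\<^bsub>V\<^esub> (restrict c {..<d})" unfolding cong by (simp add: theta_zero)
      moreover have "?P \<zero>\<^bsub>V\<^esub> (restrict (\<lambda>_. 0) {..<d})"
        unfolding cong using subspace_0[OF W(2)] by (simp add: theta_zero)
      moreover have "\<exists>!c. c \<in> {..<d} \<rightarrow>\<^sub>E UNIV \<and> ?P \<zero>\<^bsub>V\<^esub> c" using L by simp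
      ultimately have "restrict c {..<d} = restrict (\<lambda>_. 0) {..<d}"
        by (intro ex1_eqI[of "\<lambda>c. c \<in> {..<d} \<rightarrow>\<^sub>E UNIV \<and> ?P \<zero>\<^bsub>V\<^esub> c"]) simp_all
      from fun_cong[OF this, of l] show "c l = 0" using l by simp
    qed
  next
    assume SI: "?S \<and> ?I"
    show ?L
    proof
      fix v assume v: "v \<in> carrier V"
      then have "\<exists>c. ?P v c" using SI by (auto simp: spans_mod_def)
      then obtain c where c: "?P v c" ..
      show "\<exists>!c. c \<in> {..<d} \<rightarrow>\<^sub>E UNIV \<and> ?P v c"
      proof (rule ex1I[of _ "restrict c {..<d}"])
        show "restrict c {..<d} \<in> {..<d} \<rightarrow>\<^sub>E UNIV \<and> ?P v (restrict c {..<d})"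
          using c by simp
        fix c' assume c': "c' \<in> {..<d} \<rightarrow>\<^sub>E UNIV \<and> ?P v c'"
        have "(\<theta> v - (\<Sum>l<d. s (c l) (\<theta> (b l)))) - (\<theta> v - (\<Sum>l<d. s (c' l) (\<theta> (b l)))) \<in> \<theta> ` W"
          using c c' subspace_diff[OF W(2)] by blast
        then have "(\<Sum>l<d. s (c' l - c l) ((\<theta> \<circ> b) l)) \<in> \<theta> ` W"
          by (simp add: scale_left_diff_distrib sum_subtractf)
        then have "\<forall>l<d. c' l - c l = 0"
          by (rule conjunct2[OF SI, unfolded indep_mod_def, THEN spec, THEN mp])
        with c' show "c' = restrict c {..<d}" by (auto simp: restrict_def PiE_def extensional_def)
      qed
    qed
  qed
  finally show ?thesis .
qed

text \<open>The definite description is resolved from both sides: a basis modulo W gives a basis of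
  cosets, and every basis of cosets lifts to representatives, whose number is fixed by
  \<open>codim_unique\<close>.\<close>

lemma cdim_quot_module:
  assumes "codim s (\<theta> ` carrier V) (\<theta> ` W) d"
  shows "cdim (quot_module V W) = d"
  unfolding cdim_def
proof (rule the_equality)
  obtain b where b: "spans_mod s (\<theta> ` carrier V) (\<theta> ` W) d b" "indep_mod s (\<theta> ` W) d b"
    using assms by (auto simp: codim_def)
  then have "\<exists>x. x \<in> carrier V \<and> b l = \<theta> x" if "l < d" for l
    using that by (auto simp: spans_mod_def)
  then obtain b' where b': "\<forall>l<d. b' l \<in> carrier V" "\<forall>l<d. b l = \<theta> (b' l)" by metis
  have "spans_mod s (\<theta> ` carrier V) (\<theta> ` W) d (\<theta> \<circ> b')" "indep_mod s (\<theta> ` W) d (\<theta> \<circ> b')"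
    using b b' by (auto simp: spans_mod_def indep_mod_def)
  then show "\<exists>b. is_basis (quot_module V W) d b" using is_basis_iff[OF b'(1)] by blast
next
  fix d' assume "\<exists>b. is_basis (quot_module V W) d' b"
  then obtain b where b: "is_basis (quot_module V W) d' b" by auto
  have "carrier (quot_module V W) = (\<lambda>v. W +>\<^bsub>V\<^esub> v) ` carrier V"
    unfolding quot_module_def A_RCOSETS_def' by auto
  then have "\<exists>x. x \<in> carrier V \<and> b l = W +>\<^bsub>V\<^esub> x" if "l < d'" for l
    using that conjunct1[OF b[unfolded is_basis_def]] by blast
  then obtain b' where b': "\<forall>l<d'. b' l \<in> carrier V" "\<forall>l<d'. b l = W +>\<^bsub>V\<^esub> b' l" by metis
  have clos: "fps_const c \<odot>\<^bsub>quot_module V W\<^esub> (W +>\<^bsub>V\<^esub> b' l) \<in> carrier (quot_module V W)" if "l < d'" for c l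
    using that b' by (simp add: quot_smult coset_closed smult_closed)
  have eq: "finsum (quot_module V W) (\<lambda>l. fps_const (c l) \<odot>\<^bsub>quot_module V W\<^esub> b l) {..<d'} =
      finsum (quot_module V W) (\<lambda>l. fps_const (c l) \<odot>\<^bsub>quot_module V W\<^esub> (W +>\<^bsub>V\<^esub> b' l)) {..<d'}" for c
    by (rule Q.finsum_cong') (use b' clos in auto)
  have "is_basis (quot_module V W) d' (\<lambda>l. W +>\<^bsub>V\<^esub> b' l)"
    unfolding is_basis_def
  proof (rule conjI)
    show "\<forall>l<d'. W +>\<^bsub>V\<^esub> b' l \<in> carrier (quot_module V W)" using b'(1) coset_closed by blast
  qed (rule conjunct2[OF b[unfolded is_basis_def], unfolded eq])
  then have "codim s (\<theta> ` carrier V) (\<theta> ` W) d'"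
    using is_basis_iff[OF b'(1)] by (auto simp: codim_def)
  then show "d' = d" using codim_unique[OF W(2) assms] by simp
qed

end

section \<open>The path algebra\<close>

lemma end_vertex_append: "end_vertex n v (xs @ ys) = end_vertex n (end_vertex n v xs) ys"
  by (induction xs arbitrary: v) auto

lemma end_vertex_less: "0 < n \<Longrightarrow> is_walk n v w \<Longrightarrow> end_vertex n v w < n"
proof (induction w arbitrary: v)
  case (Cons a w)
  then show ?case by simp
qed simp

lemma is_walk_append:
  "0 < n \<Longrightarrow> is_walk n v (xs @ ys) \<longleftrightarrow> is_walk n v xs \<and> is_walk n (end_vertex n v xs) ys"
proof (induction xs arbitrary: v)
  case Nil
  have "is_walk n v ys \<Longrightarrow> v < n" by (cases ys; cases "hd ys") (use Nil in auto)
  then show ?case by auto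
qed auto

lemma is_walk_start: "0 < n \<Longrightarrow> is_walk n v w \<Longrightarrow> v < n"
  using is_walk_append[of n v "[]" w] by simp

lemma path_carrier: "f \<in> carrier (path_algebra n) \<longleftrightarrow> finite {p. f p \<noteq> 0} \<and> (\<forall>v w. f (v, w) \<noteq> 0 \<longrightarrow> is_walk n v w)"
  by (simp add: path_algebra_def)

lemma path_mult: "(f \<otimes>\<^bsub>path_algebra n\<^esub> g) (v, w) =
    (\<Sum>l\<le>length w. f (end_vertex n v (take l w), drop l w) * g (v, take l w))"
  by (simp add: path_algebra_def)

lemma path_add: "(f \<oplus>\<^bsub>path_algebra n\<^esub> g) p = f p + g p"
  by (simp add: path_algebra_def)

lemma path_zero: "\<zero>\<^bsub>path_algebra n\<^esub> = (\<lambda>_. 0)"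
  by (simp add: path_algebra_def)

lemma path_one: "\<one>\<^bsub>path_algebra n\<^esub> = scalar n 1"
  by (simp add: path_algebra_def)

lemma path_mult_closed:
  assumes n: "0 < n" and f: "f \<in> carrier (path_algebra n)" and g: "g \<in> carrier (path_algebra n)"
  shows "f \<otimes>\<^bsub>path_algebra n\<^esub> g \<in> carrier (path_algebra n)"
proof -
  \<comment> \<open>Concatenation, the path of the right factor first. Every path in the support of
    the product arises this way, which bounds the support.\<close>
  let ?j = "\<lambda>(p, q). (fst q, snd q @ snd p) :: path"
  have nz: "\<exists>l. f (end_vertex n v (take l w), drop l w) \<noteq> 0 \<and> g (v, take l w) \<noteq> 0"
    if "(f \<otimes>\<^bsub>path_algebra n\<^esub> g) (v, w) \<noteq> 0" for v w
    using that unfolding path_mult by (metis (no_types, lifting) mult_eq_0_iff sum.neutral)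
  have "{p. (f \<otimes>\<^bsub>path_algebra n\<^esub> g) p \<noteq> 0} \<subseteq> ?j ` ({p. f p \<noteq> 0} \<times> {p. g p \<noteq> 0})"
  proof
    fix p assume p: "p \<in> {p. (f \<otimes>\<^bsub>path_algebra n\<^esub> g) p \<noteq> 0}"
    obtain v w where vw: "p = (v, w)" by (cases p)
    obtain l where l: "f (end_vertex n v (take l w), drop l w) \<noteq> 0" "g (v, take l w) \<noteq> 0"
      using nz[of v w] p vw by auto
    then show "p \<in> ?j ` ({p. f p \<noteq> 0} \<times> {p. g p \<noteq> 0})"
      by (intro image_eqI[of _ _ "((end_vertex n v (take l w), drop l w), (v, take l w))"]) (auto simp: vw)
  qed
  moreover have "is_walk n v w" if fg: "(f \<otimes>\<^bsub>path_algebra n\<^esub> g) (v, w) \<noteq> 0" for v w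
  proof -
    obtain l where "f (end_vertex n v (take l w), drop l w) \<noteq> 0" "g (v, take l w) \<noteq> 0"
      using nz[OF fg] by auto
    then have "is_walk n v (take l w @ drop l w)"
      using f g n by (subst is_walk_append) (auto simp: path_carrier)
    then show ?thesis by simp
  qed
  ultimately show ?thesis
    using f g unfolding path_carrier by (meson finite_SigmaI finite_imageI finite_subset)
qed

text \<open>Both sides sum over the ways to cut a path at two places. On the left the first cut is
  the outer index, on the right the second one is; the two orders of summation over the triangle
  agree.\<close>

lemma path_mult_assoc:
  "(f \<otimes>\<^bsub>path_algebra n\<^esub> g) \<otimes>\<^bsub>path_algebra n\<^esub> h = f \<otimes>\<^bsub>path_algebra n\<^esub> (g \<otimes>\<^bsub>path_algebra n\<^esub> h)"
proof (rule ext, clarify)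
  fix v w
  let ?e = "\<lambda>l. end_vertex n v (take l w)"
  define F where "F l l2 = f (?e (l + l2), drop (l + l2) w) * g (?e l, take l2 (drop l w)) * h (v, take l w)" for l l2
  have "((f \<otimes>\<^bsub>path_algebra n\<^esub> g) \<otimes>\<^bsub>path_algebra n\<^esub> h) (v, w) =
      (\<Sum>l\<le>length w. \<Sum>l2\<le>length w - l. F l l2)"
    by (simp add: path_mult F_def take_add end_vertex_append sum_distrib_right add.commute)
  also have "\<dots> = (\<Sum>(l, l2)\<in>{(l, l2). l + l2 \<le> length w}. F l l2)"
    by (subst sum.Sigma) (auto intro!: sum.cong)
  also have "\<dots> = (\<Sum>l'\<le>length w. \<Sum>l\<le>l'. F l (l' - l))"
    by (rule sum.triangle_reindex_eq)
  also have "\<dots> = (f \<otimes>\<^bsub>path_algebra n\<^esub> (g \<otimes>\<^bsub>path_algebra n\<^esub> h)) (v, w)"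
    by (simp add: path_mult F_def sum_distrib_left min_absorb1 min_absorb2 drop_take mult.assoc cong: sum.cong_simp)
  finally show "((f \<otimes>\<^bsub>path_algebra n\<^esub> g) \<otimes>\<^bsub>path_algebra n\<^esub> h) (v, w) =
    (f \<otimes>\<^bsub>path_algebra n\<^esub> (g \<otimes>\<^bsub>path_algebra n\<^esub> h)) (v, w)" .
qed

lemma scalar_mult:
  assumes "0 < n" "f \<in> carrier (path_algebra n)"
  shows "scalar n r \<otimes>\<^bsub>path_algebra n\<^esub> f = (\<lambda>p. r * f p)"
proof (rule ext, clarify)
  fix v w
  have "(scalar n r \<otimes>\<^bsub>path_algebra n\<^esub> f) (v, w) =
      (\<Sum>l\<le>length w. if l = length w then (if end_vertex n v w < n then r * f (v, w) else 0) else 0)"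
    unfolding path_mult by (rule sum.cong) (auto simp: scalar_def)
  also have "\<dots> = r * f (v, w)"
    using assms end_vertex_less by (auto simp: path_carrier)
  finally show "(scalar n r \<otimes>\<^bsub>path_algebra n\<^esub> f) (v, w) = r * f (v, w)" .
qed

lemma mult_scalar:
  assumes "0 < n" "f \<in> carrier (path_algebra n)"
  shows "f \<otimes>\<^bsub>path_algebra n\<^esub> scalar n r = (\<lambda>p. r * f p)"
proof (rule ext, clarify)
  fix v w
  have "(f \<otimes>\<^bsub>path_algebra n\<^esub> scalar n r) (v, w) =
      (\<Sum>l\<le>length w. if l = 0 then (if v < n then r * f (v, w) else 0) else 0)"
    unfolding path_mult by (rule sum.cong) (auto simp: scalar_def)
  also have "v < n" if "f (v, w) \<noteq> 0"
    using assms that by (auto simp: path_carrier intro: is_walk_start)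
  then have "(\<Sum>l\<le>length w. if l = 0 then (if v < n then r * f (v, w) else 0) else 0) = r * f (v, w)"
    by auto
  finally show "(f \<otimes>\<^bsub>path_algebra n\<^esub> scalar n r) (v, w) = r * f (v, w)" .
qed

lemma scalar_closed: "scalar n r \<in> carrier (path_algebra n)"
proof -
  have "{p. scalar n r p \<noteq> 0} \<subseteq> {..<n} \<times> {[]}" by (auto simp: scalar_def split: if_splits)
  then show ?thesis unfolding path_carrier
    by (auto simp: scalar_def split: if_splits intro: finite_subset)
qed

lemma path_term_closed: "is_walk n v w \<Longrightarrow> path_term (v, w) r \<in> carrier (path_algebra n)"
  by (auto simp: path_carrier path_term_def)

lemma path_algebra_ring:
  assumes n: "0 < n"
  shows "ring (path_algebra n)"
proof (rule ringI)
  show "abelian_group (path_algebra n)"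
  proof (rule abelian_groupI)
    fix f assume f: "f \<in> carrier (path_algebra n)"
    show "\<exists>g\<in>carrier (path_algebra n). g \<oplus>\<^bsub>path_algebra n\<^esub> f = \<zero>\<^bsub>path_algebra n\<^esub>"
      by (rule bexI[of _ "\<lambda>p. - f p"]) (use f in \<open>auto simp: path_algebra_def\<close>)
    fix g assume g: "g \<in> carrier (path_algebra n)"
    have "{p. f p + g p \<noteq> 0} \<subseteq> {p. f p \<noteq> 0} \<union> {p. g p \<noteq> 0}" by auto
    moreover have "f p + g p \<noteq> 0 \<Longrightarrow> f p \<noteq> 0 \<or> g p \<noteq> 0" for p by auto
    ultimately show "f \<oplus>\<^bsub>path_algebra n\<^esub> g \<in> carrier (path_algebra n)"
      using f g unfolding path_carrier path_add by (meson finite_UnI finite_subset)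
  qed (auto simp: path_algebra_def add_ac)
  show "monoid (path_algebra n)"
    by (rule monoidI) (auto simp: path_mult_assoc path_mult_closed path_one scalar_closed scalar_mult mult_scalar n)
qed (auto simp: fun_eq_iff path_mult path_add distrib_left distrib_right sum.distrib)

lemma scalar_hom: "0 < n \<Longrightarrow> scalar n r \<otimes>\<^bsub>path_algebra n\<^esub> scalar n r' = scalar n (r * r')"
  by (subst scalar_mult) (auto simp: scalar_closed, auto simp: scalar_def fun_eq_iff)

lemma scalar_add: "scalar n r \<oplus>\<^bsub>path_algebra n\<^esub> scalar n r' = scalar n (r + r')"
  by (auto simp: fun_eq_iff path_add scalar_def)

lemma scalar_path_term:
  "0 < n \<Longrightarrow> is_walk n v w \<Longrightarrow> scalar n r \<otimes>\<^bsub>path_algebra n\<^esub> path_term (v, w) c = path_term (v, w) (r * c)"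
  by (subst scalar_mult[OF _ path_term_closed]) (auto simp: path_term_def fun_eq_iff)

lemma path_term_mult:
  "path_term (u, w2) 1 \<otimes>\<^bsub>path_algebra n\<^esub> path_term (v, w1) 1 =
    (if end_vertex n v w1 = u then path_term (v, w1 @ w2) 1 else \<zero>\<^bsub>path_algebra n\<^esub>)"
proof (rule ext, clarify)
  fix v' w
  have "(path_term (u, w2) 1 \<otimes>\<^bsub>path_algebra n\<^esub> path_term (v, w1) 1) (v', w) =
    (\<Sum>l\<le>length w. if l = length w1 then
       (if v' = v \<and> w = w1 @ w2 \<and> end_vertex n v w1 = u then 1 else 0) else 0)"
    unfolding path_mult
  proof (rule sum.cong)
    fix l assume l: "l \<in> {..length w}"
    have iff: "take l w = w1 \<and> drop l w = w2 \<longleftrightarrow> l = length w1 \<and> w = w1 @ w2"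
      using l by (auto simp: min_def)
    have "path_term (u, w2) 1 (end_vertex n v' (take l w), drop l w) * path_term (v, w1) 1 (v', take l w) =
      (if (take l w = w1 \<and> drop l w = w2) \<and> v' = v \<and> end_vertex n v w1 = u then 1 else 0)"
      by (auto simp: path_term_def)
    then show "path_term (u, w2) 1 (end_vertex n v' (take l w), drop l w) * path_term (v, w1) 1 (v', take l w) =
      (if l = length w1 then (if v' = v \<and> w = w1 @ w2 \<and> end_vertex n v w1 = u then 1 else 0) else 0)"
      unfolding iff by simp
  qed simp
  also have "\<dots> = (if end_vertex n v w1 = u then path_term (v, w1 @ w2) 1 else \<zero>\<^bsub>path_algebra n\<^esub>) (v', w)"
    by (auto simp: path_term_def path_zero)
  finally show "(path_term (u, w2) 1 \<otimes>\<^bsub>path_algebra n\<^esub> path_term (v, w1) 1) (v', w) =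
    (if end_vertex n v w1 = u then path_term (v, w1 @ w2) 1 else \<zero>\<^bsub>path_algebra n\<^esub>) (v', w)" .
qed

text \<open>Induction on the finite support. A term is written as scalar times path so that a ring
  homomorphism turns it into a product.\<close>

lemma path_algebra_induct [consumes 2, case_names zero add]:
  assumes n: "0 < n" and f: "f \<in> carrier (path_algebra n)"
    and zero: "P \<zero>\<^bsub>path_algebra n\<^esub>"
    and add: "\<And>v w r f. is_walk n v w \<Longrightarrow> f \<in> carrier (path_algebra n) \<Longrightarrow> P f \<Longrightarrow>
      P (scalar n r \<otimes>\<^bsub>path_algebra n\<^esub> path_term (v, w) 1 \<oplus>\<^bsub>path_algebra n\<^esub> f)"
  shows "P f"
proof -
  have "finite F \<Longrightarrow> f \<in> carrier (path_algebra n) \<Longrightarrow> {p. f p \<noteq> 0} = F \<Longrightarrow> P f" for F f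
  proof (induction F arbitrary: f rule: finite_induct)
    case empty
    then have "f = \<zero>\<^bsub>path_algebra n\<^esub>" by (auto simp: path_zero)
    with zero show ?case by simp
  next
    case (insert p F)
    obtain v w where p: "p = (v, w)" by (cases p)
    have "f p \<noteq> 0" using insert by auto
    with insert have walk: "is_walk n v w" by (auto simp: path_carrier p)
    have "{q. (f(p := 0)) q \<noteq> 0} = F" using insert by auto
    moreover from this have "f(p := 0) \<in> carrier (path_algebra n)"
      using insert by (auto simp: path_carrier)
    ultimately have "P (scalar n (f p) \<otimes>\<^bsub>path_algebra n\<^esub> path_term (v, w) 1 \<oplus>\<^bsub>path_algebra n\<^esub> (f(p := 0)))"
      by (intro add walk insert.IH)
    also have "scalar n (f p) \<otimes>\<^bsub>path_algebra n\<^esub> path_term (v, w) 1 \<oplus>\<^bsub>path_algebra n\<^esub> (f(p := 0)) = f"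
      by (simp add: scalar_path_term n walk) (auto simp: fun_eq_iff path_add path_term_def p)
    finally show ?case .
  qed
  then show ?thesis using f by (auto simp: path_carrier)
qed

lemma (in abelian_group_hom) hom_finsum':
  "finite A \<Longrightarrow> f \<in> A \<rightarrow> carrier G \<Longrightarrow> h (finsum G f A) = finsum H (h \<circ> f) A"
  by (induction A rule: finite_induct) (auto simp: Pi_iff)

lemma bij_betw_add_mod:
  assumes "0 < (n :: nat)"
  shows "bij_betw (\<lambda>l. (a + l) mod n) {..<n} {..<n}"
proof -
  have "inj_on (\<lambda>l. (a + l) mod n) {..<n}"
  proof (rule inj_onI)
    fix x y assume "x \<in> {..<n}" "y \<in> {..<n}" "(a + x) mod n = (a + y) mod n"
    then have "[a + x = a + y] (mod n)" by (simp add: cong_def)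
    then have "[x = y] (mod n)" by (simp add: cong_add_lcancel_nat)
    with \<open>x \<in> {..<n}\<close> \<open>y \<in> {..<n}\<close> show "x = y" by (simp add: cong_def)
  qed
  moreover from this have "(\<lambda>l. (a + l) mod n) ` {..<n} = {..<n}"
    using assms by (intro endo_inj_surj) auto
  ultimately show ?thesis by (simp add: bij_betw_def)
qed

lemma finsum_path_algebra:
  assumes "0 < n" "finite A" "F \<in> A \<rightarrow> carrier (path_algebra n)"
  shows "finsum (path_algebra n) F A p = (\<Sum>a\<in>A. F a p)"
proof -
  interpret P: ring "path_algebra n" by (rule path_algebra_ring[OF assms(1)])
  show ?thesis using assms(2,3)
    by (induction A rule: finite_induct) (auto simp: Pi_iff path_add, simp add: path_zero)
qed

text \<open>\<open>source\<close> and \<open>target\<close> encode the predecessor in Z/n as adding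
  n - 1. This is the cancellation of one step forward and one step back.\<close>

lemma Suc_mod_pred:
  assumes n: "0 < n"
  shows "(Suc v mod n + n - 1) mod n = v mod n"
proof -
  have "Suc v mod n + n - 1 = Suc v mod n + (n - 1)" using n by simp
  then have "(Suc v mod n + n - 1) mod n = (Suc v + (n - 1)) mod n" by (simp add: mod_add_left_eq)
  also have "Suc v + (n - 1) = v + n" using n by simp
  finally show ?thesis by simp
qed

lemma is_walk_xq:
  assumes n: "0 < n"
  shows "is_walk n (a mod n) (map (\<lambda>j. Xarr ((a + j) mod n)) [1..<Suc l]) \<and>
    end_vertex n (a mod n) (map (\<lambda>j. Xarr ((a + j) mod n)) [1..<Suc l]) = (a + l) mod n"
proof (induction l)
  case (Suc l)
  have "[1..<Suc (Suc l)] = [1..<Suc l] @ [Suc l]" by simp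
  then show ?case using Suc.IH Suc_mod_pred[OF n, of "a + l"] n
    by (simp only: map_append is_walk_append end_vertex_append) simp
qed (use n in simp)

lemma is_walk_yq:
  assumes n: "0 < n"
  shows "is_walk n ((a + l) mod n) (map (\<lambda>j. Yarr ((a + l - j) mod n)) [0..<l]) \<and>
    end_vertex n ((a + l) mod n) (map (\<lambda>j. Yarr ((a + l - j) mod n)) [0..<l]) = a mod n"
proof (induction l)
  case (Suc l)
  have "map (\<lambda>j. Yarr ((a + Suc l - j) mod n)) [0..<Suc l] =
      Yarr ((a + Suc l) mod n) # map (\<lambda>j. Yarr ((a + l - j) mod n)) [0..<l]"
    by (subst map_upt_Suc) simp
  then show ?case using Suc.IH Suc_mod_pred[OF n, of "a + l"] n by simp
qed (use n in simp)

text \<open>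
  The image of the path algebra under a ring homomorphism \<open>\<pi>\<close> that kills the relations. Vertices
  are indexed by all natural numbers, read modulo \<open>n\<close>; \<open>x v\<close> and \<open>y v\<close> are the arrows between
  \<open>v - 1\<close> and \<open>v\<close>.
\<close>

locale path_image = B: ring B for B :: "'d ring" (structure) +
  fixes k n :: nat and \<pi> :: "(path \<Rightarrow> complex fps) \<Rightarrow> 'd"
  assumes k: "0 < k" "k < n"
    and hom: "\<pi> \<in> ring_hom (path_algebra n) B"
    and relations: "\<And>r. r \<in> relations k n \<Longrightarrow> \<pi> r = \<zero>"
begin

sublocale P: ring "path_algebra n"
  using k by (intro path_algebra_ring) simp

sublocale h: ring_hom_ring "path_algebra n" B \<pi>
  by (rule ring_hom_ringI2[OF P.ring_axioms B.ring_axioms hom])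

definition walk :: "nat \<Rightarrow> arrow list \<Rightarrow> 'd" where
  "walk v w = \<pi> (path_term (v, w) 1)"

definition \<rho> :: "complex fps \<Rightarrow> 'd" where "\<rho> r = \<pi> (scalar n r)"

definition E :: "nat \<Rightarrow> 'd" where "E v = walk (v mod n) []"

definition x :: "nat \<Rightarrow> 'd" where "x v = walk ((v mod n + n - 1) mod n) [Xarr (v mod n)]"

definition y :: "nat \<Rightarrow> 'd" where "y v = walk (v mod n) [Yarr (v mod n)]"

text \<open>\<open>xq a l\<close> is the image of the path going up from a by l arrows
  \<open>x\<close>; \<open>yq a l\<close> below is the path back down from a + l to a. The end point
  a as first argument of both makes the products of the two collapse.\<close>

definition xq :: "nat \<Rightarrow> nat \<Rightarrow> 'd" where
  "xq a l = walk (a mod n) (map (\<lambda>j. Xarr ((a + j) mod n)) [1..<Suc l])"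

definition yq :: "nat \<Rightarrow> nat \<Rightarrow> 'd" where
  "yq a l = walk ((a + l) mod n) (map (\<lambda>j. Yarr ((a + l - j) mod n)) [0..<l])"

abbreviation \<tau> :: 'd where "\<tau> \<equiv> \<rho> fps_X"

lemma n: "0 < n" using k by simp

lemmas Suc_mod_pred = Suc_mod_pred[OF n]

lemmas is_walk_xq = is_walk_xq[OF n]

lemmas is_walk_yq = is_walk_yq[OF n]

lemma walk_closed: "is_walk n v w \<Longrightarrow> walk v w \<in> carrier B"
  by (simp add: walk_def path_term_closed)

lemma rho_closed: "\<rho> r \<in> carrier B"
  by (simp add: \<rho>_def scalar_closed)

lemma walk_mult:
  assumes "is_walk n u w2" "is_walk n v w1"
  shows "walk u w2 \<otimes> walk v w1 = (if end_vertex n v w1 = u then walk v (w1 @ w2) else \<zero>)"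
  using assms by (simp add: walk_def path_term_closed path_term_mult flip: h.hom_mult)

lemma rho_add: "\<rho> (r + r') = \<rho> r \<oplus> \<rho> r'"
  by (simp add: \<rho>_def scalar_closed flip: scalar_add)

lemma rho_mult: "\<rho> (r * r') = \<rho> r \<otimes> \<rho> r'"
  by (simp add: \<rho>_def scalar_closed n flip: scalar_hom)

lemma rho_one: "\<rho> 1 = \<one>"
  using h.hom_one by (simp add: \<rho>_def path_one)

lemma rho_power: "\<rho> (r ^ m) = \<rho> r [^] m"
proof (induction m)
  case (Suc m)
  have "\<rho> (r ^ Suc m) = \<rho> (r ^ m) \<otimes> \<rho> r" by (simp add: mult.commute flip: rho_mult)
  with Suc show ?case by simp
qed (simp add: rho_one)

lemma rho_central: "f \<in> carrier (path_algebra n) \<Longrightarrow> \<rho> r \<otimes> \<pi> f = \<pi> f \<otimes> \<rho> r"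
  by (simp add: \<rho>_def scalar_closed mult_scalar scalar_mult n flip: h.hom_mult)

lemma xq_closed: "xq a l \<in> carrier B" and yq_closed: "yq a l \<in> carrier B"
  unfolding xq_def yq_def
  by (rule walk_closed[OF conjunct1[OF is_walk_xq]], rule walk_closed[OF conjunct1[OF is_walk_yq]])

lemma is_walk_x: "is_walk n ((v mod n + n - 1) mod n) [Xarr (v mod n)]"
  and is_walk_y: "is_walk n (v mod n) [Yarr (v mod n)]"
  and is_walk_E: "is_walk n (v mod n) []"
  using n by auto

lemma x_closed: "x v \<in> carrier B" and y_closed: "y v \<in> carrier B" and E_closed: "E v \<in> carrier B"
  using is_walk_x is_walk_y is_walk_E by (auto simp: x_def y_def E_def intro!: walk_closed)

lemma y_mod: "y (v mod n) = y v"
  by (simp add: y_def)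

lemma xq_0: "xq a 0 = E a" and yq_0: "yq a 0 = E a"
  by (simp_all add: xq_def yq_def E_def)

lemma xq_Suc: "xq a (Suc l) = x (a + Suc l) \<otimes> xq a l"
proof -
  have "[1..<Suc (Suc l)] = [1..<Suc l] @ [Suc l]" by simp
  then show ?thesis unfolding xq_def x_def
    using is_walk_xq[of a l] is_walk_x[of "a + Suc l"] Suc_mod_pred[of "a + l"]
    by (subst walk_mult) simp_all
qed

lemma yq_Suc: "yq a (Suc l) = yq a l \<otimes> y (a + Suc l)"
proof -
  have "map (\<lambda>j. Yarr ((a + Suc l - j) mod n)) [0..<Suc l] =
      Yarr ((a + Suc l) mod n) # map (\<lambda>j. Yarr ((a + l - j) mod n)) [0..<l]"
    by (subst map_upt_Suc) simp
  then show ?thesis unfolding yq_def y_def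
    using is_walk_yq[of a l] is_walk_y[of "a + Suc l"] Suc_mod_pred[of "a + l"]
    by (subst walk_mult) simp_all
qed

lemma E_idem: "E v \<otimes> E v = E v"
  using is_walk_E[of v] by (simp add: E_def walk_mult)

lemma E_xq: "E (a + l) \<otimes> xq a l = xq a l" and xq_E: "xq a l \<otimes> E a = xq a l"
  and E_yq: "E a \<otimes> yq a l = yq a l" and yq_E: "yq a l \<otimes> E (a + l) = yq a l"
  using is_walk_xq[of a l] is_walk_yq[of a l] is_walk_E
  by (simp_all add: E_def xq_def yq_def walk_mult)

lemma relation_eq:
  assumes "is_walk n v w" "is_walk n u w'" "path_term (v, w) 1 \<ominus>\<^bsub>path_algebra n\<^esub> path_term (u, w') r \<in> relations k n"
  shows "walk v w = \<rho> r \<otimes> walk u w'"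
proof -
  have pt: "path_term (u, w') r = scalar n r \<otimes>\<^bsub>path_algebra n\<^esub> path_term (u, w') 1"
    using scalar_path_term[OF n assms(2), of r 1] by simp
  have "walk v w \<ominus> \<rho> r \<otimes> walk u w' = \<zero>"
    using relations[OF assms(3)] assms(1,2)
    by (simp add: pt walk_def \<rho>_def a_minus_def path_term_closed scalar_closed)
  then show ?thesis using assms(1,2) walk_closed rho_closed by simp
qed

lemma x_y: "x v \<otimes> y v = \<tau> \<otimes> E v"
proof -
  have "x v \<otimes> y v = walk (v mod n) [Yarr (v mod n), Xarr (v mod n)]"
    unfolding x_def y_def by (subst walk_mult) (use n in auto)
  also have "\<dots> = \<tau> \<otimes> walk (v mod n) []"
    by (rule relation_eq) (use n in \<open>auto simp: relations_def\<close>)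
  finally show ?thesis by (simp add: E_def)
qed

lemma y_x: "y (Suc v) \<otimes> x (Suc v) = \<tau> \<otimes> E v"
proof -
  have "y (Suc v) \<otimes> x (Suc v) = walk (v mod n) [Xarr (Suc v mod n), Yarr (Suc v mod n)]"
    unfolding x_def y_def by (subst walk_mult) (use n Suc_mod_pred[of v] in auto)
  also have "\<dots> = \<tau> \<otimes> walk (v mod n) []"
  proof (rule relation_eq)
    show "path_term (v mod n, [Xarr (Suc v mod n), Yarr (Suc v mod n)]) 1 \<ominus>\<^bsub>path_algebra n\<^esub>
        path_term (v mod n, []) fps_X \<in> relations k n"
      unfolding relations_def using n by (intro UN_I[of "v mod n"]) (auto simp: mod_Suc_eq)
  qed (use n Suc_mod_pred[of v] in auto)
  finally show ?thesis by (simp add: E_def)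
qed

lemma xq_k: "xq a k = yq (a + k) (n - k)"
proof -
  let ?v = "a mod n"
  \<comment> \<open>The path \<open>y^(n-k)\<close> of the relation ends at a + k. As a
    \<open>yq\<close> it starts at a + k + (n - k), which is the vertex a again.\<close>
  have eq: "(a + k + (n - k)) mod n = ?v" using k by simp
  have m: "map (\<lambda>j. Yarr ((a + k + (n - k) - j) mod n)) [0..<n - k] = map (\<lambda>j. Yarr ((?v + n - j) mod n)) [0..<n - k]"
  proof (rule map_cong)
    fix j assume j: "j \<in> set [0..<n - k]"
    have "a + k + (n - k) - j = a + (n - j)" "?v + n - j = ?v + (n - j)" using j k by auto
    then show "Yarr ((a + k + (n - k) - j) mod n) = Yarr ((?v + n - j) mod n)" by (simp add: mod_add_left_eq)
  qed simp
  have m': "map (\<lambda>j. Xarr ((a + j) mod n)) [1..<Suc k] = map (\<lambda>j. Xarr ((?v + j) mod n)) [1..<Suc k]"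
    by (simp add: mod_add_left_eq)
  have "walk ?v (map (\<lambda>j. Xarr ((?v + j) mod n)) [1..<Suc k]) =
      \<rho> 1 \<otimes> walk ?v (map (\<lambda>j. Yarr ((?v + n - j) mod n)) [0..<n - k])"
  proof (rule relation_eq)
    show "is_walk n ?v (map (\<lambda>j. Xarr ((?v + j) mod n)) [1..<Suc k])" 
      using is_walk_xq[of ?v k] by simp
    show "is_walk n ?v (map (\<lambda>j. Yarr ((?v + n - j) mod n)) [0..<n - k])"
      using is_walk_yq[of "a + k" "n - k"] unfolding m eq by simp
    show "path_term (?v, map (\<lambda>j. Xarr ((?v + j) mod n)) [1..<Suc k]) 1 \<ominus>\<^bsub>path_algebra n\<^esub>
        path_term (?v, map (\<lambda>j. Yarr ((?v + n - j) mod n)) [0..<n - k]) 1 \<in> relations k n"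
      unfolding relations_def using n by (intro UN_I[of ?v]) auto
  qed
  also have "\<dots> = walk ?v (map (\<lambda>j. Yarr ((?v + n - j) mod n)) [0..<n - k])"
    using yq_closed[of "a + k" "n - k"] unfolding yq_def m eq by (simp add: rho_one)
  finally show ?thesis unfolding xq_def yq_def m eq m' .
qed

end

section \<open>Walks and corners up to powers of t\<close>

context path_image
begin

lemma rho_walk: "is_walk n v w \<Longrightarrow> \<rho> r \<otimes> walk v w = walk v w \<otimes> \<rho> r"
  unfolding walk_def by (intro rho_central path_term_closed)

lemma rho_xq: "\<rho> r \<otimes> xq a l = xq a l \<otimes> \<rho> r"
  unfolding xq_def by (rule rho_walk[OF conjunct1[OF is_walk_xq]])

lemma rho_E: "\<rho> r \<otimes> E a = E a \<otimes> \<rho> r"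
  unfolding E_def by (rule rho_walk[OF is_walk_E])

lemma rho_x: "\<rho> r \<otimes> x a = x a \<otimes> \<rho> r"
  unfolding x_def by (rule rho_walk[OF is_walk_x])

lemma rho_y: "\<rho> r \<otimes> y a = y a \<otimes> \<rho> r"
  unfolding y_def by (rule rho_walk[OF is_walk_y])

text \<open>The products are nested: the inner \<open>xq a l\<close> times \<open>yq a l\<close> is
  \<open>t^l\<close> at an idempotent, and the surrounding pair x, y contributes one more t.\<close>

lemma xq_yq: "xq a l \<otimes> yq a l = \<rho> (fps_X ^ l) \<otimes> E (a + l)"
proof (induction l)
  case 0
  then show ?case by (simp add: xq_0 yq_0 E_idem rho_one E_closed)
next
  case (Suc l)
  note cl = xq_closed yq_closed x_closed y_closed E_closed rho_closed
  have "xq a (Suc l) \<otimes> yq a (Suc l) = x (a + Suc l) \<otimes> (xq a l \<otimes> yq a l) \<otimes> y (a + Suc l)"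
    by (simp add: xq_Suc yq_Suc B.m_assoc cl)
  also have "\<dots> = x (a + Suc l) \<otimes> \<rho> (fps_X ^ l) \<otimes> (E (a + l) \<otimes> y (a + Suc l))"
    by (simp add: Suc B.m_assoc cl)
  also have "E (a + l) \<otimes> y (a + Suc l) = y (a + Suc l)"
    using is_walk_y[of "a + Suc l"] is_walk_E Suc_mod_pred[of "a + l"] n
    by (simp add: E_def y_def walk_mult)
  also have "x (a + Suc l) \<otimes> \<rho> (fps_X ^ l) \<otimes> y (a + Suc l) = \<rho> (fps_X ^ l) \<otimes> (x (a + Suc l) \<otimes> y (a + Suc l))"
    by (simp add: rho_x[symmetric] B.m_assoc cl)
  also have "\<dots> = \<rho> (fps_X ^ Suc l) \<otimes> E (a + Suc l)"
    by (simp add: x_y rho_mult B.m_assoc cl rho_central mult.commute[of fps_X])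
  finally show ?case .
qed

lemma xq_add: "xq a (l1 + l2) = xq (a + l1) l2 \<otimes> xq a l1"
  by (induction l2) (simp_all add: xq_0 E_xq xq_Suc B.m_assoc xq_closed x_closed add.assoc)

lemma E_add_n: "E (a + n) = E a" and xq_add_n: "xq (a + n) l = xq a l"
proof -
  show "E (a + n) = E a" by (simp add: E_def)
  have "a + n + j = a + j + n" for j by simp
  then have "(a + n + j) mod n = (a + j) mod n" for j by (simp only: mod_add_self2)
  then show "xq (a + n) l = xq a l" by (simp add: xq_def)
qed

text \<open>Once around the quiver:
  \<open>x^n = x^(n-k) x^k = x^(n-k) y^(n-k) = t^(n-k)\<close>.\<close>

lemma xq_n: "xq a n = \<rho> (fps_X ^ (n - k)) \<otimes> E a"
proof -
  have "xq a n = xq (a + k) (n - k) \<otimes> xq a k" using xq_add[of a k "n - k"] k by simp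
  also have "\<dots> = \<rho> (fps_X ^ (n - k)) \<otimes> E (a + k + (n - k))" by (simp add: xq_k xq_yq)
  also have "a + k + (n - k) = a + n" using k by simp
  finally show ?thesis by (simp add: E_add_n)
qed

lemma xq_mult_n: "xq a (c * n) = \<rho> (fps_X ^ (c * (n - k))) \<otimes> E a"
proof (induction c)
  case 0
  then show ?case by (simp add: xq_0 rho_one E_closed)
next
  case (Suc c)
  note cl = xq_closed E_closed rho_closed
  have "xq a (Suc c * n) = xq (a + n) (c * n) \<otimes> xq a n" by (simp add: xq_add)
  also have "\<dots> = \<rho> (fps_X ^ (c * (n - k))) \<otimes> (E a \<otimes> \<rho> (fps_X ^ (n - k))) \<otimes> E a"
    by (simp add: xq_add_n Suc xq_n B.m_assoc cl)
  also have "\<dots> = \<rho> (fps_X ^ (c * (n - k))) \<otimes> \<rho> (fps_X ^ (n - k)) \<otimes> (E a \<otimes> E a)"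
    by (simp add: rho_E[symmetric] B.m_assoc cl)
  also have "\<rho> (fps_X ^ (c * (n - k))) \<otimes> \<rho> (fps_X ^ (n - k)) = \<rho> (fps_X ^ (Suc c * (n - k)))"
    by (simp add: rho_mult[symmetric] power_add mult.commute)
  finally show ?case by (simp add: E_idem)
qed

lemma rho_commute: "\<rho> r \<otimes> \<rho> r' = \<rho> r' \<otimes> \<rho> r"
  by (simp add: mult.commute flip: rho_mult)

text \<open>
  Up to powers of \<open>t\<close>, every walk is a scalar multiple of a walk along the arrows \<open>x\<close> only: a step
  along \<open>y\<close> either cancels the last \<open>x\<close> or is replaced using that going around the quiver along
  \<open>x\<close> is a power of \<open>t\<close>.
\<close>

lemma walk_scalar:
  assumes "a < n" "is_walk n a w"
  shows "\<exists>N r l. end_vertex n a w = (a + l) mod n \<and> \<rho> (fps_X ^ N) \<otimes> walk a w = \<rho> r \<otimes> xq a l"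
  using assms(2)
proof (induction w rule: rev_induct)
  case Nil
  have "walk a [] = E a" using assms by (simp add: E_def)
  then show ?case using assms by (intro exI[of _ 0] exI[of _ 1]) (simp add: xq_0)
next
  case (snoc b w)
  note cl = xq_closed E_closed rho_closed x_closed y_closed
  have w: "is_walk n a w" "is_walk n (end_vertex n a w) [b]"
    using snoc.prems n by (simp_all only: is_walk_append)
  then obtain N r l where IH: "end_vertex n a w = (a + l) mod n" "\<rho> (fps_X ^ N) \<otimes> walk a w = \<rho> r \<otimes> xq a l"
    using snoc.IH by blast
  define z where "z = walk ((a + l) mod n) [b]"
  have z: "z \<in> carrier B" unfolding z_def using w IH by (auto intro: walk_closed)
  have cw: "walk a w \<in> carrier B" using w walk_closed by blast
  have step: "walk a (w @ [b]) = z \<otimes> walk a w"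
    unfolding z_def using w IH by (subst walk_mult) auto
  have "\<rho> (fps_X ^ N) \<otimes> walk a (w @ [b]) = z \<otimes> (\<rho> (fps_X ^ N) \<otimes> walk a w)"
    unfolding step using z cw rho_walk[OF w(2)] IH(1) by (simp add: z_def B.m_assoc[symmetric] cl)
  also have "\<dots> = \<rho> r \<otimes> (z \<otimes> xq a l)"
    unfolding IH(2) using z rho_walk[OF w(2)] IH(1) by (simp add: z_def B.m_assoc[symmetric] cl)
  finally have main: "\<rho> (fps_X ^ N) \<otimes> walk a (w @ [b]) = \<rho> r \<otimes> (z \<otimes> xq a l)" .
  show ?case
  proof (cases b)
    case (Xarr u)
    then have u: "u < n" "(u + n - 1) mod n = (a + l) mod n" using w IH by auto
    have "(a + Suc l) mod n = u"
    proof -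
      have "(a + Suc l) mod n = Suc ((u + n - 1) mod n) mod n" using u(2) by (simp add: mod_Suc_eq)
      also have "\<dots> = Suc (u + n - 1) mod n" by (simp add: mod_Suc_eq)
      also have "Suc (u + n - 1) = u + n" using n by simp
      finally show ?thesis using u by simp
    qed
    then have "z = x (a + Suc l)" and e: "end_vertex n a (w @ [b]) = (a + Suc l) mod n"
      using u Xarr by (simp_all add: z_def x_def end_vertex_append)
    then have "z \<otimes> xq a l = xq a (Suc l)" by (simp add: xq_Suc)
    with main e show ?thesis by metis
  next
    case (Yarr u)
    then have u: "u = (a + l) mod n" using w IH by auto
    then have zy: "z = y (a + l)" using Yarr by (simp add: z_def y_def)
    show ?thesis
    proof (cases l)
      case (Suc l')
      have e: "end_vertex n a (w @ [b]) = (a + l') mod n"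
        using Yarr u Suc Suc_mod_pred[of "a + l'"] by (simp add: end_vertex_append)
      have "z \<otimes> xq a l = (y (Suc (a + l')) \<otimes> x (Suc (a + l'))) \<otimes> xq a l'"
        by (simp add: zy Suc xq_Suc B.m_assoc cl)
      also have "\<dots> = \<tau> \<otimes> xq a l'" unfolding y_x by (simp add: B.m_assoc cl E_xq)
      finally have "\<rho> r \<otimes> (z \<otimes> xq a l) = \<rho> (r * fps_X) \<otimes> xq a l'"
        by (simp add: rho_mult B.m_assoc cl)
      with main e show ?thesis by metis
    next
      case 0
      \<comment> \<open>At length 0 there is no arrow x for y to cancel. Scaling by
        \<open>t^(n-k)\<close> turns the trivial walk into a full turn, whose last arrow does
        cancel, leaving n' = n - 1 arrows.\<close>
      obtain n' where n': "n = Suc n'" using n by (cases n) auto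
      have e: "end_vertex n a (w @ [b]) = (a + n') mod n"
        using Yarr u 0 n' by (simp add: end_vertex_append mod_add_left_eq)
      have "y (a + n) = y a" using y_mod[of "a + n"] y_mod[of a] by simp
      then have z0: "z = y (Suc (a + n'))" using zy 0 n' by simp
      have "\<rho> (fps_X ^ (n - k)) \<otimes> (z \<otimes> xq a 0) = z \<otimes> (\<rho> (fps_X ^ (n - k)) \<otimes> xq a 0)"
        using z rho_y by (simp add: zy B.m_assoc[symmetric] cl)
      also have "\<dots> = z \<otimes> xq a n" by (simp add: xq_n xq_0)
      also have "xq a n = x (Suc (a + n')) \<otimes> xq a n'" using xq_Suc[of a n', folded n'] n' by simp
      also have "z \<otimes> \<dots> = (y (Suc (a + n')) \<otimes> x (Suc (a + n'))) \<otimes> xq a n'"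
        unfolding z0 by (simp add: B.m_assoc cl)
      also have "\<dots> = \<tau> \<otimes> xq a n'" unfolding y_x by (simp add: B.m_assoc cl E_xq)
      finally have *: "\<rho> (fps_X ^ (n - k)) \<otimes> (z \<otimes> xq a 0) = \<tau> \<otimes> xq a n'" .
      have "\<rho> (fps_X ^ ((n - k) + N)) \<otimes> walk a (w @ [b]) = \<rho> (fps_X ^ (n - k)) \<otimes> (\<rho> r \<otimes> (z \<otimes> xq a 0))"
        using main 0 z cw step by (simp add: power_add rho_mult B.m_assoc cl)
      also have "\<dots> = \<rho> r \<otimes> (\<rho> (fps_X ^ (n - k)) \<otimes> (z \<otimes> xq a 0))"
        using z by (simp add: B.m_assoc[symmetric] cl rho_commute)
      also have "\<dots> = \<rho> (r * fps_X) \<otimes> xq a n'" unfolding * by (simp add: rho_mult B.m_assoc cl)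
      finally show ?thesis using e by blast
    qed
  qed
qed

text \<open>A walk from a to a has x-length divisible by n up to a scalar, so it is a full number of
  turns and hence a power of t. Any other walk is killed by \<open>E a\<close> on one side.\<close>

lemma corner_walk:
  assumes "a < n" "is_walk n v w"
  shows "\<exists>N r. \<rho> (fps_X ^ N) \<otimes> (E a \<otimes> walk v w \<otimes> E a) = \<rho> r \<otimes> E a"
proof (cases "v = a \<and> end_vertex n v w = a")
  case True
  note cl = xq_closed E_closed rho_closed
  have "walk v w \<otimes> E a = walk v w" "E a \<otimes> walk v w = walk v w"
    using True assms is_walk_E[of a] by (auto simp: E_def walk_mult)
  moreover obtain N r l where l: "a = (a + l) mod n" "\<rho> (fps_X ^ N) \<otimes> walk a w = \<rho> r \<otimes> xq a l"
    using walk_scalar[of a w] True assms by metis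
  \<comment> \<open>Returning to the start forces l to be a multiple of n, so
    \<open>xq_mult_n\<close> applies.\<close>
  from l(1) assms(1) have "[a + l = a + 0] (mod n)" by (simp add: cong_def)
  then have "[l = 0] (mod n)" by (simp only: cong_add_lcancel_nat)
  then have "n dvd l" by (simp add: cong_0_iff)
  then obtain c where "l = c * n" by (metis dvd_div_mult_self)
  with l(2) have "\<rho> (fps_X ^ N) \<otimes> walk a w = \<rho> (r * fps_X ^ (c * (n - k))) \<otimes> E a"
    by (simp add: xq_mult_n rho_mult B.m_assoc cl)
  ultimately show ?thesis using True by metis
next
  case False
  have "E a \<otimes> walk v w \<otimes> E a = \<zero>"
  proof (cases "v = a")
    case True
    then have "E a \<otimes> walk v w = \<zero>" using False assms is_walk_E[of a] by (auto simp: E_def walk_mult)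
    then show ?thesis by (simp add: E_closed)
  next
    case False
    then have "walk v w \<otimes> E a = \<zero>" using assms is_walk_E[of a] by (auto simp: E_def walk_mult)
    then show ?thesis using assms walk_closed by (simp add: E_closed B.m_assoc)
  qed
  moreover have "\<rho> 0 = \<zero>" using rho_add[of 0 0] rho_closed by simp
  ultimately show ?thesis by (intro exI[of _ 0]) (simp add: rho_closed E_closed)
qed

text \<open>\<open>corner_walk\<close> extends to linear combinations by clearing denominators: the
  exponents of t of the two summands are added.\<close>

lemma corner_path:
  assumes a: "a < n" and f: "f \<in> carrier (path_algebra n)"
  shows "\<exists>N r. \<rho> (fps_X ^ N) \<otimes> (E a \<otimes> \<pi> f \<otimes> E a) = \<rho> r \<otimes> E a"
  using n f
proof (induction f rule: path_algebra_induct)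
  case zero
  have "\<rho> 0 = \<zero>" using rho_add[of 0 0] rho_closed by simp
  then show ?case by (intro exI[of _ 0]) (simp add: rho_closed E_closed)
next
  case (add v w c f)
  note cl = rho_closed E_closed walk_closed[OF add(1)] h.hom_closed[OF add(2)]
  obtain N r where 1: "\<rho> (fps_X ^ N) \<otimes> (E a \<otimes> walk v w \<otimes> E a) = \<rho> r \<otimes> E a"
    using corner_walk a add by blast
  obtain N' r' where 2: "\<rho> (fps_X ^ N') \<otimes> (E a \<otimes> \<pi> f \<otimes> E a) = \<rho> r' \<otimes> E a"
    using add by blast
  have "\<pi> (scalar n c \<otimes>\<^bsub>path_algebra n\<^esub> path_term (v, w) 1 \<oplus>\<^bsub>path_algebra n\<^esub> f) = \<rho> c \<otimes> walk v w \<oplus> \<pi> f"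
    using add by (simp add: \<rho>_def walk_def scalar_closed path_term_closed)
  moreover have "\<rho> (fps_X ^ (N + N')) \<otimes> (E a \<otimes> (\<rho> c \<otimes> walk v w \<oplus> \<pi> f) \<otimes> E a) =
      \<rho> (fps_X ^ N' * c) \<otimes> (\<rho> (fps_X ^ N) \<otimes> (E a \<otimes> walk v w \<otimes> E a)) \<oplus>
      \<rho> (fps_X ^ N) \<otimes> (\<rho> (fps_X ^ N') \<otimes> (E a \<otimes> \<pi> f \<otimes> E a))"
  proof -
    have "E a \<otimes> (\<rho> c \<otimes> walk v w \<oplus> \<pi> f) \<otimes> E a = \<rho> c \<otimes> (E a \<otimes> walk v w \<otimes> E a) \<oplus> E a \<otimes> \<pi> f \<otimes> E a"
      by (simp add: cl B.l_distr B.r_distr B.m_assoc[symmetric] rho_E)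
    moreover have "\<rho> (fps_X ^ (N + N')) \<otimes> (\<rho> c \<otimes> (E a \<otimes> walk v w \<otimes> E a)) =
        \<rho> (fps_X ^ N' * c) \<otimes> (\<rho> (fps_X ^ N) \<otimes> (E a \<otimes> walk v w \<otimes> E a))"
    proof -
      have "fps_X ^ (N + N') * c = fps_X ^ N' * c * fps_X ^ N" by (simp add: power_add mult_ac)
      from arg_cong[OF this, of \<rho>] show ?thesis by (simp add: rho_mult cl flip: B.m_assoc)
    qed
    ultimately show ?thesis by (simp add: cl B.r_distr power_add rho_mult B.m_assoc)
  qed
  moreover have "\<dots> = \<rho> (fps_X ^ N' * c * r + fps_X ^ N * r') \<otimes> E a"
    unfolding 1 2 by (simp add: rho_add rho_mult B.l_distr B.m_assoc cl)
  ultimately show ?case by metis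
qed

text \<open>The vertices a, a + 1, ..., a + n - 1 run once through Z/n, so the sum of their
  idempotents is the identity.\<close>

lemma sum_E: "finsum B (\<lambda>l. E (a + l)) {..<n} = \<one>"
proof -
  let ?F = "\<lambda>l. path_term ((a + l) mod n, []) 1"
  have cl: "?F \<in> {..<n} \<rightarrow> carrier (path_algebra n)" using n by (auto intro: path_term_closed)
  have "finsum (path_algebra n) ?F {..<n} = \<one>\<^bsub>path_algebra n\<^esub>"
  proof (rule ext, clarify)
    fix v and w :: "arrow list"
    have "(\<Sum>l<n. ?F l (v, w)) = (\<Sum>l<n. if v = l \<and> w = [] then 1 else 0)"
      unfolding path_term_def
      by (subst sum.reindex_bij_betw[OF bij_betw_add_mod[OF n, of a], symmetric]) simp
    also have "\<dots> = (if v < n \<and> w = [] then 1 else 0)" by (cases "w = []") (auto simp: sum.delta)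
    finally show "finsum (path_algebra n) ?F {..<n} (v, w) = \<one>\<^bsub>path_algebra n\<^esub> (v, w)"
      using cl n by (simp add: finsum_path_algebra path_one scalar_def)
  qed
  then have "\<one> = \<pi> (finsum (path_algebra n) ?F {..<n})" by simp
  also have "\<dots> = finsum B (\<pi> \<circ> ?F) {..<n}" using cl by (simp add: abelian_group_hom.hom_finsum'[OF h.abelian_group_hom_axioms])
  finally show ?thesis by (simp add: E_def walk_def comp_def)
qed

end

text \<open>
  What is used about \<open>B\<close>: it is an \<open>R\<close>-algebra that is Morita equivalent to \<open>R\<close> through \<open>e\<close> after
  inverting \<open>t\<close>.
\<close>

locale corner_order = B: ring B for B :: "'b ring" (structure) +
  fixes \<rho> :: "complex fps \<Rightarrow> 'b" and e :: 'b and n :: nat and ex ey :: "nat \<Rightarrow> 'b"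
  assumes rho_closed: "\<rho> r \<in> carrier B"
    and rho_add: "\<rho> (r + r') = \<rho> r \<oplus> \<rho> r'"
    and rho_mult: "\<rho> (r * r') = \<rho> r \<otimes> \<rho> r'"
    and rho_one: "\<rho> 1 = \<one>"
    and rho_central: "b \<in> carrier B \<Longrightarrow> \<rho> r \<otimes> b = b \<otimes> \<rho> r"
    and e_closed: "e \<in> carrier B"
    and e_idem: "e \<otimes> e = e"
    and ex_closed: "ex l \<in> carrier B" and ey_closed: "ey l \<in> carrier B"
    and ex_e: "ex l \<otimes> e = ex l" and e_ey: "e \<otimes> ey l = ey l"
    and full: "finsum B (\<lambda>l. ex l \<otimes> ey l) {..<n} = \<rho> (fps_X ^ n)"
    and corner: "b \<in> carrier B \<Longrightarrow> \<exists>N r. \<rho> (fps_X ^ N) \<otimes> (e \<otimes> b \<otimes> e) = \<rho> r \<otimes> e"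

text \<open>Going up by l and back costs \<open>t^l\<close>, which depends on l. The factor
  \<open>t^(n-l)\<close> in the choice of \<open>ey\<close> makes every product equal to
  \<open>t^n E (a + l)\<close>, and these add up to \<open>t^n\<close>. The premise
  \<open>dense\<close> reduces the corner condition for b to path algebra elements.\<close>

lemma (in path_image) corner_order:
  assumes "a < n"
    and central: "\<And>b r. b \<in> carrier B \<Longrightarrow> \<rho> r \<otimes> b = b \<otimes> \<rho> r"
    and dense: "\<And>b. b \<in> carrier B \<Longrightarrow> \<exists>N. \<exists>f\<in>carrier (path_algebra n). b \<otimes> \<rho> (fps_X ^ N) = \<pi> f"
  shows "corner_order B \<rho> (E a) n (xq a) (\<lambda>l. \<rho> (fps_X ^ (n - l)) \<otimes> yq a l)"
proof unfold_locales
  note cl = rho_closed E_closed xq_closed yq_closed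
  fix r r' b l
  show "E a \<otimes> (\<rho> (fps_X ^ (n - l)) \<otimes> yq a l) = \<rho> (fps_X ^ (n - l)) \<otimes> yq a l"
  proof -
    have "E a \<otimes> (\<rho> (fps_X ^ (n - l)) \<otimes> yq a l) = \<rho> (fps_X ^ (n - l)) \<otimes> (E a \<otimes> yq a l)"
      by (simp add: B.m_assoc[symmetric] cl rho_E)
    then show ?thesis by (simp add: E_yq)
  qed
  have eq: "xq a l \<otimes> (\<rho> (fps_X ^ (n - l)) \<otimes> yq a l) = \<rho> (fps_X ^ n) \<otimes> E (a + l)" if "l < n" for l
  proof -
    have "xq a l \<otimes> (\<rho> (fps_X ^ (n - l)) \<otimes> yq a l) = \<rho> (fps_X ^ (n - l)) \<otimes> (xq a l \<otimes> yq a l)"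
      by (simp add: B.m_assoc[symmetric] cl rho_xq)
    also have "\<dots> = \<rho> (fps_X ^ (n - l) * fps_X ^ l) \<otimes> E (a + l)"
      by (simp add: xq_yq rho_mult B.m_assoc cl)
    finally show ?thesis using that by (simp flip: power_add)
  qed
  have "finsum B (\<lambda>l. xq a l \<otimes> (\<rho> (fps_X ^ (n - l)) \<otimes> yq a l)) {..<n} =
      finsum B (\<lambda>l. \<rho> (fps_X ^ n) \<otimes> E (a + l)) {..<n}"
    by (rule B.finsum_cong') (auto simp: eq cl)
  also have "\<dots> = \<rho> (fps_X ^ n) \<otimes> finsum B (\<lambda>l. E (a + l)) {..<n}"
    by (rule B.finsum_rdistr[symmetric]) (auto simp: cl)
  finally show "finsum B (\<lambda>l. xq a l \<otimes> (\<rho> (fps_X ^ (n - l)) \<otimes> yq a l)) {..<n} = \<rho> (fps_X ^ n)"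
    by (simp add: sum_E cl)
  assume b: "b \<in> carrier B"
  obtain N f where f: "f \<in> carrier (path_algebra n)" "b \<otimes> \<rho> (fps_X ^ N) = \<pi> f" using dense[OF b] by auto
  obtain N' r where r: "\<rho> (fps_X ^ N') \<otimes> (E a \<otimes> \<pi> f \<otimes> E a) = \<rho> r \<otimes> E a"
    using corner_path[OF assms(1) f(1)] by auto
  have "E a \<otimes> \<pi> f \<otimes> E a = \<rho> (fps_X ^ N) \<otimes> (E a \<otimes> b \<otimes> E a)"
  proof -
    have "E a \<otimes> \<pi> f \<otimes> E a = E a \<otimes> (\<rho> (fps_X ^ N) \<otimes> b) \<otimes> E a" using f(2) central[OF b] by simp
    also have "\<dots> = (E a \<otimes> \<rho> (fps_X ^ N)) \<otimes> b \<otimes> E a" using b by (simp add: B.m_assoc cl)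
    also have "\<dots> = \<rho> (fps_X ^ N) \<otimes> (E a \<otimes> b \<otimes> E a)" using b by (simp add: rho_E[symmetric] B.m_assoc cl)
    finally show ?thesis .
  qed
  with r have "\<rho> (fps_X ^ (N' + N)) \<otimes> (E a \<otimes> b \<otimes> E a) = \<rho> r \<otimes> E a"
    using b by (simp add: power_add rho_mult B.m_assoc cl)
  then show "\<exists>N r. \<rho> (fps_X ^ N) \<otimes> (E a \<otimes> b \<otimes> E a) = \<rho> r \<otimes> E a" by blast
qed (assumption | rule rho_closed rho_add rho_mult rho_one E_closed E_idem xq_closed xq_E central
    B.m_closed yq_closed)+

lemma relations_closed:
  assumes k: "0 < k" "k < n"
  shows "relations k n \<subseteq> carrier (path_algebra n)"
proof
  have n: "0 < n" using k by simp
  interpret P: ring "path_algebra n" by (rule path_algebra_ring[OF n])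
  fix r assume "r \<in> relations k n"
  then obtain v where v: "v < n" and r: "r \<in> {path_term (v, [Yarr v, Xarr v]) 1 \<ominus>\<^bsub>path_algebra n\<^esub> path_term (v, []) fps_X,
    path_term (v, [Xarr ((v + 1) mod n), Yarr ((v + 1) mod n)]) 1
      \<ominus>\<^bsub>path_algebra n\<^esub> path_term (v, []) fps_X,
    path_term (v, map (\<lambda>j. Xarr ((v + j) mod n)) [1..<Suc k]) 1
      \<ominus>\<^bsub>path_algebra n\<^esub> path_term (v, map (\<lambda>j. Yarr ((v + n - j) mod n)) [0..<n - k]) 1}"
    unfolding relations_def by blast
  have "is_walk n v []" using v by simp
  moreover have "is_walk n v [Yarr v, Xarr v]" "is_walk n v [Xarr ((v + 1) mod n), Yarr ((v + 1) mod n)]"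
    using v n Suc_mod_pred[OF n, of v] by auto
  moreover have "is_walk n v (map (\<lambda>j. Xarr ((v + j) mod n)) [1..<Suc k])"
    using is_walk_xq[OF n, of v k] v by (simp del: upt_Suc)
  moreover have "is_walk n v (map (\<lambda>j. Yarr ((v + n - j) mod n)) [0..<n - k])"
    using is_walk_yq[OF n, of "v + k" "n - k"] v k by simp
  ultimately show "r \<in> carrier (path_algebra n)"
    using r by (auto simp del: upt_Suc intro!: P.minus_closed path_term_closed)
qed

text \<open>The properties of B are inherited from D: an element times a suitable power of t lies in
  the image of the path algebra, where scalars are central and corners are known, and t is cancelled
  in D.\<close>

lemma order_over_C_corner_order:
  fixes D B :: "'d ring"
  assumes k: "0 < k" "k < n" and star: "star < n"
    and loc: "is_localisation (C_alg k n) (C_scalar k n fps_X) D \<phi>"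
    and order: "order_over_C k n D \<phi> S"
    and B: "B = D\<lparr>carrier := S\<rparr>"
  shows "\<exists>ex ey. corner_order B (\<lambda>r. \<phi> (C_scalar k n r)) (\<phi> (C_idem k n star)) n ex ey"
proof -
  let ?P = "path_algebra n" and ?I = "C_ideal k n"
  define \<pi> where "\<pi> f = \<phi> (?I +>\<^bsub>?P\<^esub> f)" for f
  have n: "0 < n" using k by simp
  interpret P: ring ?P by (rule path_algebra_ring[OF n])
  interpret I: ideal ?I ?P
    unfolding C_ideal_def by (rule P.genideal_ideal[OF relations_closed[OF k]])
  interpret D: ring D using loc by (simp add: is_localisation_def)
  have phi: "\<phi> \<in> ring_hom (C_alg k n) D" using loc by (simp add: is_localisation_def)
  have q: "(+>\<^bsub>?P\<^esub>) ?I \<in> ring_hom ?P (C_alg k n)" unfolding C_alg_def by (rule I.rcos_ring_hom)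
  have piD: "\<pi> \<in> ring_hom ?P D"
    using ring_hom_trans[OF q phi] by (simp add: \<pi>_def[abs_def] comp_def)
  have S: "subring S D" and phiS: "\<phi> ` carrier (C_alg k n) \<subseteq> S"
    using order by (auto simp: order_over_C_def)
  interpret B: ring B unfolding B by (rule D.subring_is_ring[OF S])
  have piS: "\<pi> f \<in> S" if "f \<in> carrier ?P" for f
    using that phiS ring_hom_closed[OF q that] by (auto simp: \<pi>_def)
  have piB: "\<pi> \<in> ring_hom ?P B"
    using piD piS by (auto simp: ring_hom_def B)
  interpret path_image B k n \<pi>
  proof unfold_locales
    show "\<pi> \<in> ring_hom ?P B" by (rule piB)
    fix r assume "r \<in> relations k n"
    then have "r \<in> ?I" using P.genideal_self[OF relations_closed[OF k]] by (auto simp: C_ideal_def)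
    then have "?I +>\<^bsub>?P\<^esub> r = ?I" using I.a_rcos_const by blast
    then have "\<pi> r = \<phi> \<zero>\<^bsub>C_alg k n\<^esub>" by (simp add: \<pi>_def C_alg_def FactRing_def)
    moreover have "\<pi> \<zero>\<^bsub>?P\<^esub> = \<phi> \<zero>\<^bsub>C_alg k n\<^esub>"
      using I.a_rcos_const[OF I.zero_closed] by (simp add: \<pi>_def C_alg_def FactRing_def)
    moreover have "\<pi> \<zero>\<^bsub>?P\<^esub> = \<zero>\<^bsub>B\<^esub>" by (rule ring_hom_zero[OF piB P.ring_axioms B.ring_axioms])
    ultimately show "\<pi> r = \<zero>\<^bsub>B\<^esub>" by simp
  qed (use k in auto)
  have rho: "\<rho> r = \<phi> (C_scalar k n r)" for r by (simp add: \<rho>_def C_scalar_def \<pi>_def)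
  have E: "E star = \<phi> (C_idem k n star)" using star by (simp add: E_def walk_def C_idem_def \<pi>_def)
  have unit: "\<tau> \<in> Units D" using loc by (simp add: is_localisation_def rho)
  have tauD: "\<tau> [^]\<^bsub>D\<^esub> m = \<rho> (fps_X ^ m)" for m :: nat
    unfolding rho_power by (simp add: B nat_pow_def)
  have dense: "\<exists>N. \<exists>f\<in>carrier ?P. b \<otimes>\<^bsub>D\<^esub> \<rho> (fps_X ^ N) = \<pi> f" if b: "b \<in> carrier D" for b
  proof -
    obtain a m where "a \<in> carrier (C_alg k n)" "b \<otimes>\<^bsub>D\<^esub> (\<tau> [^]\<^bsub>D\<^esub> (m :: nat)) = \<phi> a"
      using loc b by (auto simp: is_localisation_def rho)
    moreover from this obtain f where "f \<in> carrier ?P" "a = ?I +>\<^bsub>?P\<^esub> f"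
      unfolding C_alg_def FactRing_def A_RCOSETS_def' by auto
    ultimately show ?thesis by (auto simp: \<pi>_def tauD)
  qed
  have central: "\<rho> r \<otimes>\<^bsub>D\<^esub> b = b \<otimes>\<^bsub>D\<^esub> \<rho> r" if b: "b \<in> carrier D" for b r
  proof -
    have SD: "c \<in> carrier D" if "c \<in> carrier B" for c
      using that subringE(1)[OF S] by (auto simp: B)
    obtain N f where f: "f \<in> carrier ?P" "b \<otimes>\<^bsub>D\<^esub> \<rho> (fps_X ^ N) = \<pi> f" using dense[OF b] by auto
    have mB: "mult B = mult D" by (simp add: B)
    note cl = SD[OF rho_closed]
    \<comment> \<open>Both products with b agree after right multiplication by this power of t; its
      inverse in D removes the power again.\<close>
    have u: "\<rho> (fps_X ^ N) \<in> Units D" using unit by (simp add: D.Units_pow_closed flip: tauD)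
    have "(\<rho> r \<otimes>\<^bsub>D\<^esub> b) \<otimes>\<^bsub>D\<^esub> \<rho> (fps_X ^ N) = \<rho> r \<otimes>\<^bsub>D\<^esub> \<pi> f"
      using b f by (simp add: D.m_assoc cl)
    also have "\<dots> = \<pi> f \<otimes>\<^bsub>D\<^esub> \<rho> r" using rho_central[OF f(1)] by (simp add: mB)
    also have "\<dots> = b \<otimes>\<^bsub>D\<^esub> (\<rho> (fps_X ^ N) \<otimes>\<^bsub>D\<^esub> \<rho> r)" using b by (simp add: D.m_assoc cl flip: f(2))
    also have "\<dots> = (b \<otimes>\<^bsub>D\<^esub> \<rho> r) \<otimes>\<^bsub>D\<^esub> \<rho> (fps_X ^ N)"
      using b rho_commute[of "fps_X ^ N" r] by (simp add: D.m_assoc cl mB)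
    finally have "((\<rho> r \<otimes>\<^bsub>D\<^esub> b) \<otimes>\<^bsub>D\<^esub> \<rho> (fps_X ^ N)) \<otimes>\<^bsub>D\<^esub> inv\<^bsub>D\<^esub> \<rho> (fps_X ^ N) =
        ((b \<otimes>\<^bsub>D\<^esub> \<rho> r) \<otimes>\<^bsub>D\<^esub> \<rho> (fps_X ^ N)) \<otimes>\<^bsub>D\<^esub> inv\<^bsub>D\<^esub> \<rho> (fps_X ^ N)" by simp
    then show ?thesis using b u cl by (simp add: D.m_assoc)
  qed
  have "corner_order B \<rho> (E star) n (xq star) (\<lambda>l. \<rho> (fps_X ^ (n - l)) \<otimes>\<^bsub>B\<^esub> yq star l)"
  proof (rule corner_order[OF star])
    have SD: "c \<in> carrier D" if "c \<in> carrier B" for c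
      using that subringE(1)[OF S] by (auto simp: B)
    show "\<rho> r \<otimes>\<^bsub>B\<^esub> b = b \<otimes>\<^bsub>B\<^esub> \<rho> r" if "b \<in> carrier B" for b r
      using central[OF SD[OF that]] by (simp add: B)
    show "\<exists>N. \<exists>f\<in>carrier ?P. b \<otimes>\<^bsub>B\<^esub> \<rho> (fps_X ^ N) = \<pi> f" if "b \<in> carrier B" for b
      using dense[OF SD[OF that]] by (simp add: B)
  qed
  then show ?thesis unfolding E rho[abs_def] by blast
qed

section \<open>Homomorphisms, direct sums and summands\<close>

context left_module
begin

lemma smult_zero: "b \<in> carrier B \<Longrightarrow> b \<odot> \<zero> = \<zero>"
  using smult_r_distr[of b \<zero> \<zero>] by (simp add: smult_closed)

lemma zero_smult: "x \<in> carrier M \<Longrightarrow> \<zero>\<^bsub>B\<^esub> \<odot> x = \<zero>"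
  using smult_l_distr[of "\<zero>\<^bsub>B\<^esub>" "\<zero>\<^bsub>B\<^esub>" x] by (simp add: smult_closed)

lemma smult_minus: "b \<in> carrier B \<Longrightarrow> x \<in> carrier M \<Longrightarrow> b \<odot> (\<ominus> x) = \<ominus> (b \<odot> x)"
  using smult_r_distr[of b "\<ominus> x" x]
  by (intro M.minus_equality[symmetric]) (simp_all add: smult_closed M.l_neg smult_zero)

lemma minus_one_smult: "x \<in> carrier M \<Longrightarrow> (\<ominus>\<^bsub>B\<^esub> \<one>\<^bsub>B\<^esub>) \<odot> x = \<ominus> x"
  using smult_l_distr[of "\<ominus>\<^bsub>B\<^esub> \<one>\<^bsub>B\<^esub>" "\<one>\<^bsub>B\<^esub>" x]
  by (intro M.minus_equality[symmetric]) (simp_all add: smult_closed B.l_neg zero_smult smult_one)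

lemma smult_finsum:
  "finite A \<Longrightarrow> b \<in> carrier B \<Longrightarrow> v \<in> A \<rightarrow> carrier M \<Longrightarrow> b \<odot> finsum M v A = finsum M (\<lambda>i. b \<odot> v i) A"
  by (induction A rule: finite_induct) (auto simp: smult_zero smult_r_distr smult_closed Pi_iff)

lemma finsum_smult:
  "finite A \<Longrightarrow> x \<in> carrier M \<Longrightarrow> c \<in> A \<rightarrow> carrier B \<Longrightarrow> finsum B c A \<odot> x = finsum M (\<lambda>i. c i \<odot> x) A"
  by (induction A rule: finite_induct) (auto simp: zero_smult smult_l_distr smult_closed Pi_iff)

end

text \<open>The closure facts of M stand in the premises because the restricted map is evaluated at
  sums and multiples, where it agrees with f only inside the carrier.\<close>

lemma lhomI:
  assumes "\<And>x. x \<in> carrier M \<Longrightarrow> f x \<in> carrier N"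
    and "\<And>x y. x \<in> carrier M \<Longrightarrow> y \<in> carrier M \<Longrightarrow> x \<oplus>\<^bsub>M\<^esub> y \<in> carrier M \<and> f (x \<oplus>\<^bsub>M\<^esub> y) = f x \<oplus>\<^bsub>N\<^esub> f y"
    and "\<And>b x. b \<in> carrier B \<Longrightarrow> x \<in> carrier M \<Longrightarrow> b \<odot>\<^bsub>M\<^esub> x \<in> carrier M \<and> f (b \<odot>\<^bsub>M\<^esub> x) = b \<odot>\<^bsub>N\<^esub> f x"
  shows "restrict f (carrier M) \<in> lhom B M N"
  using assms by (auto simp: lhom_def)

lemma lhom_closed: "f \<in> lhom B M N \<Longrightarrow> x \<in> carrier M \<Longrightarrow> f x \<in> carrier N"
  and lhom_add: "f \<in> lhom B M N \<Longrightarrow> x \<in> carrier M \<Longrightarrow> y \<in> carrier M \<Longrightarrow> f (x \<oplus>\<^bsub>M\<^esub> y) = f x \<oplus>\<^bsub>N\<^esub> f y"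
  and lhom_smult: "f \<in> lhom B M N \<Longrightarrow> b \<in> carrier B \<Longrightarrow> x \<in> carrier M \<Longrightarrow> f (b \<odot>\<^bsub>M\<^esub> x) = b \<odot>\<^bsub>N\<^esub> f x"
  by (auto simp: lhom_def)

lemma lhom_extensional: "f \<in> lhom B M N \<Longrightarrow> f \<in> extensional (carrier M)"
  by (auto simp: lhom_def PiE_def)

lemma lhom_eqI:
  "f \<in> lhom B M N \<Longrightarrow> g \<in> lhom B M N \<Longrightarrow> (\<And>x. x \<in> carrier M \<Longrightarrow> f x = g x) \<Longrightarrow> f = g"
  by (rule extensionalityI[OF lhom_extensional lhom_extensional])

lemma lhom_compose: "f \<in> lhom B M N \<Longrightarrow> g \<in> lhom B N K \<Longrightarrow> left_module B M \<Longrightarrow> compose (carrier M) g f \<in> lhom B M K"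
  unfolding compose_def
  by (rule lhomI)
    (auto simp: lhom_closed lhom_add lhom_smult abelian_monoid.a_closed[OF abelian_group.axioms(1)]
      left_module.smult_closed left_module.axioms(2))

lemma lhom_id: "left_module B M \<Longrightarrow> (\<lambda>x\<in>carrier M. x) \<in> lhom B M M"
  by (rule lhomI) (auto simp: abelian_monoid.a_closed[OF abelian_group.axioms(1)]
      left_module.smult_closed left_module.axioms(2))

locale left_module_hom = M: left_module B M + N: left_module B N
  for B :: "'b ring" and M :: "('b, 'm) module" and N :: "('b, 'n) module" +
  fixes f assumes hom: "f \<in> lhom B M N"
begin

lemmas closed = lhom_closed[OF hom]
lemmas add = lhom_add[OF hom]
lemmas smult = lhom_smult[OF hom]

lemma zero: "f \<zero>\<^bsub>M\<^esub> = \<zero>\<^bsub>N\<^esub>"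
  using add[of "\<zero>\<^bsub>M\<^esub>" "\<zero>\<^bsub>M\<^esub>"] closed[of "\<zero>\<^bsub>M\<^esub>"] by simp

lemma uminus: "x \<in> carrier M \<Longrightarrow> f (\<ominus>\<^bsub>M\<^esub> x) = \<ominus>\<^bsub>N\<^esub> f x"
  using add[of "\<ominus>\<^bsub>M\<^esub> x" x] closed[of "\<ominus>\<^bsub>M\<^esub> x"] closed[of x]
  by (intro N.M.minus_equality[symmetric]) (simp_all add: M.M.l_neg zero)

lemma minus: "x \<in> carrier M \<Longrightarrow> y \<in> carrier M \<Longrightarrow> f (x \<ominus>\<^bsub>M\<^esub> y) = f x \<ominus>\<^bsub>N\<^esub> f y"
  by (simp add: a_minus_def add uminus)

lemma finsum: "finite A \<Longrightarrow> v \<in> A \<rightarrow> carrier M \<Longrightarrow> f (finsum M v A) = finsum N (\<lambda>i. f (v i)) A"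
  by (induction A rule: finite_induct) (auto simp: zero add closed Pi_iff)

end

lemma (in abelian_group) minus_eq_zero_iff: "x \<in> carrier G \<Longrightarrow> y \<in> carrier G \<Longrightarrow> x \<ominus> y = \<zero> \<longleftrightarrow> x = y"
  by (metis a_minus_def minus_equality minus_minus r_neg a_inv_closed)

text \<open>A total submodule of V x Y that meets 0 x Y trivially is the graph of a homomorphism.
  This defines maps by choosing preimages: independence of the choice has to be checked only at
  zero.\<close>

lemma lhom_of_relation:
  assumes "left_module B V" "left_module B Y"
    and R: "R \<subseteq> carrier V \<times> carrier Y"
    and total: "\<And>v. v \<in> carrier V \<Longrightarrow> \<exists>y. (v, y) \<in> R"
    and add: "\<And>v y v' y'. (v, y) \<in> R \<Longrightarrow> (v', y') \<in> R \<Longrightarrow> (v \<oplus>\<^bsub>V\<^esub> v', y \<oplus>\<^bsub>Y\<^esub> y') \<in> R"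
    and smult: "\<And>b v y. b \<in> carrier B \<Longrightarrow> (v, y) \<in> R \<Longrightarrow> (b \<odot>\<^bsub>V\<^esub> v, b \<odot>\<^bsub>Y\<^esub> y) \<in> R"
    and zero: "\<And>y. (\<zero>\<^bsub>V\<^esub>, y) \<in> R \<Longrightarrow> y = \<zero>\<^bsub>Y\<^esub>"
  shows "\<exists>k\<in>lhom B V Y. \<forall>(v, y)\<in>R. k v = y"
proof -
  interpret V: left_module B V by fact
  interpret Y: left_module B Y by fact
  have R': "v \<in> carrier V" "y \<in> carrier Y" if "(v, y) \<in> R" for v y using that R by auto
  have unique: "y = y'" if "(v, y) \<in> R" "(v, y') \<in> R" for v y y'
  proof -
    \<comment> \<open>The difference of two pairs with the same first entry, formed with the scalar
      -1, has first entry zero.\<close>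
    have "(v \<oplus>\<^bsub>V\<^esub> (\<ominus>\<^bsub>B\<^esub> \<one>\<^bsub>B\<^esub>) \<odot>\<^bsub>V\<^esub> v, y \<oplus>\<^bsub>Y\<^esub> (\<ominus>\<^bsub>B\<^esub> \<one>\<^bsub>B\<^esub>) \<odot>\<^bsub>Y\<^esub> y') \<in> R"
      using that by (intro add smult) auto
    then have "(\<zero>\<^bsub>V\<^esub>, y \<ominus>\<^bsub>Y\<^esub> y') \<in> R"
      using R'[OF that(1)] R'[OF that(2)]
      by (simp add: V.minus_one_smult Y.minus_one_smult a_minus_def V.M.r_neg)
    then have "y \<ominus>\<^bsub>Y\<^esub> y' = \<zero>\<^bsub>Y\<^esub>" by (rule zero)
    then show ?thesis using Y.M.minus_eq_zero_iff R'[OF that(1)] R'[OF that(2)] by blast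
  qed
  define k where "k v = (THE y. (v, y) \<in> R)" for v
  have k: "k v = y" if "(v, y) \<in> R" for v y
    unfolding k_def using that unique by blast
  have kR: "(v, k v) \<in> R" if "v \<in> carrier V" for v
    using total[OF that] k by blast
  have "restrict k (carrier V) \<in> lhom B V Y"
  proof (rule lhomI)
    fix x assume x: "x \<in> carrier V"
    show "k x \<in> carrier Y" using R'(2)[OF kR[OF x]] .
    show "x \<oplus>\<^bsub>V\<^esub> y \<in> carrier V \<and> k (x \<oplus>\<^bsub>V\<^esub> y) = k x \<oplus>\<^bsub>Y\<^esub> k y" if "y \<in> carrier V" for y
      using k[OF add[OF kR[OF x] kR[OF that]]] x that by simp
    show "b \<odot>\<^bsub>V\<^esub> x \<in> carrier V \<and> k (b \<odot>\<^bsub>V\<^esub> x) = b \<odot>\<^bsub>Y\<^esub> k x" if "b \<in> carrier B" for b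
      using k[OF smult[OF that kR[OF x]]] V.smult_closed[OF that x] by simp
  qed
  moreover have "\<forall>(v, y)\<in>R. restrict k (carrier V) v = y" using k R' by auto
  ultimately show ?thesis by blast
qed

lemma lhom_inverse:
  assumes "left_module B M" "left_module B N" and f: "f \<in> lhom B M N" and bij: "bij_betw f (carrier M) (carrier N)"
  shows "\<exists>g\<in>lhom B N M. (\<forall>x\<in>carrier M. g (f x) = x) \<and> (\<forall>y\<in>carrier N. f (g y) = y)"
proof -
  interpret f: left_module_hom B M N f using assms by (simp add: left_module_hom_def left_module_hom_axioms_def)
  have "\<exists>g\<in>lhom B N M. \<forall>(y, x)\<in>(\<lambda>x. (f x, x)) ` carrier M. g y = x"
  proof (rule lhom_of_relation)
    show "\<exists>x. (y, x) \<in> (\<lambda>x. (f x, x)) ` carrier M" if "y \<in> carrier N" for y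
      using that bij_betw_imp_surj_on[OF bij] by (auto simp: image_iff)
    show "x = \<zero>\<^bsub>M\<^esub>" if "(\<zero>\<^bsub>N\<^esub>, x) \<in> (\<lambda>x. (f x, x)) ` carrier M" for x
    proof -
      from that have x: "x \<in> carrier M" "f x = f \<zero>\<^bsub>M\<^esub>" using f.zero by auto
      then show ?thesis using bij inj_onD[of f "carrier M" x "\<zero>\<^bsub>M\<^esub>"] by (simp add: bij_betw_def)
    qed
  qed (use assms f.closed in \<open>auto simp: f.add f.smult f.M.smult_closed image_iff\<close>)
  then obtain g where g: "g \<in> lhom B N M" "\<And>x. x \<in> carrier M \<Longrightarrow> g (f x) = x" by auto
  moreover have "f (g y) = y" if y: "y \<in> carrier N" for y
  proof -
    obtain x where "x \<in> carrier M" "y = f x" using y bij_betw_imp_surj_on[OF bij] by auto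
    then show ?thesis using g by simp
  qed
  ultimately show ?thesis by blast
qed

section \<open>Direct sums and free modules\<close>

lemma dsum_simps [simp]:
  "carrier (dsum I F) = (\<Pi>\<^sub>E i\<in>I. carrier (F i))"
  "\<zero>\<^bsub>dsum I F\<^esub> = (\<lambda>i\<in>I. \<zero>\<^bsub>F i\<^esub>)"
  "x \<oplus>\<^bsub>dsum I F\<^esub> y = (\<lambda>i\<in>I. x i \<oplus>\<^bsub>F i\<^esub> y i)"
  "b \<odot>\<^bsub>dsum I F\<^esub> x = (\<lambda>i\<in>I. b \<odot>\<^bsub>F i\<^esub> x i)"
  by (simp_all add: dsum_def)

lemma dsum_left_module:
  fixes B :: "'b ring"
  assumes "ring B" and F: "\<And>i. i \<in> I \<Longrightarrow> left_module B (F i)"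
  shows "left_module B (dsum I F)"
proof (rule left_module.intro[OF assms(1)])
  have grp: "abelian_group (F i)" if "i \<in> I" for i using left_module.axioms(2)[OF F[OF that]] .
  have G: "abelian_monoid (F i)" if "i \<in> I" for i using grp[OF that] by (rule abelian_group.axioms)
  show "abelian_group (dsum I F)"
  proof (rule abelian_groupI)
    fix x assume x: "x \<in> carrier (dsum I F)"
    show "\<exists>y\<in>carrier (dsum I F). y \<oplus>\<^bsub>dsum I F\<^esub> x = \<zero>\<^bsub>dsum I F\<^esub>"
      by (rule bexI[of _ "\<lambda>i\<in>I. \<ominus>\<^bsub>F i\<^esub> x i"])
        (use x grp in \<open>auto simp: abelian_group.l_neg abelian_group.a_inv_closed PiE_iff intro!: restrict_ext\<close>)
    show "\<zero>\<^bsub>dsum I F\<^esub> \<oplus>\<^bsub>dsum I F\<^esub> x = x"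
      using x G by (auto simp: abelian_monoid.l_zero PiE_iff intro!: extensionalityI[of _ I])
  qed (use G in \<open>auto simp: abelian_monoid.a_closed abelian_monoid.zero_closed abelian_monoid.a_assoc PiE_iff
      intro!: restrict_ext intro: abelian_monoid.a_comm\<close>)
  show "left_module_axioms B (dsum I F)"
    by unfold_locales
      (auto simp: left_module.smult_closed[OF F] left_module.smult_l_distr[OF F] left_module.smult_r_distr[OF F]
        left_module.smult_assoc[OF F] left_module.smult_one[OF F] PiE_iff intro!: restrict_ext extensionalityI[of _ I])
qed

lemma dsum_proj:
  fixes B :: "'b ring"
  assumes "i \<in> I" "ring B" "\<And>i. i \<in> I \<Longrightarrow> left_module B (F i)"
  shows "(\<lambda>x\<in>carrier (dsum I F). x i) \<in> lhom B (dsum I F) (F i)"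
proof (rule lhomI)
  interpret left_module B "dsum I F" using assms(2,3) by (rule dsum_left_module)
  fix x y b assume x: "x \<in> carrier (dsum I F)"
  show "x i \<in> carrier (F i)" using x assms(1) by auto
  show "x \<oplus>\<^bsub>dsum I F\<^esub> y \<in> carrier (dsum I F) \<and> (x \<oplus>\<^bsub>dsum I F\<^esub> y) i = x i \<oplus>\<^bsub>F i\<^esub> y i"
    if "y \<in> carrier (dsum I F)"
    using M.a_closed[OF x that] assms(1) by simp
  show "b \<odot>\<^bsub>dsum I F\<^esub> x \<in> carrier (dsum I F) \<and> (b \<odot>\<^bsub>dsum I F\<^esub> x) i = b \<odot>\<^bsub>F i\<^esub> x i" if "b \<in> carrier B"
    using smult_closed[OF that x] assms(1) by simp
qed

definition dsum_incl :: "'i set \<Rightarrow> ('i \<Rightarrow> ('b, 'm) module) \<Rightarrow> 'i \<Rightarrow> 'm \<Rightarrow> 'i \<Rightarrow> 'm" where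
  "dsum_incl I F i = (\<lambda>x\<in>carrier (F i). \<lambda>j\<in>I. if j = i then x else \<zero>\<^bsub>F j\<^esub>)"

lemma dsum_incl_lhom:
  fixes B :: "'b ring"
  assumes "\<And>i. i \<in> I \<Longrightarrow> left_module B (F i)" "i \<in> I"
  shows "dsum_incl I F i \<in> lhom B (F i) (dsum I F)"
  unfolding dsum_incl_def
proof (rule lhomI)
  note grp = left_module.axioms(2)[OF assms(1)]
  have G: "abelian_monoid (F i)" if "i \<in> I" for i using grp[OF that] by (rule abelian_group.axioms)
  fix x assume x: "x \<in> carrier (F i)"
  show "(\<lambda>j\<in>I. if j = i then x else \<zero>\<^bsub>F j\<^esub>) \<in> carrier (dsum I F)"
    using x G by (auto simp: abelian_monoid.zero_closed)
  show "x \<oplus>\<^bsub>F i\<^esub> y \<in> carrier (F i) \<and> (\<lambda>j\<in>I. if j = i then x \<oplus>\<^bsub>F i\<^esub> y else \<zero>\<^bsub>F j\<^esub>) =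
      (\<lambda>j\<in>I. if j = i then x else \<zero>\<^bsub>F j\<^esub>) \<oplus>\<^bsub>dsum I F\<^esub> (\<lambda>j\<in>I. if j = i then y else \<zero>\<^bsub>F j\<^esub>)"
    if "y \<in> carrier (F i)" for y
    using x that G assms(2)
    by (auto simp: abelian_monoid.a_closed abelian_monoid.l_zero abelian_monoid.zero_closed intro!: restrict_ext)
  show "b \<odot>\<^bsub>F i\<^esub> x \<in> carrier (F i) \<and> (\<lambda>j\<in>I. if j = i then b \<odot>\<^bsub>F i\<^esub> x else \<zero>\<^bsub>F j\<^esub>) =
      b \<odot>\<^bsub>dsum I F\<^esub> (\<lambda>j\<in>I. if j = i then x else \<zero>\<^bsub>F j\<^esub>)" if "b \<in> carrier B" for b
    using x that assms(2) left_module.smult_closed[OF assms(1)] left_module.smult_zero[OF assms(1)]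
    by (auto intro!: restrict_ext)
qed

lemma dsum_finsum:
  fixes B :: "'b ring"
  assumes "ring B" "\<And>i. i \<in> I \<Longrightarrow> left_module B (F i)" "finite A" "v \<in> A \<rightarrow> carrier (dsum I F)" "i \<in> I"
  shows "finsum (dsum I F) v A i = finsum (F i) (\<lambda>a. v a i) A"
proof -
  interpret D: left_module B "dsum I F" using assms by (intro dsum_left_module) auto
  interpret left_module B "F i" using assms by auto
  interpret p: left_module_hom B "dsum I F" "F i" "\<lambda>x\<in>carrier (dsum I F). x i"
    using dsum_proj[of i I B F] assms(1,2,5) D.left_module_axioms left_module_axioms
    by (simp add: left_module_hom_def left_module_hom_axioms_def)
  have "finsum (dsum I F) v A \<in> carrier (dsum I F)" using assms(4) by (rule D.M.finsum_closed)
  then have "finsum (dsum I F) v A i = finsum (F i) (\<lambda>a. (\<lambda>x\<in>carrier (dsum I F). x i) (v a)) A"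
    using p.finsum[OF assms(3,4)] by (simp del: dsum_simps)
  also have "\<dots> = finsum (F i) (\<lambda>a. v a i) A"
    using assms(4,5) by (intro M.finsum_cong') (auto simp: Pi_iff PiE_mem)
  finally show ?thesis .
qed

lemma dsum_decompose:
  fixes B :: "'b ring"
  assumes "ring B" "\<And>i. i \<in> I \<Longrightarrow> left_module B (F i)" "finite I" "x \<in> carrier (dsum I F)"
  shows "finsum (dsum I F) (\<lambda>i. dsum_incl I F i (x i)) I = x"
proof -
  interpret D: left_module B "dsum I F" using assms by (intro dsum_left_module) auto
  have inc: "dsum_incl I F i \<in> lhom B (F i) (dsum I F)" if "i \<in> I" for i
    using assms(2) that by (rule dsum_incl_lhom)
  have xi: "x i \<in> carrier (F i)" if "i \<in> I" for i using assms(4) that by auto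
  have cl: "(\<lambda>i. dsum_incl I F i (x i)) \<in> I \<rightarrow> carrier (dsum I F)"
    using lhom_closed[OF inc xi] by blast
  have "finsum (dsum I F) (\<lambda>i. dsum_incl I F i (x i)) I i = x i" if i: "i \<in> I" for i
  proof -
    interpret left_module B "F i" using assms i by auto
    have "finsum (dsum I F) (\<lambda>i. dsum_incl I F i (x i)) I i = finsum (F i) (\<lambda>j. dsum_incl I F j (x j) i) I"
      by (rule dsum_finsum[OF assms(1-3) cl i])
    also have "\<dots> = finsum (F i) (\<lambda>j. if i = j then x i else \<zero>\<^bsub>F i\<^esub>) I"
      using i xi by (intro M.finsum_cong') (auto simp: dsum_incl_def)
    also have "\<dots> = x i" using i assms(3) xi[OF i] M.finsum_singleton[of i I "\<lambda>_. x i"] by simp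
    finally show ?thesis .
  qed
  moreover have "finsum (dsum I F) (\<lambda>i. dsum_incl I F i (x i)) I \<in> carrier (dsum I F)"
    by (rule D.M.finsum_closed[OF cl])
  ultimately show ?thesis using assms(4) by (intro PiE_ext[of _ I]) simp_all
qed

lemma regular_left_module: "ring B \<Longrightarrow> left_module B (regular B)"
proof (rule left_module.intro)
  assume "ring B"
  then interpret ring B .
  have l_inv_ex: "\<exists>y\<in>carrier B. y \<oplus>\<^bsub>B\<^esub> x = \<zero>\<^bsub>B\<^esub>" if "x \<in> carrier B" for x
    using that l_neg by blast
  show "abelian_group (regular B)"
    by (rule abelian_groupI) (auto simp: ring_as_module_def a_ac intro: l_inv_ex)
  show "left_module_axioms B (regular B)"
    by unfold_locales (auto simp: ring_as_module_def l_distr r_distr m_assoc)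
qed

lemma free_left_module: "ring B \<Longrightarrow> left_module B (free_module B m)"
  by (intro dsum_left_module regular_left_module)

text \<open>Projectivity of the free module: preimages v i of the images of the standard basis
  determine the lift.\<close>

lemma free_lift:
  assumes V: "left_module B V" and W: "left_module B W"
    and g: "g \<in> lhom B V W" "g ` carrier V = carrier W" and k: "k \<in> lhom B (free_module B m) W"
  shows "\<exists>l\<in>lhom B (free_module B m) V. \<forall>p\<in>carrier (free_module B m). g (l p) = k p"
proof -
  interpret V: left_module B V by fact
  interpret W: left_module B W by fact
  let ?P = "free_module B m" and ?F = "\<lambda>_ :: nat. regular B"
  have reg: "left_module B (?F i)" for i by (rule regular_left_module[OF V.ring_axioms])
  interpret P: left_module B ?P by (rule free_left_module[OF V.ring_axioms])
  interpret g: left_module_hom B V W g using assms by (simp add: left_module_hom_def left_module_hom_axioms_def)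
  interpret k: left_module_hom B ?P W k
    using assms P.left_module_axioms by (simp add: left_module_hom_def left_module_hom_axioms_def)
  have cP: "p \<in> carrier ?P \<longleftrightarrow> p \<in> {..<m} \<rightarrow>\<^sub>E carrier B" for p by (simp add: ring_as_module_def)
  have inc: "dsum_incl {..<m} ?F i \<in> lhom B (regular B) ?P" if "i < m" for i
    using dsum_incl_lhom[of "{..<m}" B ?F i] reg that by auto
  define b where "b i = dsum_incl {..<m} ?F i \<one>\<^bsub>B\<^esub>" for i
  have b: "b i \<in> carrier ?P" if "i < m" for i
    unfolding b_def using that by (intro lhom_closed[OF inc]) (auto simp: ring_as_module_def)
  have "\<exists>v\<in>carrier V. g v = k (b i)" if "i < m" for i
    using k.closed[OF b[OF that]] g(2) by (metis imageE)
  then obtain v where v: "\<And>i. i < m \<Longrightarrow> v i \<in> carrier V" "\<And>i. i < m \<Longrightarrow> g (v i) = k (b i)" by metis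
  define l where "l p = finsum V (\<lambda>i. p i \<odot>\<^bsub>V\<^esub> v i) {..<m}" for p
  have cl: "(\<lambda>i. p i \<odot>\<^bsub>V\<^esub> v i) \<in> {..<m} \<rightarrow> carrier V" if "p \<in> carrier ?P" for p
    using that v by (auto simp: PiE_iff ring_as_module_def intro!: V.smult_closed)
  have lin: "restrict l (carrier ?P) \<in> lhom B ?P V"
  proof (rule lhomI)
    fix p assume p: "p \<in> carrier ?P"
    show "l p \<in> carrier V" unfolding l_def by (rule V.M.finsum_closed[OF cl[OF p]])
    show "p \<oplus>\<^bsub>?P\<^esub> q \<in> carrier ?P \<and> l (p \<oplus>\<^bsub>?P\<^esub> q) = l p \<oplus>\<^bsub>V\<^esub> l q" if q: "q \<in> carrier ?P" for q
    proof
      show pq: "p \<oplus>\<^bsub>?P\<^esub> q \<in> carrier ?P" using p q by (rule P.M.a_closed)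
      have "l (p \<oplus>\<^bsub>?P\<^esub> q) = finsum V (\<lambda>i. p i \<odot>\<^bsub>V\<^esub> v i \<oplus>\<^bsub>V\<^esub> q i \<odot>\<^bsub>V\<^esub> v i) {..<m}"
        unfolding l_def using p q v cl[OF p] cl[OF q] unfolding cP
        by (intro V.M.finsum_cong') (auto simp: ring_as_module_def V.smult_l_distr PiE_iff Pi_iff)
      also have "\<dots> = l p \<oplus>\<^bsub>V\<^esub> l q" unfolding l_def by (rule V.M.finsum_addf[OF cl[OF p] cl[OF q]])
      finally show "l (p \<oplus>\<^bsub>?P\<^esub> q) = l p \<oplus>\<^bsub>V\<^esub> l q" .
    qed
    show "c \<odot>\<^bsub>?P\<^esub> p \<in> carrier ?P \<and> l (c \<odot>\<^bsub>?P\<^esub> p) = c \<odot>\<^bsub>V\<^esub> l p" if c: "c \<in> carrier B" for c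
    proof
      show "c \<odot>\<^bsub>?P\<^esub> p \<in> carrier ?P" using c p by (rule P.smult_closed)
      have "l (c \<odot>\<^bsub>?P\<^esub> p) = finsum V (\<lambda>i. c \<odot>\<^bsub>V\<^esub> (p i \<odot>\<^bsub>V\<^esub> v i)) {..<m}"
        unfolding l_def using p v c cl[OF p] unfolding cP
        by (intro V.M.finsum_cong') (auto simp: ring_as_module_def V.smult_assoc V.smult_closed PiE_iff Pi_iff)
      also have "\<dots> = c \<odot>\<^bsub>V\<^esub> l p" unfolding l_def using c cl[OF p] by (intro V.smult_finsum[symmetric]) auto
      finally show "l (c \<odot>\<^bsub>?P\<^esub> p) = c \<odot>\<^bsub>V\<^esub> l p" .
    qed
  qed
  have "g (l p) = k p" if p: "p \<in> carrier ?P" for p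
  proof -
    have pi: "p i \<in> carrier B" if "i < m" for i using p that by (auto simp: PiE_iff ring_as_module_def)
    have inc_cl: "dsum_incl {..<m} ?F i (p i) \<in> carrier ?P" if "i \<in> {..<m}" for i
      using lhom_closed[OF inc, of i "p i"] pi that by (simp add: ring_as_module_def del: dsum_simps)
    have "g (l p) = finsum W (\<lambda>i. g (p i \<odot>\<^bsub>V\<^esub> v i)) {..<m}"
      unfolding l_def by (rule g.finsum[OF _ cl[OF p]]) simp
    also have "\<dots> = finsum W (\<lambda>i. k (dsum_incl {..<m} ?F i (p i))) {..<m}"
    proof (rule W.M.finsum_cong')
      fix i assume i: "i \<in> {..<m}"
      have "dsum_incl {..<m} ?F i (p i) = p i \<odot>\<^bsub>?P\<^esub> b i"
        using pi[of i] i V.B.one_closed by (simp add: b_def dsum_incl_def ring_as_module_def fun_eq_iff)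
      then show "g (p i \<odot>\<^bsub>V\<^esub> v i) = k (dsum_incl {..<m} ?F i (p i))"
        using i pi b v by (simp add: g.smult k.smult del: dsum_simps)
    qed (use inc_cl k.closed in blast)+
    also have "\<dots> = k (finsum ?P (\<lambda>i. dsum_incl {..<m} ?F i (p i)) {..<m})"
      by (rule k.finsum[symmetric]) (use inc_cl in \<open>blast, blast\<close>)
    also have "\<dots> = k p" using dsum_decompose[of B "{..<m}" ?F p] V.ring_axioms reg p by simp
    finally show ?thesis .
  qed
  with lin show ?thesis by (intro bexI[OF _ lin]) auto
qed

section \<open>Vanishing of Ext and extension of homomorphisms\<close>

lemma short_exactD:
  assumes "short_exact B X Y Z f g"
  shows "left_module B X" "left_module B Y" "left_module B Z" "f \<in> lhom B X Y" "g \<in> lhom B Y Z"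
    "inj_on f (carrier X)" "g ` carrier Y = carrier Z"
    "\<And>x. x \<in> carrier X \<Longrightarrow> g (f x) = \<zero>\<^bsub>Z\<^esub>"
    "\<And>y. y \<in> carrier Y \<Longrightarrow> g y = \<zero>\<^bsub>Z\<^esub> \<Longrightarrow> \<exists>x\<in>carrier X. f x = y"
    "left_module_hom B X Y f" "left_module_hom B Y Z g"
proof -
  have im: "f ` carrier X = {y \<in> carrier Y. g y = \<zero>\<^bsub>Z\<^esub>}" using assms by (simp add: short_exact_def)
  show "\<And>x. x \<in> carrier X \<Longrightarrow> g (f x) = \<zero>\<^bsub>Z\<^esub>" using im by blast
  show "\<And>y. y \<in> carrier Y \<Longrightarrow> g y = \<zero>\<^bsub>Z\<^esub> \<Longrightarrow> \<exists>x\<in>carrier X. f x = y" using im by (metis (mono_tags, lifting) imageE mem_Collect_eq)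
qed (use assms in \<open>auto simp: short_exact_def left_module_hom_def left_module_hom_axioms_def\<close>)

text \<open>
  The common core of lifting along \<open>g\<close> and extending along \<open>f\<close>: a comparison of the presentation
  \<open>\<epsilon> : P \<rightarrow> T\<close> with the extension, in which the obstruction cocycle has been made a coboundary.
\<close>

lemma ext_vanishes_comparison:
  fixes B :: "'b ring" and T :: "('b, 't) module" and Y :: "('b, 'y) module" and V :: "('b, 'v) module"
  assumes ext: "ext_vanishes B 1 T Y" and T: "left_module B T" and Y: "left_module B Y"
    and ses: "short_exact B U V W f g" and h: "h \<in> lhom B T W" and u: "u \<in> lhom B U Y"
  obtains P :: "('b, nat \<Rightarrow> 'b) module" and \<epsilon> l g'
  where "left_module B P" "\<epsilon> \<in> lhom B P T" "\<epsilon> ` carrier P = carrier T" "l \<in> lhom B P V" "g' \<in> lhom B P Y"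
    "\<And>p. p \<in> carrier P \<Longrightarrow> g (l p) = h (\<epsilon> p)"
    "\<And>p. p \<in> carrier P \<Longrightarrow> \<epsilon> p = \<zero>\<^bsub>T\<^esub> \<Longrightarrow> \<exists>a\<in>carrier U. f a = l p \<and> u a = g' p"
proof -
  note S = short_exactD[OF ses]
  interpret f: left_module_hom B U V f by (rule S)
  interpret g: left_module_hom B V W g by (rule S)
  obtain r d \<epsilon> where res: "free_resolution B T r d \<epsilon>"
      and coc: "ext_cocycles B r d Y 1 = ext_coboundaries B r d Y 1"
    using ext by (auto simp: ext_vanishes_def)
  let ?P = "\<lambda>i. free_module B (r i)"
  have P: "left_module B (?P i)" for i by (rule free_left_module[OF f.M.ring_axioms])
  interpret u: left_module_hom B U Y u
    using S(1) Y u by (simp add: left_module_hom_def left_module_hom_axioms_def)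
  interpret h: left_module_hom B T W h
    using S(3) T h by (simp add: left_module_hom_def left_module_hom_axioms_def)
  have eps: "\<epsilon> \<in> lhom B (?P 0) T" "\<epsilon> ` carrier (?P 0) = carrier T"
    and d: "\<And>j. d j \<in> lhom B (?P (Suc j)) (?P j)"
    and im0: "d 0 ` carrier (?P (Suc 0)) = {x \<in> carrier (?P 0). \<epsilon> x = \<zero>\<^bsub>T\<^esub>}"
    and im1: "d (Suc 0) ` carrier (?P (Suc (Suc 0))) = {x \<in> carrier (?P (Suc 0)). d 0 x = \<zero>\<^bsub>?P 0\<^esub>}"
    using res by (simp_all add: free_resolution_def del: dsum_simps)
  interpret eps: left_module_hom B "?P 0" T \<epsilon>
    using P T eps by (simp add: left_module_hom_def left_module_hom_axioms_def del: dsum_simps)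
  interpret d: left_module_hom B "?P (Suc 0)" "?P 0" "d 0"
    using P d[of 0] by (simp add: left_module_hom_def left_module_hom_axioms_def del: dsum_simps)
  have "compose (carrier (?P 0)) h \<epsilon> \<in> lhom B (?P 0) W" by (rule lhom_compose[OF eps(1) h P])
  from free_lift[OF S(2,3,5,7) this] obtain l where l: "l \<in> lhom B (?P 0) V"
    "\<And>p. p \<in> carrier (?P 0) \<Longrightarrow> g (l p) = h (\<epsilon> p)" by (auto simp: compose_eq simp del: dsum_simps)
  interpret l: left_module_hom B "?P 0" V l
    using P S l by (simp add: left_module_hom_def left_module_hom_axioms_def del: dsum_simps)
  have "\<exists>a\<in>carrier U. f a = l (d 0 q)" if "q \<in> carrier (?P (Suc 0))" for q
  proof (rule S(9))
    have dq: "d 0 q \<in> carrier (?P 0)" "\<epsilon> (d 0 q) = \<zero>\<^bsub>T\<^esub>" using im0 that by blast+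
    show "l (d 0 q) \<in> carrier V" "g (l (d 0 q)) = \<zero>\<^bsub>W\<^esub>"
      using dq l.closed l(2) h.zero by (simp_all del: dsum_simps)
  qed
  \<comment> \<open>The connecting construction: l after \<open>d 0\<close> lands in the kernel of
    g, and c is its factorisation through f. Since d d = 0, the map u c is a cocycle.\<close>
  then obtain c where c: "\<And>q. q \<in> carrier (?P (Suc 0)) \<Longrightarrow> c q \<in> carrier U"
      "\<And>q. q \<in> carrier (?P (Suc 0)) \<Longrightarrow> f (c q) = l (d 0 q)" by metis
  have c_unique: "c q = a" if "q \<in> carrier (?P (Suc 0))" "a \<in> carrier U" "f a = l (d 0 q)" for q a
    using inj_onD[OF S(6), of "c q" a] c that by simp
  have "restrict (\<lambda>q. u (c q)) (carrier (?P (Suc 0))) \<in> lhom B (?P (Suc 0)) Y"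
  proof (rule lhomI)
    fix q assume q: "q \<in> carrier (?P (Suc 0))"
    show "u (c q) \<in> carrier Y" using u.closed c(1) q by blast
    show "q \<oplus>\<^bsub>?P (Suc 0)\<^esub> q' \<in> carrier (?P (Suc 0)) \<and> u (c (q \<oplus>\<^bsub>?P (Suc 0)\<^esub> q')) = u (c q) \<oplus>\<^bsub>Y\<^esub> u (c q')" if q': "q' \<in> carrier (?P (Suc 0))" for q'
    proof
      show qq: "q \<oplus>\<^bsub>?P (Suc 0)\<^esub> q' \<in> carrier (?P (Suc 0))" using q q' by (rule d.M.M.a_closed)
      have "c (q \<oplus>\<^bsub>?P (Suc 0)\<^esub> q') = c q \<oplus>\<^bsub>U\<^esub> c q'"
      proof (rule c_unique[OF qq])
        show "f (c q \<oplus>\<^bsub>U\<^esub> c q') = l (d 0 (q \<oplus>\<^bsub>?P (Suc 0)\<^esub> q'))"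
          using q q' c d.closed by (simp add: f.add d.add l.add del: dsum_simps)
      qed (use c q q' in blast)
      then show "u (c (q \<oplus>\<^bsub>?P (Suc 0)\<^esub> q')) = u (c q) \<oplus>\<^bsub>Y\<^esub> u (c q')" using c q q' u.add by simp
    qed
    show "b \<odot>\<^bsub>?P (Suc 0)\<^esub> q \<in> carrier (?P (Suc 0)) \<and> u (c (b \<odot>\<^bsub>?P (Suc 0)\<^esub> q)) = b \<odot>\<^bsub>Y\<^esub> u (c q)" if b: "b \<in> carrier B" for b
    proof
      show qq: "b \<odot>\<^bsub>?P (Suc 0)\<^esub> q \<in> carrier (?P (Suc 0))" using b q by (rule d.M.smult_closed)
      have "c (b \<odot>\<^bsub>?P (Suc 0)\<^esub> q) = b \<odot>\<^bsub>U\<^esub> c q"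
      proof (rule c_unique[OF qq])
        show "f (b \<odot>\<^bsub>U\<^esub> c q) = l (d 0 (b \<odot>\<^bsub>?P (Suc 0)\<^esub> q))"
          using q b c d.closed by (simp add: f.smult d.smult l.smult del: dsum_simps)
      qed (use c q b f.M.smult_closed in blast)
      then show "u (c (b \<odot>\<^bsub>?P (Suc 0)\<^esub> q)) = b \<odot>\<^bsub>Y\<^esub> u (c q)" using c q b u.smult by simp
    qed
  qed
  moreover have "restrict (\<lambda>q. u (c q)) (carrier (?P (Suc 0))) (d (Suc 0) x) = \<zero>\<^bsub>Y\<^esub>" if "x \<in> carrier (?P (Suc (Suc 0)))" for x
  proof -
    have x: "d (Suc 0) x \<in> carrier (?P (Suc 0))" "d 0 (d (Suc 0) x) = \<zero>\<^bsub>?P 0\<^esub>" using im1 that by blast+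
    have "c (d (Suc 0) x) = \<zero>\<^bsub>U\<^esub>"
      using x by (intro c_unique) (simp_all add: f.zero l.zero del: dsum_simps)
    then show ?thesis using x u.zero by (simp del: dsum_simps)
  qed
  ultimately have "restrict (\<lambda>q. u (c q)) (carrier (?P (Suc 0))) \<in> ext_cocycles B r d Y 1"
    by (simp add: ext_cocycles_def del: dsum_simps)
  \<comment> \<open>Vanishing of Ext makes the cocycle u c a coboundary, with g' as primitive on the
    zeroth free module.\<close>
  then obtain g' where g': "g' \<in> lhom B (?P 0) Y"
      "restrict (\<lambda>q. u (c q)) (carrier (?P (Suc 0))) = compose (carrier (?P (Suc 0))) g' (d 0)"
    unfolding coc by (auto simp: ext_coboundaries_def simp del: dsum_simps)
  have g'c: "g' (d 0 q) = u (c q)" if "q \<in> carrier (?P (Suc 0))" for q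
    using fun_cong[OF g'(2), of q] that by (simp add: compose_eq del: dsum_simps)
  have "\<exists>a\<in>carrier U. f a = l p \<and> u a = g' p" if "p \<in> carrier (?P 0)" "\<epsilon> p = \<zero>\<^bsub>T\<^esub>" for p
  proof -
    have "p \<in> d 0 ` carrier (?P (Suc 0))" unfolding im0 using that by blast
    then obtain q where "q \<in> carrier (?P (Suc 0))" "p = d 0 q" by blast
    then show ?thesis using c g'c by metis
  qed
  from that[OF P eps l(1) g'(1) l(2) this] show thesis .
qed

text \<open>With u the identity of X, the primitive g' corrects the lift l: on the kernel of
  \<open>\<epsilon>\<close> one has l = f g', so l - f g' descends to T. The correction is invisible
  after g because g f = 0.\<close>

lemma ext_vanishes_lift:
  fixes B :: "'b ring"
  assumes ext: "ext_vanishes B 1 T X" and T: "left_module B T"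
    and ses: "short_exact B X Y M f g" and h: "h \<in> lhom B T M"
  shows "\<exists>h'\<in>lhom B T Y. \<forall>x\<in>carrier T. g (h' x) = h x"
proof -
  note S = short_exactD[OF ses]
  interpret f: left_module_hom B X Y f by (rule S)
  interpret g: left_module_hom B Y M g by (rule S)
  obtain P :: "('b, nat \<Rightarrow> 'b) module" and \<epsilon> l g' where P: "left_module B P"
    and eps: "\<epsilon> \<in> lhom B P T" "\<epsilon> ` carrier P = carrier T" and l: "l \<in> lhom B P Y" and g': "g' \<in> lhom B P X"
    and gl: "\<And>p. p \<in> carrier P \<Longrightarrow> g (l p) = h (\<epsilon> p)"
    and ker: "\<And>p. p \<in> carrier P \<Longrightarrow> \<epsilon> p = \<zero>\<^bsub>T\<^esub> \<Longrightarrow> \<exists>a\<in>carrier X. f a = l p \<and> (\<lambda>x\<in>carrier X. x) a = g' p"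
    using ext_vanishes_comparison[OF ext T S(1) ses h lhom_id[OF S(1)]] by blast
  interpret P: left_module B P by (rule P)
  interpret l: left_module_hom B P Y l using P S l by (simp add: left_module_hom_def left_module_hom_axioms_def)
  interpret g': left_module_hom B P X g' using P S g' by (simp add: left_module_hom_def left_module_hom_axioms_def)
  interpret eps: left_module_hom B P T \<epsilon> using P T eps by (simp add: left_module_hom_def left_module_hom_axioms_def)
  let ?k = "\<lambda>p. l p \<ominus>\<^bsub>Y\<^esub> f (g' p)"
  have kcl: "?k p \<in> carrier Y" if "p \<in> carrier P" for p
    using that by (simp add: l.closed g'.closed f.closed)
  have "\<exists>k\<in>lhom B T Y. \<forall>(x, y)\<in>(\<lambda>p. (\<epsilon> p, ?k p)) ` carrier P. k x = y"
  proof (rule lhom_of_relation[OF T S(2)])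
    show "\<exists>y. (v, y) \<in> (\<lambda>p. (\<epsilon> p, ?k p)) ` carrier P" if "v \<in> carrier T" for v
      using that unfolding eps(2)[symmetric] by auto
    show "(v \<oplus>\<^bsub>T\<^esub> v', y \<oplus>\<^bsub>Y\<^esub> y') \<in> (\<lambda>p. (\<epsilon> p, ?k p)) ` carrier P"
      if vy: "(v, y) \<in> (\<lambda>p. (\<epsilon> p, ?k p)) ` carrier P" "(v', y') \<in> (\<lambda>p. (\<epsilon> p, ?k p)) ` carrier P" for v y v' y'
    proof -
      obtain p p' where p: "p \<in> carrier P" "p' \<in> carrier P" "v = \<epsilon> p" "y = ?k p" "v' = \<epsilon> p'" "y' = ?k p'"
        using vy by auto
      then have "v \<oplus>\<^bsub>T\<^esub> v' = \<epsilon> (p \<oplus>\<^bsub>P\<^esub> p')" "y \<oplus>\<^bsub>Y\<^esub> y' = ?k (p \<oplus>\<^bsub>P\<^esub> p')"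
        by (simp_all add: eps.add l.add g'.add f.add l.closed g'.closed f.closed a_minus_def
            f.N.M.minus_add f.N.M.a_ac)
      then show ?thesis using p by auto
    qed
    show "(b \<odot>\<^bsub>T\<^esub> v, b \<odot>\<^bsub>Y\<^esub> y) \<in> (\<lambda>p. (\<epsilon> p, ?k p)) ` carrier P"
      if b: "b \<in> carrier B" and vy: "(v, y) \<in> (\<lambda>p. (\<epsilon> p, ?k p)) ` carrier P" for b v y
    proof -
      obtain p where p: "p \<in> carrier P" "v = \<epsilon> p" "y = ?k p" using vy by auto
      then have "b \<odot>\<^bsub>T\<^esub> v = \<epsilon> (b \<odot>\<^bsub>P\<^esub> p)" "b \<odot>\<^bsub>Y\<^esub> y = ?k (b \<odot>\<^bsub>P\<^esub> p)"
        using b by (simp_all add: eps.smult l.smult g'.smult f.smult l.closed g'.closed f.closed a_minus_def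
            f.N.smult_r_distr f.N.smult_minus)
      moreover have "b \<odot>\<^bsub>P\<^esub> p \<in> carrier P" using b p P.smult_closed by simp
      ultimately show ?thesis by auto
    qed
    show "y = \<zero>\<^bsub>Y\<^esub>" if y: "(\<zero>\<^bsub>T\<^esub>, y) \<in> (\<lambda>p. (\<epsilon> p, ?k p)) ` carrier P" for y
    proof -
      obtain p where p: "p \<in> carrier P" "\<epsilon> p = \<zero>\<^bsub>T\<^esub>" "y = ?k p" using y by auto
      then obtain a where "a \<in> carrier X" "f a = l p" "a = g' p" using ker by auto
      with p show ?thesis using f.N.M.minus_eq_zero_iff l.closed by simp
    qed
  qed (use eps.closed kcl in auto)
  then obtain k where k: "k \<in> lhom B T Y" "\<And>p. p \<in> carrier P \<Longrightarrow> k (\<epsilon> p) = ?k p" by auto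
  have "g (k x) = h x" if x: "x \<in> carrier T" for x
  proof -
    obtain p where p: "p \<in> carrier P" "x = \<epsilon> p" using x eps(2) by auto
    have hx: "h (\<epsilon> p) \<in> carrier M" using lhom_closed[OF h] x p by simp
    have "g (k x) = g (l p) \<ominus>\<^bsub>M\<^esub> g (f (g' p))"
      using p k(2) by (simp add: g.minus l.closed f.closed g'.closed)
    also have "\<dots> = h x" using p S(8) g'.closed gl hx by (simp add: a_minus_def)
    finally show ?thesis .
  qed
  with k(1) show ?thesis by blast
qed

text \<open>The obstruction to extending u over V lies in Ext of W, a summand of T. The comparison
  is made over T, with the retraction r in place of h. An element of V is written as f a + l p, and
  its image is declared to be u a + g' p.\<close>

lemma ext_vanishes_extend:
  fixes B :: "'b ring"
  assumes ext: "ext_vanishes B 1 T Y" and T: "left_module B T" and Y: "left_module B Y"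
    and ses: "short_exact B U V W f g" and W: "is_summand B W T" and u: "u \<in> lhom B U Y"
  shows "\<exists>u'\<in>lhom B V Y. \<forall>a\<in>carrier U. u' (f a) = u a"
proof -
  note S = short_exactD[OF ses]
  interpret f: left_module_hom B U V f by (rule S)
  interpret g: left_module_hom B V W g by (rule S)
  interpret Y: left_module B Y by (rule Y)
  obtain s r where s: "s \<in> lhom B W T" and r: "r \<in> lhom B T W" and rs: "\<And>x. x \<in> carrier W \<Longrightarrow> r (s x) = x"
    using W by (auto simp: is_summand_def)
  interpret s: left_module_hom B W T s using S T s by (simp add: left_module_hom_def left_module_hom_axioms_def)
  obtain P :: "('b, nat \<Rightarrow> 'b) module" and \<epsilon> l g' where P: "left_module B P"
    and eps: "\<epsilon> \<in> lhom B P T" "\<epsilon> ` carrier P = carrier T" and l: "l \<in> lhom B P V" and g': "g' \<in> lhom B P Y"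
    and gl: "\<And>p. p \<in> carrier P \<Longrightarrow> g (l p) = r (\<epsilon> p)"
    and ker: "\<And>p. p \<in> carrier P \<Longrightarrow> \<epsilon> p = \<zero>\<^bsub>T\<^esub> \<Longrightarrow> \<exists>a\<in>carrier U. f a = l p \<and> u a = g' p"
    using ext_vanishes_comparison[OF ext T Y ses r u] by blast
  interpret P: left_module B P by (rule P)
  interpret u: left_module_hom B U Y u using Y S u by (simp add: left_module_hom_def left_module_hom_axioms_def)
  interpret l: left_module_hom B P V l using P S l by (simp add: left_module_hom_def left_module_hom_axioms_def)
  interpret g': left_module_hom B P Y g' using P Y g' by (simp add: left_module_hom_def left_module_hom_axioms_def)
  interpret eps: left_module_hom B P T \<epsilon> using P T eps by (simp add: left_module_hom_def left_module_hom_axioms_def)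
  \<comment> \<open>Requiring \<open>\<epsilon> p\<close> to equal s (g v), rather than just g (l p)
    to equal g v, is what makes the value independent of choices: for v = 0 it puts p into the
    kernel of \<open>\<epsilon>\<close>, where the comparison property applies.\<close>
  define R where "R = {(f a \<oplus>\<^bsub>V\<^esub> l p, u a \<oplus>\<^bsub>Y\<^esub> g' p) | a p.
    a \<in> carrier U \<and> p \<in> carrier P \<and> \<epsilon> p = s (g (f a \<oplus>\<^bsub>V\<^esub> l p))}"
  have RI: "(f a \<oplus>\<^bsub>V\<^esub> l p, u a \<oplus>\<^bsub>Y\<^esub> g' p) \<in> R"
    if "a \<in> carrier U" "p \<in> carrier P" "\<epsilon> p = s (g (f a \<oplus>\<^bsub>V\<^esub> l p))" for a p
    using that by (auto simp: R_def)
  have RE: "\<exists>a p. a \<in> carrier U \<and> p \<in> carrier P \<and> \<epsilon> p = s (g v) \<and> v = f a \<oplus>\<^bsub>V\<^esub> l p \<and> y = u a \<oplus>\<^bsub>Y\<^esub> g' p"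
    if "(v, y) \<in> R" for v y
    using that by (auto simp: R_def)
  note cl = f.closed g.closed u.closed l.closed g'.closed s.closed eps.closed
  have "\<exists>k\<in>lhom B V Y. \<forall>(v, y)\<in>R. k v = y"
  proof (rule lhom_of_relation[OF S(2) Y])
    show "R \<subseteq> carrier V \<times> carrier Y" by (auto simp: R_def cl)
    show "\<exists>y. (v, y) \<in> R" if v: "v \<in> carrier V" for v
    proof -
      have "s (g v) \<in> carrier T" using v by (simp add: cl)
      then obtain p where p: "p \<in> carrier P" "\<epsilon> p = s (g v)" using eps(2) by (metis imageE)
      have "g (l p) = g v" using gl p rs v by (simp add: cl)
      then have "g (v \<ominus>\<^bsub>V\<^esub> l p) = \<zero>\<^bsub>W\<^esub>" using v p by (simp add: g.minus cl g.N.M.minus_eq_zero_iff)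
      then obtain a where a: "a \<in> carrier U" "f a = v \<ominus>\<^bsub>V\<^esub> l p" using S(9)[of "v \<ominus>\<^bsub>V\<^esub> l p"] v p cl by auto
      have "f a \<oplus>\<^bsub>V\<^esub> l p = v" unfolding a(2) using v p by (simp add: a_minus_def f.N.M.a_assoc f.N.M.l_neg cl)
      then show ?thesis using RI[OF a(1) p(1)] p by auto
    qed
    show "(v \<oplus>\<^bsub>V\<^esub> v', y \<oplus>\<^bsub>Y\<^esub> y') \<in> R" if vy: "(v, y) \<in> R" "(v', y') \<in> R" for v y v' y'
    proof -
      obtain a p where 1: "a \<in> carrier U" "p \<in> carrier P" "\<epsilon> p = s (g v)" "v = f a \<oplus>\<^bsub>V\<^esub> l p" "y = u a \<oplus>\<^bsub>Y\<^esub> g' p"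
        using RE[OF vy(1)] by blast
      obtain a' p' where 2: "a' \<in> carrier U" "p' \<in> carrier P" "\<epsilon> p' = s (g v')" "v' = f a' \<oplus>\<^bsub>V\<^esub> l p'" "y' = u a' \<oplus>\<^bsub>Y\<^esub> g' p'"
        using RE[OF vy(2)] by blast
      have v: "v \<in> carrier V" "v' \<in> carrier V" using 1 2 by (simp_all add: cl)
      have "f (a \<oplus>\<^bsub>U\<^esub> a') \<oplus>\<^bsub>V\<^esub> l (p \<oplus>\<^bsub>P\<^esub> p') = v \<oplus>\<^bsub>V\<^esub> v'"
        using 1 2 by (simp add: f.add l.add cl f.N.M.a_ac)
      moreover have "u (a \<oplus>\<^bsub>U\<^esub> a') \<oplus>\<^bsub>Y\<^esub> g' (p \<oplus>\<^bsub>P\<^esub> p') = y \<oplus>\<^bsub>Y\<^esub> y'"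
        using 1 2 by (simp add: u.add g'.add cl Y.M.a_ac)
      moreover have "\<epsilon> (p \<oplus>\<^bsub>P\<^esub> p') = s (g (v \<oplus>\<^bsub>V\<^esub> v'))"
        using 1(2,3) 2(2,3) v by (simp add: eps.add g.add s.add cl)
      ultimately show ?thesis using RI[of "a \<oplus>\<^bsub>U\<^esub> a'" "p \<oplus>\<^bsub>P\<^esub> p'"] 1(1,2) 2(1,2) by simp
    qed
    show "(b \<odot>\<^bsub>V\<^esub> v, b \<odot>\<^bsub>Y\<^esub> y) \<in> R" if b: "b \<in> carrier B" and vy: "(v, y) \<in> R" for b v y
    proof -
      obtain a p where 1: "a \<in> carrier U" "p \<in> carrier P" "\<epsilon> p = s (g v)" "v = f a \<oplus>\<^bsub>V\<^esub> l p" "y = u a \<oplus>\<^bsub>Y\<^esub> g' p"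
        using RE[OF vy] by blast
      have v: "v \<in> carrier V" using 1 by (simp add: cl)
      have "f (b \<odot>\<^bsub>U\<^esub> a) \<oplus>\<^bsub>V\<^esub> l (b \<odot>\<^bsub>P\<^esub> p) = b \<odot>\<^bsub>V\<^esub> v"
        using 1 b by (simp add: f.smult l.smult cl f.N.smult_r_distr)
      moreover have "u (b \<odot>\<^bsub>U\<^esub> a) \<oplus>\<^bsub>Y\<^esub> g' (b \<odot>\<^bsub>P\<^esub> p) = b \<odot>\<^bsub>Y\<^esub> y"
        using 1 b by (simp add: u.smult g'.smult cl Y.smult_r_distr)
      moreover have "\<epsilon> (b \<odot>\<^bsub>P\<^esub> p) = s (g (b \<odot>\<^bsub>V\<^esub> v))"
        using 1(2,3) v b by (simp add: eps.smult g.smult s.smult cl)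
      ultimately show ?thesis using RI[of "b \<odot>\<^bsub>U\<^esub> a" "b \<odot>\<^bsub>P\<^esub> p"] 1(1,2) b f.M.smult_closed P.smult_closed by simp
    qed
    show "y = \<zero>\<^bsub>Y\<^esub>" if vy: "(\<zero>\<^bsub>V\<^esub>, y) \<in> R" for y
    proof -
      obtain a p where 1: "a \<in> carrier U" "p \<in> carrier P" "\<epsilon> p = s (g \<zero>\<^bsub>V\<^esub>)" "\<zero>\<^bsub>V\<^esub> = f a \<oplus>\<^bsub>V\<^esub> l p" "y = u a \<oplus>\<^bsub>Y\<^esub> g' p"
        using RE[OF vy] by blast
      have "\<epsilon> p = \<zero>\<^bsub>T\<^esub>" using 1(3) by (simp add: g.zero s.zero)
      then obtain a' where a': "a' \<in> carrier U" "f a' = l p" "u a' = g' p" using ker 1 by blast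
      have "f (a \<oplus>\<^bsub>U\<^esub> a') = f \<zero>\<^bsub>U\<^esub>" using 1 a' by (simp add: f.add f.zero)
      then have "a \<oplus>\<^bsub>U\<^esub> a' = \<zero>\<^bsub>U\<^esub>" by (rule inj_onD[OF S(6)]) (use 1 a' in auto)
      then show ?thesis using 1(1,5) a' u.add[of a a'] u.zero by simp
    qed
  qed
  then obtain k where k: "k \<in> lhom B V Y" and kR: "\<forall>(v, y)\<in>R. k v = y" by metis
  have kR: "k v = y" if "(v, y) \<in> R" for v y using bspec[OF kR that] by simp
  have "k (f a) = u a" if a: "a \<in> carrier U" for a
    using kR[OF RI[OF a P.M.zero_closed]] a S(8)[OF a] by (simp add: l.zero g'.zero eps.zero s.zero cl)
  with k show ?thesis by blast
qed

section \<open>Endomorphisms of modules over the complete ring \<open>R\<close>\<close>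

text \<open>A finitely generated, t-adically separated and complete R-module Z inside an ambient
  R-module. The action of B is kept as a set of operators, as only commuting with it matters; the
  scalars belong to that set, so its endomorphisms are R-linear. \<open>res\<close> plays the role
  of finitely many coordinates modulo t.\<close>

locale adic_module = scal: Modules.module scal
  for scal :: "complex fps \<Rightarrow> 'w::ab_group_add \<Rightarrow> 'w" +
  fixes Z :: "'w set" and \<BB> :: "('w \<Rightarrow> 'w) set"
    and d :: nat and gen :: "nat \<Rightarrow> 'w" and res :: "'w \<Rightarrow> nat \<Rightarrow> complex"
  assumes Z_zero: "0 \<in> Z"
    and Z_add: "z \<in> Z \<Longrightarrow> z' \<in> Z \<Longrightarrow> z + z' \<in> Z"
    and Z_scal: "z \<in> Z \<Longrightarrow> scal a z \<in> Z"
    and op_closed: "\<beta> \<in> \<BB> \<Longrightarrow> z \<in> Z \<Longrightarrow> \<beta> z \<in> Z"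
    and op_add: "\<beta> \<in> \<BB> \<Longrightarrow> z \<in> Z \<Longrightarrow> z' \<in> Z \<Longrightarrow> \<beta> (z + z') = \<beta> z + \<beta> z'"
    and op_scal: "\<beta> \<in> \<BB> \<Longrightarrow> z \<in> Z \<Longrightarrow> \<beta> (scal a z) = scal a (\<beta> z)"
    and scal_op: "scal a \<in> \<BB>"
    and separated': "z \<in> Z \<Longrightarrow> (\<And>K. z \<in> scal (fps_X ^ K) ` Z) \<Longrightarrow> z = 0"
    and complete': "(\<And>K. s K \<in> Z) \<Longrightarrow> (\<And>K. s (Suc K) - s K \<in> scal (fps_X ^ K) ` Z) \<Longrightarrow>
      \<exists>x\<in>Z. \<forall>K. x - s K \<in> scal (fps_X ^ K) ` Z"
    and gen_closed: "l < d \<Longrightarrow> gen l \<in> Z"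
    and gen: "z \<in> Z \<Longrightarrow> \<exists>c. z = (\<Sum>l<d. scal (c l) (gen l))"
    and res_add: "res (z + z') l = res z l + res z' l"
    and res_const: "res (scal (fps_const c) z) l = c * res z l"
    and res_zero: "z \<in> Z \<Longrightarrow> (\<And>l. l < d \<Longrightarrow> res z l = 0) \<Longrightarrow> z \<in> scal fps_X ` Z"
begin

definition End :: "('w \<Rightarrow> 'w) set" where
  "End = {\<phi>. (\<forall>z\<in>Z. \<phi> z \<in> Z) \<and> (\<forall>z\<in>Z. \<forall>z'\<in>Z. \<phi> (z + z') = \<phi> z + \<phi> z') \<and>
    (\<forall>\<beta>\<in>\<BB>. \<forall>z\<in>Z. \<phi> (\<beta> z) = \<beta> (\<phi> z))}"

definition adic :: "nat \<Rightarrow> 'w set" where "adic K = scal (fps_X ^ K) ` Z"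

lemma End_closed: "\<phi> \<in> End \<Longrightarrow> z \<in> Z \<Longrightarrow> \<phi> z \<in> Z"
  and End_add: "\<phi> \<in> End \<Longrightarrow> z \<in> Z \<Longrightarrow> z' \<in> Z \<Longrightarrow> \<phi> (z + z') = \<phi> z + \<phi> z'"
  and End_op: "\<phi> \<in> End \<Longrightarrow> \<beta> \<in> \<BB> \<Longrightarrow> z \<in> Z \<Longrightarrow> \<phi> (\<beta> z) = \<beta> (\<phi> z)"
  and End_scal: "\<phi> \<in> End \<Longrightarrow> z \<in> Z \<Longrightarrow> \<phi> (scal a z) = scal a (\<phi> z)"
  using scal_op by (auto simp: End_def)

lemma Z_minus: "z \<in> Z \<Longrightarrow> - z \<in> Z"
  using Z_scal[of z "-1"] by simp

lemma Z_diff: "z \<in> Z \<Longrightarrow> z' \<in> Z \<Longrightarrow> z - z' \<in> Z"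
  using Z_add[OF _ Z_minus, of z z'] by simp

lemma Z_sum: "(\<And>j. j \<in> A \<Longrightarrow> v j \<in> Z) \<Longrightarrow> sum v A \<in> Z"
  by (induction A rule: infinite_finite_induct) (auto intro: Z_zero Z_add)

lemma End_zero: "\<phi> \<in> End \<Longrightarrow> \<phi> 0 = 0"
  using End_scal[OF _ Z_zero, of \<phi> 0] by simp

lemma End_minus: "\<phi> \<in> End \<Longrightarrow> z \<in> Z \<Longrightarrow> \<phi> (- z) = - \<phi> z"
  using End_scal[of \<phi> z "-1"] by simp

lemma End_diff: "\<phi> \<in> End \<Longrightarrow> z \<in> Z \<Longrightarrow> z' \<in> Z \<Longrightarrow> \<phi> (z - z') = \<phi> z - \<phi> z'"
  using End_add[OF _ _ Z_minus, of \<phi> z z'] by (simp add: End_minus)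

lemma End_sum: "\<phi> \<in> End \<Longrightarrow> (\<And>j. j \<in> A \<Longrightarrow> v j \<in> Z) \<Longrightarrow> \<phi> (sum v A) = (\<Sum>j\<in>A. \<phi> (v j))"
  by (induction A rule: infinite_finite_induct) (auto simp: End_zero End_add Z_sum)

lemma EndI:
  assumes "\<And>z. z \<in> Z \<Longrightarrow> \<phi> z \<in> Z" "\<And>z z'. z \<in> Z \<Longrightarrow> z' \<in> Z \<Longrightarrow> \<phi> (z + z') = \<phi> z + \<phi> z'"
    "\<And>\<beta> z. \<beta> \<in> \<BB> \<Longrightarrow> z \<in> Z \<Longrightarrow> \<phi> (\<beta> z) = \<beta> (\<phi> z)"
  shows "\<phi> \<in> End"
  using assms by (simp add: End_def)

lemma End_funpow: "\<phi> \<in> End \<Longrightarrow> (\<phi> ^^ j) \<in> End"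
  by (induction j) (auto intro!: EndI simp: End_closed End_add End_op op_closed)

lemma adicE: "z \<in> adic K \<Longrightarrow> \<exists>y\<in>Z. z = scal (fps_X ^ K) y"
  by (auto simp: adic_def)

lemma adic_Z: "z \<in> adic K \<Longrightarrow> z \<in> Z"
  by (auto simp: adic_def Z_scal)

lemma adic_zero: "0 \<in> adic K"
  unfolding adic_def by (rule image_eqI[OF _ Z_zero]) simp

lemma adic_add: "z \<in> adic K \<Longrightarrow> z' \<in> adic K \<Longrightarrow> z + z' \<in> adic K"
  unfolding adic_def by (auto simp flip: scal.scale_right_distrib intro: Z_add)

lemma adic_scal:
  assumes "z \<in> adic K"
  shows "scal a z \<in> adic K"
proof -
  obtain y where y: "y \<in> Z" "z = scal (fps_X ^ K) y" using adicE[OF assms] by blast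
  then have "scal a z = scal (fps_X ^ K) (scal a y)" by (simp add: mult.commute)
  then show ?thesis unfolding adic_def using y Z_scal by blast
qed

lemma adic_minus: "z \<in> adic K \<Longrightarrow> - z \<in> adic K"
  using adic_scal[of z K "-1"] by simp

lemma adic_diff: "z \<in> adic K \<Longrightarrow> z' \<in> adic K \<Longrightarrow> z - z' \<in> adic K"
  using adic_add[OF _ adic_minus, of z K z'] by simp

lemma adic_sum: "(\<And>j. j \<in> A \<Longrightarrow> v j \<in> adic K) \<Longrightarrow> sum v A \<in> adic K"
  by (induction A rule: infinite_finite_induct) (auto intro: adic_zero adic_add)

lemma adic_mono: "K \<le> K' \<Longrightarrow> z \<in> adic K' \<Longrightarrow> z \<in> adic K"
proof -
  assume "K \<le> K'" "z \<in> adic K'"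
  then obtain y where y: "y \<in> Z" "z = scal (fps_X ^ (K + (K' - K))) y" by (auto simp: adic_def)
  then have "z = scal (fps_X ^ K) (scal (fps_X ^ (K' - K)) y)" by (simp add: power_add)
  then show ?thesis unfolding adic_def using y Z_scal by blast
qed

lemma End_adic: "\<phi> \<in> End \<Longrightarrow> z \<in> adic K \<Longrightarrow> \<phi> z \<in> adic K"
  unfolding adic_def by (auto simp: End_scal End_closed)

lemma op_adic: "\<beta> \<in> \<BB> \<Longrightarrow> z \<in> adic K \<Longrightarrow> \<beta> z \<in> adic K"
  unfolding adic_def by (auto simp: op_scal op_closed)

lemma op_minus: "\<beta> \<in> \<BB> \<Longrightarrow> z \<in> Z \<Longrightarrow> z' \<in> Z \<Longrightarrow> \<beta> (z - z') = \<beta> z - \<beta> z'"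
  using op_add[of \<beta> "z - z'" z'] by (simp add: Z_diff algebra_simps)

lemma separated: "(\<And>K. z \<in> adic K) \<Longrightarrow> z = 0"
  using separated'[of z] adic_Z[of z 0] unfolding adic_def by blast

lemma complete:
  "(\<And>K. s K \<in> Z) \<Longrightarrow> (\<And>K. s (Suc K) - s K \<in> adic K) \<Longrightarrow> \<exists>x\<in>Z. \<forall>K. x - s K \<in> adic K"
  unfolding adic_def by (rule complete')

text \<open>The inverse of 1 - psi is the geometric series of psi, which converges t-adically
  because every application of psi gains a factor t.\<close>

lemma bij_minus_small:
  assumes \<psi>: "\<psi> \<in> End" and small: "\<And>z. z \<in> Z \<Longrightarrow> \<psi> z \<in> adic 1"
  shows "bij_betw (\<lambda>z. z - \<psi> z) Z Z"
proof -
  have step: "\<psi> z \<in> adic (Suc K)" if z: "z \<in> adic K" for z K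
  proof -
    obtain y where y: "y \<in> Z" "z = scal (fps_X ^ K) y" using adicE[OF z] by blast
    obtain x where x: "x \<in> Z" "\<psi> y = scal (fps_X ^ 1) x" using adicE[OF small[OF y(1)]] by blast
    have "\<psi> z = scal (fps_X ^ Suc K) x" using x y \<psi> by (simp add: End_scal mult.commute)
    then show ?thesis unfolding adic_def using x by blast
  qed
  have "inj_on (\<lambda>z. z - \<psi> z) Z"
  proof (rule inj_onI)
    fix z z' assume z: "z \<in> Z" "z' \<in> Z" "z - \<psi> z = z' - \<psi> z'"
    then have eq: "z - z' = \<psi> (z - z')" using \<psi> by (simp add: End_diff algebra_simps)
    have "z - z' \<in> adic K" for K
    proof (induction K)
      case 0
      then show ?case using z by (auto simp: adic_def Z_diff)
    next
      case (Suc K)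
      then show ?case using step eq by metis
    qed
    then show "z = z'" using separated[of "z - z'"] by simp
  qed
  moreover have "\<exists>z\<in>Z. z - \<psi> z = y" if y: "y \<in> Z" for y
  proof -
    have pow: "(\<psi> ^^ K) y \<in> adic K" for K
    proof (induction K)
      case 0
      then show ?case using y by (auto simp: adic_def)
    qed (simp add: step)
    define s where "s K = (\<Sum>j<K. (\<psi> ^^ j) y)" for K
    have s: "s K \<in> Z" for K unfolding s_def using pow adic_Z by (intro Z_sum) blast
    have "s (Suc K) - s K \<in> adic K" for K using pow by (simp add: s_def)
    then obtain x where x: "x \<in> Z" "\<And>K. x - s K \<in> adic K" using complete[of s] s by blast
    \<comment> \<open>On the partial sum s K the operator 1 - psi telescopes to y minus the K-th
      iterate of y, which is divisible by \<open>t^K\<close>; x differs from s K by as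
      little.\<close>
    have "x - \<psi> x - y \<in> adic K" for K
    proof -
      have "\<psi> (s K) = (\<Sum>j<K. (\<psi> ^^ Suc j) y)"
        unfolding s_def using pow adic_Z by (subst End_sum[OF \<psi>]) auto
      then have "s K - \<psi> (s K) = y - (\<psi> ^^ K) y"
        unfolding s_def using sum_lessThan_telescope'[of "\<lambda>j. (\<psi> ^^ j) y" K] by (simp add: sum_subtractf)
      then have "x - \<psi> x - y = (x - s K) - \<psi> (x - s K) - (\<psi> ^^ K) y"
        using x s \<psi> by (simp add: End_diff algebra_simps)
      also have "\<dots> \<in> adic K" by (rule adic_diff[OF adic_diff[OF x(2) End_adic[OF \<psi> x(2)]] pow])
      finally show ?thesis .
    qed
    then show ?thesis using separated[of "x - \<psi> x - y"] x(1) by auto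
  qed
  moreover have "z - \<psi> z \<in> Z" if "z \<in> Z" for z using that \<psi> by (simp add: Z_diff End_closed)
  ultimately show ?thesis unfolding bij_betw_def by (auto simp: image_iff)
qed

text \<open>The operator p(phi). Coefficients are complex constants rather than power series, so
  that annihilators modulo t are ordinary polynomials over a field and admit Bezout
  identities.\<close>

definition ev :: "('w \<Rightarrow> 'w) \<Rightarrow> complex poly \<Rightarrow> 'w \<Rightarrow> 'w" where
  "ev \<phi> p z = (\<Sum>j\<le>degree p. scal (fps_const (coeff p j)) ((\<phi> ^^ j) z))"

lemma ev_upto: "degree p \<le> N \<Longrightarrow> ev \<phi> p z = (\<Sum>j\<le>N. scal (fps_const (coeff p j)) ((\<phi> ^^ j) z))"
  unfolding ev_def by (rule sum.mono_neutral_left) (auto simp: coeff_eq_0)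

lemma ev_add: "ev \<phi> (p + q) z = ev \<phi> p z + ev \<phi> q z"
proof -
  let ?N = "max (degree p) (degree q)"
  have "degree (p + q) \<le> ?N" by (rule degree_add_le_max)
  then show ?thesis
    by (simp add: ev_upto[where N = ?N] sum.distrib scal.scale_left_distrib flip: fps_const_add)
qed

lemma ev_smult: "ev \<phi> (smult c p) z = scal (fps_const c) (ev \<phi> p z)"
  by (simp add: ev_upto[OF degree_smult_le] ev_def[of \<phi> p] scal.scale_sum_right flip: fps_const_mult)

lemma ev_0: "ev \<phi> 0 z = 0" and ev_1: "ev \<phi> 1 z = z"
  by (simp_all add: ev_def)

lemma ev_minus: "ev \<phi> (- p) z = - ev \<phi> p z"
  using ev_smult[of \<phi> "-1" p z] by (simp flip: fps_const_neg)

lemma ev_diff: "ev \<phi> (p - q) z = ev \<phi> p z - ev \<phi> q z"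
  using ev_add[of \<phi> p "- q" z] by (simp add: ev_minus)

lemma ev_End:
  assumes \<phi>: "\<phi> \<in> End"
  shows "ev \<phi> p \<in> End"
proof (rule EndI)
  fix z assume z: "z \<in> Z"
  show "ev \<phi> p z \<in> Z"
    unfolding ev_def by (intro Z_sum Z_scal End_closed[OF End_funpow[OF \<phi>]] z)
  show "ev \<phi> p (z + z') = ev \<phi> p z + ev \<phi> p z'" if "z' \<in> Z" for z'
    using z that by (simp add: ev_def End_add[OF End_funpow[OF \<phi>]] scal.scale_right_distrib sum.distrib)
  fix \<beta> assume \<beta>: "\<beta> \<in> \<BB>"
  have "\<beta> (sum v A) = (\<Sum>j\<in>A. \<beta> (v j))" if "\<And>j. j \<in> A \<Longrightarrow> v j \<in> Z" for v and A :: "nat set"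
    using that
  proof (induction A rule: infinite_finite_induct)
    case empty
    show ?case using op_scal[OF \<beta> Z_zero, of 0] by simp
  qed (use op_scal[OF \<beta> Z_zero, of 0] in \<open>auto simp: op_add[OF \<beta>] Z_sum\<close>)
  then show "ev \<phi> p (\<beta> z) = \<beta> (ev \<phi> p z)"
    unfolding ev_def using z \<beta>
    by (simp add: End_op[OF End_funpow[OF \<phi>]] op_scal Z_scal End_closed[OF End_funpow[OF \<phi>]])
qed

lemma ev_pCons:
  assumes "\<phi> \<in> End" "z \<in> Z"
  shows "ev \<phi> (pCons a p) z = scal (fps_const a) z + \<phi> (ev \<phi> p z)"
proof -
  have "ev \<phi> (pCons a p) z = (\<Sum>j\<le>Suc (degree p). scal (fps_const (coeff (pCons a p) j)) ((\<phi> ^^ j) z))"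
    by (rule ev_upto) (rule degree_pCons_le)
  also have "\<dots> = scal (fps_const a) z + (\<Sum>j\<le>degree p. scal (fps_const (coeff p j)) (\<phi> ((\<phi> ^^ j) z)))"
    by (subst sum.atMost_Suc_shift) simp
  also have "(\<Sum>j\<le>degree p. scal (fps_const (coeff p j)) (\<phi> ((\<phi> ^^ j) z))) = \<phi> (ev \<phi> p z)"
    unfolding ev_def using assms
    by (subst End_sum[OF assms(1)]) (auto simp: End_scal End_closed[OF End_funpow] Z_scal)
  finally show ?thesis .
qed

lemma ev_mult:
  assumes \<phi>: "\<phi> \<in> End" and z: "z \<in> Z"
  shows "ev \<phi> (p * q) z = ev \<phi> p (ev \<phi> q z)"
proof (induction p)
  case 0
  then show ?case by (simp add: ev_0)
next
  case (pCons a p)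
  have "ev \<phi> q z \<in> Z" using ev_End[OF \<phi>] z End_closed by blast
  then show ?case
    by (simp add: mult_pCons_left ev_add ev_smult ev_pCons[OF \<phi>] z pCons)
qed

lemma ev_X: "\<phi> \<in> End \<Longrightarrow> z \<in> Z \<Longrightarrow> ev \<phi> [:0, 1:] z = \<phi> z"
  by (subst ev_pCons) (auto simp: ev_1[unfolded one_pCons])

text \<open>Every factor P contributes one t, and operators that are polynomials in phi preserve the
  filtration. Divisibility of polynomials by powers of P thus becomes t-adic smallness.\<close>

lemma ev_dvd_adic:
  assumes \<phi>: "\<phi> \<in> End" and P: "\<And>z. z \<in> Z \<Longrightarrow> ev \<phi> P z \<in> adic 1" and "P ^ K dvd p" and z: "z \<in> Z"
  shows "ev \<phi> p z \<in> adic K"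
proof -
  have pow: "ev \<phi> (P ^ K) z \<in> adic K" if "z \<in> Z" for K z
    using that
  proof (induction K arbitrary: z)
    case 0
    then show ?case by (auto simp: ev_1 adic_def)
  next
    case (Suc K)
    obtain y where y: "y \<in> Z" "ev \<phi> P z = scal (fps_X ^ 1) y" using adicE[OF P[OF Suc.prems]] by blast
    have "ev \<phi> (P ^ Suc K) z = ev \<phi> (P ^ K) (scal (fps_X ^ 1) y)"
      using Suc.prems y \<phi> by (simp add: power_Suc2 ev_mult del: power_Suc)
    also have "\<dots> = scal fps_X (ev \<phi> (P ^ K) y)" using y ev_End[OF \<phi>] by (simp add: End_scal)
    also obtain x where "x \<in> Z" "ev \<phi> (P ^ K) y = scal (fps_X ^ K) x" using adicE[OF Suc.IH[OF y(1)]] by blast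
    ultimately show ?case by (auto simp: adic_def)
  qed
  obtain g where g: "p = P ^ K * g" using assms(3) by auto
  show ?thesis unfolding g using pow End_closed[OF ev_End[OF \<phi>] z] by (simp add: ev_mult \<phi> z)
qed

text \<open>The d + 1 iterates of a vector have residues in a d-dimensional space, so a nonzero
  polynomial in phi kills the vector modulo t. The product over the generators kills all of Z modulo
  t.\<close>

lemma annihilator_mod_X:
  assumes \<phi>: "\<phi> \<in> End"
  shows "\<exists>P. P \<noteq> 0 \<and> (\<forall>z\<in>Z. ev \<phi> P z \<in> adic 1)"
proof -
  note ev = End_closed[OF ev_End[OF \<phi>]]
  have res_sum: "res (sum v A) l = (\<Sum>j\<in>A. res (v j) l)" for v :: "nat \<Rightarrow> 'w" and A l
  proof (induction A rule: infinite_finite_induct)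
    case empty
    show ?case using res_const[of 0 0 l] by simp
  qed (use res_const[of 0 0 l] in \<open>simp_all add: res_add\<close>)
  have one: "\<exists>p. p \<noteq> 0 \<and> ev \<phi> p z \<in> adic 1" if z: "z \<in> Z" for z
  proof -
    obtain c where c: "\<exists>j\<in>{..d}. c j \<noteq> 0" "\<forall>l<d. (\<Sum>j\<le>d. c j * res ((\<phi> ^^ j) z) l) = 0"
      using homogeneous_system_solution[of "{..d}" d "\<lambda>j. res ((\<phi> ^^ j) z)"] by auto
    define p where "p = (\<Sum>j\<le>d. monom (c j) j)"
    have cp: "coeff p j = (if j \<le> d then c j else 0)" for j
      by (auto simp: p_def coeff_sum)
    have "p \<noteq> 0" using c(1) cp by (metis atMost_iff coeff_0)
    moreover have "ev \<phi> p z = (\<Sum>j\<le>d. scal (fps_const (c j)) ((\<phi> ^^ j) z))"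
      by (subst ev_upto[where N = d]) (auto simp: cp intro: degree_le)
    then have "res (ev \<phi> p z) l = 0" if "l < d" for l
      using that c(2) by (simp add: res_sum res_const)
    then have "ev \<phi> p z \<in> adic 1" using res_zero[OF ev[OF z]] by (simp add: adic_def)
    ultimately show ?thesis by blast
  qed
  then have "\<forall>l. \<exists>p. l < d \<longrightarrow> p \<noteq> 0 \<and> ev \<phi> p (gen l) \<in> adic 1" using gen_closed by blast
  then obtain p where p: "\<And>l. l < d \<Longrightarrow> p l \<noteq> 0" "\<And>l. l < d \<Longrightarrow> ev \<phi> (p l) (gen l) \<in> adic 1" by metis
  define P where "P = (\<Prod>l<d. p l)"
  have gen1: "ev \<phi> P (gen l) \<in> adic 1" if l: "l < d" for l
  proof -
    \<comment> \<open>Polynomials in phi commute, so the factor belonging to generator l may be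
      applied first.\<close>
    have "P = (\<Prod>j\<in>{..<d} - {l}. p j) * p l" using l by (simp add: P_def prod.remove mult.commute)
    then show ?thesis using gen_closed[OF l] p(2)[OF l] End_adic[OF ev_End[OF \<phi>]] by (simp add: ev_mult \<phi>)
  qed
  have "ev \<phi> P z \<in> adic 1" if z: "z \<in> Z" for z
  proof -
    obtain c where c: "z = (\<Sum>l<d. scal (c l) (gen l))" using gen[OF z] by blast
    have "ev \<phi> P z = (\<Sum>l<d. scal (c l) (ev \<phi> P (gen l)))"
      unfolding c using gen_closed Z_scal by (subst End_sum[OF ev_End[OF \<phi>]]) (auto simp: End_scal[OF ev_End[OF \<phi>]])
    then show ?thesis using gen1 by (auto intro!: adic_sum adic_scal)
  qed
  moreover have "P \<noteq> 0" using p(1) by (simp add: P_def)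
  ultimately show ?thesis by blast
qed

text \<open>One map h equal to both composites yields injectivity from g f and surjectivity from f
  g.\<close>

lemma bij_factor:
  assumes f: "\<And>z. z \<in> Z \<Longrightarrow> f z \<in> Z" and g: "\<And>z. z \<in> Z \<Longrightarrow> g z \<in> Z"
    and comm: "\<And>z. z \<in> Z \<Longrightarrow> f (g z) = h z" "\<And>z. z \<in> Z \<Longrightarrow> g (f z) = h z" and h: "bij_betw h Z Z"
  shows "bij_betw f Z Z"
proof -
  have "inj_on f Z"
  proof (rule inj_onI)
    fix z z' assume "z \<in> Z" "z' \<in> Z" "f z = f z'"
    then have "h z = h z'" using comm(2) by metis
    then show "z = z'" using h \<open>z \<in> Z\<close> \<open>z' \<in> Z\<close> by (auto simp: bij_betw_def dest: inj_onD)
  qed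
  moreover have "y \<in> f ` Z" if y: "y \<in> Z" for y
  proof -
    obtain z where "z \<in> Z" "y = h z" using y bij_betw_imp_surj_on[OF h] by auto
    then show ?thesis using comm(1) g by (metis imageI)
  qed
  ultimately show ?thesis using f unfolding bij_betw_def by blast
qed

text \<open>
  Fitting's lemma. An involution commuting with \<open>\<phi>\<close> is found by applying Newton's iteration
  \<open>h \<mapsto> h (3 - h\<^sup>2) / 2\<close> to the polynomial \<open>h\<close> that is \<open>1\<close> modulo the nilpotent part and \<open>-1\<close> modulo the
  invertible part of the annihilator of \<open>\<phi>\<close> modulo \<open>t\<close>.
\<close>

lemma fitting:
  assumes \<phi>: "\<phi> \<in> End"
  shows "bij_betw \<phi> Z Z \<or> bij_betw (\<lambda>z. z - \<phi> z) Z Z \<or>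
    (\<exists>\<sigma>\<in>End. (\<forall>z\<in>Z. \<sigma> (\<sigma> z) = z) \<and> (\<exists>z\<in>Z. \<sigma> z \<noteq> z) \<and> (\<exists>z\<in>Z. \<sigma> z \<noteq> - z))"
proof -
  note evE = ev_End[OF \<phi>]
  note evC = End_closed[OF evE]
  note evM = ev_mult[OF \<phi>]
  obtain P0 where P0: "P0 \<noteq> 0" "\<And>z. z \<in> Z \<Longrightarrow> ev \<phi> P0 z \<in> adic 1"
    using annihilator_mod_X[OF \<phi>] by blast
  define x :: "complex poly" where "x = [:0, 1:]"
  \<comment> \<open>Splits the annihilator at the eigenvalue 0: the power of x belongs to the part
    where phi is nilpotent modulo t, q to the part where it is invertible.\<close>
  obtain a q where aq: "P0 = x ^ a * q" "poly q 0 \<noteq> 0"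
    using order_decomp[OF P0(1), of 0] unfolding x_def by (metis minus_zero poly_eq_0_iff_dvd)
  \<comment> \<open>The exponent is raised by one so that it is positive even when 0 is not a root.
    Below this lets w be written as x times a polynomial.\<close>
  define P where "P = x ^ Suc a * q"
  have P: "ev \<phi> P z \<in> adic 1" if z: "z \<in> Z" for z
  proof -
    have "P = x * P0" by (simp add: P_def aq(1))
    then show ?thesis using End_adic[OF evE P0(2)[OF z], of x] by (simp add: evM z)
  qed
  \<comment> \<open>Coprimality by hand: the constant coefficient of q is nonzero, so q is a unit
    modulo x, and the identity for b is multiplied by the one for exponent 1.\<close>
  have "\<exists>u v. u * x ^ b + v * q = 1" for b
  proof (induction b)
    case 0
    show ?case by (rule exI[of _ 1], rule exI[of _ 0]) simp
  next
    case (Suc b)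
    then obtain u v where uv: "u * x ^ b + v * q = 1" by blast
    obtain c q' where q: "q = pCons c q'" by (cases q)
    have c: "c \<noteq> 0" using aq(2) q by simp
    have "q = [:c:] + x * q'" by (simp add: q x_def)
    then have "smult (1 / c) q + (- smult (1 / c) q') * x = 1"
      using c by (simp add: smult_add_right one_pCons mult.commute)
    then have "(smult (1 / c) q + (- smult (1 / c) q') * x) * (u * x ^ b + v * q) = 1" using uv by simp
    then have "(- smult (1 / c) q' * u) * x ^ Suc b + ([:1 / c:] * (u * x ^ b + v * q) + (- smult (1 / c) q') * x * v) * q = 1"
      by (simp add: algebra_simps)
    then show ?case by blast
  qed
  then obtain u v where uv: "u * x ^ Suc a + v * q = 1" by blast
  \<comment> \<open>w is divisible by \<open>x^(a+1)\<close> and 1 - w = v q by q, so w (1 - w) is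
    divisible by P: an idempotent modulo P. Then 1 - 2 w is 1 on the nilpotent part and -1 on the
    invertible part.\<close>
  define w where "w = u * x ^ Suc a"
  define h where "h = rec_nat (1 - 2 * w) (\<lambda>_ h. smult (1/2) (h * (3 - h\<^sup>2)))"
  have h0: "h 0 = 1 - 2 * w" and hS: "h (Suc K) = smult (1/2) (h K * (3 - (h K)\<^sup>2))" for K
    by (simp_all add: h_def)
  have dvd: "P ^ Suc K dvd (h K)\<^sup>2 - 1" for K
  proof (induction K)
    case 0
    have "1 - w = v * q" using uv by (simp add: w_def algebra_simps)
    moreover have "(h 0)\<^sup>2 - 1 = - (4 * (w * (1 - w)))" unfolding h0 by (simp add: power2_eq_square algebra_simps)
    ultimately have "(h 0)\<^sup>2 - 1 = - (4 * (w * (v * q)))" by simp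
    also have "\<dots> = P * (- (4 * u * v))" by (simp add: w_def P_def mult_ac)
    finally have "(h 0)\<^sup>2 - 1 = P * (- (4 * u * v))" .
    then show ?case by simp
  next
    case (Suc K)
    \<comment> \<open>In terms of the error b the new square is (1 + b) (2 - b)^2 / 4 = 1 + b^2 (b -
      3) / 4. The error is squared up to a factor, which more than suffices for one further power of
      P.\<close>
    define b where "b = (h K)\<^sup>2 - 1"
    have hK: "(h K)\<^sup>2 = 1 + b" by (simp add: b_def)
    have "(h (Suc K))\<^sup>2 = smult (1/4) ((h K)\<^sup>2 * (3 - (h K)\<^sup>2)\<^sup>2)"
      by (simp add: hS power2_eq_square mult_ac)
    also have "(h K)\<^sup>2 * (3 - (h K)\<^sup>2)\<^sup>2 = 4 + b\<^sup>2 * (b - 3)"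
      unfolding hK by (simp add: power2_eq_square algebra_simps)
    also have "smult (1/4) (4 + b\<^sup>2 * (b - 3)) - 1 = smult (1/4) (b\<^sup>2 * (b - 3))"
      by (simp add: smult_add_right numeral_poly one_pCons)
    finally have "(h (Suc K))\<^sup>2 - 1 = b\<^sup>2 * smult (1/4) (b - 3)" by simp
    moreover have "P ^ Suc (Suc K) dvd (P ^ Suc K)\<^sup>2"
      by (simp add: power2_eq_square le_imp_power_dvd flip: power_add)
    moreover have "(P ^ Suc K)\<^sup>2 dvd b\<^sup>2" using Suc by (simp add: b_def dvd_power_same)
    ultimately show ?case by (metis dvd_mult2 dvd_trans)
  qed
  have dvd': "P ^ Suc K dvd h (Suc K) - h K" for K
  proof -
    have "h K = smult (1/2) (2 * h K)" by (simp add: numeral_poly)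
    then have "h (Suc K) - h K = smult (1/2) (h K * (3 - (h K)\<^sup>2) - 2 * h K)"
      unfolding hS by (simp only: smult_diff_right)
    also have "h K * (3 - (h K)\<^sup>2) - 2 * h K = - (h K * ((h K)\<^sup>2 - 1))" by (simp add: algebra_simps)
    also have "smult (1/2) \<dots> = ((h K)\<^sup>2 - 1) * smult (- 1/2) (h K)" by (simp add: mult.commute)
    finally have "h (Suc K) - h K = ((h K)\<^sup>2 - 1) * smult (- 1/2) (h K)" .
    then show ?thesis using dvd[of K] by (metis dvd_mult2)
  qed
  have evd: "ev \<phi> p z \<in> adic K" if "P ^ K dvd p" "z \<in> Z" for p z K
    by (rule ev_dvd_adic[OF \<phi> _ that]) (rule P)
  have "\<exists>y\<in>Z. \<forall>K. y - ev \<phi> (h K) z \<in> adic K" if z: "z \<in> Z" for z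
  proof (rule complete)
    show "ev \<phi> (h K) z \<in> Z" for K by (rule evC[OF z])
    show "ev \<phi> (h (Suc K)) z - ev \<phi> (h K) z \<in> adic K" for K
      using evd[OF dvd' z, of K] adic_mono[of K "Suc K"] by (simp add: ev_diff)
  qed
  then obtain \<sigma> where \<sigma>: "\<And>z. z \<in> Z \<Longrightarrow> \<sigma> z \<in> Z" "\<And>z K. z \<in> Z \<Longrightarrow> \<sigma> z - ev \<phi> (h K) z \<in> adic K" by metis
  have \<sigma>E: "\<sigma> \<in> End"
  proof (rule EndI)
    fix z assume z: "z \<in> Z"
    show "\<sigma> (z + z') = \<sigma> z + \<sigma> z'" if z': "z' \<in> Z" for z'
    proof -
      have "\<sigma> (z + z') - (\<sigma> z + \<sigma> z') \<in> adic K" for K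
      proof -
        have "(\<sigma> (z + z') - ev \<phi> (h K) (z + z')) - (\<sigma> z - ev \<phi> (h K) z) - (\<sigma> z' - ev \<phi> (h K) z') \<in> adic K"
          by (rule adic_diff[OF adic_diff[OF \<sigma>(2)[OF Z_add[OF z z']] \<sigma>(2)[OF z]] \<sigma>(2)[OF z']])
        from this[unfolded End_add[OF evE z z']] show ?thesis by (simp add: algebra_simps)
      qed
      then show ?thesis using separated[of "\<sigma> (z + z') - (\<sigma> z + \<sigma> z')"] by simp
    qed
    show "\<sigma> (\<beta> z) = \<beta> (\<sigma> z)" if \<beta>: "\<beta> \<in> \<BB>" for \<beta>
    proof -
      have "\<sigma> (\<beta> z) - \<beta> (\<sigma> z) \<in> adic K" for K
      proof -
        have "(\<sigma> (\<beta> z) - ev \<phi> (h K) (\<beta> z)) - \<beta> (\<sigma> z - ev \<phi> (h K) z) \<in> adic K"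
          by (rule adic_diff[OF \<sigma>(2)[OF op_closed[OF \<beta> z]] op_adic[OF \<beta> \<sigma>(2)[OF z]]])
        then show ?thesis using \<beta> z by (simp add: op_minus \<sigma> evC End_op[OF evE])
      qed
      then show ?thesis using separated[of "\<sigma> (\<beta> z) - \<beta> (\<sigma> z)"] by simp
    qed
  qed (rule \<sigma>)
  have invol: "\<sigma> (\<sigma> z) = z" if z: "z \<in> Z" for z
  proof -
    have "\<sigma> (\<sigma> z) - z \<in> adic K" for K
    proof -
      have "ev \<phi> ((h K)\<^sup>2 - 1) z \<in> adic K" using evd[OF dvd z, of K] adic_mono[of K "Suc K"] by simp
      then have 1: "ev \<phi> (h K) (ev \<phi> (h K) z) - z \<in> adic K"
        by (simp add: ev_diff ev_1 power2_eq_square evM z)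
      have "(\<sigma> (\<sigma> z) - ev \<phi> (h K) (\<sigma> z)) + ev \<phi> (h K) (\<sigma> z - ev \<phi> (h K) z) +
          (ev \<phi> (h K) (ev \<phi> (h K) z) - z) \<in> adic K"
        by (rule adic_add[OF adic_add[OF \<sigma>(2)[OF \<sigma>(1)[OF z]] End_adic[OF evE \<sigma>(2)[OF z]]] 1])
      then show ?thesis using z by (simp add: End_diff[OF evE] \<sigma> evC)
    qed
    then show ?thesis using separated[of "\<sigma> (\<sigma> z) - z"] by simp
  qed
  \<comment> \<open>All iterates agree with h 0 modulo P, hence modulo t after evaluation. The
    comparison goes through h 1 because stage K controls the limit only modulo
    \<open>t^K\<close>.\<close>
  have \<sigma>0: "\<sigma> z - (z - scal (fps_const 2) (ev \<phi> w z)) \<in> adic 1" if z: "z \<in> Z" for z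
  proof -
    have "(\<sigma> z - ev \<phi> (h 1) z) + ev \<phi> (h (Suc 0) - h 0) z \<in> adic 1"
      using adic_add[OF \<sigma>(2)[OF z, of "Suc 0"] evd[OF dvd'[of 0] z]] by simp
    moreover have "2 * w = smult 2 w" by (simp add: numeral_poly)
    ultimately have "\<sigma> z + (scal (fps_const 2) (ev \<phi> w z) - z) \<in> adic 1" by (simp add: ev_diff h0 ev_1 ev_smult)
    then show ?thesis by (simp add: algebra_simps)
  qed
  have half: "z \<in> adic 1" if "scal (fps_const 2) z \<in> adic 1" for z
    using adic_scal[OF that, of "fps_const (1/2)"] by simp
  have evx: "ev \<phi> x z = \<phi> z" if "z \<in> Z" for z unfolding x_def by (rule ev_X[OF \<phi> that])
  show ?thesis
  proof (cases "\<forall>z\<in>Z. \<sigma> z = z")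
    case True
    have w1: "ev \<phi> w z \<in> adic 1" if z: "z \<in> Z" for z
      using \<sigma>0[OF z] True z half by simp
    have small: "ev \<phi> (x ^ Suc a) z \<in> adic 1" if z: "z \<in> Z" for z
    proof -
      \<comment> \<open>If the involution is the identity, w(phi) vanishes modulo t, and this
        identity makes \<open>phi^(a+1)\<close> vanish modulo t too. Then 1 - phi divides the
        invertible 1 - \<open>phi^(a+1)\<close>.\<close>
      have "x ^ Suc a = x ^ Suc a * (u * x ^ Suc a + v * q)" by (simp only: uv mult_1_right)
      also have "\<dots> = x ^ Suc a * w + v * P" by (simp add: w_def P_def algebra_simps)
      finally have "ev \<phi> (x ^ Suc a) z = ev \<phi> (x ^ Suc a) (ev \<phi> w z) + ev \<phi> v (ev \<phi> P z)"
        by (metis ev_add evM z)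
      then show ?thesis using w1[OF z] P[OF z] End_adic[OF evE] adic_add by metis
    qed
    have geo: "(1 - x) * (\<Sum>j<Suc a. x ^ j) = 1 - x ^ Suc a" by (rule one_diff_power_eq[symmetric])
    have "bij_betw (ev \<phi> (1 - x)) Z Z"
    proof (rule bij_factor[where g = "ev \<phi> (\<Sum>j<Suc a. x ^ j)" and h = "\<lambda>z. z - ev \<phi> (x ^ Suc a) z"])
      show "bij_betw (\<lambda>z. z - ev \<phi> (x ^ Suc a) z) Z Z" using bij_minus_small[OF evE small] .
      fix z assume z: "z \<in> Z"
      show "ev \<phi> (1 - x) (ev \<phi> (\<Sum>j<Suc a. x ^ j) z) = z - ev \<phi> (x ^ Suc a) z"
        using arg_cong[OF geo, of "\<lambda>p. ev \<phi> p z"] unfolding evM[OF z] by (simp only: ev_diff ev_1)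
      show "ev \<phi> (\<Sum>j<Suc a. x ^ j) (ev \<phi> (1 - x) z) = z - ev \<phi> (x ^ Suc a) z"
        using arg_cong[OF geo, of "\<lambda>p. ev \<phi> p z"] unfolding mult.commute[of "1 - x"] evM[OF z] by (simp only: ev_diff ev_1)
    qed (use evC in auto)
    moreover have "ev \<phi> (1 - x) z = z - \<phi> z" if "z \<in> Z" for z using that by (simp add: ev_diff ev_1 evx)
    ultimately show ?thesis using bij_betw_cong[of Z "ev \<phi> (1 - x)" "\<lambda>z. z - \<phi> z" Z] by blast
  next
    case False
    show ?thesis
    proof (cases "\<forall>z\<in>Z. \<sigma> z = - z")
      case True
      have small: "ev \<phi> (1 - w) z \<in> adic 1" if z: "z \<in> Z" for z
      proof -
        have "scal (fps_const 2) z = z + z"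
          by (metis (no_types) fps_const_add fps_const_1_eq_1 one_add_one scal.scale_left_distrib scal.scale_one)
        then have "scal (fps_const 2) (- ev \<phi> (1 - w) z) \<in> adic 1"
          using \<sigma>0[OF z] True z by (simp add: ev_diff ev_1 scal.scale_right_diff_distrib algebra_simps)
        then have "- ev \<phi> (1 - w) z \<in> adic 1" by (rule half)
        from adic_minus[OF this] show ?thesis by simp
      qed
      have "bij_betw (ev \<phi> x) Z Z"
      proof (rule bij_factor[where g = "ev \<phi> (u * x ^ a)" and h = "\<lambda>z. z - ev \<phi> (1 - w) z"])
        show "bij_betw (\<lambda>z. z - ev \<phi> (1 - w) z) Z Z" using bij_minus_small[OF evE small] .
        fix z assume z: "z \<in> Z"
        \<comment> \<open>If the involution is minus the identity, w(phi) is the identity modulo t,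
          hence bijective; its factor x transfers this to phi.\<close>
        have "x * (u * x ^ a) = w" "u * x ^ a * x = w" by (simp_all add: w_def)
        then show "ev \<phi> x (ev \<phi> (u * x ^ a) z) = z - ev \<phi> (1 - w) z"
            "ev \<phi> (u * x ^ a) (ev \<phi> x z) = z - ev \<phi> (1 - w) z"
          by (simp_all add: ev_diff ev_1 z flip: evM)
      qed (use evC in auto)
      then have "bij_betw \<phi> Z Z" using bij_betw_cong[of Z "ev \<phi> x" \<phi> Z] evx by blast
      then show ?thesis by blast
    next
      case False': False
      then show ?thesis using False invol \<sigma>E by blast
    qed
  qed
qed

end

section \<open>Lattices over R in coordinates\<close>

definition scal :: "complex fps \<Rightarrow> ('i \<Rightarrow> complex fps) \<Rightarrow> 'i \<Rightarrow> complex fps" where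
  "scal a z = (\<lambda>l. a * z l)"

lemma scal_apply: "scal a z l = a * z l"
  by (simp add: scal_def)

interpretation scal: Modules.module scal
  by unfold_locales (auto simp: scal_def fun_eq_iff algebra_simps)

text \<open>The free module \<open>R^d\<close>, realised for all d in one type by sequences that
  vanish from d on.\<close>

definition vecs :: "nat \<Rightarrow> univ set" where "vecs d = {v. \<forall>l\<ge>d. v l = 0}"

lemma vecs_add: "v \<in> vecs d \<Longrightarrow> v' \<in> vecs d \<Longrightarrow> v + v' \<in> vecs d"
  and vecs_scal: "v \<in> vecs d \<Longrightarrow> scal a v \<in> vecs d"
  and vecs_zero: "0 \<in> vecs d"
  by (auto simp: vecs_def scal_def)

definition unit_vec :: "nat \<Rightarrow> univ" where "unit_vec l = (\<lambda>j. if j = l then 1 else 0)"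

lemma sum_fun_apply: "(\<Sum>j\<in>A. f j) x = (\<Sum>j\<in>A. f j x)" for f :: "'a \<Rightarrow> 'b \<Rightarrow> 'c::comm_monoid_add"
  by (induction A rule: infinite_finite_induct) simp_all

lemma vecs_expand: "v \<in> vecs d \<Longrightarrow> v = (\<Sum>l<d. scal (v l) (unit_vec l))"
  by (rule ext) (auto simp: vecs_def sum_fun_apply scal_apply unit_vec_def if_distrib[of "\<lambda>x. _ * x"] sum.delta cong: if_cong)

text \<open>Z is the image of an R-linear projection of \<open>R^d\<close>. Quotients and limits are
  computed coefficientwise in \<open>R^d\<close> and projected back; as the projection is linear and
  fixes Z, the t-adic filtration of Z is the coordinatewise one.\<close>

lemma adic_module_summand:
  assumes Z: "Z \<subseteq> vecs d" and Z_add: "\<And>z z'. z \<in> Z \<Longrightarrow> z' \<in> Z \<Longrightarrow> z + z' \<in> Z"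
    and Z_scal: "\<And>z a. z \<in> Z \<Longrightarrow> scal a z \<in> Z"
    and proj_closed: "\<And>v. v \<in> vecs d \<Longrightarrow> \<pi> v \<in> Z"
    and proj_id: "\<And>z. z \<in> Z \<Longrightarrow> \<pi> z = z"
    and proj_add: "\<And>v v'. v \<in> vecs d \<Longrightarrow> v' \<in> vecs d \<Longrightarrow> \<pi> (v + v') = \<pi> v + \<pi> v'"
    and proj_scal: "\<And>v a. v \<in> vecs d \<Longrightarrow> \<pi> (scal a v) = scal a (\<pi> v)"
    and op: "\<And>\<beta> z. \<beta> \<in> \<BB> \<Longrightarrow> z \<in> Z \<Longrightarrow> \<beta> z \<in> Z"
      "\<And>\<beta> z z'. \<beta> \<in> \<BB> \<Longrightarrow> z \<in> Z \<Longrightarrow> z' \<in> Z \<Longrightarrow> \<beta> (z + z') = \<beta> z + \<beta> z'"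
      "\<And>\<beta> z a. \<beta> \<in> \<BB> \<Longrightarrow> z \<in> Z \<Longrightarrow> \<beta> (scal a z) = scal a (\<beta> z)"
      "\<And>a. scal a \<in> \<BB>"
  shows "adic_module scal Z \<BB> d (\<lambda>l. \<pi> (unit_vec l)) (\<lambda>z l. fps_nth (z l) 0)"
proof -
  have Z_diff: "z - z' \<in> Z" if "z \<in> Z" "z' \<in> Z" for z z'
    using Z_add[OF that(1) Z_scal[OF that(2), of "-1"]] by simp
  have adic_iff: "z \<in> scal (fps_X ^ K) ` Z \<longleftrightarrow> (\<forall>l N. N < K \<longrightarrow> fps_nth (z l) N = 0)" if z: "z \<in> Z" for z K
  proof
    assume low: "\<forall>l N. N < K \<longrightarrow> fps_nth (z l) N = 0"
    define y where "y l = fps_shift K (z l)" for l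
    have zy: "z = scal (fps_X ^ K) y"
      using low by (auto simp: fun_eq_iff scal_def y_def fps_eq_iff fps_X_power_mult_nth)
    have y: "y \<in> vecs d" using z Z by (auto simp: y_def vecs_def)
    \<comment> \<open>The coordinatewise quotient y is not known to lie in Z; its projection is in Z
      and serves equally well.\<close>
    have "z = scal (fps_X ^ K) (\<pi> y)" using proj_scal[OF y] proj_id[OF z] zy by metis
    then show "z \<in> scal (fps_X ^ K) ` Z" using proj_closed[OF y] by blast
  qed (auto simp: scal_def fps_X_power_mult_nth)
  have zero: "0 \<in> Z" using Z_scal[OF proj_closed[OF vecs_zero], of 0] by simp
  have unit: "unit_vec l \<in> vecs d" if "l < d" for l using that by (auto simp: unit_vec_def vecs_def)
  have proj_sum: "\<pi> (\<Sum>l\<in>A. v l) = (\<Sum>l\<in>A. \<pi> (v l)) \<and> (\<Sum>l\<in>A. v l) \<in> vecs d" if "\<And>l. l \<in> A \<Longrightarrow> v l \<in> vecs d" for A :: "nat set" and v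
    using that
  proof (induction A rule: infinite_finite_induct)
    case (insert a A)
    have "sum v (insert a A) = v a + sum v A" by (rule sum.insert[OF insert.hyps])
    moreover have "(\<Sum>l\<in>insert a A. \<pi> (v l)) = \<pi> (v a) + (\<Sum>l\<in>A. \<pi> (v l))"
      by (rule sum.insert[OF insert.hyps])
    moreover have va: "v a \<in> vecs d" using insert.prems by simp
    moreover have IH: "\<pi> (sum v A) = (\<Sum>l\<in>A. \<pi> (v l))" "sum v A \<in> vecs d"
      using insert.IH insert.prems by simp_all
    ultimately show ?case
      by (intro conjI) (simp only: proj_add[OF va IH(2)] IH(1), simp only: vecs_add[OF va IH(2)])
  qed (simp_all add: vecs_zero proj_id[OF zero])
  show ?thesis
  proof unfold_locales
    fix z assume z: "z \<in> Z"
    show "z = 0" if "\<And>K. z \<in> scal (fps_X ^ K) ` Z"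
    proof (intro ext fps_ext)
      fix l N show "fps_nth (z l) N = fps_nth (0 l) N"
        using that[of "Suc N"] unfolding adic_iff[OF z] by simp
    qed
    show "\<exists>c. z = (\<Sum>l<d. scal (c l) (\<pi> (unit_vec l)))"
    proof
      have "z = \<pi> (\<Sum>l<d. scal (z l) (unit_vec l))"
        using z Z vecs_expand proj_id by (metis subsetD)
      also have "\<dots> = (\<Sum>l<d. \<pi> (scal (z l) (unit_vec l)))"
        by (rule proj_sum[THEN conjunct1]) (use unit vecs_scal in auto)
      also have "\<dots> = (\<Sum>l<d. scal (z l) (\<pi> (unit_vec l)))"
        by (rule sum.cong) (use unit proj_scal in auto)
      finally show "z = (\<Sum>l<d. scal (z l) (\<pi> (unit_vec l)))" .
    qed
    show "z \<in> scal fps_X ` Z" if "\<And>l. l < d \<Longrightarrow> fps_nth (z l) 0 = 0"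
    proof -
      have "fps_nth (z l) 0 = 0" for l
        using that z Z by (cases "l < d") (auto simp: vecs_def)
      then show ?thesis using adic_iff[OF z, of 1] by simp
    qed
  next
    fix s :: "nat \<Rightarrow> univ" assume s: "\<And>K. s K \<in> Z" and cauchy: "\<And>K. s (Suc K) - s K \<in> scal (fps_X ^ K) ` Z"
    have le: "fps_nth (s (K + j) l) N = fps_nth (s K l) N" if "N < K" for K j l N
    proof (induction j)
      case (Suc j)
      have "fps_nth ((s (Suc (K + j)) - s (K + j)) l) N = 0"
        using cauchy[of "K + j"] adic_iff[OF Z_diff[OF s s]] that by auto
      then show ?case using Suc by simp
    qed simp
    \<comment> \<open>Coefficient N no longer changes from stage N + 1 on, so the limit is read off
      along the diagonal.\<close>
    define v where "v l = Abs_fps (\<lambda>N. fps_nth (s (Suc N) l) N)" for l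
    have v: "v \<in> vecs d" using s Z by (auto simp: v_def vecs_def fps_eq_iff subset_iff)
    have "\<pi> v - s K \<in> scal (fps_X ^ K) ` Z" for K
    proof -
      have low: "fps_nth (v l) N = fps_nth (s K l) N" if "N < K" for l N
        using le[of N "Suc N" "K - Suc N" l] that by (simp add: v_def)
      define y where "y l = fps_shift K (v l - s K l)" for l
      have "s K \<in> vecs d" using s Z by blast
      then have y: "y \<in> vecs d" using v by (simp add: y_def vecs_def)
      have "v = s K + scal (fps_X ^ K) y"
        using low by (auto simp: fun_eq_iff scal_def y_def fps_eq_iff fps_X_power_mult_nth)
      then have "\<pi> v = \<pi> (s K) + \<pi> (scal (fps_X ^ K) y)"
        using proj_add[of "s K" "scal (fps_X ^ K) y"] s Z vecs_scal[OF y] by auto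
      then have "\<pi> v - s K = scal (fps_X ^ K) (\<pi> y)"
        using proj_scal[OF y] proj_id[OF s] by (simp add: fun_eq_iff)
      then show ?thesis using proj_closed[OF y] by blast
    qed
    then show "\<exists>x\<in>Z. \<forall>K. x - s K \<in> scal (fps_X ^ K) ` Z" using proj_closed[OF v] by blast
  qed (use zero Z_add Z_scal op proj_closed unit in \<open>auto simp: scal_apply\<close>)
qed

locale module_coordinates = left_module B M
  for B :: "'b ring" and \<rho> :: "complex fps \<Rightarrow> 'b" and M :: "('b, 'm) module"
    and d :: nat and \<xi> :: "'m \<Rightarrow> univ" +
  assumes bij: "bij_betw \<xi> (carrier M) (vecs d)"
    and add: "x \<in> carrier M \<Longrightarrow> y \<in> carrier M \<Longrightarrow> \<xi> (x \<oplus>\<^bsub>M\<^esub> y) = \<xi> x + \<xi> y"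
    and scal: "x \<in> carrier M \<Longrightarrow> \<xi> (\<rho> a \<odot>\<^bsub>M\<^esub> x) = scal a (\<xi> x)"

text \<open>A summand of a lattice is described by an embedding into \<open>R^d\<close> and an
  R-linear projection onto its image. This gives it coordinates without producing an
  R-basis.\<close>

locale summand_coordinates = left_module B W
  for B :: "'b ring" and \<rho> :: "complex fps \<Rightarrow> 'b" and W :: "('b, 'm) module"
    and d :: nat and \<zeta> :: "'m \<Rightarrow> univ" and \<pi> :: "univ \<Rightarrow> univ" +
  assumes inj: "inj_on \<zeta> (carrier W)"
    and into: "\<zeta> ` carrier W \<subseteq> vecs d"
    and add: "x \<in> carrier W \<Longrightarrow> y \<in> carrier W \<Longrightarrow> \<zeta> (x \<oplus>\<^bsub>W\<^esub> y) = \<zeta> x + \<zeta> y"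
    and scal: "x \<in> carrier W \<Longrightarrow> \<zeta> (\<rho> a \<odot>\<^bsub>W\<^esub> x) = scal a (\<zeta> x)"
    and proj: "v \<in> vecs d \<Longrightarrow> \<pi> v \<in> \<zeta> ` carrier W"
      "z \<in> \<zeta> ` carrier W \<Longrightarrow> \<pi> z = z"
      "v \<in> vecs d \<Longrightarrow> v' \<in> vecs d \<Longrightarrow> \<pi> (v + v') = \<pi> v + \<pi> v'"
      "v \<in> vecs d \<Longrightarrow> \<pi> (scal a v) = scal a (\<pi> v)"

context corner_order
begin

lemma rho_zero: "\<rho> 0 = \<zero>"
  using rho_add[of 0 0] rho_closed by simp

lemma CM_coordinates:
  assumes "M \<in> CM B \<rho>"
  shows "\<exists>d \<xi>. module_coordinates B \<rho> M d \<xi>"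
proof -
  interpret M: left_module B M using assms by (simp add: CM_def)
  from assms have "\<exists>d b. (\<forall>l<d. b l \<in> carrier M) \<and>
      (\<forall>x\<in>carrier M. \<exists>!c. c \<in> {..<d :: nat} \<rightarrow>\<^sub>E UNIV \<and> x = finsum M (\<lambda>l. \<rho> (c l) \<odot>\<^bsub>M\<^esub> b l) {..<d})"
    by (simp add: CM_def)
  then obtain d :: nat and b where bb: "\<forall>l<d. b l \<in> carrier M"
    and ex: "\<forall>x\<in>carrier M. \<exists>!c. c \<in> {..<d} \<rightarrow>\<^sub>E UNIV \<and> x = finsum M (\<lambda>l. \<rho> (c l) \<odot>\<^bsub>M\<^esub> b l) {..<d}"
    by (elim exE conjE)
  note b = bb[rule_format]
  note ex1 = bspec[OF ex]
  define comb where "comb v = finsum M (\<lambda>l. \<rho> (v l) \<odot>\<^bsub>M\<^esub> b l) {..<d}" for v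
  have cl: "(\<lambda>l. \<rho> (v l) \<odot>\<^bsub>M\<^esub> b l) \<in> {..<d} \<rightarrow> carrier M" for v
    using b by (auto intro: M.smult_closed rho_closed)
  have comb_cl: "comb v \<in> carrier M" for v unfolding comb_def by (rule M.M.finsum_closed[OF cl])
  have comb_add: "comb (v + v') = comb v \<oplus>\<^bsub>M\<^esub> comb v'" for v v'
  proof -
    have "comb (v + v') = finsum M (\<lambda>l. \<rho> (v l) \<odot>\<^bsub>M\<^esub> b l \<oplus>\<^bsub>M\<^esub> \<rho> (v' l) \<odot>\<^bsub>M\<^esub> b l) {..<d}"
      unfolding comb_def
      by (rule M.M.finsum_cong') (use b in \<open>auto simp: rho_add M.smult_l_distr M.smult_closed rho_closed\<close>)
    then show ?thesis unfolding comb_def using M.M.finsum_addf[OF cl cl] by simp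
  qed
  have comb_scal: "comb (scal a v) = \<rho> a \<odot>\<^bsub>M\<^esub> comb v" for a v
  proof -
    have "comb (scal a v) = finsum M (\<lambda>l. \<rho> a \<odot>\<^bsub>M\<^esub> (\<rho> (v l) \<odot>\<^bsub>M\<^esub> b l)) {..<d}"
      unfolding comb_def
      by (rule M.M.finsum_cong') (use b in \<open>auto simp: scal_apply rho_mult M.smult_assoc M.smult_closed rho_closed\<close>)
    then show ?thesis unfolding comb_def using M.smult_finsum[OF _ rho_closed cl] by simp
  qed
  \<comment> \<open>The coefficient functions in \<open>CM\<close> are undefined from d on, those in
    \<open>vecs d\<close> vanish there; the combination does not see the difference.\<close>
  have comb_cong: "comb (restrict v {..<d}) = comb v" for v
    unfolding comb_def by (rule M.M.finsum_cong') (use cl in auto)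
  have bij: "bij_betw comb (vecs d) (carrier M)"
    unfolding bij_betw_def
  proof
    show "inj_on comb (vecs d)"
    proof (rule inj_onI)
      fix v v' assume v: "v \<in> vecs d" "v' \<in> vecs d" "comb v = comb v'"
      have "restrict v {..<d} = restrict v' {..<d}"
        by (rule ex1_eqI[OF ex1[OF comb_cl[of v]]])
          (use v(3) comb_cong[of v] comb_cong[of v'] in \<open>simp_all add: comb_def\<close>)
      then have "v l = v' l" if "l < d" for l using that by (metis lessThan_iff restrict_apply')
      then show "v = v'" using v by (auto simp: vecs_def fun_eq_iff) (metis not_le)
    qed
    show "comb ` vecs d = carrier M"
    proof (intro equalityI subsetI)
      fix x assume "x \<in> carrier M"
      from ex1_implies_ex[OF ex1[OF this]] obtain c where c: "x = comb c" unfolding comb_def by (elim exE conjE)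
      have "comb (\<lambda>l. if l < d then c l else 0) = comb c"
        unfolding comb_def by (rule M.M.finsum_cong') (use cl in auto)
      moreover have "(\<lambda>l. if l < d then c l else 0) \<in> vecs d" by (simp add: vecs_def)
      ultimately show "x \<in> comb ` vecs d" unfolding c by (intro image_eqI[of "comb c" comb]) (rule sym)
    qed (use comb_cl in auto)
  qed
  define \<xi> where "\<xi> = inv_into (vecs d) comb"
  have xi: "bij_betw \<xi> (carrier M) (vecs d)" unfolding \<xi>_def by (rule bij_betw_inv_into[OF bij])
  have cxi: "comb (\<xi> x) = x" if "x \<in> carrier M" for x
    unfolding \<xi>_def using bij_betw_inv_into_right[OF bij that] .
  have xic: "\<xi> (comb v) = v" if "v \<in> vecs d" for v
    unfolding \<xi>_def using bij_betw_inv_into_left[OF bij that] .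
  have xv: "\<xi> x \<in> vecs d" if "x \<in> carrier M" for x using xi that by (auto simp: bij_betw_def)
  have "module_coordinates B \<rho> M d \<xi>"
  proof unfold_locales
    fix x y a assume x: "x \<in> carrier M"
    show "\<xi> (x \<oplus>\<^bsub>M\<^esub> y) = \<xi> x + \<xi> y" if y: "y \<in> carrier M"
      using xic[OF vecs_add[OF xv[OF x] xv[OF y]]] by (simp add: comb_add cxi x y)
    show "\<xi> (\<rho> a \<odot>\<^bsub>M\<^esub> x) = scal a (\<xi> x)"
      using xic[OF vecs_scal[OF xv[OF x]]] by (simp add: comb_scal cxi x)
  qed (rule xi)
  then show ?thesis by blast
qed

lemma CM_summand_coordinates:
  assumes "T \<in> CM B \<rho>" "is_summand B W T" "left_module B W"
  shows "\<exists>d \<zeta> \<pi>. summand_coordinates B \<rho> W d \<zeta> \<pi>"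
proof -
  interpret T: left_module B T using assms by (simp add: CM_def)
  interpret W: left_module B W by fact
  obtain d \<xi> where "module_coordinates B \<rho> T d \<xi>" using CM_coordinates[OF assms(1)] by blast
  then interpret xi: module_coordinates B \<rho> T d \<xi> .
  note xi = xi.bij xi.add xi.scal
  obtain s r where s: "s \<in> lhom B W T" and r: "r \<in> lhom B T W" and rs: "\<And>x. x \<in> carrier W \<Longrightarrow> r (s x) = x"
    using assms(2) by (auto simp: is_summand_def)
  interpret s: left_module_hom B W T s by unfold_locales (rule s)
  interpret r: left_module_hom B T W r by unfold_locales (rule r)
  define \<eta> where "\<eta> = inv_into (carrier T) \<xi>"
  have xe: "\<xi> (\<eta> v) = v" if "v \<in> vecs d" for v
    unfolding \<eta>_def using bij_betw_inv_into_right[OF xi(1) that] .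
  have ex: "\<eta> (\<xi> x) = x" if "x \<in> carrier T" for x
    unfolding \<eta>_def using bij_betw_inv_into_left[OF xi(1) that] .
  have eT: "\<eta> v \<in> carrier T" if "v \<in> vecs d" for v
    unfolding \<eta>_def using bij_betwE[OF bij_betw_inv_into[OF xi(1)]] that by blast
  have xv: "\<xi> x \<in> vecs d" if "x \<in> carrier T" for x using xi(1) that by (auto simp: bij_betw_def)
  have eadd: "\<eta> (v + v') = \<eta> v \<oplus>\<^bsub>T\<^esub> \<eta> v'" if "v \<in> vecs d" "v' \<in> vecs d" for v v'
    using ex[of "\<eta> v \<oplus>\<^bsub>T\<^esub> \<eta> v'"] that by (simp add: xi eT xe)
  have escal: "\<eta> (scal a v) = \<rho> a \<odot>\<^bsub>T\<^esub> \<eta> v" if "v \<in> vecs d" for v a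
    using ex[of "\<rho> a \<odot>\<^bsub>T\<^esub> \<eta> v"] that by (simp add: xi eT xe T.smult_closed rho_closed)
  have inj: "inj_on (\<lambda>x. \<xi> (s x)) (carrier W)"
    by (rule inj_on_inverseI[of _ "\<lambda>v. r (\<eta> v)"]) (simp add: ex s.closed rs)
  have "summand_coordinates B \<rho> W d (\<lambda>x. \<xi> (s x)) (\<lambda>v. \<xi> (s (r (\<eta> v))))"
  proof unfold_locales
    show "(\<lambda>x. \<xi> (s x)) ` carrier W \<subseteq> vecs d" using xv s.closed by auto
    show "\<xi> (s (r (\<eta> z))) = z" if "z \<in> (\<lambda>x. \<xi> (s x)) ` carrier W" for z
      using that by (auto simp: ex s.closed rs)
  qed (auto simp: s.add s.smult r.add r.smult s.closed r.closed xi eT eadd escal rho_closed inj)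
  then show ?thesis by blast
qed

text \<open>Fitting's lemma leaves, besides the two wanted cases, an involution that commutes with B
  and is neither 1 nor -1. As 2 is invertible, its eigenspaces for 1 and -1 would decompose W
  nontrivially.\<close>

lemma local_endomorphism:
  assumes ind: "indecomposable B W" and T: "T \<in> CM B \<rho>" "is_summand B W T" and \<phi>: "\<phi> \<in> lhom B W W"
  shows "bij_betw \<phi> (carrier W) (carrier W) \<or> bij_betw (\<lambda>w. w \<ominus>\<^bsub>W\<^esub> \<phi> w) (carrier W) (carrier W)"
proof -
  interpret W: left_module B W using ind by (simp add: indecomposable_def)
  interpret phi: left_module_hom B W W \<phi> by unfold_locales (rule \<phi>)
  obtain d \<zeta> \<pi> where "summand_coordinates B \<rho> W d \<zeta> \<pi>"
    using CM_summand_coordinates[OF T W.left_module_axioms] by blast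
  then interpret c: summand_coordinates B \<rho> W d \<zeta> \<pi> .
  note inj = c.inj and Z = c.into and add = c.add and scal = c.scal and proj = c.proj
  let ?Z = "\<zeta> ` carrier W"
  \<comment> \<open>Operators are constrained only on the image of W, where they must agree with
    some b in B. For a given operator such a b is picked by choice.\<close>
  define \<BB> where "\<BB> = {\<beta>. \<exists>b\<in>carrier B. \<forall>w\<in>carrier W. \<beta> (\<zeta> w) = \<zeta> (b \<odot>\<^bsub>W\<^esub> w)}"
  define op_of where "op_of \<beta> = (SOME b. b \<in> carrier B \<and> (\<forall>w\<in>carrier W. \<beta> (\<zeta> w) = \<zeta> (b \<odot>\<^bsub>W\<^esub> w)))" for \<beta>
  have op_of: "op_of \<beta> \<in> carrier B \<and> (\<forall>w\<in>carrier W. \<beta> (\<zeta> w) = \<zeta> (op_of \<beta> \<odot>\<^bsub>W\<^esub> w))" if "\<beta> \<in> \<BB>" for \<beta>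
    unfolding op_of_def by (rule someI_ex) (use that in \<open>auto simp: \<BB>_def\<close>)
  have zminus: "\<zeta> (\<ominus>\<^bsub>W\<^esub> w) = - \<zeta> w" if "w \<in> carrier W" for w
  proof -
    have "\<zeta> \<zero>\<^bsub>W\<^esub> = 0" using scal[OF W.M.zero_closed, of 0] by (simp add: rho_zero W.zero_smult)
    then have "\<zeta> (\<ominus>\<^bsub>W\<^esub> w) + \<zeta> w = 0" using add[of "\<ominus>\<^bsub>W\<^esub> w" w] that by (simp add: W.M.l_neg)
    then show ?thesis by (simp only: eq_neg_iff_add_eq_0)
  qed
  interpret adic_module scal ?Z \<BB> d "\<lambda>l. \<pi> (unit_vec l)" "\<lambda>z l. fps_nth (z l) 0"
  proof (rule adic_module_summand[OF Z _ _ proj])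
    show "z + z' \<in> ?Z" if "z \<in> ?Z" "z' \<in> ?Z" for z z'
      using that by (auto simp flip: add)
    show "scal a z \<in> ?Z" if "z \<in> ?Z" for z a
      using that W.smult_closed[OF rho_closed] by (auto simp flip: scal)
    show "scal a \<in> \<BB>" for a
      unfolding \<BB>_def by (intro CollectI bexI[OF _ rho_closed[of a]] ballI) (rule scal[symmetric])
    fix \<beta> assume "\<beta> \<in> \<BB>"
    define b where "b = op_of \<beta>"
    have b: "b \<in> carrier B" "\<And>w. w \<in> carrier W \<Longrightarrow> \<beta> (\<zeta> w) = \<zeta> (b \<odot>\<^bsub>W\<^esub> w)"
      using op_of[OF \<open>\<beta> \<in> \<BB>\<close>] by (auto simp: b_def)
    fix z assume "z \<in> ?Z"
    then obtain w where w: "w \<in> carrier W" "z = \<zeta> w" by blast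
    show "\<beta> z \<in> ?Z" using b w W.smult_closed by auto
    show "\<beta> (z + z') = \<beta> z + \<beta> z'" if z': "z' \<in> ?Z" for z'
    proof -
      obtain w' where w': "w' \<in> carrier W" "z' = \<zeta> w'" using z' by blast
      have "\<beta> (z + z') = \<zeta> (b \<odot>\<^bsub>W\<^esub> (w \<oplus>\<^bsub>W\<^esub> w'))" using b(2)[of "w \<oplus>\<^bsub>W\<^esub> w'"] w w' by (simp add: add)
      then show ?thesis using w w' b by (simp add: W.smult_r_distr add W.smult_closed)
    qed
    show "\<beta> (scal a z) = scal a (\<beta> z)" for a
    proof -
      have "\<beta> (scal a z) = \<zeta> (b \<odot>\<^bsub>W\<^esub> (\<rho> a \<odot>\<^bsub>W\<^esub> w))"
        using b(2)[of "\<rho> a \<odot>\<^bsub>W\<^esub> w"] w by (simp add: scal W.smult_closed rho_closed)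
      also have "\<dots> = \<zeta> (\<rho> a \<odot>\<^bsub>W\<^esub> (b \<odot>\<^bsub>W\<^esub> w))"
        using b(1) w rho_central[OF b(1)] by (simp add: rho_closed flip: W.smult_assoc)
      finally show ?thesis using b w by (simp add: scal W.smult_closed)
    qed
  qed
  define \<phi>' where "\<phi>' z = \<zeta> (\<phi> (inv_into (carrier W) \<zeta> z))" for z
  have phi': "\<phi>' (\<zeta> w) = \<zeta> (\<phi> w)" if "w \<in> carrier W" for w
    using that inj by (simp add: \<phi>'_def)
  have "\<phi>' \<in> End"
  proof (rule EndI)
    fix z assume "z \<in> ?Z"
    then obtain w where w: "w \<in> carrier W" "z = \<zeta> w" by blast
    show "\<phi>' z \<in> ?Z" using w phi' phi.closed by simp
    show "\<phi>' (z + z') = \<phi>' z + \<phi>' z'" if z': "z' \<in> ?Z" for z'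
    proof -
      obtain w' where w': "w' \<in> carrier W" "z' = \<zeta> w'" using z' by blast
      have "\<phi>' (z + z') = \<zeta> (\<phi> (w \<oplus>\<^bsub>W\<^esub> w'))" using phi'[of "w \<oplus>\<^bsub>W\<^esub> w'"] w w' by (simp add: add)
      then show ?thesis using w w' by (simp add: phi.add add phi.closed phi')
    qed
    show "\<phi>' (\<beta> z) = \<beta> (\<phi>' z)" if "\<beta> \<in> \<BB>" for \<beta>
    proof -
      define b where "b = op_of \<beta>"
      have b: "b \<in> carrier B" "\<And>w. w \<in> carrier W \<Longrightarrow> \<beta> (\<zeta> w) = \<zeta> (b \<odot>\<^bsub>W\<^esub> w)"
        using op_of[OF that] by (auto simp: b_def)
      show ?thesis using b w by (simp add: phi' phi.closed phi.smult W.smult_closed)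
    qed
  qed
  from fitting[OF this] consider "bij_betw \<phi>' ?Z ?Z" | "bij_betw (\<lambda>z. z - \<phi>' z) ?Z ?Z"
    | \<sigma> where "\<sigma> \<in> End" "\<And>z. z \<in> ?Z \<Longrightarrow> \<sigma> (\<sigma> z) = z" "\<exists>z\<in>?Z. \<sigma> z \<noteq> z" "\<exists>z\<in>?Z. \<sigma> z \<noteq> - z" by blast
  then show ?thesis
  proof cases
    have z: "bij_betw \<zeta> (carrier W) ?Z" using inj by (simp add: bij_betw_def)
    have transfer: "bij_betw f (carrier W) (carrier W)"
      if "bij_betw f' ?Z ?Z" "\<And>w. w \<in> carrier W \<Longrightarrow> f w \<in> carrier W \<and> \<zeta> (f w) = f' (\<zeta> w)" for f f'
    proof -
      have "bij_betw (inv_into (carrier W) \<zeta> \<circ> (f' \<circ> \<zeta>)) (carrier W) (carrier W)"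
        using bij_betw_trans[OF bij_betw_trans[OF z that(1)] bij_betw_inv_into[OF z]] .
      moreover have "(inv_into (carrier W) \<zeta> \<circ> (f' \<circ> \<zeta>)) w = f w" if "w \<in> carrier W" for w
        using inj \<open>\<And>w. w \<in> carrier W \<Longrightarrow> f w \<in> carrier W \<and> \<zeta> (f w) = f' (\<zeta> w)\<close>[OF that]
        by (metis comp_apply inv_into_f_f)
      ultimately show ?thesis by (subst bij_betw_cong) auto
    qed
    case 1
    then show ?thesis using transfer[of \<phi>' \<phi>] phi' phi.closed by simp
  next
    have z: "bij_betw \<zeta> (carrier W) ?Z" using inj by (simp add: bij_betw_def)
    case 2
    have "bij_betw (inv_into (carrier W) \<zeta> \<circ> ((\<lambda>z. z - \<phi>' z) \<circ> \<zeta>)) (carrier W) (carrier W)"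
      using bij_betw_trans[OF bij_betw_trans[OF z 2] bij_betw_inv_into[OF z]] .
    moreover have "(inv_into (carrier W) \<zeta> \<circ> ((\<lambda>z. z - \<phi>' z) \<circ> \<zeta>)) w = w \<ominus>\<^bsub>W\<^esub> \<phi> w" if "w \<in> carrier W" for w
    proof -
      have "\<zeta> (w \<ominus>\<^bsub>W\<^esub> \<phi> w) = \<zeta> w - \<phi>' (\<zeta> w)"
        using that phi.closed by (simp add: a_minus_def add zminus phi')
      then show ?thesis using inv_into_f_f[OF inj, of "w \<ominus>\<^bsub>W\<^esub> \<phi> w"] that phi.closed by simp
    qed
    ultimately have "bij_betw (\<lambda>w. w \<ominus>\<^bsub>W\<^esub> \<phi> w) (carrier W) (carrier W)"
      using bij_betw_cong[of "carrier W" "inv_into (carrier W) \<zeta> \<circ> ((\<lambda>z. z - \<phi>' z) \<circ> \<zeta>)" "\<lambda>w. w \<ominus>\<^bsub>W\<^esub> \<phi> w"] by blast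
    then show ?thesis ..
  next
    case (3 \<sigma>)
    define eig where "eig a = {w \<in> carrier W. \<sigma> (\<zeta> w) = scal a (\<zeta> w)}" for a
    have "submodule (eig a) B W" for a
    proof (intro submodule.intro subgroup.intro submodule_axioms.intro)
      have z0: "\<zeta> \<zero>\<^bsub>W\<^esub> = 0" using scal[OF W.M.zero_closed, of 0] by (simp add: rho_zero W.zero_smult)
      show "eig a \<subseteq> carrier (add_monoid W)" by (auto simp: eig_def)
      show "\<one>\<^bsub>add_monoid W\<^esub> \<in> eig a" using End_zero[OF 3(1)] by (simp add: eig_def z0)
      fix x assume x: "x \<in> eig a"
      then have xW: "x \<in> carrier W" "\<zeta> x \<in> ?Z" "\<sigma> (\<zeta> x) = scal a (\<zeta> x)" by (auto simp: eig_def)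
      have "\<sigma> (- \<zeta> x) = scal a (- \<zeta> x)" using End_minus[OF 3(1) xW(2)] xW(3) by simp
      then show "inv\<^bsub>add_monoid W\<^esub> x \<in> eig a"
        using xW by (simp add: eig_def zminus flip: a_inv_def)
      show "x \<otimes>\<^bsub>add_monoid W\<^esub> y \<in> eig a" if y: "y \<in> eig a" for y
      proof -
        have yW: "y \<in> carrier W" "\<zeta> y \<in> ?Z" "\<sigma> (\<zeta> y) = scal a (\<zeta> y)" using y by (auto simp: eig_def)
        have "\<sigma> (\<zeta> x + \<zeta> y) = scal a (\<zeta> x + \<zeta> y)"
          using End_add[OF 3(1) xW(2) yW(2)] xW(3) yW(3) by (simp add: scal.scale_right_distrib)
        then show ?thesis using xW(1) yW(1) by (simp add: eig_def add)
      qed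
      show "b \<odot>\<^bsub>W\<^esub> x \<in> eig a" if b: "b \<in> carrier B" for b
      proof -
        define \<beta> where "\<beta> z = \<zeta> (b \<odot>\<^bsub>W\<^esub> inv_into (carrier W) \<zeta> z)" for z
        have \<beta>: "\<beta> (\<zeta> w) = \<zeta> (b \<odot>\<^bsub>W\<^esub> w)" if "w \<in> carrier W" for w using that inj by (simp add: \<beta>_def)
        then have "\<beta> \<in> \<BB>" using b by (auto simp: \<BB>_def)
        from End_op[OF 3(1) this xW(2)] op_scal[OF this xW(2)] xW(3)
        have "\<sigma> (\<beta> (\<zeta> x)) = scal a (\<beta> (\<zeta> x))" by simp
        then show ?thesis using xW(1) b by (simp add: eig_def \<beta> W.smult_closed)
      qed
    qed
    moreover have "eig 1 \<inter> eig (- 1) = {\<zero>\<^bsub>W\<^esub>}"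
    proof (intro equalityI subsetI)
      fix w assume w: "w \<in> eig 1 \<inter> eig (- 1)"
      then have wW: "w \<in> carrier W" and "\<zeta> w = - \<zeta> w" by (auto simp: eig_def)
      then have "\<zeta> w l = 0" for l using fun_cong[of "\<zeta> w" "- \<zeta> w" l] by simp
      then have "\<zeta> w = \<zeta> \<zero>\<^bsub>W\<^esub>"
        using scal[OF W.M.zero_closed, of 0] by (simp add: rho_zero W.zero_smult fun_eq_iff)
      then show "w \<in> {\<zero>\<^bsub>W\<^esub>}" using inj wW by (auto dest: inj_onD)
    next
      fix w assume "w \<in> {\<zero>\<^bsub>W\<^esub>}"
      moreover have "\<zeta> \<zero>\<^bsub>W\<^esub> = 0" using scal[OF W.M.zero_closed, of 0] by (simp add: rho_zero W.zero_smult)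
      ultimately show "w \<in> eig 1 \<inter> eig (- 1)" using End_zero[OF 3(1)] by (simp add: eig_def)
    qed
    \<comment> \<open>The usual projections (1 + sigma)/2 and (1 - sigma)/2. Their explicit values
      are kept, so that the vanishing of one eigenspace determines sigma everywhere.\<close>
    moreover have split: "\<exists>u v. u \<in> eig 1 \<and> v \<in> eig (- 1) \<and> w = u \<oplus>\<^bsub>W\<^esub> v \<and>
        \<zeta> u = scal (fps_const (1/2)) (\<zeta> w + \<sigma> (\<zeta> w)) \<and> \<zeta> v = scal (fps_const (1/2)) (\<zeta> w - \<sigma> (\<zeta> w))"
      if w: "w \<in> carrier W" for w
    proof -
      let ?u = "scal (fps_const (1/2)) (\<zeta> w + \<sigma> (\<zeta> w))" and ?v = "scal (fps_const (1/2)) (\<zeta> w - \<sigma> (\<zeta> w))"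
      have zw: "\<zeta> w \<in> ?Z" "\<sigma> (\<zeta> w) \<in> ?Z" using w End_closed[OF 3(1)] by auto
      have "?u \<in> ?Z" "?v \<in> ?Z" using zw by (auto intro!: Z_scal Z_add Z_diff)
      note uv = this
      define u where "u = inv_into (carrier W) \<zeta> ?u"
      define v where "v = inv_into (carrier W) \<zeta> ?v"
      have u: "u \<in> carrier W" "\<zeta> u = ?u" and v: "v \<in> carrier W" "\<zeta> v = ?v"
        unfolding u_def v_def by (rule inv_into_into[OF uv(1)] f_inv_into_f[OF uv(1)] inv_into_into[OF uv(2)] f_inv_into_f[OF uv(2)])+
      have "\<sigma> ?u = ?u" using zw 3(2)[OF zw(1)] End_scal[OF 3(1)] End_add[OF 3(1)]
        by (simp add: Z_add add.commute)
      then have 1: "u \<in> eig 1" using u by (simp add: eig_def)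
      have neg: "c * (y - x) = - 1 * (c * (x - y))" for c x y :: "complex fps" by (simp add: algebra_simps)
      have "\<sigma> ?v = scal (fps_const (1/2)) (\<sigma> (\<zeta> w) - \<zeta> w)"
        using zw 3(2)[OF zw(1)] End_scal[OF 3(1)] End_diff[OF 3(1)] by (simp add: Z_diff)
      also have "scal (fps_const (1/2)) (\<sigma> (\<zeta> w) - \<zeta> w) = scal (- 1) ?v"
        by (rule ext, unfold scal_apply minus_apply, rule neg)
      finally have "\<sigma> (\<zeta> v) = scal (- 1) (\<zeta> v)" by (simp only: v(2))
      then have 2: "v \<in> eig (- 1)" using v(1) unfolding eig_def by blast
      have "fps_const (1/2) * (a + b) + fps_const (1/2) * (a - b) = a" for a b :: "complex fps"
      proof -
        have "fps_const (1/2) * (a + b) + fps_const (1/2) * (a - b) = (fps_const (1/2) + fps_const (1/2)) * a"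
          by (simp only: distrib_left distrib_right right_diff_distrib) simp
        then show ?thesis by simp
      qed
      then have "?u + ?v = \<zeta> w" by (simp add: fun_eq_iff scal_apply)
      then have "\<zeta> (u \<oplus>\<^bsub>W\<^esub> v) = \<zeta> w" using u v by (simp add: add)
      then have "w = u \<oplus>\<^bsub>W\<^esub> v" using inj_onD[OF inj, of "u \<oplus>\<^bsub>W\<^esub> v" w] u v w by simp
      then show ?thesis using 1 2 u v by blast
    qed
    then have "set_add W (eig 1) (eig (- 1)) = carrier W"
    proof (intro equalityI subsetI)
      fix w assume "w \<in> set_add W (eig 1) (eig (- 1))"
      then show "w \<in> carrier W" by (auto simp: set_add_def' eig_def)
    next
      fix w assume "w \<in> carrier W"
      from split[OF this] show "w \<in> set_add W (eig 1) (eig (- 1))" unfolding set_add_def' by blast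
    qed
    ultimately consider "eig 1 = {\<zero>\<^bsub>W\<^esub>}" | "eig (- 1) = {\<zero>\<^bsub>W\<^esub>}"
      using ind unfolding indecomposable_def by blast
    then have False
    proof cases
      have half: "f = 0" if "scal (fps_const (1/2)) f = \<zeta> \<zero>\<^bsub>W\<^esub>" for f
      proof -
        have "\<zeta> \<zero>\<^bsub>W\<^esub> = 0" using scal[OF W.M.zero_closed, of 0] by (simp add: rho_zero W.zero_smult)
        then have "fps_const (1/2) * f l = 0" for l using fun_cong[OF that, of l] by (simp add: scal_apply)
        then show ?thesis by (simp add: fun_eq_iff fps_const_eq_0_iff)
      qed
      case 1
      obtain w where w: "w \<in> carrier W" "\<sigma> (\<zeta> w) \<noteq> - \<zeta> w" using 3(4) by blast
      then have "\<zeta> w + \<sigma> (\<zeta> w) = 0" using split[OF w(1)] 1 half by (metis singletonD)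
      then have "\<sigma> (\<zeta> w) = - \<zeta> w" by (simp only: eq_neg_iff_add_eq_0 add.commute)
      then show False using w by simp
    next
      have half: "f = 0" if "scal (fps_const (1/2)) f = \<zeta> \<zero>\<^bsub>W\<^esub>" for f
      proof -
        have "\<zeta> \<zero>\<^bsub>W\<^esub> = 0" using scal[OF W.M.zero_closed, of 0] by (simp add: rho_zero W.zero_smult)
        then have "fps_const (1/2) * f l = 0" for l using fun_cong[OF that, of l] by (simp add: scal_apply)
        then show ?thesis by (simp add: fun_eq_iff fps_const_eq_0_iff)
      qed
      case 2
      obtain w where w: "w \<in> carrier W" "\<sigma> (\<zeta> w) \<noteq> \<zeta> w" using 3(3) by blast
      then have "\<zeta> w - \<sigma> (\<zeta> w) = 0" using split[OF w(1)] 2 half by (metis singletonD)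
      then have "\<sigma> (\<zeta> w) = \<zeta> w" by (simp only: right_minus_eq)
      then show False using w by simp
    qed
    then show ?thesis ..
  qed
qed

end

section \<open>Removing an indecomposable summand\<close>

lemma left_module_homI: "left_module B M \<Longrightarrow> left_module B N \<Longrightarrow> f \<in> lhom B M N \<Longrightarrow> left_module_hom B M N f"
  by (simp add: left_module_hom_def left_module_hom_axioms_def)

lemma is_summand_trans:
  assumes "left_module B X" "left_module B Z" "is_summand B X Y" "is_summand B Y Z"
  shows "is_summand B X Z"
proof -
  obtain s r where s: "s \<in> lhom B X Y" and r: "r \<in> lhom B Y X" "\<And>x. x \<in> carrier X \<Longrightarrow> r (s x) = x"
    using assms(3) by (auto simp: is_summand_def)
  obtain s' r' where s': "s' \<in> lhom B Y Z" and r': "r' \<in> lhom B Z Y" "\<And>y. y \<in> carrier Y \<Longrightarrow> r' (s' y) = y"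
    using assms(4) by (auto simp: is_summand_def)
  have "compose (carrier X) s' s \<in> lhom B X Z" "compose (carrier Z) r r' \<in> lhom B Z X"
    using s s' r r' assms(1,2) by (auto intro: lhom_compose)
  moreover have "compose (carrier Z) r r' (compose (carrier X) s' s x) = x" if "x \<in> carrier X" for x
    using that s s' r r' by (simp add: compose_eq lhom_closed)
  ultimately show ?thesis unfolding is_summand_def by blast
qed

lemma lm_iso_summand:
  assumes "left_module B M" "left_module B N" "lm_iso B M N"
  shows "is_summand B M N" "is_summand B N M"
proof -
  obtain f where f: "f \<in> lhom B M N" "bij_betw f (carrier M) (carrier N)"
    using assms(3) by (auto simp: lm_iso_def)
  obtain g where "g \<in> lhom B N M" "\<forall>x\<in>carrier M. g (f x) = x" "\<forall>y\<in>carrier N. f (g y) = y"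
    using lhom_inverse[OF assms(1,2) f] by blast
  with f show "is_summand B M N" "is_summand B N M" unfolding is_summand_def by blast+
qed

lemma dsum_summand:
  fixes B :: "'b ring"
  assumes "ring B" "\<And>i. i \<in> I \<Longrightarrow> left_module B (F i)" "i \<in> I"
  shows "is_summand B (F i) (dsum I F)"
  unfolding is_summand_def
proof (intro bexI ballI)
  show inc: "dsum_incl I F i \<in> lhom B (F i) (dsum I F)" using assms(2,3) by (rule dsum_incl_lhom)
  show "(\<lambda>x\<in>carrier (dsum I F). x i) (dsum_incl I F i x) = x" if x: "x \<in> carrier (F i)" for x
  proof -
    have "(\<lambda>x\<in>carrier (dsum I F). x i) (dsum_incl I F i x) = dsum_incl I F i x i"
      using lhom_closed[OF inc x] by (simp del: dsum_simps)
    then show ?thesis using x assms(3) by (simp add: dsum_incl_def)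
  qed
  show "(\<lambda>x\<in>carrier (dsum I F). x i) \<in> lhom B (dsum I F) (F i)" using assms(3,1,2) by (rule dsum_proj)
qed

lemma decomposition_summand:
  assumes "ring B" "left_module B T" "decomposition B T Q0 m Ts" "j \<in> Q0"
  shows "is_summand B (Ts j) T" "left_module B (Ts j)"
proof -
  have Ts: "left_module B (Ts j)" if "j \<in> Q0" for j
    using assms(3) that by (simp add: decomposition_def indecomposable_def)
  show j: "left_module B (Ts j)" by (rule Ts[OF assms(4)])
  have D: "left_module B (multiples Q0 m Ts)"
    unfolding multiples_def using assms(1) Ts by (intro dsum_left_module) auto
  have iso: "lm_iso B T (multiples Q0 m Ts)" using assms(3) by (simp add: decomposition_def)
  have "0 < m j" using assms(3,4) by (simp add: decomposition_def)
  then have "is_summand B ((Ts \<circ> fst) (j, 0 :: nat)) (multiples Q0 m Ts)"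
    unfolding multiples_def using assms(1,4) Ts by (intro dsum_summand[where F = "Ts \<circ> fst" and i = "(j, 0 :: nat)"]) auto
  then show "is_summand B (Ts j) T"
    using is_summand_trans[OF j assms(2) _ lm_iso_summand(2)[OF assms(2) D iso]] by simp
qed

text \<open>The identity of X is a finite sum of maps through the F a, that is, X is a summand of
  their direct sum. Stated by components, a single factor can be removed without rebuilding a direct
  sum, and the factors may be any indexed family.\<close>

definition sum_factors :: "'b ring \<Rightarrow> ('b, 'm) module \<Rightarrow> ('i \<Rightarrow> ('b, 'n) module) \<Rightarrow> 'i set \<Rightarrow> bool" where
  "sum_factors B X F A \<longleftrightarrow> (\<exists>s r. (\<forall>a\<in>A. s a \<in> lhom B X (F a) \<and> r a \<in> lhom B (F a) X) \<and>
     (\<forall>x\<in>carrier X. finsum X (\<lambda>a. r a (s a x)) A = x))"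

lemma sum_factorsI:
  assumes "\<And>a. a \<in> A \<Longrightarrow> s a \<in> lhom B X (F a)" "\<And>a. a \<in> A \<Longrightarrow> r a \<in> lhom B (F a) X"
    "\<And>x. x \<in> carrier X \<Longrightarrow> finsum X (\<lambda>a. r a (s a x)) A = x"
  shows "sum_factors B X F A"
  using assms unfolding sum_factors_def by blast

lemma summand_sum_factors:
  fixes B :: "'b ring" and X :: "('b, 'm) module"
  assumes X: "left_module B X" and F: "\<And>i. i \<in> I \<Longrightarrow> left_module B (F i)" and I: "finite I"
    and summand: "is_summand B X (dsum I F)"
  shows "sum_factors B X F I"
proof -
  interpret X: left_module B X by fact
  interpret D: left_module B "dsum I F" using X.ring_axioms F by (rule dsum_left_module)
  obtain s r where s: "s \<in> lhom B X (dsum I F)" and r: "r \<in> lhom B (dsum I F) X"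
    and rs: "\<And>x. x \<in> carrier X \<Longrightarrow> r (s x) = x"
    using summand by (auto simp: is_summand_def)
  interpret r: left_module_hom B "dsum I F" X r by (intro left_module_homI D.left_module_axioms X r)
  have inc: "dsum_incl I F i \<in> lhom B (F i) (dsum I F)" if "i \<in> I" for i
    using F that by (rule dsum_incl_lhom)
  show ?thesis
  proof (rule sum_factorsI)
    fix i assume i: "i \<in> I"
    show "compose (carrier X) (\<lambda>x\<in>carrier (dsum I F). x i) s \<in> lhom B X (F i)"
      by (rule lhom_compose[OF s _ X]) (use i X.ring_axioms F in \<open>rule dsum_proj\<close>)
    show "compose (carrier (F i)) r (dsum_incl I F i) \<in> lhom B (F i) X"
      by (rule lhom_compose[OF inc[OF i] r F[OF i]])
  next
    fix x assume x: "x \<in> carrier X"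
    have sx: "s x \<in> carrier (dsum I F)" by (rule lhom_closed[OF s x])
    then have sxi: "s x i \<in> carrier (F i)" if "i \<in> I" for i using that by auto
    have "finsum X (\<lambda>i. compose (carrier (F i)) r (dsum_incl I F i)
        (compose (carrier X) (\<lambda>x\<in>carrier (dsum I F). x i) s x)) I =
      finsum X (\<lambda>i. r (dsum_incl I F i (s x i))) I"
    proof (rule X.M.finsum_cong')
      show "(\<lambda>i. r (dsum_incl I F i (s x i))) \<in> I \<rightarrow> carrier X"
        using lhom_closed[OF inc sxi] r.closed by blast
      show "compose (carrier (F i)) r (dsum_incl I F i) (compose (carrier X) (\<lambda>x\<in>carrier (dsum I F). x i) s x) =
        r (dsum_incl I F i (s x i))" if "i \<in> I" for i
        using x sx sxi[OF that] by (simp add: compose_eq del: dsum_simps)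
    qed simp
    also have "\<dots> = r (finsum (dsum I F) (\<lambda>i. dsum_incl I F i (s x i)) I)"
      by (rule r.finsum[OF I, symmetric]) (use lhom_closed[OF inc sxi] in blast)
    also have "\<dots> = x" using dsum_decompose[OF X.ring_axioms F I sx] rs[OF x] by simp
    finally show "finsum X (\<lambda>i. compose (carrier (F i)) r (dsum_incl I F i)
        (compose (carrier X) (\<lambda>x\<in>carrier (dsum I F). x i) s x)) I = x" .
  qed
qed

lemma (in abelian_monoid) finsum_Sigma:
  assumes "finite I" "\<And>a. a \<in> I \<Longrightarrow> finite (K a)" "\<And>a b. a \<in> I \<Longrightarrow> b \<in> K a \<Longrightarrow> f a b \<in> carrier G"
  shows "finsum G (\<lambda>(a, b). f a b) (Sigma I K) = finsum G (\<lambda>a. finsum G (f a) (K a)) I"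
  using assms
proof (induction I rule: finite_induct)
  case (insert a I)
  have eq: "Sigma (insert a I) K = Pair a ` K a \<union> Sigma I K" by auto
  have "finsum G (\<lambda>(a, b). f a b) (Sigma (insert a I) K) =
      finsum G (\<lambda>(a, b). f a b) (Pair a ` K a) \<oplus> finsum G (\<lambda>(a, b). f a b) (Sigma I K)"
    unfolding eq using insert by (intro finsum_Un_disjoint) auto
  also have "finsum G (\<lambda>(a, b). f a b) (Pair a ` K a) = finsum G (f a) (K a)"
    using insert by (subst finsum_reindex) (auto simp: inj_on_def)
  also have "finsum G (\<lambda>(a, b). f a b) (Sigma I K) = finsum G (\<lambda>a. finsum G (f a) (K a)) I"
    using insert by auto
  also have "finsum G (f a) (K a) \<oplus> finsum G (\<lambda>a. finsum G (f a) (K a)) I =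
      finsum G (\<lambda>a. finsum G (f a) (K a)) (insert a I)"
    using insert by (intro finsum_insert[symmetric]) (auto intro!: finsum_closed)
  finally show ?case .
qed simp

text \<open>Substituting a factorisation of each identity of F a into that of X; the index set
  becomes a dependent sum.\<close>

lemma sum_factors_refine:
  fixes B :: "'b ring"
  assumes X: "left_module B X" and F: "\<And>a. a \<in> I \<Longrightarrow> left_module B (F a)"
    and G: "\<And>a b. a \<in> I \<Longrightarrow> b \<in> K a \<Longrightarrow> left_module B (G a b)"
    and fin: "finite I" "\<And>a. a \<in> I \<Longrightarrow> finite (K a)"
    and XF: "sum_factors B X F I" and FG: "\<And>a. a \<in> I \<Longrightarrow> sum_factors B (F a) (G a) (K a)"
  shows "sum_factors B X (\<lambda>(a, b). G a b) (Sigma I K)"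
proof -
  interpret X: left_module B X by fact
  obtain s r where sr: "\<forall>a\<in>I. s a \<in> lhom B X (F a) \<and> r a \<in> lhom B (F a) X"
    and rsx: "\<forall>x\<in>carrier X. finsum X (\<lambda>a. r a (s a x)) I = x"
    using XF unfolding sum_factors_def by (elim exE conjE)
  note s = bspec[OF sr, THEN conjunct1] and r = bspec[OF sr, THEN conjunct2] and rs = bspec[OF rsx]
  have "\<forall>a\<in>I. \<exists>s' r'. (\<forall>b\<in>K a. s' b \<in> lhom B (F a) (G a b) \<and> r' b \<in> lhom B (G a b) (F a)) \<and>
     (\<forall>x\<in>carrier (F a). finsum (F a) (\<lambda>b. r' b (s' b x)) (K a) = x)"
  proof
    fix a assume "a \<in> I"
    from FG[OF this] show "\<exists>s' r'. (\<forall>b\<in>K a. s' b \<in> lhom B (F a) (G a b) \<and> r' b \<in> lhom B (G a b) (F a)) \<and>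
      (\<forall>x\<in>carrier (F a). finsum (F a) (\<lambda>b. r' b (s' b x)) (K a) = x)" unfolding sum_factors_def .
  qed
  from bchoice[OF this] obtain s' where "\<forall>a\<in>I. \<exists>r'. (\<forall>b\<in>K a. s' a b \<in> lhom B (F a) (G a b) \<and> r' b \<in> lhom B (G a b) (F a)) \<and>
     (\<forall>x\<in>carrier (F a). finsum (F a) (\<lambda>b. r' b (s' a b x)) (K a) = x)" by (elim exE)
  from bchoice[OF this] obtain r' where "\<forall>a\<in>I. (\<forall>b\<in>K a. s' a b \<in> lhom B (F a) (G a b) \<and> r' a b \<in> lhom B (G a b) (F a)) \<and>
     (\<forall>x\<in>carrier (F a). finsum (F a) (\<lambda>b. r' a b (s' a b x)) (K a) = x)" by (elim exE)
  then have s': "\<And>a b. a \<in> I \<Longrightarrow> b \<in> K a \<Longrightarrow> s' a b \<in> lhom B (F a) (G a b)"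
    and r': "\<And>a b. a \<in> I \<Longrightarrow> b \<in> K a \<Longrightarrow> r' a b \<in> lhom B (G a b) (F a)"
    and rs': "\<And>a y. a \<in> I \<Longrightarrow> y \<in> carrier (F a) \<Longrightarrow> finsum (F a) (\<lambda>b. r' a b (s' a b y)) (K a) = y" by auto
  show ?thesis
  proof (rule sum_factorsI)
    fix p assume "p \<in> Sigma I K"
    then obtain a b where p: "p = (a, b)" "a \<in> I" "b \<in> K a" by auto
    show "(case p of (a, b) \<Rightarrow> compose (carrier X) (s' a b) (s a)) \<in> lhom B X (case p of (a, b) \<Rightarrow> G a b)"
      using p lhom_compose[OF s s' X] by simp
    show "(case p of (a, b) \<Rightarrow> compose (carrier (G a b)) (r a) (r' a b)) \<in> lhom B (case p of (a, b) \<Rightarrow> G a b) X"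
      using p lhom_compose[OF r' r G] by simp
  next
    fix x assume x: "x \<in> carrier X"
    have cl: "s a x \<in> carrier (F a)" "s' a b (s a x) \<in> carrier (G a b)" "r' a b (s' a b (s a x)) \<in> carrier (F a)"
      "r a (r' a b (s' a b (s a x))) \<in> carrier X"
      if "a \<in> I" "b \<in> K a" for a b
      using that x lhom_closed[OF s] lhom_closed[OF r] lhom_closed[OF s'] lhom_closed[OF r'] by blast+
    have "finsum X (\<lambda>p. (case p of (a, b) \<Rightarrow> compose (carrier (G a b)) (r a) (r' a b))
        ((case p of (a, b) \<Rightarrow> compose (carrier X) (s' a b) (s a)) x)) (Sigma I K) =
      finsum X (\<lambda>(a, b). r a (r' a b (s' a b (s a x)))) (Sigma I K)"
      using x cl by (intro X.M.finsum_cong') (auto simp: compose_eq)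
    also have "\<dots> = finsum X (\<lambda>a. finsum X (\<lambda>b. r a (r' a b (s' a b (s a x)))) (K a)) I"
      by (rule X.M.finsum_Sigma[OF fin cl(4)])
    also have "\<dots> = finsum X (\<lambda>a. r a (s a x)) I"
    proof (rule X.M.finsum_cong')
      show "(\<lambda>a. r a (s a x)) \<in> I \<rightarrow> carrier X" using lhom_closed[OF r lhom_closed[OF s x]] by blast
      fix a assume a: "a \<in> I"
      interpret r: left_module_hom B "F a" X "r a" by (rule left_module_homI[OF F[OF a] X r[OF a]])
      have "finsum X (\<lambda>b. r a (r' a b (s' a b (s a x)))) (K a) = r a (finsum (F a) (\<lambda>b. r' a b (s' a b (s a x))) (K a))"
        by (rule r.finsum[OF fin(2)[OF a], symmetric]) (use cl(3)[OF a] in blast)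
      then show "finsum X (\<lambda>b. r a (r' a b (s' a b (s a x)))) (K a) = r a (s a x)"
        using rs'[OF a lhom_closed[OF s[OF a] x]] by simp
    qed simp
    finally show "finsum X (\<lambda>p. (case p of (a, b) \<Rightarrow> compose (carrier (G a b)) (r a) (r' a b))
        ((case p of (a, b) \<Rightarrow> compose (carrier X) (s' a b) (s a)) x)) (Sigma I K) = x"
      using rs[OF x] by simp
  qed
qed

text \<open>Each factor gets a copy of T of its own, which assembles the components into a split
  embedding of X in a power of T.\<close>

lemma sum_factors_summand:
  fixes B :: "'b ring"
  assumes X: "left_module B X" and T: "left_module B T" and F: "\<And>a. a \<in> A \<Longrightarrow> left_module B (F a)"
    and A: "finite A" and XF: "sum_factors B X F A" and FT: "\<And>a. a \<in> A \<Longrightarrow> is_summand B (F a) T"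
  shows "is_summand B X (power_module T (card A))"
proof -
  interpret X: left_module B X by fact
  interpret T: left_module B T by fact
  let ?N = "{..<card A}" and ?D = "power_module T (card A)"
  interpret D: left_module B ?D using X.ring_axioms T by (intro dsum_left_module)
  obtain h where h: "bij_betw h ?N A" using A ex_bij_betw_nat_finite[of A] by (auto simp: atLeast0LessThan)
  have hA: "h l \<in> A" if "l < card A" for l using h that by (auto simp: bij_betw_def)
  obtain s r where sr: "\<forall>a\<in>A. s a \<in> lhom B X (F a) \<and> r a \<in> lhom B (F a) X"
    and rsx: "\<forall>x\<in>carrier X. finsum X (\<lambda>a. r a (s a x)) A = x"
    using XF unfolding sum_factors_def by (elim exE conjE)
  note s = bspec[OF sr, THEN conjunct1] and r = bspec[OF sr, THEN conjunct2] and rs = bspec[OF rsx]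
  have "\<forall>a\<in>A. \<exists>s' r'. s' \<in> lhom B (F a) T \<and> r' \<in> lhom B T (F a) \<and> (\<forall>x\<in>carrier (F a). r' (s' x) = x)"
    using FT unfolding is_summand_def by blast
  then obtain s' r' where sr: "\<And>a. a \<in> A \<Longrightarrow> s' a \<in> lhom B (F a) T \<and> r' a \<in> lhom B T (F a) \<and> (\<forall>x\<in>carrier (F a). r' a (s' a x) = x)"
    by metis
  define S where "S l = compose (carrier X) (s' (h l)) (s (h l))" for l
  define R where "R l = compose (carrier T) (r (h l)) (r' (h l))" for l
  have S: "left_module_hom B X T (S l)" and R: "left_module_hom B T X (R l)" if "l < card A" for l
    using sr[OF hA[OF that]] s[OF hA[OF that]] r[OF hA[OF that]] unfolding S_def R_def
    by (auto intro!: left_module_homI X T lhom_compose)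
  have RS: "R l (S l x) = r (h l) (s (h l) x)" if "l < card A" "x \<in> carrier X" for l x
  proof -
    have c: "s (h l) x \<in> carrier (F (h l))" by (rule lhom_closed[OF s[OF hA[OF that(1)]] that(2)])
    have "s' (h l) (s (h l) x) \<in> carrier T" by (rule lhom_closed[OF conjunct1[OF sr[OF hA[OF that(1)]]] c])
    then show ?thesis using sr[OF hA[OF that(1)]] c that(2) by (simp add: S_def R_def compose_eq)
  qed
  have Scl: "S l x \<in> carrier T" if "l < card A" "x \<in> carrier X" for l x
    by (rule left_module_hom.closed[OF S[OF that(1)] that(2)])
  have Rcl: "R l y \<in> carrier X" if "l < card A" "y \<in> carrier T" for l y
    by (rule left_module_hom.closed[OF R[OF that(1)] that(2)])
  have "(\<lambda>x\<in>carrier X. \<lambda>l\<in>?N. S l x) \<in> lhom B X ?D"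
    by (rule lhomI) (auto simp: Scl left_module_hom.add[OF S] left_module_hom.smult[OF S] X.smult_closed intro!: restrict_ext)
  moreover have "(\<lambda>y\<in>carrier ?D. finsum X (\<lambda>l. R l (y l)) ?N) \<in> lhom B ?D X"
  proof (rule lhomI)
    fix y assume y: "y \<in> carrier ?D"
    then have yl: "y l \<in> carrier T" if "l < card A" for l using that by auto
    then have cl: "(\<lambda>l. R l (y l)) \<in> ?N \<rightarrow> carrier X" using Rcl by auto
    show "finsum X (\<lambda>l. R l (y l)) ?N \<in> carrier X" by (rule X.M.finsum_closed[OF cl])
    show "y \<oplus>\<^bsub>?D\<^esub> z \<in> carrier ?D \<and> finsum X (\<lambda>l. R l ((y \<oplus>\<^bsub>?D\<^esub> z) l)) ?N =
        finsum X (\<lambda>l. R l (y l)) ?N \<oplus>\<^bsub>X\<^esub> finsum X (\<lambda>l. R l (z l)) ?N" if z: "z \<in> carrier ?D" for z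
    proof
      show "y \<oplus>\<^bsub>?D\<^esub> z \<in> carrier ?D" using y z by (rule D.M.a_closed)
      have zl: "z l \<in> carrier T" if "l < card A" for l using that z by auto
      then have cl': "(\<lambda>l. R l (z l)) \<in> ?N \<rightarrow> carrier X" using Rcl by auto
      have "finsum X (\<lambda>l. R l ((y \<oplus>\<^bsub>?D\<^esub> z) l)) ?N = finsum X (\<lambda>l. R l (y l) \<oplus>\<^bsub>X\<^esub> R l (z l)) ?N"
        by (rule X.M.finsum_cong') (use yl zl Rcl in \<open>auto simp: left_module_hom.add[OF R]\<close>)
      then show "finsum X (\<lambda>l. R l ((y \<oplus>\<^bsub>?D\<^esub> z) l)) ?N =
        finsum X (\<lambda>l. R l (y l)) ?N \<oplus>\<^bsub>X\<^esub> finsum X (\<lambda>l. R l (z l)) ?N"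
        using X.M.finsum_addf[OF cl cl'] by simp
    qed
    show "b \<odot>\<^bsub>?D\<^esub> y \<in> carrier ?D \<and> finsum X (\<lambda>l. R l ((b \<odot>\<^bsub>?D\<^esub> y) l)) ?N =
        b \<odot>\<^bsub>X\<^esub> finsum X (\<lambda>l. R l (y l)) ?N" if b: "b \<in> carrier B" for b
    proof
      show "b \<odot>\<^bsub>?D\<^esub> y \<in> carrier ?D" using b y by (rule D.smult_closed)
      have "finsum X (\<lambda>l. R l ((b \<odot>\<^bsub>?D\<^esub> y) l)) ?N = finsum X (\<lambda>l. b \<odot>\<^bsub>X\<^esub> R l (y l)) ?N"
        by (rule X.M.finsum_cong') (use b yl Rcl in \<open>auto simp: left_module_hom.smult[OF R] X.smult_closed\<close>)
      then show "finsum X (\<lambda>l. R l ((b \<odot>\<^bsub>?D\<^esub> y) l)) ?N = b \<odot>\<^bsub>X\<^esub> finsum X (\<lambda>l. R l (y l)) ?N"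
        using X.smult_finsum[OF _ b cl] by simp
    qed
  qed
  moreover have "(\<lambda>y\<in>carrier ?D. finsum X (\<lambda>l. R l (y l)) ?N) ((\<lambda>x\<in>carrier X. \<lambda>l\<in>?N. S l x) x) = x"
    if x: "x \<in> carrier X" for x
  proof -
    have "(\<lambda>l\<in>?N. S l x) \<in> carrier ?D" using Scl x by auto
    then have "(\<lambda>y\<in>carrier ?D. finsum X (\<lambda>l. R l (y l)) ?N) ((\<lambda>x\<in>carrier X. \<lambda>l\<in>?N. S l x) x) =
        finsum X (\<lambda>l. R l ((\<lambda>l\<in>?N. S l x) l)) ?N" using x by (simp del: dsum_simps)
    also have "\<dots> = finsum X (\<lambda>l. r (h l) (s (h l) x)) ?N"
      by (rule X.M.finsum_cong') (use RS x lhom_closed[OF r lhom_closed[OF s x]] hA in auto)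
    also have "\<dots> = finsum X (\<lambda>a. r a (s a x)) (h ` ?N)"
      by (rule X.M.finsum_reindex[symmetric])
        (use h lhom_closed[OF r lhom_closed[OF s x]] in \<open>auto simp: bij_betw_def\<close>)
    also have "h ` ?N = A" using h by (simp add: bij_betw_def)
    also have "finsum X (\<lambda>a. r a (s a x)) A = x" by (rule rs[OF x])
    finally show ?thesis .
  qed
  ultimately show ?thesis unfolding is_summand_def by blast
qed

context corner_order
begin

text \<open>Let s, r be the maps to and from F a. If s r is bijective, F a splits off X, which is
  excluded. Otherwise locality makes 1 - s r bijective, hence also 1 - r s on X. The latter is the
  sum of the remaining terms, so composing those with its inverse gives a factorisation without F
  a.\<close>

lemma sum_factors_remove:
  fixes F :: "'i \<Rightarrow> ('b, 'n) module"
  assumes X: "left_module B X" and F: "\<And>b. b \<in> insert a A \<Longrightarrow> left_module B (F b)" and A: "finite A" "a \<notin> A"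
    and XF: "sum_factors B X F (insert a A)"
    and ind: "indecomposable B (F a)" and T: "T \<in> CM B \<rho>" "is_summand B (F a) T"
    and not: "\<not> is_summand B (F a) X"
  shows "sum_factors B X F A"
proof -
  interpret X: left_module B X by fact
  obtain s r where sr: "\<forall>b\<in>insert a A. s b \<in> lhom B X (F b) \<and> r b \<in> lhom B (F b) X"
    and rsx: "\<forall>x\<in>carrier X. finsum X (\<lambda>b. r b (s b x)) (insert a A) = x"
    using XF unfolding sum_factors_def by (elim exE conjE)
  note s = bspec[OF sr, THEN conjunct1] and r = bspec[OF sr, THEN conjunct2] and rs = bspec[OF rsx]
  interpret W: left_module B "F a" using F by simp
  interpret s: left_module_hom B X "F a" "s a" by (intro left_module_homI X F s) simp_all
  interpret r: left_module_hom B "F a" X "r a" by (intro left_module_homI X F r) simp_all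
  let ?u = "compose (carrier (F a)) (s a) (r a)"
  have u: "?u \<in> lhom B (F a) (F a)" by (rule lhom_compose[OF r.hom s.hom W.left_module_axioms])
  define \<theta> where "\<theta> x = x \<ominus>\<^bsub>X\<^esub> r a (s a x)" for x
  from local_endomorphism[OF ind T u] show ?thesis
  proof
    assume bij: "bij_betw ?u (carrier (F a)) (carrier (F a))"
    obtain v where v: "v \<in> lhom B (F a) (F a)" "\<forall>y\<in>carrier (F a). ?u (v y) = y"
      using lhom_inverse[OF W.left_module_axioms W.left_module_axioms u bij] by blast
    have "compose (carrier (F a)) (r a) v \<in> lhom B (F a) X"
      by (rule lhom_compose[OF v(1) r.hom W.left_module_axioms])
    moreover have "s a (compose (carrier (F a)) (r a) v x) = x" if "x \<in> carrier (F a)" for x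
      using bspec[OF v(2) that] lhom_closed[OF v(1) that] that by (simp add: compose_eq)
    ultimately have "is_summand B (F a) X" unfolding is_summand_def using s.hom by blast
    with not show ?thesis by simp
  next
    assume bij: "bij_betw (\<lambda>w. w \<ominus>\<^bsub>F a\<^esub> ?u w) (carrier (F a)) (carrier (F a))"
    have cl: "r b (s b x) \<in> carrier X" if "b \<in> insert a A" "x \<in> carrier X" for b x
      using that lhom_closed[OF r lhom_closed[OF s]] by blast
    have theta: "\<theta> x = finsum X (\<lambda>b. r b (s b x)) A" if x: "x \<in> carrier X" for x
    proof -
      have "x = r a (s a x) \<oplus>\<^bsub>X\<^esub> finsum X (\<lambda>b. r b (s b x)) A"
        using rs[OF x] A cl[OF _ x] by (simp add: Pi_iff)
      then have "\<theta> x = (r a (s a x) \<oplus>\<^bsub>X\<^esub> finsum X (\<lambda>b. r b (s b x)) A) \<ominus>\<^bsub>X\<^esub> r a (s a x)"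
        unfolding \<theta>_def by simp
      moreover have "finsum X (\<lambda>b. r b (s b x)) A \<in> carrier X" using cl x by (intro X.M.finsum_closed) auto
      ultimately show ?thesis using cl[of a x] x
        by (simp add: a_minus_def X.M.a_ac X.M.r_neg2 X.M.r_neg1)
    qed
    have thcl: "\<theta> x \<in> carrier X" if "x \<in> carrier X" for x unfolding \<theta>_def using that cl by simp
    have th: "restrict \<theta> (carrier X) \<in> lhom B X X"
    proof (rule lhomI)
      fix x assume x: "x \<in> carrier X"
      show "x \<oplus>\<^bsub>X\<^esub> y \<in> carrier X \<and> \<theta> (x \<oplus>\<^bsub>X\<^esub> y) = \<theta> x \<oplus>\<^bsub>X\<^esub> \<theta> y" if "y \<in> carrier X" for y
        using x that cl[of a] unfolding \<theta>_def
        by (simp add: s.add r.add s.closed r.closed a_minus_def X.M.minus_add X.M.a_ac)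
      show "b \<odot>\<^bsub>X\<^esub> x \<in> carrier X \<and> \<theta> (b \<odot>\<^bsub>X\<^esub> x) = b \<odot>\<^bsub>X\<^esub> \<theta> x" if "b \<in> carrier B" for b
        using x that cl[of a] unfolding \<theta>_def
        by (simp add: s.smult r.smult s.closed r.closed a_minus_def X.smult_closed X.smult_r_distr X.smult_minus)
    qed (rule thcl)
    have "bij_betw \<theta> (carrier X) (carrier X)"
      unfolding bij_betw_def
    proof
      interpret th: left_module_hom B X X "restrict \<theta> (carrier X)" by (rule left_module_homI[OF X X th])
      show "inj_on \<theta> (carrier X)"
      proof (rule inj_onI)
        fix x y assume xy: "x \<in> carrier X" "y \<in> carrier X" "\<theta> x = \<theta> y"
        define z where "z = x \<ominus>\<^bsub>X\<^esub> y"
        have z: "z \<in> carrier X" using xy by (simp add: z_def)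
        have "\<theta> z = \<zero>\<^bsub>X\<^esub>" using th.minus[of x y] xy z thcl by (simp add: z_def X.M.minus_eq_zero_iff)
        then have zr: "z = r a (s a z)" unfolding \<theta>_def using z cl X.M.minus_eq_zero_iff by simp
        then have "s a z = s a (r a (s a z))" by simp
        then have "s a z \<ominus>\<^bsub>F a\<^esub> ?u (s a z) = \<zero>\<^bsub>F a\<^esub> \<ominus>\<^bsub>F a\<^esub> ?u \<zero>\<^bsub>F a\<^esub>"
          using z s.closed W.M.minus_eq_zero_iff by (simp add: compose_eq r.zero s.zero a_minus_def W.M.r_neg)
        then have "s a z = \<zero>\<^bsub>F a\<^esub>" using bij z s.closed by (auto simp: bij_betw_def dest: inj_onD)
        then have "z = \<zero>\<^bsub>X\<^esub>" using zr by (simp add: r.zero)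
        then show "x = y" using xy X.M.minus_eq_zero_iff by (simp add: z_def)
      qed
      show "\<theta> ` carrier X = carrier X"
      proof (intro equalityI subsetI)
        fix x assume x: "x \<in> carrier X"
        have "s a x \<in> (\<lambda>w. w \<ominus>\<^bsub>F a\<^esub> ?u w) ` carrier (F a)" using bij x s.closed by (simp add: bij_betw_def)
        then obtain w where w: "w \<in> carrier (F a)" "s a x = w \<ominus>\<^bsub>F a\<^esub> s a (r a w)" by (auto simp: compose_eq)
        \<comment> \<open>The preimage of x under 1 - r s is x + r w with w = (1 - s r)^(-1) s x,
          the standard formula relating the two inverses.\<close>
        have "s a (x \<oplus>\<^bsub>X\<^esub> r a w) = w"
          using w x s.closed r.closed by (simp add: s.add a_minus_def W.M.a_assoc W.M.l_neg)
        then have "\<theta> (x \<oplus>\<^bsub>X\<^esub> r a w) = x"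
          unfolding \<theta>_def using w x r.closed by (simp add: a_minus_def X.M.a_assoc X.M.r_neg)
        then show "x \<in> \<theta> ` carrier X" using x w r.closed by (metis X.M.a_closed imageI)
      qed (use thcl in auto)
    qed
    then have "bij_betw (restrict \<theta> (carrier X)) (carrier X) (carrier X)"
      by (subst bij_betw_cong[of _ _ \<theta>]) auto
    then obtain v where v: "v \<in> lhom B X X" "\<And>x. x \<in> carrier X \<Longrightarrow> v (restrict \<theta> (carrier X) x) = x"
      using lhom_inverse[OF X X th] by blast
    interpret v: left_module_hom B X X v by (rule left_module_homI[OF X X v(1)])
    show ?thesis
    proof (rule sum_factorsI)
      fix b assume b: "b \<in> A"
      show "s b \<in> lhom B X (F b)" using s b by simp
      show "compose (carrier (F b)) v (r b) \<in> lhom B (F b) X" using lhom_compose[OF r v(1) F] b by simp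
    next
      fix x assume x: "x \<in> carrier X"
      have cl': "(\<lambda>b. r b (s b x)) \<in> A \<rightarrow> carrier X" using cl x by auto
      have "finsum X (\<lambda>b. compose (carrier (F b)) v (r b) (s b x)) A = finsum X (\<lambda>b. v (r b (s b x))) A"
        by (rule X.M.finsum_cong') (use lhom_closed[OF s x] v.closed cl' in \<open>auto simp: compose_eq\<close>)
      also have "\<dots> = v (finsum X (\<lambda>b. r b (s b x)) A)" by (rule v.finsum[OF A(1) cl', symmetric])
      also have "\<dots> = x" using v(2)[OF x] theta[OF x] x by simp
      finally show "finsum X (\<lambda>b. compose (carrier (F b)) v (r b) (s b x)) A = x" .
    qed
  qed
qed

text \<open>The identity of X factors through the summands \<open>Ts j\<close>, one for each copy of
  T, each j and each multiplicity. All factors with j = i are removed one by one; the rest are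
  summands of T'.\<close>

lemma addcat_remove:
  fixes T T' X :: "('b, univ) module"
  assumes X: "X \<in> addcat B T" and T: "T \<in> CM B \<rho>" and dec: "decomposition B T Q0 m Ts"
    and not: "\<not> is_summand B (Ts i) X"
    and T': "left_module B T'" and rest: "\<And>j. j \<in> Q0 \<Longrightarrow> j \<noteq> i \<Longrightarrow> is_summand B (Ts j) T'"
  shows "X \<in> addcat B T'"
proof -
  have XM: "left_module B X" using X by (simp add: addcat_def)
  have TM: "left_module B T" using T by (simp add: CM_def)
  obtain p where p: "is_summand B X (power_module T p)" using X by (auto simp: addcat_def)
  note D = decomposition_summand[OF B.ring_axioms TM dec]
  have fin: "finite Q0" using dec by (simp add: decomposition_def)
  have 1: "sum_factors B X (\<lambda>_. T) {..<p}" by (rule summand_sum_factors[OF XM TM _ p]) simp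
  let ?K = "SIGMA j:Q0. {..<m j}"
  have 2: "sum_factors B T (Ts \<circ> fst) ?K"
  proof (rule summand_sum_factors[OF TM])
    have "left_module B (multiples Q0 m Ts)"
      unfolding multiples_def using B.ring_axioms D(2) by (intro dsum_left_module) auto
    moreover have "lm_iso B T (multiples Q0 m Ts)" using dec by (simp add: decomposition_def)
    ultimately show "is_summand B T (dsum ?K (Ts \<circ> fst))"
      using lm_iso_summand(1)[OF TM] unfolding multiples_def by blast
  qed (use fin D(2) in auto)
  let ?F = "\<lambda>(a :: nat, b). (Ts \<circ> fst) b" and ?A = "{..<p} \<times> ?K"
  have FM: "left_module B (?F a)" if "a \<in> ?A" for a using that D(2) by auto
  have all: "sum_factors B X ?F ?A"
    by (rule sum_factors_refine[OF XM _ _ _ _ 1 2]) (use TM D(2) fin in auto)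
  \<comment> \<open>Generalised over the retained set A, so that the induction can delete the
    elements of E while A stays fixed.\<close>
  have remove: "sum_factors B X ?F A" if "finite E" "A \<subseteq> ?A" "E \<subseteq> {a \<in> ?A. fst (snd a) = i}" "A \<inter> E = {}"
    "sum_factors B X ?F (A \<union> E)" for A E
    using that
  proof (induction E rule: finite_induct)
    case (insert a E)
    have a: "a \<in> ?A" "fst (snd a) = i" using insert by auto
    then have i: "i \<in> Q0" and Fa: "?F a = Ts i" by auto
    have finA: "finite (A \<union> E)" using insert.prems(1,2) insert.hyps fin by (auto intro!: finite_subset[OF insert.prems(1)])
    have "sum_factors B X ?F (A \<union> E)"
    proof (rule sum_factors_remove[where a = a and T = T])
      show "sum_factors B X ?F (insert a (A \<union> E))" using insert by simp
      show "left_module B (?F b)" if "b \<in> insert a (A \<union> E)" for b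
        using that insert.prems(1,2) a FM by blast
      show "indecomposable B (?F a)" using dec i unfolding Fa by (simp add: decomposition_def)
      show "is_summand B (?F a) T" unfolding Fa by (rule D(1)[OF i])
      show "\<not> is_summand B (?F a) X" unfolding Fa by (rule not)
    qed (use XM finA T insert in auto)
    then show ?case using insert by auto
  qed simp
  have split: "{a \<in> ?A. fst (snd a) \<noteq> i} \<union> {a \<in> ?A. fst (snd a) = i} = ?A" by auto
  have fac: "sum_factors B X ?F {a \<in> ?A. fst (snd a) \<noteq> i}"
  proof (rule remove)
    show "finite {a \<in> ?A. fst (snd a) = i}" using fin by (intro finite_Collect_conjI disjI1) auto
    show "sum_factors B X ?F ({a \<in> ?A. fst (snd a) \<noteq> i} \<union> {a \<in> ?A. fst (snd a) = i})"
      unfolding split by (rule all)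
  qed auto
  have "is_summand B X (power_module T' (card {a \<in> ?A. fst (snd a) \<noteq> i}))"
  proof (rule sum_factors_summand[OF XM T' _ _ fac])
    show "is_summand B (?F a) T'" if "a \<in> {a \<in> ?A. fst (snd a) \<noteq> i}" for a using that rest by auto
  qed (use FM fin in auto)
  then show ?thesis using XM by (auto simp: addcat_def)
qed

end

section \<open>The invariant \<open>\<kappa>\<close> as a codimension\<close>

definition cscale :: "complex \<Rightarrow> ('n \<Rightarrow> univ) \<Rightarrow> 'n \<Rightarrow> univ" where
  "cscale c \<psi> = (\<lambda>x. scal (fps_const c) (\<psi> x))"

lemma cscale_apply: "cscale c \<psi> x l = fps_const c * \<psi> x l"
  by (simp add: cscale_def scal_def)

interpretation cscale: vector_space cscale
  by unfold_locales (auto simp: cscale_apply fun_eq_iff algebra_simps simp flip: fps_const_add fps_const_mult)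

text \<open>Finitely many linear functionals whose common kernel in L lies in H bound L/H. For each
  functional that is nonzero on L one vector is added and L is replaced by the kernel of the
  functional.\<close>

lemma (in vector_space) spans_mod_coordinates:
  fixes \<nu> :: "'b \<Rightarrow> 'k \<Rightarrow> 'a"
  assumes "finite K" "subspace L"
    and add: "\<And>v w k. \<nu> (v + w) k = \<nu> v k + \<nu> w k" and scl: "\<And>c v k. \<nu> (scale c v) k = c * \<nu> v k"
    and H: "\<And>v. v \<in> L \<Longrightarrow> (\<And>k. k \<in> K \<Longrightarrow> \<nu> v k = 0) \<Longrightarrow> v \<in> H"
  shows "\<exists>d b. spans_mod scale L H d b"
  using assms(1,2) H
proof (induction K arbitrary: L rule: finite_induct)
  case empty
  then have "spans_mod scale L H 0 (\<lambda>_. 0)" by (auto simp: spans_mod_def)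
  then show ?case by blast
next
  case (insert k K)
  show ?case
  proof (cases "\<forall>v\<in>L. \<nu> v k = 0")
    case True
    show ?thesis
    proof (rule insert.IH[OF insert.prems(1)])
      fix v assume v: "v \<in> L" and "\<And>k. k \<in> K \<Longrightarrow> \<nu> v k = 0"
      then show "v \<in> H" using True by (intro insert.prems(2)[OF v]) auto
    qed
  next
    case False
    then obtain v0 where v0: "v0 \<in> L" "\<nu> v0 k \<noteq> 0" by blast
    define L' where "L' = {v \<in> L. \<nu> v k = 0}"
    have "\<nu> 0 k = 0" using scl[of 0 0 k] by simp
    then have "subspace L'"
      using insert.prems(1) unfolding L'_def subspace_def by (auto simp: add scl)
    then have "\<exists>d b. spans_mod scale L' H d b"
    proof (rule insert.IH)
      fix v assume v: "v \<in> L'" and z: "\<And>k. k \<in> K \<Longrightarrow> \<nu> v k = 0"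
      show "v \<in> H" by (rule insert.prems(2)) (use v z in \<open>auto simp: L'_def\<close>)
    qed
    then obtain d b where b: "spans_mod scale L' H d b" by blast
    have "spans_mod scale L H (Suc d) (b(d := v0))"
      unfolding spans_mod_def
    proof (intro conjI allI impI ballI)
      fix l assume "l < Suc d"
      then show "(b(d := v0)) l \<in> L" using b v0 by (auto simp: spans_mod_def L'_def less_Suc_eq)
    next
      fix v assume v: "v \<in> L"
      define c where "c = \<nu> v k / \<nu> v0 k"
      have "v + scale (- c) v0 \<in> L" by (intro subspace_add subspace_scale insert.prems(1) v v0(1))
      moreover have "\<nu> (v + scale (- c) v0) k = 0" using v0 unfolding add scl by (simp add: c_def)
      ultimately have "v + scale (- c) v0 \<in> L'" by (simp add: L'_def)
      then obtain a where a: "v + scale (- c) v0 - (\<Sum>l<d. scale (a l) (b l)) \<in> H"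
        using b by (auto simp: spans_mod_def)
      have "(\<Sum>l<Suc d. scale ((a(d := c)) l) ((b(d := v0)) l)) = (\<Sum>l<d. scale (a l) (b l)) + scale c v0"
        by simp
      then have "v - (\<Sum>l<Suc d. scale ((a(d := c)) l) ((b(d := v0)) l)) \<in> H"
        using a by (simp add: algebra_simps)
      then show "\<exists>c. v - (\<Sum>l<Suc d. scale (c l) ((b(d := v0)) l)) \<in> H" by blast
    qed
    then show ?thesis by blast
  qed
qed

definition corner_part :: "'b \<Rightarrow> ('b, 'm) module \<Rightarrow> 'm set" where
  "corner_part e N = {x \<in> carrier N. e \<odot>\<^bsub>N\<^esub> x = x}"

lemma (in corner_order) smult_rho_commute:
  assumes "left_module B N" "b \<in> carrier B" "x \<in> carrier N"
  shows "b \<odot>\<^bsub>N\<^esub> (\<rho> a \<odot>\<^bsub>N\<^esub> x) = \<rho> a \<odot>\<^bsub>N\<^esub> (b \<odot>\<^bsub>N\<^esub> x)"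
proof -
  interpret N: left_module B N by fact
  have "b \<odot>\<^bsub>N\<^esub> (\<rho> a \<odot>\<^bsub>N\<^esub> x) = (\<rho> a \<otimes> b) \<odot>\<^bsub>N\<^esub> x"
    using assms(2,3) by (simp add: N.smult_assoc[symmetric] rho_closed rho_central)
  then show ?thesis using assms(2,3) by (simp add: N.smult_assoc rho_closed)
qed

locale corner_module = corner_order B \<rho> e n ex ey + M: module_coordinates B \<rho> M d \<xi>
  for B :: "'b ring" (structure) and \<rho> :: "complex fps \<Rightarrow> 'b" and e n ex ey
    and M :: "('b, 'm) module" and d \<xi>
begin

definition \<eta> :: "univ \<Rightarrow> 'm" where "\<eta> = inv_into (carrier M) \<xi>"

lemma xi_eta: "v \<in> vecs d \<Longrightarrow> \<xi> (\<eta> v) = v"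
  unfolding \<eta>_def by (rule bij_betw_inv_into_right[OF M.bij])

lemma eta_xi: "x \<in> carrier M \<Longrightarrow> \<eta> (\<xi> x) = x"
  unfolding \<eta>_def by (rule bij_betw_inv_into_left[OF M.bij])

lemma eta_closed: "v \<in> vecs d \<Longrightarrow> \<eta> v \<in> carrier M"
  unfolding \<eta>_def using bij_betwE[OF bij_betw_inv_into[OF M.bij]] by blast

lemma xi_closed: "x \<in> carrier M \<Longrightarrow> \<xi> x \<in> vecs d"
  using bij_betwE[OF M.bij] by blast

lemma xi_inj: "x \<in> carrier M \<Longrightarrow> y \<in> carrier M \<Longrightarrow> \<xi> x = \<xi> y \<Longrightarrow> x = y"
  using eta_xi by metis

lemma xi_zero: "\<xi> \<zero>\<^bsub>M\<^esub> = 0"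
  using M.scal[OF M.M.zero_closed, of 0] by (simp add: rho_zero M.zero_smult)

lemma xi_finsum: "finite A \<Longrightarrow> v \<in> A \<rightarrow> carrier M \<Longrightarrow> \<xi> (finsum M v A) = (\<Sum>i\<in>A. \<xi> (v i))"
proof (induction A rule: finite_induct)
  case (insert a A)
  then have "\<xi> (finsum M v (insert a A)) = \<xi> (v a) + (\<Sum>i\<in>A. \<xi> (v i))"
    by (simp add: Pi_iff M.add)
  also have "\<dots> = (\<Sum>i\<in>insert a A. \<xi> (v i))" by (rule sum.insert[OF insert.hyps, symmetric])
  finally show ?case .
qed (simp add: xi_zero)

lemma torsion_free:
  assumes "x \<in> carrier M" "y \<in> carrier M" "\<rho> (fps_X ^ N) \<odot>\<^bsub>M\<^esub> x = \<rho> (fps_X ^ N) \<odot>\<^bsub>M\<^esub> y"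
  shows "x = y"
proof (rule xi_inj[OF assms(1,2)])
  have "scal (fps_X ^ N) (\<xi> x) = scal (fps_X ^ N) (\<xi> y)"
    using assms M.scal by metis
  then show "\<xi> x = \<xi> y" by (auto simp: scal_def fun_eq_iff)
qed

lemma expand: "x \<in> carrier M \<Longrightarrow> finsum M (\<lambda>l. \<rho> (\<xi> x l) \<odot>\<^bsub>M\<^esub> \<eta> (unit_vec l)) {..<d} = x"
proof -
  assume x: "x \<in> carrier M"
  have u: "unit_vec l \<in> vecs d" if "l < d" for l using that by (auto simp: unit_vec_def vecs_def)
  have cl: "(\<lambda>l. \<rho> (\<xi> x l) \<odot>\<^bsub>M\<^esub> \<eta> (unit_vec l)) \<in> {..<d} \<rightarrow> carrier M"
    using u by (auto intro!: M.smult_closed rho_closed eta_closed)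
  have "\<xi> (finsum M (\<lambda>l. \<rho> (\<xi> x l) \<odot>\<^bsub>M\<^esub> \<eta> (unit_vec l)) {..<d}) =
      (\<Sum>l<d. \<xi> (\<rho> (\<xi> x l) \<odot>\<^bsub>M\<^esub> \<eta> (unit_vec l)))" by (rule xi_finsum[OF _ cl]) simp
  also have "\<dots> = (\<Sum>l<d. scal (\<xi> x l) (unit_vec l))"
    using u by (intro sum.cong) (auto simp: M.scal eta_closed xi_eta)
  also have "\<dots> = \<xi> x" by (rule vecs_expand[OF xi_closed[OF x], symmetric])
  finally show ?thesis using xi_inj[OF M.M.finsum_closed[OF cl] x] by simp
qed

definition corner_lin :: "('b, 'n) module \<Rightarrow> ('n \<Rightarrow> 'm) \<Rightarrow> bool" where
  "corner_lin N \<mu> \<longleftrightarrow> (\<forall>x\<in>corner_part e N. \<mu> x \<in> corner_part e M) \<and>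
     (\<forall>x\<in>corner_part e N. \<forall>y\<in>corner_part e N. \<mu> (x \<oplus>\<^bsub>N\<^esub> y) = \<mu> x \<oplus>\<^bsub>M\<^esub> \<mu> y) \<and>
     (\<forall>a. \<forall>x\<in>corner_part e N. \<mu> (\<rho> a \<odot>\<^bsub>N\<^esub> x) = \<rho> a \<odot>\<^bsub>M\<^esub> \<mu> x)"

text \<open>An R-linear map from eN to eM, written in coordinates of M and extended by zero. Outside
  eN a \<open>corner_lin\<close> function is arbitrary; the normal form makes equality of functions
  mean equality of maps and lets pointwise operations serve as the vector space structure.\<close>

definition ext :: "('b, 'n) module \<Rightarrow> ('n \<Rightarrow> 'm) \<Rightarrow> 'n \<Rightarrow> univ" where
  "ext N \<mu> = (\<lambda>x. if x \<in> corner_part e N then \<xi> (\<mu> x) else 0)"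

definition L :: "('b, 'n) module \<Rightarrow> ('n \<Rightarrow> univ) set" where "L N = ext N ` {\<mu>. corner_lin N \<mu>}"

text \<open>B-linear maps, recorded by their restriction to eN; \<open>faithful\<close> shows that
  this loses nothing. Thus H sits inside L as Hom over B sits inside the R-linear maps of
  corners.\<close>

definition H :: "('b, 'n) module \<Rightarrow> ('n \<Rightarrow> univ) set" where "H N = ext N ` lhom B N M"

lemma corner_linD:
  assumes "corner_lin N \<mu>" "x \<in> corner_part e N"
  shows "\<mu> x \<in> carrier M" "e \<odot>\<^bsub>M\<^esub> \<mu> x = \<mu> x" "y \<in> corner_part e N \<Longrightarrow> \<mu> (x \<oplus>\<^bsub>N\<^esub> y) = \<mu> x \<oplus>\<^bsub>M\<^esub> \<mu> y"
    "\<mu> (\<rho> a \<odot>\<^bsub>N\<^esub> x) = \<rho> a \<odot>\<^bsub>M\<^esub> \<mu> x"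
  using assms by (auto simp: corner_lin_def corner_part_def[of e M])

lemma corner_partD: "x \<in> corner_part e N \<Longrightarrow> x \<in> carrier N" "x \<in> corner_part e N \<Longrightarrow> e \<odot>\<^bsub>N\<^esub> x = x"
  by (auto simp: corner_part_def)

lemma corner_part_closed:
  assumes "left_module B N"
  shows "\<zero>\<^bsub>N\<^esub> \<in> corner_part e N"
    "x \<in> corner_part e N \<Longrightarrow> y \<in> corner_part e N \<Longrightarrow> x \<oplus>\<^bsub>N\<^esub> y \<in> corner_part e N"
    "x \<in> corner_part e N \<Longrightarrow> \<rho> a \<odot>\<^bsub>N\<^esub> x \<in> corner_part e N"
    "b \<in> carrier B \<Longrightarrow> e \<otimes> b = b \<Longrightarrow> x \<in> carrier N \<Longrightarrow> b \<odot>\<^bsub>N\<^esub> x \<in> corner_part e N"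
    "x \<in> carrier N \<Longrightarrow> e \<odot>\<^bsub>N\<^esub> x \<in> corner_part e N"
proof -
  interpret N: left_module B N by fact
  show "\<zero>\<^bsub>N\<^esub> \<in> corner_part e N" by (simp add: corner_part_def N.smult_zero e_closed)
  show "x \<in> corner_part e N \<Longrightarrow> y \<in> corner_part e N \<Longrightarrow> x \<oplus>\<^bsub>N\<^esub> y \<in> corner_part e N"
    by (simp add: corner_part_def N.smult_r_distr e_closed)
  show "x \<in> corner_part e N \<Longrightarrow> \<rho> a \<odot>\<^bsub>N\<^esub> x \<in> corner_part e N"
  proof -
    assume x: "x \<in> corner_part e N"
    have "e \<odot>\<^bsub>N\<^esub> (\<rho> a \<odot>\<^bsub>N\<^esub> x) = \<rho> a \<odot>\<^bsub>N\<^esub> (e \<odot>\<^bsub>N\<^esub> x)"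
      using x by (intro smult_rho_commute[OF assms e_closed]) (simp add: corner_part_def)
    then show ?thesis using x by (simp add: corner_part_def N.smult_closed rho_closed)
  qed
  show *: "b \<in> carrier B \<Longrightarrow> e \<otimes> b = b \<Longrightarrow> x \<in> carrier N \<Longrightarrow> b \<odot>\<^bsub>N\<^esub> x \<in> corner_part e N" for b
    by (simp add: corner_part_def N.smult_closed e_closed flip: N.smult_assoc)
  show "x \<in> carrier N \<Longrightarrow> e \<odot>\<^bsub>N\<^esub> x \<in> corner_part e N" by (rule *[OF e_closed e_idem])
qed

lemma lhom_corner_lin:
  assumes "h \<in> lhom B N M"
  shows "corner_lin N h"
proof -
  have "h x \<in> corner_part e M" if "x \<in> corner_part e N" for x
    using that lhom_closed[OF assms, of x] lhom_smult[OF assms e_closed, of x] by (simp add: corner_part_def)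
  then show ?thesis
    using assms unfolding corner_lin_def by (auto simp: lhom_add lhom_smult rho_closed corner_part_def)
qed

lemma corner_lin_zero: "left_module B N \<Longrightarrow> corner_lin N \<mu> \<Longrightarrow> \<mu> \<zero>\<^bsub>N\<^esub> = \<zero>\<^bsub>M\<^esub>"
proof -
  assume N: "left_module B N" and \<mu>: "corner_lin N \<mu>"
  interpret N: left_module B N by fact
  have z: "\<zero>\<^bsub>N\<^esub> \<in> corner_part e N" by (rule corner_part_closed[OF N])
  show ?thesis using corner_linD(1)[OF \<mu> z] corner_linD(4)[OF \<mu> z, of 0]
    by (simp add: rho_zero N.zero_smult M.zero_smult)
qed

lemma corner_lin_finsum:
  assumes N: "left_module B N" and \<mu>: "corner_lin N \<mu>"
  shows "finite A \<Longrightarrow> v \<in> A \<rightarrow> corner_part e N \<Longrightarrow>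
    \<mu> (finsum N v A) = finsum M (\<lambda>i. \<mu> (v i)) A \<and> finsum N v A \<in> corner_part e N"
proof (induction A rule: finite_induct)
  case empty
  interpret N: left_module B N by fact
  show ?case using corner_lin_zero[OF N \<mu>] corner_part_closed(1)[OF N] by simp
next
  case (insert a A)
  interpret N: left_module B N by fact
  have cl: "v a \<in> corner_part e N" "v \<in> A \<rightarrow> corner_part e N" using insert by auto
  have cN: "v \<in> A \<rightarrow> carrier N" "v a \<in> carrier N" using cl by (auto intro: corner_partD(1))
  have cM: "(\<lambda>i. \<mu> (v i)) \<in> A \<rightarrow> carrier M" using cl by (auto intro: corner_linD(1)[OF \<mu>])
  have IH: "\<mu> (finsum N v A) = finsum M (\<lambda>i. \<mu> (v i)) A" "finsum N v A \<in> corner_part e N"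
    using insert.IH cl by auto
  have "finsum N v (insert a A) = v a \<oplus>\<^bsub>N\<^esub> finsum N v A" using insert.hyps cN by simp
  moreover have "finsum M (\<lambda>i. \<mu> (v i)) (insert a A) = \<mu> (v a) \<oplus>\<^bsub>M\<^esub> finsum M (\<lambda>i. \<mu> (v i)) A"
    using insert.hyps cM corner_linD(1)[OF \<mu> cl(1)] by simp
  ultimately show ?case
    using corner_linD(3)[OF \<mu> cl(1) IH(2)] corner_part_closed(2)[OF N cl(1) IH(2)] IH(1) by simp
qed

text \<open>\<open>t^n h x\<close> is the sum of the \<open>ex l h(ey l x)\<close>, and every
  \<open>ey l x\<close> lies in eN. Torsion-freeness of M removes \<open>t^n\<close>.\<close>

lemma faithful:
  assumes N: "left_module B N" and h: "h \<in> lhom B N M" and zero: "\<And>x. x \<in> corner_part e N \<Longrightarrow> h x = \<zero>\<^bsub>M\<^esub>"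
    and x: "x \<in> carrier N"
  shows "h x = \<zero>\<^bsub>M\<^esub>"
proof -
  interpret N: left_module B N by fact
  interpret h: left_module_hom B N M h by (rule left_module_homI[OF N M.left_module_axioms h])
  have "\<rho> (fps_X ^ n) \<odot>\<^bsub>M\<^esub> h x = finsum B (\<lambda>l. ex l \<otimes> ey l) {..<n} \<odot>\<^bsub>M\<^esub> h x" by (simp add: full)
  also have "\<dots> = finsum M (\<lambda>l. (ex l \<otimes> ey l) \<odot>\<^bsub>M\<^esub> h x) {..<n}"
    by (rule M.finsum_smult) (use x h.closed ex_closed ey_closed in auto)
  also have "\<dots> = finsum M (\<lambda>l. \<zero>\<^bsub>M\<^esub>) {..<n}"
  proof (rule M.M.finsum_cong')
    fix l
    have "(ex l \<otimes> ey l) \<odot>\<^bsub>M\<^esub> h x = ex l \<odot>\<^bsub>M\<^esub> h (ey l \<odot>\<^bsub>N\<^esub> x)"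
      using x h.closed ex_closed ey_closed by (simp add: M.smult_assoc h.smult)
    also have "\<dots> = \<zero>\<^bsub>M\<^esub>"
      using zero[OF corner_part_closed(4)[OF N ey_closed e_ey x]] by (simp add: M.smult_zero ex_closed)
    finally show "(ex l \<otimes> ey l) \<odot>\<^bsub>M\<^esub> h x = \<zero>\<^bsub>M\<^esub>" .
  qed auto
  also have "\<dots> = \<rho> (fps_X ^ n) \<odot>\<^bsub>M\<^esub> \<zero>\<^bsub>M\<^esub>" by (simp add: M.smult_zero rho_closed)
  finally show ?thesis using torsion_free h.closed[OF x] by blast
qed

text \<open>R-linearity implies linearity over \<open>e B e\<close>: some power of t carries z to a
  scalar times e, and that power cancels in M.\<close>

lemma corner_lin_corner:
  assumes N: "left_module B N" and \<mu>: "corner_lin N \<mu>" and z: "z \<in> carrier B" "e \<otimes> z = z" "z \<otimes> e = z"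
    and y: "y \<in> corner_part e N"
  shows "\<mu> (z \<odot>\<^bsub>N\<^esub> y) = z \<odot>\<^bsub>M\<^esub> \<mu> y"
proof -
  interpret N: left_module B N by fact
  have zy: "z \<odot>\<^bsub>N\<^esub> y \<in> corner_part e N" by (rule corner_part_closed(4)[OF N z(1,2) corner_partD(1)[OF y]])
  note cl = corner_linD(1)[OF \<mu>] corner_partD(1)[OF y] rho_closed z(1) e_closed
  obtain K r where "\<rho> (fps_X ^ K) \<otimes> (e \<otimes> z \<otimes> e) = \<rho> r \<otimes> e" using corner[OF z(1)] by blast
  then have K: "\<rho> (fps_X ^ K) \<otimes> z = \<rho> r \<otimes> e" using z by simp
  have "\<rho> (fps_X ^ K) \<odot>\<^bsub>M\<^esub> \<mu> (z \<odot>\<^bsub>N\<^esub> y) = \<mu> (\<rho> (fps_X ^ K) \<odot>\<^bsub>N\<^esub> (z \<odot>\<^bsub>N\<^esub> y))"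
    by (rule corner_linD(4)[OF \<mu> zy, symmetric])
  also have "\<rho> (fps_X ^ K) \<odot>\<^bsub>N\<^esub> (z \<odot>\<^bsub>N\<^esub> y) = \<rho> r \<odot>\<^bsub>N\<^esub> (e \<odot>\<^bsub>N\<^esub> y)"
    using cl K by (simp flip: N.smult_assoc)
  also have "\<mu> \<dots> = \<rho> r \<odot>\<^bsub>M\<^esub> (e \<odot>\<^bsub>M\<^esub> \<mu> y)"
    using corner_linD(2,4)[OF \<mu> y] corner_partD(2)[OF y] by simp
  also have "\<dots> = \<rho> (fps_X ^ K) \<odot>\<^bsub>M\<^esub> (z \<odot>\<^bsub>M\<^esub> \<mu> y)"
    using cl(3-) cl(1)[OF y] K by (simp flip: M.smult_assoc)
  finally show ?thesis
    by (rule torsion_free[OF cl(1)[OF zy] M.smult_closed[OF z(1) cl(1)[OF y]]])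
qed

text \<open>The map x to the sum of \<open>ex l \<mu>(ey l x)\<close> is the candidate. Its
  B-linearity is tested after multiplication by \<open>t^n\<close>: inserting a second such sum
  around b produces elements of \<open>e B e\<close>, with which mu already commutes.\<close>

lemma corner_lin_extend:
  assumes N: "left_module B N" and \<mu>: "corner_lin N \<mu>"
  shows "\<exists>h\<in>lhom B N M. \<forall>x\<in>corner_part e N. h x = \<rho> (fps_X ^ n) \<odot>\<^bsub>M\<^esub> \<mu> x"
proof -
  interpret N: left_module B N by fact
  define \<Psi> where "\<Psi> x = finsum M (\<lambda>l. ex l \<odot>\<^bsub>M\<^esub> \<mu> (ey l \<odot>\<^bsub>N\<^esub> x)) {..<n}" for x
  have yx: "ey l \<odot>\<^bsub>N\<^esub> x \<in> corner_part e N" if "x \<in> carrier N" for l x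
    by (rule corner_part_closed(4)[OF N ey_closed e_ey that])
  have my: "\<mu> (ey l \<odot>\<^bsub>N\<^esub> x) \<in> carrier M" if "x \<in> carrier N" for l x
    by (rule corner_linD(1)[OF \<mu> yx[OF that]])
  have cl: "(\<lambda>l. ex l \<odot>\<^bsub>M\<^esub> \<mu> (ey l \<odot>\<^bsub>N\<^esub> x)) \<in> {..<n} \<rightarrow> carrier M" if "x \<in> carrier N" for x
    using my[OF that] by (auto intro!: M.smult_closed ex_closed)
  have Pcl: "\<Psi> x \<in> carrier M" if "x \<in> carrier N" for x
    unfolding \<Psi>_def by (rule M.M.finsum_closed[OF cl[OF that]])
  have sum: "finsum M (\<lambda>l. ex l \<odot>\<^bsub>M\<^esub> (ey l \<odot>\<^bsub>M\<^esub> m)) {..<n} = \<rho> (fps_X ^ n) \<odot>\<^bsub>M\<^esub> m" if m: "m \<in> carrier M" for m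
  proof -
    have "\<rho> (fps_X ^ n) \<odot>\<^bsub>M\<^esub> m = finsum M (\<lambda>l. (ex l \<otimes> ey l) \<odot>\<^bsub>M\<^esub> m) {..<n}"
      unfolding full[symmetric] by (rule M.finsum_smult) (use m ex_closed ey_closed in auto)
    also have "\<dots> = finsum M (\<lambda>l. ex l \<odot>\<^bsub>M\<^esub> (ey l \<odot>\<^bsub>M\<^esub> m)) {..<n}"
      by (rule M.M.finsum_cong') (use m ex_closed ey_closed in \<open>auto simp: M.smult_assoc intro!: M.smult_closed\<close>)
    finally show ?thesis by simp
  qed
  have sumN: "finsum N (\<lambda>l. ex l \<odot>\<^bsub>N\<^esub> (ey l \<odot>\<^bsub>N\<^esub> x)) {..<n} = \<rho> (fps_X ^ n) \<odot>\<^bsub>N\<^esub> x" if m: "x \<in> carrier N" for x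
  proof -
    have "\<rho> (fps_X ^ n) \<odot>\<^bsub>N\<^esub> x = finsum N (\<lambda>l. (ex l \<otimes> ey l) \<odot>\<^bsub>N\<^esub> x) {..<n}"
      unfolding full[symmetric] by (rule N.finsum_smult) (use m ex_closed ey_closed in auto)
    also have "\<dots> = finsum N (\<lambda>l. ex l \<odot>\<^bsub>N\<^esub> (ey l \<odot>\<^bsub>N\<^esub> x)) {..<n}"
      by (rule N.M.finsum_cong') (use m ex_closed ey_closed in \<open>auto simp: N.smult_assoc intro!: N.smult_closed\<close>)
    finally show ?thesis by simp
  qed
  have key: "\<rho> (fps_X ^ n) \<odot>\<^bsub>M\<^esub> \<mu> (ey l \<odot>\<^bsub>N\<^esub> (b \<odot>\<^bsub>N\<^esub> x)) = ey l \<odot>\<^bsub>M\<^esub> (b \<odot>\<^bsub>M\<^esub> \<Psi> x)"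
    if b: "b \<in> carrier B" and x: "x \<in> carrier N" for b x l
  proof -
    have bx: "b \<odot>\<^bsub>N\<^esub> x \<in> carrier N" using b x by (rule N.smult_closed)
    \<comment> \<open>Sandwiching b between \<open>ey l\<close> and \<open>ex j\<close> puts it into
      \<open>e B e\<close>, so mu can be moved past it.\<close>
    let ?z = "\<lambda>j. ey l \<otimes> b \<otimes> ex j"
    have z: "?z j \<in> carrier B" "e \<otimes> ?z j = ?z j" "?z j \<otimes> e = ?z j" for j
    proof -
      show "?z j \<in> carrier B" using b ey_closed ex_closed by simp
      have "e \<otimes> ?z j = (e \<otimes> ey l) \<otimes> b \<otimes> ex j" using b ey_closed[of l] ex_closed[of j] e_closed by (simp add: B.m_assoc)
      then show "e \<otimes> ?z j = ?z j" by (simp add: e_ey)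
      have "?z j \<otimes> e = ey l \<otimes> b \<otimes> (ex j \<otimes> e)" using b ey_closed[of l] ex_closed[of j] e_closed by (simp add: B.m_assoc)
      then show "?z j \<otimes> e = ?z j" by (simp add: ex_e)
    qed
    have zin: "(\<lambda>j. ?z j \<odot>\<^bsub>N\<^esub> (ey j \<odot>\<^bsub>N\<^esub> x)) \<in> {..<n} \<rightarrow> corner_part e N"
      using z corner_part_closed(4)[OF N z(1,2)] N.smult_closed[OF ey_closed x] by blast
    have "\<rho> (fps_X ^ n) \<odot>\<^bsub>N\<^esub> (ey l \<odot>\<^bsub>N\<^esub> (b \<odot>\<^bsub>N\<^esub> x)) = (ey l \<otimes> b) \<odot>\<^bsub>N\<^esub> (\<rho> (fps_X ^ n) \<odot>\<^bsub>N\<^esub> x)"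
    proof -
      have "\<rho> (fps_X ^ n) \<otimes> (ey l \<otimes> b) = (ey l \<otimes> b) \<otimes> \<rho> (fps_X ^ n)"
        by (rule rho_central) (simp add: b ey_closed)
      then show ?thesis using b x ey_closed[of l] rho_closed
        by (metis B.m_closed N.smult_assoc N.smult_closed)
    qed
    also have "\<dots> = (ey l \<otimes> b) \<odot>\<^bsub>N\<^esub> finsum N (\<lambda>j. ex j \<odot>\<^bsub>N\<^esub> (ey j \<odot>\<^bsub>N\<^esub> x)) {..<n}" by (simp only: sumN[OF x])
    also have "\<dots> = finsum N (\<lambda>j. (ey l \<otimes> b) \<odot>\<^bsub>N\<^esub> (ex j \<odot>\<^bsub>N\<^esub> (ey j \<odot>\<^bsub>N\<^esub> x))) {..<n}"
      by (rule N.smult_finsum) (use b x ex_closed ey_closed N.smult_closed in auto)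
    also have "\<dots> = finsum N (\<lambda>j. ?z j \<odot>\<^bsub>N\<^esub> (ey j \<odot>\<^bsub>N\<^esub> x)) {..<n}"
      by (rule N.M.finsum_cong') (use b x ex_closed ey_closed N.smult_closed z in \<open>auto simp: N.smult_assoc\<close>)
    finally have eq: "\<rho> (fps_X ^ n) \<odot>\<^bsub>N\<^esub> (ey l \<odot>\<^bsub>N\<^esub> (b \<odot>\<^bsub>N\<^esub> x)) = finsum N (\<lambda>j. ?z j \<odot>\<^bsub>N\<^esub> (ey j \<odot>\<^bsub>N\<^esub> x)) {..<n}" .
    have "\<rho> (fps_X ^ n) \<odot>\<^bsub>M\<^esub> \<mu> (ey l \<odot>\<^bsub>N\<^esub> (b \<odot>\<^bsub>N\<^esub> x)) = \<mu> (\<rho> (fps_X ^ n) \<odot>\<^bsub>N\<^esub> (ey l \<odot>\<^bsub>N\<^esub> (b \<odot>\<^bsub>N\<^esub> x)))"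
      by (rule corner_linD(4)[OF \<mu> yx[OF bx], symmetric])
    also have "\<dots> = finsum M (\<lambda>j. \<mu> (?z j \<odot>\<^bsub>N\<^esub> (ey j \<odot>\<^bsub>N\<^esub> x))) {..<n}"
      unfolding eq using corner_lin_finsum[OF N \<mu> _ zin] by simp
    also have "\<dots> = finsum M (\<lambda>j. (ey l \<otimes> b) \<odot>\<^bsub>M\<^esub> (ex j \<odot>\<^bsub>M\<^esub> \<mu> (ey j \<odot>\<^bsub>N\<^esub> x))) {..<n}"
    proof (rule M.M.finsum_cong')
      fix j
      show "\<mu> (?z j \<odot>\<^bsub>N\<^esub> (ey j \<odot>\<^bsub>N\<^esub> x)) = (ey l \<otimes> b) \<odot>\<^bsub>M\<^esub> (ex j \<odot>\<^bsub>M\<^esub> \<mu> (ey j \<odot>\<^bsub>N\<^esub> x))"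
        using corner_lin_corner[OF N \<mu> z yx[OF x]] b my[OF x] ex_closed ey_closed
        by (simp add: M.smult_assoc M.smult_closed)
    qed (use b my[OF x] ex_closed ey_closed M.smult_closed in auto)
    also have "\<dots> = (ey l \<otimes> b) \<odot>\<^bsub>M\<^esub> \<Psi> x"
      unfolding \<Psi>_def by (rule M.smult_finsum[symmetric]) (use b ey_closed cl[OF x] in auto)
    also have "\<dots> = ey l \<odot>\<^bsub>M\<^esub> (b \<odot>\<^bsub>M\<^esub> \<Psi> x)" using b ey_closed Pcl[OF x] by (simp add: M.smult_assoc)
    finally show ?thesis .
  qed
  have "restrict \<Psi> (carrier N) \<in> lhom B N M"
  proof (rule lhomI)
    fix x assume x: "x \<in> carrier N"
    show "x \<oplus>\<^bsub>N\<^esub> y \<in> carrier N \<and> \<Psi> (x \<oplus>\<^bsub>N\<^esub> y) = \<Psi> x \<oplus>\<^bsub>M\<^esub> \<Psi> y" if y: "y \<in> carrier N" for y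
    proof
      show "x \<oplus>\<^bsub>N\<^esub> y \<in> carrier N" using x y by simp
      have "\<Psi> (x \<oplus>\<^bsub>N\<^esub> y) = finsum M (\<lambda>l. ex l \<odot>\<^bsub>M\<^esub> \<mu> (ey l \<odot>\<^bsub>N\<^esub> x) \<oplus>\<^bsub>M\<^esub> ex l \<odot>\<^bsub>M\<^esub> \<mu> (ey l \<odot>\<^bsub>N\<^esub> y)) {..<n}"
        unfolding \<Psi>_def
        by (rule M.M.finsum_cong') (use x y my ex_closed M.smult_closed corner_linD(3)[OF \<mu> yx yx] ey_closed in
          \<open>auto simp: N.smult_r_distr M.smult_r_distr\<close>)
      then show "\<Psi> (x \<oplus>\<^bsub>N\<^esub> y) = \<Psi> x \<oplus>\<^bsub>M\<^esub> \<Psi> y"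
        unfolding \<Psi>_def using M.M.finsum_addf[OF cl[OF x] cl[OF y]] by simp
    qed
    show "b \<odot>\<^bsub>N\<^esub> x \<in> carrier N \<and> \<Psi> (b \<odot>\<^bsub>N\<^esub> x) = b \<odot>\<^bsub>M\<^esub> \<Psi> x" if b: "b \<in> carrier B" for b
    proof
      show bx: "b \<odot>\<^bsub>N\<^esub> x \<in> carrier N" using b x by (rule N.smult_closed)
      have bP: "b \<odot>\<^bsub>M\<^esub> \<Psi> x \<in> carrier M" using b Pcl[OF x] by (rule M.smult_closed)
      have "\<rho> (fps_X ^ n) \<odot>\<^bsub>M\<^esub> \<Psi> (b \<odot>\<^bsub>N\<^esub> x) = finsum M (\<lambda>l. \<rho> (fps_X ^ n) \<odot>\<^bsub>M\<^esub> (ex l \<odot>\<^bsub>M\<^esub> \<mu> (ey l \<odot>\<^bsub>N\<^esub> (b \<odot>\<^bsub>N\<^esub> x)))) {..<n}"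
        unfolding \<Psi>_def by (rule M.smult_finsum[OF _ rho_closed cl[OF bx]]) simp
      also have "\<dots> = finsum M (\<lambda>l. ex l \<odot>\<^bsub>M\<^esub> (ey l \<odot>\<^bsub>M\<^esub> (b \<odot>\<^bsub>M\<^esub> \<Psi> x))) {..<n}"
      proof (rule M.M.finsum_cong')
        fix l
        have "\<rho> (fps_X ^ n) \<odot>\<^bsub>M\<^esub> (ex l \<odot>\<^bsub>M\<^esub> \<mu> (ey l \<odot>\<^bsub>N\<^esub> (b \<odot>\<^bsub>N\<^esub> x))) =
            ex l \<odot>\<^bsub>M\<^esub> (\<rho> (fps_X ^ n) \<odot>\<^bsub>M\<^esub> \<mu> (ey l \<odot>\<^bsub>N\<^esub> (b \<odot>\<^bsub>N\<^esub> x)))"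
          using rho_central[OF ex_closed, of "fps_X ^ n" l] my[OF bx, of l] ex_closed[of l] rho_closed
          by (metis M.smult_assoc)
        then show "\<rho> (fps_X ^ n) \<odot>\<^bsub>M\<^esub> (ex l \<odot>\<^bsub>M\<^esub> \<mu> (ey l \<odot>\<^bsub>N\<^esub> (b \<odot>\<^bsub>N\<^esub> x))) =
            ex l \<odot>\<^bsub>M\<^esub> (ey l \<odot>\<^bsub>M\<^esub> (b \<odot>\<^bsub>M\<^esub> \<Psi> x))" unfolding key[OF b x] .
      qed (use bP ex_closed ey_closed M.smult_closed in auto)
      also have "\<dots> = \<rho> (fps_X ^ n) \<odot>\<^bsub>M\<^esub> (b \<odot>\<^bsub>M\<^esub> \<Psi> x)" by (rule sum[OF bP])
      finally show "\<Psi> (b \<odot>\<^bsub>N\<^esub> x) = b \<odot>\<^bsub>M\<^esub> \<Psi> x" by (rule torsion_free[OF Pcl[OF bx] bP])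
    qed
  qed (rule Pcl)
  moreover have "\<Psi> x = \<rho> (fps_X ^ n) \<odot>\<^bsub>M\<^esub> \<mu> x" if x: "x \<in> corner_part e N" for x
  proof -
    have xN: "x \<in> carrier N" and mx: "\<mu> x \<in> carrier M" using corner_partD(1)[OF x] corner_linD(1)[OF \<mu> x] .
    have "\<mu> (ey l \<odot>\<^bsub>N\<^esub> x) = ey l \<odot>\<^bsub>M\<^esub> \<mu> x" for l
    proof -
      have z: "ey l \<otimes> e \<in> carrier B" "e \<otimes> (ey l \<otimes> e) = ey l \<otimes> e" "(ey l \<otimes> e) \<otimes> e = ey l \<otimes> e"
        using ey_closed[of l] e_closed e_ey[of l] e_idem by (simp_all add: B.m_assoc flip: B.m_assoc[of e "ey l" e])
      have "ey l \<odot>\<^bsub>N\<^esub> x = (ey l \<otimes> e) \<odot>\<^bsub>N\<^esub> x" "(ey l \<otimes> e) \<odot>\<^bsub>M\<^esub> \<mu> x = ey l \<odot>\<^bsub>M\<^esub> \<mu> x"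
        using xN mx corner_partD(2)[OF x] corner_linD(2)[OF \<mu> x] ey_closed e_closed
        by (simp_all add: N.smult_assoc M.smult_assoc)
      then show ?thesis using corner_lin_corner[OF N \<mu> z x] by simp
    qed
    then show ?thesis unfolding \<Psi>_def using sum[OF mx] by simp
  qed
  moreover have "restrict \<Psi> (carrier N) x = \<Psi> x" if "x \<in> corner_part e N" for x
    using corner_partD(1)[OF that] by simp
  ultimately show ?thesis by (intro bexI[of _ "restrict \<Psi> (carrier N)"]) simp_all
qed

end

section \<open>Finiteness and exactness of the codimension\<close>

context corner_module
begin

lemma L_I: "corner_lin N \<mu> \<Longrightarrow> ext N \<mu> \<in> L N"
  by (auto simp: L_def)

lemma H_I: "h \<in> lhom B N M \<Longrightarrow> ext N h \<in> H N"
  by (auto simp: H_def)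

lemma H_subset_L: "H N \<subseteq> L N"
  using lhom_corner_lin by (auto simp: H_def L_def)

lemma ext_apply: "x \<in> corner_part e N \<Longrightarrow> ext N \<mu> x = \<xi> (\<mu> x)"
  by (simp add: ext_def)

lemma corner_linI:
  assumes "\<And>x. x \<in> corner_part e N \<Longrightarrow> \<mu> x \<in> corner_part e M"
    "\<And>x y. x \<in> corner_part e N \<Longrightarrow> y \<in> corner_part e N \<Longrightarrow> \<mu> (x \<oplus>\<^bsub>N\<^esub> y) = \<mu> x \<oplus>\<^bsub>M\<^esub> \<mu> y"
    "\<And>x a. x \<in> corner_part e N \<Longrightarrow> \<mu> (\<rho> a \<odot>\<^bsub>N\<^esub> x) = \<rho> a \<odot>\<^bsub>M\<^esub> \<mu> x"
  shows "corner_lin N \<mu>"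
  using assms by (simp add: corner_lin_def)

lemma M_corner_closed: "x \<in> corner_part e M \<Longrightarrow> y \<in> corner_part e M \<Longrightarrow> x \<oplus>\<^bsub>M\<^esub> y \<in> corner_part e M"
  "x \<in> corner_part e M \<Longrightarrow> \<rho> a \<odot>\<^bsub>M\<^esub> x \<in> corner_part e M"
  "\<zero>\<^bsub>M\<^esub> \<in> corner_part e M"
  using corner_part_closed[OF M.left_module_axioms] by blast+

lemma corner_linD': "corner_lin N \<mu> \<Longrightarrow> x \<in> corner_part e N \<Longrightarrow> \<mu> x \<in> corner_part e M"
  by (simp add: corner_lin_def)

lemma rho_smult_commute: "x \<in> carrier M \<Longrightarrow> b \<in> carrier B \<Longrightarrow> \<rho> a \<odot>\<^bsub>M\<^esub> (b \<odot>\<^bsub>M\<^esub> x) = b \<odot>\<^bsub>M\<^esub> (\<rho> a \<odot>\<^bsub>M\<^esub> x)"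
  by (rule smult_rho_commute[OF M.left_module_axioms, symmetric])

lemma L_subspace:
  assumes N: "left_module B N"
  shows "cscale.subspace (L N)"
  unfolding cscale.subspace_def
proof (intro conjI ballI allI)
  show "0 \<in> L N"
  proof -
    have "corner_lin N (\<lambda>x. \<zero>\<^bsub>M\<^esub>)"
      by (rule corner_linI) (simp_all add: M_corner_closed M.smult_zero rho_closed)
    moreover have "ext N (\<lambda>x. \<zero>\<^bsub>M\<^esub>) = 0" by (auto simp: ext_def fun_eq_iff xi_zero)
    ultimately show ?thesis using L_I by metis
  qed
  fix \<psi> assume "\<psi> \<in> L N"
  then obtain \<mu> where \<mu>: "corner_lin N \<mu>" "\<psi> = ext N \<mu>" by (auto simp: L_def)
  note D = corner_linD[OF \<mu>(1)] corner_linD'[OF \<mu>(1)]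
  show "cscale c \<psi> \<in> L N" for c
  proof -
    have "corner_lin N (\<lambda>x. \<rho> (fps_const c) \<odot>\<^bsub>M\<^esub> \<mu> x)"
    proof (rule corner_linI)
      show "\<rho> (fps_const c) \<odot>\<^bsub>M\<^esub> \<mu> (\<rho> a \<odot>\<^bsub>N\<^esub> x) = \<rho> a \<odot>\<^bsub>M\<^esub> (\<rho> (fps_const c) \<odot>\<^bsub>M\<^esub> \<mu> x)"
        if "x \<in> corner_part e N" for x a
        using that rho_smult_commute[OF D(1)[OF that] rho_closed, of "fps_const c" a] by (simp add: D(4))
    qed (simp_all add: D M_corner_closed M.smult_r_distr rho_closed)
    moreover have "ext N (\<lambda>x. \<rho> (fps_const c) \<odot>\<^bsub>M\<^esub> \<mu> x) = cscale c \<psi>"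
      by (auto simp: \<mu>(2) ext_def cscale_def fun_eq_iff M.scal D)
    ultimately show ?thesis using L_I by metis
  qed
  fix \<psi>' assume "\<psi>' \<in> L N"
  then obtain \<mu>' where \<mu>': "corner_lin N \<mu>'" "\<psi>' = ext N \<mu>'" by (auto simp: L_def)
  note D' = corner_linD[OF \<mu>'(1)] corner_linD'[OF \<mu>'(1)]
  have "corner_lin N (\<lambda>x. \<mu> x \<oplus>\<^bsub>M\<^esub> \<mu>' x)"
    by (rule corner_linI) (simp_all add: D D' M_corner_closed M.smult_closed M.smult_r_distr rho_closed M.M.a_ac)
  moreover have "ext N (\<lambda>x. \<mu> x \<oplus>\<^bsub>M\<^esub> \<mu>' x) = \<psi> + \<psi>'"
    by (auto simp: \<mu>(2) \<mu>'(2) ext_def fun_eq_iff M.add D D')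
  ultimately show "\<psi> + \<psi>' \<in> L N" using L_I by metis
qed

lemma H_subspace:
  assumes N: "left_module B N"
  shows "cscale.subspace (H N)"
  unfolding cscale.subspace_def
proof (intro conjI ballI allI)
  interpret N: left_module B N by fact
  show "0 \<in> H N"
  proof -
    have "(\<lambda>x\<in>carrier N. \<zero>\<^bsub>M\<^esub>) \<in> lhom B N M"
      by (rule lhomI) (simp_all add: M.smult_zero N.smult_closed)
    moreover have "ext N (\<lambda>x\<in>carrier N. \<zero>\<^bsub>M\<^esub>) = 0" by (auto simp: ext_def fun_eq_iff xi_zero corner_partD)
    ultimately show ?thesis using H_I by metis
  qed
  fix \<psi> assume "\<psi> \<in> H N"
  then obtain h where h: "h \<in> lhom B N M" "\<psi> = ext N h" by (auto simp: H_def)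
  interpret h: left_module_hom B N M h by (rule left_module_homI[OF N M.left_module_axioms h(1)])
  show "cscale c \<psi> \<in> H N" for c
  proof -
    have "(\<lambda>x\<in>carrier N. \<rho> (fps_const c) \<odot>\<^bsub>M\<^esub> h x) \<in> lhom B N M"
      by (rule lhomI) (simp_all add: h.add h.smult h.closed M.smult_closed N.smult_closed M.smult_r_distr
        rho_closed rho_smult_commute)
    moreover have "ext N (\<lambda>x\<in>carrier N. \<rho> (fps_const c) \<odot>\<^bsub>M\<^esub> h x) = cscale c \<psi>"
      by (auto simp: h(2) ext_def cscale_def fun_eq_iff M.scal h.closed corner_partD)
    ultimately show ?thesis using H_I by metis
  qed
  fix \<psi>' assume "\<psi>' \<in> H N"
  then obtain h' where h': "h' \<in> lhom B N M" "\<psi>' = ext N h'" by (auto simp: H_def)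
  interpret h': left_module_hom B N M h' by (rule left_module_homI[OF N M.left_module_axioms h'(1)])
  have "(\<lambda>x\<in>carrier N. h x \<oplus>\<^bsub>M\<^esub> h' x) \<in> lhom B N M"
    by (rule lhomI) (simp_all add: h.add h.smult h.closed h'.add h'.smult h'.closed N.smult_closed
        M.smult_closed M.smult_r_distr M.M.a_ac)
  moreover have "ext N (\<lambda>x\<in>carrier N. h x \<oplus>\<^bsub>M\<^esub> h' x) = \<psi> + \<psi>'"
    by (auto simp: h(2) h'(2) ext_def fun_eq_iff M.add h.closed h'.closed corner_partD)
  ultimately show "\<psi> + \<psi>' \<in> H N" using H_I by metis
qed

definition kdim :: "('b, 'n) module \<Rightarrow> nat \<Rightarrow> bool" where
  "kdim N k \<longleftrightarrow> codim cscale (L N) (H N) k"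

definition rho_generated :: "('b, 'n) module \<Rightarrow> nat \<Rightarrow> (nat \<Rightarrow> 'n) \<Rightarrow> bool" where
  "rho_generated N dN w \<longleftrightarrow> (\<forall>l<dN. w l \<in> carrier N) \<and>
     (\<forall>x\<in>carrier N. \<exists>c. x = finsum N (\<lambda>l. \<rho> (c l) \<odot>\<^bsub>N\<^esub> w l) {..<dN})"

text \<open>A map with all values divisible by \<open>t^n\<close> is \<open>t^n\<close> times
  another R-linear map of corners, and such multiples extend to B-linear maps. So
  \<open>t^n L\<close> lies in H.\<close>

lemma L_divisible:
  assumes N: "left_module B N" and \<psi>: "\<psi> \<in> L N"
    and div: "\<And>x j q. x \<in> corner_part e N \<Longrightarrow> q < n \<Longrightarrow> fps_nth (\<psi> x j) q = 0"
  shows "\<psi> \<in> H N"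
proof -
  obtain \<mu> where \<mu>: "corner_lin N \<mu>" "\<psi> = ext N \<mu>" using \<psi> by (auto simp: L_def)
  note D = corner_linD[OF \<mu>(1)] corner_linD'[OF \<mu>(1)]
  define \<nu> where "\<nu> x = \<eta> (\<lambda>j. fps_shift n (\<xi> (\<mu> x) j))" for x
  have \<nu>: "\<nu> x \<in> carrier M" "\<rho> (fps_X ^ n) \<odot>\<^bsub>M\<^esub> \<nu> x = \<mu> x" if x: "x \<in> corner_part e N" for x
  proof -
    let ?v = "\<lambda>j. fps_shift n (\<xi> (\<mu> x) j)"
    \<comment> \<open>Shifting the series divides by \<open>t^n\<close> in coordinates; the
      hypothesis on low coefficients makes the division exact.\<close>
    have v: "?v \<in> vecs d" using xi_closed[OF D(1)[OF x]] by (simp add: vecs_def)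
    show c: "\<nu> x \<in> carrier M" unfolding \<nu>_def by (rule eta_closed[OF v])
    have "scal (fps_X ^ n) ?v = \<xi> (\<mu> x)"
      using div[OF x] by (auto simp: \<mu>(2) ext_apply[OF x] scal_def fun_eq_iff fps_eq_iff fps_X_power_mult_nth)
    then have "\<xi> (\<rho> (fps_X ^ n) \<odot>\<^bsub>M\<^esub> \<nu> x) = \<xi> (\<mu> x)"
      using c xi_eta[OF v] by (simp add: M.scal) (simp add: \<nu>_def)
    then show "\<rho> (fps_X ^ n) \<odot>\<^bsub>M\<^esub> \<nu> x = \<mu> x" using xi_inj D(1)[OF x] c M.smult_closed rho_closed by blast
  qed
  have "corner_lin N \<nu>"
  proof (rule corner_linI)
    fix x assume x: "x \<in> corner_part e N"
    have "\<rho> (fps_X ^ n) \<odot>\<^bsub>M\<^esub> (e \<odot>\<^bsub>M\<^esub> \<nu> x) = \<rho> (fps_X ^ n) \<odot>\<^bsub>M\<^esub> \<nu> x"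
      using \<nu>[OF x] D(2)[OF x] by (simp add: rho_smult_commute e_closed)
    then have "e \<odot>\<^bsub>M\<^esub> \<nu> x = \<nu> x" by (rule torsion_free[rotated 2]) (use \<nu>[OF x] M.smult_closed e_closed in auto)
    then show "\<nu> x \<in> corner_part e M" using \<nu>[OF x] by (simp add: corner_part_def)
    show "\<nu> (x \<oplus>\<^bsub>N\<^esub> y) = \<nu> x \<oplus>\<^bsub>M\<^esub> \<nu> y" if y: "y \<in> corner_part e N" for y
    proof -
      have xy: "x \<oplus>\<^bsub>N\<^esub> y \<in> corner_part e N" by (rule corner_part_closed(2)[OF N x y])
      have "\<rho> (fps_X ^ n) \<odot>\<^bsub>M\<^esub> \<nu> (x \<oplus>\<^bsub>N\<^esub> y) = \<rho> (fps_X ^ n) \<odot>\<^bsub>M\<^esub> (\<nu> x \<oplus>\<^bsub>M\<^esub> \<nu> y)"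
        using \<nu>[OF x] \<nu>[OF y] \<nu>[OF xy] D(3)[OF x y] by (simp add: M.smult_r_distr rho_closed)
      then show ?thesis by (rule torsion_free[rotated 2]) (use \<nu>[OF x] \<nu>[OF y] \<nu>[OF xy] in auto)
    qed
    show "\<nu> (\<rho> a \<odot>\<^bsub>N\<^esub> x) = \<rho> a \<odot>\<^bsub>M\<^esub> \<nu> x" for a
    proof -
      have ax: "\<rho> a \<odot>\<^bsub>N\<^esub> x \<in> corner_part e N" by (rule corner_part_closed(3)[OF N x])
      have "\<rho> (fps_X ^ n) \<odot>\<^bsub>M\<^esub> \<nu> (\<rho> a \<odot>\<^bsub>N\<^esub> x) = \<rho> (fps_X ^ n) \<odot>\<^bsub>M\<^esub> (\<rho> a \<odot>\<^bsub>M\<^esub> \<nu> x)"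
        using \<nu>[OF x] \<nu>[OF ax] D(4)[OF x] by (simp add: rho_smult_commute rho_closed)
      then show ?thesis by (rule torsion_free[rotated 2]) (use \<nu>[OF x] \<nu>[OF ax] M.smult_closed rho_closed in auto)
    qed
  qed
  from corner_lin_extend[OF N this] obtain h where h: "h \<in> lhom B N M"
      "\<forall>x\<in>corner_part e N. h x = \<rho> (fps_X ^ n) \<odot>\<^bsub>M\<^esub> \<nu> x" by blast
  have "\<psi> = ext N h" unfolding \<mu>(2) ext_def using h(2) \<nu> by (simp add: fun_eq_iff)
  then show ?thesis using h(1) by (auto simp: H_def)
qed

text \<open>Modulo \<open>t^n L\<close> a map is determined by finitely many complex numbers: its
  coefficients of order below n on the finitely many generators e w of eN.\<close>

lemma kdim_exists:
  fixes N :: "('b, 'n) module"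
  assumes N: "left_module B N" and gen: "rho_generated N dN w"
  shows "\<exists>k. kdim N k"
proof -
  interpret N: left_module B N by fact
  \<comment> \<open>The index lists the generator, the coordinate in \<open>R^d\<close> and the
    power of t.\<close>
  define \<nu> where "\<nu> \<psi> k = (case k of (l, j, q) \<Rightarrow> fps_nth (\<psi> (e \<odot>\<^bsub>N\<^esub> w l) j) q)" for \<psi> :: "'n \<Rightarrow> univ" and k :: "nat \<times> nat \<times> nat"
  have w: "w l \<in> carrier N" "e \<odot>\<^bsub>N\<^esub> w l \<in> corner_part e N" if "l < dN" for l
    using gen that corner_part_closed(5)[OF N] by (auto simp: rho_generated_def)
  have "\<exists>k b. spans_mod cscale (L N) (H N) k b"
  proof (rule cscale.spans_mod_coordinates[where K = "{..<dN} \<times> {..<d} \<times> {..<n}" and \<nu> = \<nu>])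
    fix \<psi> assume \<psi>: "\<psi> \<in> L N" and zero: "\<And>k. k \<in> {..<dN} \<times> {..<d} \<times> {..<n} \<Longrightarrow> \<nu> \<psi> k = 0"
    obtain \<mu> where \<mu>: "corner_lin N \<mu>" "\<psi> = ext N \<mu>" using \<psi> by (auto simp: L_def)
    show "\<psi> \<in> H N"
    proof (rule L_divisible[OF N \<psi>])
      fix x j q assume x: "x \<in> corner_part e N" and q: "q < n"
      obtain c where c: "x = finsum N (\<lambda>l. \<rho> (c l) \<odot>\<^bsub>N\<^esub> w l) {..<dN}"
        using gen corner_partD(1)[OF x] unfolding rho_generated_def by blast
      have "x = e \<odot>\<^bsub>N\<^esub> x" using corner_partD(2)[OF x] by simp
      also have "\<dots> = finsum N (\<lambda>l. e \<odot>\<^bsub>N\<^esub> (\<rho> (c l) \<odot>\<^bsub>N\<^esub> w l)) {..<dN}"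
        unfolding c by (rule N.smult_finsum) (use w e_closed rho_closed N.smult_closed in auto)
      also have "\<dots> = finsum N (\<lambda>l. \<rho> (c l) \<odot>\<^bsub>N\<^esub> (e \<odot>\<^bsub>N\<^esub> w l)) {..<dN}"
      proof (rule N.M.finsum_cong')
        fix l assume "l \<in> {..<dN}"
        then show "e \<odot>\<^bsub>N\<^esub> (\<rho> (c l) \<odot>\<^bsub>N\<^esub> w l) = \<rho> (c l) \<odot>\<^bsub>N\<^esub> (e \<odot>\<^bsub>N\<^esub> w l)"
          using w(1)[of l] by (intro smult_rho_commute[OF N e_closed]) simp
      qed (use w e_closed rho_closed N.smult_closed in auto)
      finally have x': "x = finsum N (\<lambda>l. \<rho> (c l) \<odot>\<^bsub>N\<^esub> (e \<odot>\<^bsub>N\<^esub> w l)) {..<dN}" .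
      have cl: "(\<lambda>l. \<rho> (c l) \<odot>\<^bsub>N\<^esub> (e \<odot>\<^bsub>N\<^esub> w l)) \<in> {..<dN} \<rightarrow> corner_part e N"
        using corner_part_closed(3)[OF N w(2)] by auto
      have "\<mu> x = finsum M (\<lambda>l. \<mu> (\<rho> (c l) \<odot>\<^bsub>N\<^esub> (e \<odot>\<^bsub>N\<^esub> w l))) {..<dN}"
        unfolding x' using corner_lin_finsum[OF N \<mu>(1) _ cl] by simp
      then have "\<xi> (\<mu> x) = (\<Sum>l<dN. \<xi> (\<mu> (\<rho> (c l) \<odot>\<^bsub>N\<^esub> (e \<odot>\<^bsub>N\<^esub> w l))))"
        using xi_finsum[of "{..<dN}" "\<lambda>l. \<mu> (\<rho> (c l) \<odot>\<^bsub>N\<^esub> (e \<odot>\<^bsub>N\<^esub> w l))"] cl corner_linD(1)[OF \<mu>(1)] by (auto simp: Pi_iff)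
      also have "\<dots> = (\<Sum>l<dN. scal (c l) (\<xi> (\<mu> (e \<odot>\<^bsub>N\<^esub> w l))))"
        by (rule sum.cong) (use w(2) in \<open>auto simp: corner_linD[OF \<mu>(1)] M.scal\<close>)
      finally have eq: "\<psi> x j = (\<Sum>l<dN. c l * \<psi> (e \<odot>\<^bsub>N\<^esub> w l) j)"
        using w(2) x by (simp add: \<mu>(2) ext_apply sum_fun_apply scal_apply)
      have low: "fps_nth (\<psi> (e \<odot>\<^bsub>N\<^esub> w l) j) q' = 0" if "l < dN" "q' < n" for l q'
      proof (cases "j < d")
        case True
        then show ?thesis using zero[of "(l, j, q')"] that by (simp add: \<nu>_def)
      next
        case False
        then show ?thesis using xi_closed[OF corner_linD(1)[OF \<mu>(1) w(2)[OF that(1)]]] w(2)[OF that(1)]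
          by (simp add: \<mu>(2) ext_apply vecs_def)
      qed
      show "fps_nth (\<psi> x j) q = 0"
        unfolding eq fps_sum_nth fps_mult_nth using low q by (intro sum.neutral ballI) auto
    qed
  qed (auto simp: \<nu>_def cscale_apply L_subspace[OF N] split: prod.splits)
  then show ?thesis unfolding kdim_def using cscale.codim_exists[OF H_subspace[OF N]] by blast
qed

lemma kdim_unique: "left_module B N \<Longrightarrow> kdim N k \<Longrightarrow> kdim N k' \<Longrightarrow> k = k'"
  unfolding kdim_def using cscale.codim_unique[OF H_subspace] by blast

text \<open>
  Exactness in \<open>N\<close> of \<open>Hom\<^sub>R(e N, e M)\<close> uses that the sequence splits over \<open>R\<close>; the function \<open>\<sigma>\<close> is a
  splitting.
\<close>

lemma quotient_sequence_short_exact: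
  assumes ses: "short_exact B U V W f g"
    and \<sigma>: "\<And>w. w \<in> carrier W \<Longrightarrow> \<sigma> w \<in> carrier V" "\<And>w. w \<in> carrier W \<Longrightarrow> g (\<sigma> w) = w"
      "\<And>w w'. w \<in> carrier W \<Longrightarrow> w' \<in> carrier W \<Longrightarrow> \<sigma> (w \<oplus>\<^bsub>W\<^esub> w') = \<sigma> w \<oplus>\<^bsub>V\<^esub> \<sigma> w'"
      "\<And>w a. w \<in> carrier W \<Longrightarrow> \<sigma> (\<rho> a \<odot>\<^bsub>W\<^esub> w) = \<rho> a \<odot>\<^bsub>V\<^esub> \<sigma> w"
  shows "quotient_sequence cscale cscale cscale (L U) (H U) (L V) (H V) (L W) (H W)
    (\<lambda>\<psi> u. if u \<in> corner_part e U then \<psi> (f u) else 0) (\<lambda>\<psi> v. if v \<in> corner_part e V then \<psi> (g v) else 0)"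
    (is "quotient_sequence _ _ _ _ _ _ _ _ _ ?p ?q")
proof -
  note S = short_exactD[OF ses]
  interpret f: left_module_hom B U V f by (rule S)
  interpret g: left_module_hom B V W g by (rule S)
  let ?U = "corner_part e U" and ?V = "corner_part e V" and ?W = "corner_part e W"
  have fV: "f u \<in> ?V" if "u \<in> ?U" for u
    using that f.closed f.smult[OF e_closed, of u] by (simp add: corner_part_def)
  have gW: "g v \<in> ?W" if "v \<in> ?V" for v
    using that g.closed g.smult[OF e_closed, of v] by (simp add: corner_part_def)
  \<comment> \<open>Multiplying the splitting by e makes it land in the corner of V; it is still a
    section on eW since g is B-linear.\<close>
  define \<tau> where "\<tau> w = e \<odot>\<^bsub>V\<^esub> \<sigma> w" for w
  have tV: "\<tau> w \<in> ?V" if "w \<in> ?W" for w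
    unfolding \<tau>_def by (rule corner_part_closed(5)[OF S(2)]) (rule \<sigma>(1)[OF corner_partD(1)[OF that]])
  have gt: "g (\<tau> w) = w" if "w \<in> ?W" for w
    using that \<sigma>(1,2)[of w] g.smult[OF e_closed, of "\<sigma> w"] by (simp add: \<tau>_def corner_part_def)
  have tadd: "\<tau> (w \<oplus>\<^bsub>W\<^esub> w') = \<tau> w \<oplus>\<^bsub>V\<^esub> \<tau> w'" if "w \<in> ?W" "w' \<in> ?W" for w w'
    using that \<sigma> by (simp add: \<tau>_def corner_partD f.N.smult_r_distr e_closed)
  have tscal: "\<tau> (\<rho> a \<odot>\<^bsub>W\<^esub> w) = \<rho> a \<odot>\<^bsub>V\<^esub> \<tau> w" if "w \<in> ?W" for w a
    using corner_partD(1)[OF that] \<sigma>(1,4)[of w] smult_rho_commute[OF S(2) e_closed, of "\<sigma> w" a]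
    by (simp add: \<tau>_def)
  \<comment> \<open>The complementary projection: v minus its image under the section lies in the
    kernel of g, and its preimage in U is again fixed by e because f is injective.\<close>
  have "\<exists>u\<in>?U. f u = v \<ominus>\<^bsub>V\<^esub> \<tau> (g v)" if v: "v \<in> ?V" for v
  proof -
    have vV: "v \<in> carrier V" "\<tau> (g v) \<in> carrier V" using corner_partD(1)[OF v] corner_partD(1)[OF tV[OF gW[OF v]]] .
    have "g (v \<ominus>\<^bsub>V\<^esub> \<tau> (g v)) = \<zero>\<^bsub>W\<^esub>"
      using vV gt[OF gW[OF v]] by (simp add: g.minus g.N.M.minus_eq_zero_iff g.closed)
    then obtain u where u: "u \<in> carrier U" "f u = v \<ominus>\<^bsub>V\<^esub> \<tau> (g v)" using S(9) vV by (meson f.N.M.minus_closed)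
    have "e \<odot>\<^bsub>V\<^esub> (v \<ominus>\<^bsub>V\<^esub> \<tau> (g v)) = v \<ominus>\<^bsub>V\<^esub> \<tau> (g v)"
      using vV corner_partD(2)[OF v] corner_partD(2)[OF tV[OF gW[OF v]]]
      by (simp add: a_minus_def f.N.smult_r_distr f.N.smult_minus e_closed)
    then have "f (e \<odot>\<^bsub>U\<^esub> u) = f u" using u by (simp add: f.smult e_closed)
    then have "e \<odot>\<^bsub>U\<^esub> u = u" using inj_onD[OF S(6)] u(1) f.M.smult_closed[OF e_closed u(1)] by blast
    then show ?thesis using u by (auto simp: corner_part_def)
  qed
  then obtain t where t: "\<And>v. v \<in> ?V \<Longrightarrow> t v \<in> ?U" "\<And>v. v \<in> ?V \<Longrightarrow> f (t v) = v \<ominus>\<^bsub>V\<^esub> \<tau> (g v)" by metis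
  have t_unique: "t v = u" if "v \<in> ?V" "u \<in> carrier U" "f u = v \<ominus>\<^bsub>V\<^esub> \<tau> (g v)" for v u
    using inj_onD[OF S(6), of "t v" u] t[OF that(1)] that corner_partD(1)[OF t(1)[OF that(1)]] by simp
  have zW: "\<zero>\<^bsub>W\<^esub> \<in> ?W" by (rule corner_part_closed(1)[OF S(3)])
  have t0: "\<tau> \<zero>\<^bsub>W\<^esub> = \<zero>\<^bsub>V\<^esub>"
    using tscal[OF zW, of 0] tV[OF zW] corner_partD(1)[OF tV[OF zW]] by (simp add: rho_zero g.N.zero_smult f.N.zero_smult)
  have comp_f: "corner_lin U (\<lambda>u. \<mu> (f u))" if \<mu>: "corner_lin V \<mu>" for \<mu>
    by (rule corner_linI)
      (simp_all add: f.add f.smult corner_partD rho_closed corner_linD[OF \<mu>] corner_linD'[OF \<mu>] fV)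
  have comp_g: "corner_lin V (\<lambda>v. \<mu> (g v))" if \<mu>: "corner_lin W \<mu>" for \<mu>
    by (rule corner_linI)
      (simp_all add: g.add g.smult corner_partD rho_closed corner_linD[OF \<mu>] corner_linD'[OF \<mu>] gW)
  have p_ext: "?p (ext V \<mu>) = ext U (\<lambda>u. \<mu> (f u))" for \<mu>
    by (auto simp: ext_def fV)
  have q_ext: "?q (ext W \<mu>) = ext V (\<lambda>v. \<mu> (g v))" for \<mu>
    by (auto simp: ext_def gW)
  have p0: "\<mu> \<zero>\<^bsub>W\<^esub> = \<zero>\<^bsub>M\<^esub>" if "corner_lin W \<mu>" for \<mu> by (rule corner_lin_zero[OF S(3) that])
  show ?thesis
  proof (intro quotient_sequence.intro quotient_sequence_axioms.intro cscale.vector_space_axioms)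
    show "cscale.subspace (H U)" "cscale.subspace (H V)" "cscale.subspace (H W)" using H_subspace S by auto
    show "cscale.subspace (L U)" "cscale.subspace (L V)" "cscale.subspace (L W)" using L_subspace S by auto
    show "H U \<subseteq> L U" "H V \<subseteq> L V" "H W \<subseteq> L W" using H_subset_L by auto
    show "module_hom cscale cscale ?p" "module_hom cscale cscale ?q"
      by (unfold_locales; auto simp: fun_eq_iff cscale_apply)+
    show "?p ` L V = L U"
    proof (intro equalityI subsetI)
      fix \<psi> assume "\<psi> \<in> ?p ` L V"
      then obtain \<mu> where "corner_lin V \<mu>" "\<psi> = ?p (ext V \<mu>)" by (auto simp: L_def)
      then show "\<psi> \<in> L U" unfolding p_ext by (simp add: L_I comp_f)
    next
      fix \<chi> assume "\<chi> \<in> L U"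
      then obtain \<mu> where \<mu>: "corner_lin U \<mu>" "\<chi> = ext U \<mu>" by (auto simp: L_def)
      \<comment> \<open>R-linear maps always extend from eU to eV, by composing with the projection
        t. This is the exactness that maps over B lack.\<close>
      have A: "corner_lin V (\<lambda>v. \<mu> (t v))"
      proof (rule corner_linI)
        fix x assume x: "x \<in> ?V"
        note xc = corner_partD(1)[OF x] corner_partD(1)[OF tV[OF gW[OF x]]] corner_partD(1)[OF t(1)[OF x]]
        show "\<mu> (t x) \<in> corner_part e M" by (rule corner_linD'[OF \<mu>(1) t(1)[OF x]])
        show "\<mu> (t (x \<oplus>\<^bsub>V\<^esub> y)) = \<mu> (t x) \<oplus>\<^bsub>M\<^esub> \<mu> (t y)" if y: "y \<in> ?V" for y
        proof -
          note yc = corner_partD(1)[OF y] corner_partD(1)[OF tV[OF gW[OF y]]] corner_partD(1)[OF t(1)[OF y]]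
          have "t (x \<oplus>\<^bsub>V\<^esub> y) = t x \<oplus>\<^bsub>U\<^esub> t y"
            by (rule t_unique[OF corner_part_closed(2)[OF S(2) x y]])
              (use xc yc in \<open>simp_all add: f.add t x y g.add tadd gW a_minus_def f.N.M.minus_add f.N.M.a_ac\<close>)
          then show ?thesis using corner_linD(3)[OF \<mu>(1) t(1)[OF x] t(1)[OF y]] by simp
        qed
        show "\<mu> (t (\<rho> a \<odot>\<^bsub>V\<^esub> x)) = \<rho> a \<odot>\<^bsub>M\<^esub> \<mu> (t x)" for a
        proof -
          have "t (\<rho> a \<odot>\<^bsub>V\<^esub> x) = \<rho> a \<odot>\<^bsub>U\<^esub> t x"
            by (rule t_unique[OF corner_part_closed(3)[OF S(2) x]])
              (use xc in \<open>simp_all add: f.smult t x g.smult tscal gW a_minus_def f.N.smult_r_distr f.N.smult_minus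
                rho_closed f.M.smult_closed\<close>)
          then show ?thesis using corner_linD(4)[OF \<mu>(1) t(1)[OF x]] by simp
        qed
      qed
      have B: "?p (ext V (\<lambda>v. \<mu> (t v))) = \<chi>"
      proof -
        have "t (f u) = u" if u: "u \<in> ?U" for u
          by (rule t_unique[OF fV[OF u]])
            (use corner_partD(1)[OF u] f.closed in \<open>simp_all add: S(8) t0 a_minus_def\<close>)
        then show ?thesis unfolding p_ext \<mu>(2) by (auto simp: ext_def)
      qed
      show "\<chi> \<in> ?p ` L V" by (rule image_eqI, rule B[symmetric], rule L_I[OF A])
    qed
    show "?q ` L W \<subseteq> L V"
    proof
      fix \<psi> assume "\<psi> \<in> ?q ` L W"
      then obtain \<mu> where "corner_lin W \<mu>" "\<psi> = ?q (ext W \<mu>)" by (auto simp: L_def)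
      then show "\<psi> \<in> L V" unfolding q_ext by (simp add: L_I comp_g)
    qed
    show "?p ` H V \<subseteq> H U"
    proof
      fix \<psi> assume "\<psi> \<in> ?p ` H V"
      then obtain h where h: "h \<in> lhom B V M" "\<psi> = ?p (ext V h)" by (auto simp: H_def)
      have "ext U (\<lambda>u. h (f u)) = ext U (compose (carrier U) h f)"
        by (auto simp: ext_def compose_eq corner_partD)
      then show "\<psi> \<in> H U" unfolding h(2) p_ext using H_I[OF lhom_compose[OF S(4) h(1) S(1)]] by simp
    qed
    show "\<psi> \<in> ?q ` L W" if \<psi>: "\<psi> \<in> L V" "?p \<psi> = 0" for \<psi>
    proof -
      obtain \<mu> where \<mu>: "corner_lin V \<mu>" "\<psi> = ext V \<mu>" using \<psi>(1) by (auto simp: L_def)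
      have kill: "\<mu> (f u) = \<zero>\<^bsub>M\<^esub>" if u: "u \<in> ?U" for u
      proof (rule xi_inj[OF corner_linD(1)[OF \<mu>(1) fV[OF u]]])
        show "\<xi> (\<mu> (f u)) = \<xi> \<zero>\<^bsub>M\<^esub>"
          using fun_cong[OF \<psi>(2), of u] u fV[OF u] by (simp add: \<mu>(2) ext_apply xi_zero)
      qed simp
      have A: "corner_lin W (\<lambda>w. \<mu> (\<tau> w))"
        by (rule corner_linI) (simp_all add: tadd tscal tV corner_linD[OF \<mu>(1)] corner_linD'[OF \<mu>(1)])
      have B: "?q (ext W (\<lambda>w. \<mu> (\<tau> w))) = \<psi>"
      proof -
        have "\<mu> (\<tau> (g v)) = \<mu> v" if v: "v \<in> ?V" for v
        proof -
          have tv: "\<tau> (g v) \<in> ?V" using tV[OF gW[OF v]] .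
          have "f (t v) \<oplus>\<^bsub>V\<^esub> \<tau> (g v) = v"
            using corner_partD(1)[OF v] corner_partD(1)[OF tv] t(2)[OF v] by (simp add: a_minus_def f.N.M.a_assoc f.N.M.l_neg)
          then have "\<mu> v = \<mu> (f (t v)) \<oplus>\<^bsub>M\<^esub> \<mu> (\<tau> (g v))"
            using corner_linD(3)[OF \<mu>(1) fV[OF t(1)[OF v]] tv] by simp
          then show ?thesis using kill[OF t(1)[OF v]] corner_linD(1)[OF \<mu>(1) tv] by simp
        qed
        then show ?thesis unfolding q_ext \<mu>(2) by (auto simp: ext_def)
      qed
      show ?thesis by (rule image_eqI, rule B[symmetric], rule L_I[OF A])
    qed
    show "?p (?q \<chi>) = 0" if \<chi>: "\<chi> \<in> L W" for \<chi>
    proof -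
      obtain \<mu> where \<mu>: "corner_lin W \<mu>" "\<chi> = ext W \<mu>" using \<chi> by (auto simp: L_def)
      show ?thesis unfolding \<mu>(2) q_ext p_ext
        by (auto simp: ext_def fun_eq_iff S(8) corner_partD p0[OF \<mu>(1)] xi_zero)
    qed
    show "?q \<chi> \<in> H V \<longleftrightarrow> \<chi> \<in> H W" if \<chi>: "\<chi> \<in> L W" for \<chi>
    proof
      obtain \<mu> where \<mu>: "corner_lin W \<mu>" "\<chi> = ext W \<mu>" using \<chi> by (auto simp: L_def)
      assume "?q \<chi> \<in> H V"
      then obtain h where h: "h \<in> lhom B V M" "?q \<chi> = ext V h" by (auto simp: H_def)
      interpret h: left_module_hom B V M h by (rule left_module_homI[OF S(2) M.left_module_axioms h(1)])
      have hv: "h v = \<mu> (g v)" if v: "v \<in> ?V" for v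
      proof (rule xi_inj[OF h.closed corner_linD(1)[OF \<mu>(1) gW[OF v]]])
        show "\<xi> (h v) = \<xi> (\<mu> (g v))"
          using fun_cong[OF h(2), of v] v gW[OF v] unfolding \<mu>(2) by (simp add: ext_apply)
      qed (rule corner_partD(1)[OF v])
      \<comment> \<open>h vanishes on f(eU), hence on all of f(U) by faithfulness. It therefore
        factors through g, and the factor restricts to mu on eW.\<close>
      have "compose (carrier U) h f u = \<zero>\<^bsub>M\<^esub>" if u: "u \<in> carrier U" for u
      proof (rule faithful[OF S(1) lhom_compose[OF S(4) h(1) S(1)] _ u])
        fix u assume u: "u \<in> ?U"
        show "compose (carrier U) h f u = \<zero>\<^bsub>M\<^esub>"
          using hv[OF fV[OF u]] corner_partD(1)[OF u] by (simp add: compose_eq S(8) p0[OF \<mu>(1)])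
      qed
      then have hf: "h (f u) = \<zero>\<^bsub>M\<^esub>" if "u \<in> carrier U" for u using that by (simp add: compose_eq)
      have "\<exists>k\<in>lhom B W M. \<forall>(w, m)\<in>(\<lambda>v. (g v, h v)) ` carrier V. k w = m"
      proof (rule lhom_of_relation[OF S(3) M.left_module_axioms])
        show "(\<lambda>v. (g v, h v)) ` carrier V \<subseteq> carrier W \<times> carrier M" using g.closed h.closed by auto
        show "\<exists>m. (w, m) \<in> (\<lambda>v. (g v, h v)) ` carrier V" if "w \<in> carrier W" for w
          using \<sigma>(1,2)[OF that] by (metis (no_types, lifting) image_eqI)
        show "(w \<oplus>\<^bsub>W\<^esub> w', m \<oplus>\<^bsub>M\<^esub> m') \<in> (\<lambda>v. (g v, h v)) ` carrier V"
          if w: "(w, m) \<in> (\<lambda>v. (g v, h v)) ` carrier V" "(w', m') \<in> (\<lambda>v. (g v, h v)) ` carrier V" for w m w' m'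
        proof -
          obtain v v' where "v \<in> carrier V" "v' \<in> carrier V" "w = g v" "m = h v" "w' = g v'" "m' = h v'" using w by auto
          then show ?thesis by (intro image_eqI[of _ _ "v \<oplus>\<^bsub>V\<^esub> v'"]) (simp_all add: g.add h.add)
        qed
        show "(b \<odot>\<^bsub>W\<^esub> w, b \<odot>\<^bsub>M\<^esub> m) \<in> (\<lambda>v. (g v, h v)) ` carrier V"
          if b: "b \<in> carrier B" and w: "(w, m) \<in> (\<lambda>v. (g v, h v)) ` carrier V" for b w m
        proof -
          obtain v where "v \<in> carrier V" "w = g v" "m = h v" using w by auto
          then show ?thesis using b by (intro image_eqI[of _ _ "b \<odot>\<^bsub>V\<^esub> v"]) (simp_all add: g.smult h.smult f.N.smult_closed)
        qed
        show "m = \<zero>\<^bsub>M\<^esub>" if m: "(\<zero>\<^bsub>W\<^esub>, m) \<in> (\<lambda>v. (g v, h v)) ` carrier V" for m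
        proof -
          obtain v where v: "v \<in> carrier V" "g v = \<zero>\<^bsub>W\<^esub>" "m = h v" using m by auto
          obtain u where "u \<in> carrier U" "f u = v" using S(9)[OF v(1,2)] by blast
          then show ?thesis using hf v(3) by auto
        qed
      qed
      then obtain k where k: "k \<in> lhom B W M" "\<forall>(w, m)\<in>(\<lambda>v. (g v, h v)) ` carrier V. k w = m" by blast
      have "k w = \<mu> w" if w: "w \<in> ?W" for w
      proof -
        have "k (g (\<tau> w)) = h (\<tau> w)" using bspec[OF k(2) imageI[OF corner_partD(1)[OF tV[OF w]]]] by simp
        then show ?thesis using hv[OF tV[OF w]] gt[OF w] by simp
      qed
      then have "\<chi> = ext W k" unfolding \<mu>(2) by (auto simp: ext_def)
      then show "\<chi> \<in> H W" using k(1) by (auto simp: H_def)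
    next
      assume "\<chi> \<in> H W"
      then obtain h where h: "h \<in> lhom B W M" "\<chi> = ext W h" by (auto simp: H_def)
      have "ext V (\<lambda>v. h (g v)) = ext V (compose (carrier V) h g)"
        by (auto simp: ext_def compose_eq corner_partD)
      then show "?q \<chi> \<in> H V" unfolding h(2) q_ext using H_I[OF lhom_compose[OF S(5) h(1) S(2)]] by simp
    qed
  qed
qed

end

section \<open>The module J M and evaluation at e\<close>

lemma J_module_simps:
  "carrier (J_module B \<rho> e M) = {f \<in> corner B e \<rightarrow>\<^sub>E (\<lambda>x. e \<odot>\<^bsub>M\<^esub> x) ` carrier M.
        (\<forall>x\<in>corner B e. \<forall>y\<in>corner B e. f (x \<oplus>\<^bsub>B\<^esub> y) = f x \<oplus>\<^bsub>M\<^esub> f y) \<and>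
        (\<forall>a. \<forall>x\<in>corner B e. f (\<rho> a \<otimes>\<^bsub>B\<^esub> x) = \<rho> a \<odot>\<^bsub>M\<^esub> f x)}"
  "\<zero>\<^bsub>J_module B \<rho> e M\<^esub> = (\<lambda>x\<in>corner B e. \<zero>\<^bsub>M\<^esub>)"
  "f \<oplus>\<^bsub>J_module B \<rho> e M\<^esub> g = (\<lambda>x\<in>corner B e. f x \<oplus>\<^bsub>M\<^esub> g x)"
  "b \<odot>\<^bsub>J_module B \<rho> e M\<^esub> f = (\<lambda>x\<in>corner B e. f (x \<otimes>\<^bsub>B\<^esub> b))"
  by (simp_all add: J_module_def)

lemma hom_module_simps:
  "carrier (hom_module B \<rho> M N) = lhom B M N"
  "\<zero>\<^bsub>hom_module B \<rho> M N\<^esub> = (\<lambda>x\<in>carrier M. \<zero>\<^bsub>N\<^esub>)"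
  "f \<oplus>\<^bsub>hom_module B \<rho> M N\<^esub> g = (\<lambda>x\<in>carrier M. f x \<oplus>\<^bsub>N\<^esub> g x)"
  "a \<odot>\<^bsub>hom_module B \<rho> M N\<^esub> f = (\<lambda>x\<in>carrier M. \<rho> a \<odot>\<^bsub>N\<^esub> f x)"
  by (simp_all add: hom_module_def)

lemma hom_module_abelian_group:
  fixes B :: "'b ring"
  assumes "left_module B M" "left_module B N"
  shows "abelian_group (hom_module B \<rho> M N)"
proof (rule abelian_groupI; unfold hom_module_simps)
  interpret M: left_module B M by fact
  interpret N: left_module B N by fact
  show "(\<lambda>x\<in>carrier M. \<zero>\<^bsub>N\<^esub>) \<in> lhom B M N"
    by (rule lhomI) (simp_all add: N.smult_zero M.smult_closed)
  fix f assume f: "f \<in> lhom B M N"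
  interpret f: left_module_hom B M N f using assms f by (rule left_module_homI)
  have "(\<lambda>x\<in>carrier M. \<ominus>\<^bsub>N\<^esub> f x) \<in> lhom B M N"
    by (rule lhomI) (simp_all add: f.closed f.add f.smult N.M.minus_add N.smult_minus M.smult_closed)
  moreover have "(\<lambda>x\<in>carrier M. (\<lambda>x\<in>carrier M. \<ominus>\<^bsub>N\<^esub> f x) x \<oplus>\<^bsub>N\<^esub> f x) = (\<lambda>x\<in>carrier M. \<zero>\<^bsub>N\<^esub>)"
    by (rule restrict_ext) (simp add: f.closed N.M.l_neg)
  ultimately show "\<exists>y\<in>lhom B M N. (\<lambda>x\<in>carrier M. y x \<oplus>\<^bsub>N\<^esub> f x) = (\<lambda>x\<in>carrier M. \<zero>\<^bsub>N\<^esub>)" by blast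
  show "(\<lambda>x\<in>carrier M. (\<lambda>x\<in>carrier M. \<zero>\<^bsub>N\<^esub>) x \<oplus>\<^bsub>N\<^esub> f x) = f"
    by (rule extensionalityI[OF _ lhom_extensional[OF f]]) (simp_all add: f.closed)
  fix g assume g: "g \<in> lhom B M N"
  interpret g: left_module_hom B M N g using assms g by (rule left_module_homI)
  show "(\<lambda>x\<in>carrier M. f x \<oplus>\<^bsub>N\<^esub> g x) \<in> lhom B M N"
    by (rule lhomI) (simp_all add: f.closed f.add f.smult g.closed g.add g.smult N.smult_r_distr N.smult_closed
        M.smult_closed N.M.a_ac)
  show "(\<lambda>x\<in>carrier M. f x \<oplus>\<^bsub>N\<^esub> g x) = (\<lambda>x\<in>carrier M. g x \<oplus>\<^bsub>N\<^esub> f x)"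
    by (rule restrict_ext) (simp add: f.closed g.closed N.M.a_comm)
  fix h assume h: "h \<in> lhom B M N"
  interpret h: left_module_hom B M N h using assms h by (rule left_module_homI)
  show "(\<lambda>x\<in>carrier M. (\<lambda>x\<in>carrier M. f x \<oplus>\<^bsub>N\<^esub> g x) x \<oplus>\<^bsub>N\<^esub> h x) =
      (\<lambda>x\<in>carrier M. f x \<oplus>\<^bsub>N\<^esub> (\<lambda>x\<in>carrier M. g x \<oplus>\<^bsub>N\<^esub> h x) x)"
    by (rule restrict_ext) (simp add: f.closed g.closed h.closed N.M.a_assoc)
qed

context corner_module
begin

abbreviation JM :: "('b, 'b \<Rightarrow> 'm) module" where "JM \<equiv> J_module B \<rho> e M"

lemma corner_iff: "b \<in> corner B e \<longleftrightarrow> b \<in> carrier B \<and> e \<otimes> b = b"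
  unfolding corner_def using e_closed e_idem by (auto simp flip: B.m_assoc) (metis image_eqI)

lemma eM_iff: "x \<in> (\<lambda>x. e \<odot>\<^bsub>M\<^esub> x) ` carrier M \<longleftrightarrow> x \<in> corner_part e M"
  using corner_part_closed(5)[OF M.left_module_axioms] by (auto simp: corner_part_def) (metis image_eqI)

lemma corner_closed:
  assumes "x \<in> corner B e"
  shows "y \<in> corner B e \<Longrightarrow> x \<oplus> y \<in> corner B e" "b \<in> carrier B \<Longrightarrow> x \<otimes> b \<in> corner B e" "\<rho> a \<otimes> x \<in> corner B e"
proof -
  show "y \<in> corner B e \<Longrightarrow> x \<oplus> y \<in> corner B e" using assms e_closed by (simp add: corner_iff B.r_distr)
  show "b \<in> carrier B \<Longrightarrow> x \<otimes> b \<in> corner B e" using assms e_closed by (simp add: corner_iff flip: B.m_assoc)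
  have x: "x \<in> carrier B" using assms by (simp add: corner_iff)
  have "e \<otimes> (\<rho> a \<otimes> x) = (e \<otimes> \<rho> a) \<otimes> x" using x e_closed rho_closed by (simp add: B.m_assoc)
  also have "e \<otimes> \<rho> a = \<rho> a \<otimes> e" by (rule rho_central[OF e_closed, symmetric])
  also have "\<rho> a \<otimes> e \<otimes> x = \<rho> a \<otimes> (e \<otimes> x)" using x e_closed rho_closed by (simp add: B.m_assoc)
  finally show "\<rho> a \<otimes> x \<in> corner B e" using assms rho_closed by (simp add: corner_iff)
qed

lemma e_corner: "e \<in> corner B e"
  using e_closed e_idem by (simp add: corner_iff)

lemma JM_carrier: "f \<in> carrier JM \<longleftrightarrow> f \<in> extensional (corner B e) \<and> (\<forall>x\<in>corner B e. f x \<in> corner_part e M) \<and>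
    (\<forall>x\<in>corner B e. \<forall>y\<in>corner B e. f (x \<oplus> y) = f x \<oplus>\<^bsub>M\<^esub> f y) \<and>
    (\<forall>a. \<forall>x\<in>corner B e. f (\<rho> a \<otimes> x) = \<rho> a \<odot>\<^bsub>M\<^esub> f x)"
  unfolding J_module_simps by (auto simp: PiE_iff eM_iff)

lemma JM_D:
  assumes "f \<in> carrier JM" "x \<in> corner B e"
  shows "f x \<in> corner_part e M" "f x \<in> carrier M" "y \<in> corner B e \<Longrightarrow> f (x \<oplus> y) = f x \<oplus>\<^bsub>M\<^esub> f y"
    "f (\<rho> a \<otimes> x) = \<rho> a \<odot>\<^bsub>M\<^esub> f x"
  using assms corner_partD(1)[of "f x" M] by (auto simp: JM_carrier)

lemma JM_I:
  assumes "\<And>x. x \<in> corner B e \<Longrightarrow> f x \<in> corner_part e M"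
    "\<And>x y. x \<in> corner B e \<Longrightarrow> y \<in> corner B e \<Longrightarrow> f (x \<oplus> y) = f x \<oplus>\<^bsub>M\<^esub> f y"
    "\<And>x a. x \<in> corner B e \<Longrightarrow> f (\<rho> a \<otimes> x) = \<rho> a \<odot>\<^bsub>M\<^esub> f x"
  shows "restrict f (corner B e) \<in> carrier JM"
  using assms corner_closed by (simp add: JM_carrier)

lemma M_corner_uminus: "x \<in> corner_part e M \<Longrightarrow> \<ominus>\<^bsub>M\<^esub> x \<in> corner_part e M"
  by (simp add: corner_part_def M.smult_minus e_closed)

lemma JM_left_module: "left_module B JM"
proof (rule left_module.intro[OF B.ring_axioms])
  show "abelian_group JM"
  proof (rule abelian_groupI)
    show "\<zero>\<^bsub>JM\<^esub> \<in> carrier JM"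
      unfolding J_module_simps(2) by (rule JM_I) (simp_all add: M_corner_closed M.smult_zero rho_closed)
    fix f assume f: "f \<in> carrier JM"
    note F = JM_D[OF f]
    have "(\<lambda>x\<in>corner B e. \<ominus>\<^bsub>M\<^esub> f x) \<in> carrier JM"
      by (rule JM_I) (simp_all add: F M_corner_uminus M.M.minus_add M.smult_minus rho_closed)
    moreover have "(\<lambda>x\<in>corner B e. \<ominus>\<^bsub>M\<^esub> f x) \<oplus>\<^bsub>JM\<^esub> f = \<zero>\<^bsub>JM\<^esub>"
      unfolding J_module_simps by (rule restrict_ext) (simp add: F M.M.l_neg)
    ultimately show "\<exists>y\<in>carrier JM. y \<oplus>\<^bsub>JM\<^esub> f = \<zero>\<^bsub>JM\<^esub>" by blast
    show "\<zero>\<^bsub>JM\<^esub> \<oplus>\<^bsub>JM\<^esub> f = f"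
      unfolding J_module_simps using f
      by (intro extensionalityI[of _ "corner B e"]) (simp_all add: F JM_carrier)
    fix g assume g: "g \<in> carrier JM"
    note G = JM_D[OF g]
    show "f \<oplus>\<^bsub>JM\<^esub> g \<in> carrier JM"
      unfolding J_module_simps(3)
      by (rule JM_I) (simp_all add: F G M_corner_closed M.smult_r_distr rho_closed M.smult_closed M.M.a_ac)
    show "f \<oplus>\<^bsub>JM\<^esub> g = g \<oplus>\<^bsub>JM\<^esub> f"
      unfolding J_module_simps(3) by (rule restrict_ext) (simp add: F G M.M.a_comm)
    fix h assume h: "h \<in> carrier JM"
    note H = JM_D[OF h]
    show "f \<oplus>\<^bsub>JM\<^esub> g \<oplus>\<^bsub>JM\<^esub> h = f \<oplus>\<^bsub>JM\<^esub> (g \<oplus>\<^bsub>JM\<^esub> h)"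
      unfolding J_module_simps(3) by (rule restrict_ext) (simp add: F G H M.M.a_assoc)
  qed
  show "left_module_axioms B JM"
  proof
    fix a b f g assume a: "a \<in> carrier B" and f: "f \<in> carrier JM"
    note F = JM_D[OF f]
    have inB: "x \<in> carrier B" if "x \<in> corner B e" for x using that by (simp add: corner_iff)
    show "a \<odot>\<^bsub>JM\<^esub> f \<in> carrier JM"
      unfolding J_module_simps(4)
      by (rule JM_I) (use a in \<open>simp_all add: F corner_closed B.l_distr inB B.m_assoc rho_closed\<close>)
    show "(a \<oplus> b) \<odot>\<^bsub>JM\<^esub> f = a \<odot>\<^bsub>JM\<^esub> f \<oplus>\<^bsub>JM\<^esub> b \<odot>\<^bsub>JM\<^esub> f" if b: "b \<in> carrier B"
      unfolding J_module_simps by (rule restrict_ext) (use a b in \<open>simp add: B.r_distr inB F(3) corner_closed\<close>)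
    show "(a \<otimes> b) \<odot>\<^bsub>JM\<^esub> f = a \<odot>\<^bsub>JM\<^esub> (b \<odot>\<^bsub>JM\<^esub> f)" if b: "b \<in> carrier B"
      unfolding J_module_simps by (rule restrict_ext) (use a b in \<open>simp add: B.m_assoc inB corner_closed\<close>)
    show "a \<odot>\<^bsub>JM\<^esub> (f \<oplus>\<^bsub>JM\<^esub> g) = a \<odot>\<^bsub>JM\<^esub> f \<oplus>\<^bsub>JM\<^esub> a \<odot>\<^bsub>JM\<^esub> g"
      unfolding J_module_simps by (rule restrict_ext) (use a in \<open>simp add: corner_closed\<close>)
  next
    fix f assume f: "f \<in> carrier JM"
    show "\<one> \<odot>\<^bsub>JM\<^esub> f = f"
      unfolding J_module_simps using f
      by (intro extensionalityI[of _ "corner B e"]) (simp_all add: corner_iff JM_carrier)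
  qed
qed

lemma J_embed_lhom:
  assumes N: "left_module B N" and h: "h \<in> lhom B N M"
  shows "compose (carrier N) (J_embed B e M) h \<in> lhom B N JM"
proof (rule lhom_compose[OF h _ N])
  have inB: "x \<in> carrier B" if "x \<in> corner B e" for x using that by (simp add: corner_iff)
  have "(\<lambda>m\<in>carrier M. \<lambda>x\<in>corner B e. x \<odot>\<^bsub>M\<^esub> m) \<in> lhom B M JM"
  proof (rule lhomI)
    fix m assume m: "m \<in> carrier M"
    show "(\<lambda>x\<in>corner B e. x \<odot>\<^bsub>M\<^esub> m) \<in> carrier JM"
    proof (rule JM_I)
      fix x assume x: "x \<in> corner B e"
      show "x \<odot>\<^bsub>M\<^esub> m \<in> corner_part e M"
        using corner_part_closed(4)[OF M.left_module_axioms _ _ m] x by (simp add: corner_iff)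
    qed (simp_all add: m inB M.smult_l_distr M.smult_assoc rho_closed)
    show "m \<oplus>\<^bsub>M\<^esub> m' \<in> carrier M \<and> (\<lambda>x\<in>corner B e. x \<odot>\<^bsub>M\<^esub> (m \<oplus>\<^bsub>M\<^esub> m')) =
        (\<lambda>x\<in>corner B e. x \<odot>\<^bsub>M\<^esub> m) \<oplus>\<^bsub>JM\<^esub> (\<lambda>x\<in>corner B e. x \<odot>\<^bsub>M\<^esub> m')" if "m' \<in> carrier M" for m'
      unfolding J_module_simps using m that by (auto simp: inB M.smult_r_distr intro!: restrict_ext)
    show "b \<odot>\<^bsub>M\<^esub> m \<in> carrier M \<and> (\<lambda>x\<in>corner B e. x \<odot>\<^bsub>M\<^esub> (b \<odot>\<^bsub>M\<^esub> m)) =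
        b \<odot>\<^bsub>JM\<^esub> (\<lambda>x\<in>corner B e. x \<odot>\<^bsub>M\<^esub> m)" if "b \<in> carrier B" for b
      unfolding J_module_simps using m that
      by (auto simp: inB M.smult_assoc M.smult_closed corner_closed intro!: restrict_ext)
  qed
  then show "J_embed B e M \<in> lhom B M JM" by (simp add: J_embed_def)
qed

text \<open>Evaluation at e is the adjunction between Hom over B into J M and R-linear maps of
  corners; the result is put into the normal form \<open>ext\<close>.\<close>

definition at_e :: "('b, 'n) module \<Rightarrow> ('n \<Rightarrow> 'b \<Rightarrow> 'm) \<Rightarrow> 'n \<Rightarrow> univ" where
  "at_e N F = ext N (\<lambda>x. F x e)"

text \<open>B acts on J M by right multiplication in the argument, so B-linearity turns the value at
  b into the value at e of the translate by b. Hence F is determined by its values at e.\<close>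

lemma lhom_JM_at_e:
  assumes N: "left_module B N" and F: "F \<in> lhom B N JM"
  shows "x \<in> carrier N \<Longrightarrow> b \<in> corner B e \<Longrightarrow> F x b = F (b \<odot>\<^bsub>N\<^esub> x) e" "corner_lin N (\<lambda>x. F x e)"
proof -
  interpret N: left_module B N by fact
  interpret F: left_module_hom B N JM F by (rule left_module_homI[OF N JM_left_module F])
  show Fb: "F x b = F (b \<odot>\<^bsub>N\<^esub> x) e" if "x \<in> carrier N" "b \<in> corner B e" for x b
    using that e_corner F.smult[of b x] by (simp add: J_module_simps(4) corner_iff)
  show "corner_lin N (\<lambda>x. F x e)"
  proof (rule corner_linI)
    fix x assume "x \<in> corner_part e N"
    then have x: "x \<in> carrier N" by (rule corner_partD)
    show "F x e \<in> corner_part e M" by (rule JM_D(1)[OF F.closed[OF x] e_corner])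
    show "F (x \<oplus>\<^bsub>N\<^esub> y) e = F x e \<oplus>\<^bsub>M\<^esub> F y e" if "y \<in> corner_part e N" for y
      using F.add[OF x corner_partD(1)[OF that]] e_corner by (simp add: J_module_simps(3))
    show "F (\<rho> a \<odot>\<^bsub>N\<^esub> x) e = \<rho> a \<odot>\<^bsub>M\<^esub> F x e" for a
      using F.smult[OF rho_closed x, of a] e_corner JM_D(4)[OF F.closed[OF x] e_corner, of a] rho_central[OF e_closed, of a]
      by (simp add: J_module_simps(4))
  qed
qed

text \<open>For surjectivity, a map mu comes from the homomorphism sending x to the function b to
  mu(b x); it is evaluated in the corner because b = e b.\<close>

lemma at_e_image:
  assumes N: "left_module B N"
  shows "at_e N ` lhom B N JM = L N"
proof (intro equalityI subsetI)
  interpret N: left_module B N by fact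
  fix \<psi> assume "\<psi> \<in> L N"
  then obtain \<mu> where \<mu>: "corner_lin N \<mu>" "\<psi> = ext N \<mu>" by (auto simp: L_def)
  note D = corner_linD[OF \<mu>(1)] corner_linD'[OF \<mu>(1)]
  have bx: "b \<odot>\<^bsub>N\<^esub> x \<in> corner_part e N" if "b \<in> corner B e" "x \<in> carrier N" for b x
    using corner_part_closed(4)[OF N _ _ that(2)] that(1) by (simp add: corner_iff)
  have inB: "x \<in> carrier B" if "x \<in> corner B e" for x using that by (simp add: corner_iff)
  define F where "F = (\<lambda>x\<in>carrier N. \<lambda>b\<in>corner B e. \<mu> (b \<odot>\<^bsub>N\<^esub> x))"
  have "F \<in> lhom B N JM"
    unfolding F_def
  proof (rule lhomI)
    fix x assume x: "x \<in> carrier N"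
    show "(\<lambda>b\<in>corner B e. \<mu> (b \<odot>\<^bsub>N\<^esub> x)) \<in> carrier JM"
    proof (rule JM_I)
      fix b assume b: "b \<in> corner B e"
      show "\<mu> (b \<odot>\<^bsub>N\<^esub> x) \<in> corner_part e M" using D bx[OF b x] by blast
      show "\<mu> ((b \<oplus> b') \<odot>\<^bsub>N\<^esub> x) = \<mu> (b \<odot>\<^bsub>N\<^esub> x) \<oplus>\<^bsub>M\<^esub> \<mu> (b' \<odot>\<^bsub>N\<^esub> x)" if b': "b' \<in> corner B e" for b'
        using D(3)[OF bx[OF b x] bx[OF b' x]] b b' x by (simp add: N.smult_l_distr inB)
      show "\<mu> ((\<rho> a \<otimes> b) \<odot>\<^bsub>N\<^esub> x) = \<rho> a \<odot>\<^bsub>M\<^esub> \<mu> (b \<odot>\<^bsub>N\<^esub> x)" for a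
        using D(4)[OF bx[OF b x], of a] b x by (simp add: N.smult_assoc inB rho_closed)
    qed
    show "x \<oplus>\<^bsub>N\<^esub> y \<in> carrier N \<and> (\<lambda>b\<in>corner B e. \<mu> (b \<odot>\<^bsub>N\<^esub> (x \<oplus>\<^bsub>N\<^esub> y))) =
        (\<lambda>b\<in>corner B e. \<mu> (b \<odot>\<^bsub>N\<^esub> x)) \<oplus>\<^bsub>JM\<^esub> (\<lambda>b\<in>corner B e. \<mu> (b \<odot>\<^bsub>N\<^esub> y))" if y: "y \<in> carrier N" for y
      unfolding J_module_simps using x y D(3)[OF bx[OF _ x] bx[OF _ y]]
      by (auto simp: N.smult_r_distr inB intro!: restrict_ext)
    show "c \<odot>\<^bsub>N\<^esub> x \<in> carrier N \<and> (\<lambda>b\<in>corner B e. \<mu> (b \<odot>\<^bsub>N\<^esub> (c \<odot>\<^bsub>N\<^esub> x))) =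
        c \<odot>\<^bsub>JM\<^esub> (\<lambda>b\<in>corner B e. \<mu> (b \<odot>\<^bsub>N\<^esub> x))" if c: "c \<in> carrier B" for c
      unfolding J_module_simps using x c
      by (auto simp: N.smult_assoc N.smult_closed inB corner_closed intro!: restrict_ext)
  qed
  moreover have "\<psi> = at_e N F"
    unfolding at_e_def \<mu>(2) ext_def F_def using e_corner
    by (auto simp: corner_part_def fun_eq_iff)
  ultimately show "\<psi> \<in> at_e N ` lhom B N JM" by blast
next
  fix \<psi> assume "\<psi> \<in> at_e N ` lhom B N JM"
  then obtain F where "F \<in> lhom B N JM" "\<psi> = at_e N F" by blast
  then show "\<psi> \<in> L N" using L_I[OF lhom_JM_at_e(2)[OF N]] by (simp add: at_e_def)
qed

lemma at_e_embed:
  assumes N: "left_module B N" and h: "h \<in> lhom B N M"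
  shows "at_e N (compose (carrier N) (J_embed B e M) h) = ext N h"
proof -
  have "e \<odot>\<^bsub>M\<^esub> h x = h x" if "x \<in> corner_part e N" for x
    using lhom_smult[OF h e_closed corner_partD(1)[OF that]] corner_partD(2)[OF that] by simp
  then show ?thesis unfolding at_e_def ext_def
    using e_corner by (auto simp: fun_eq_iff compose_eq J_embed_def corner_partD(1) lhom_closed[OF h])
qed

text \<open>Evaluation at e identifies Hom(N, J M) with L N and carries the image of Hom(N, M) onto
  H N, so \<open>cdim\<close> of the cokernel is the codimension.\<close>

lemma kappa_kdim:
  assumes N: "left_module B N" and k: "kdim N k"
  shows "kappa B \<rho> e N M = k"
proof -
  interpret N: left_module B N by fact
  let ?V = "hom_module B \<rho> N JM" and ?W = "(\<lambda>f. compose (carrier N) (J_embed B e M) f) ` lhom B N M"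
  interpret J: left_module B JM by (rule JM_left_module)
  have image: "at_e N ` ?W = H N"
    unfolding H_def image_image using at_e_embed[OF N] by simp
  have cl: "F x e \<in> carrier M" if "F \<in> lhom B N JM" "x \<in> corner_part e N" for F x
    using corner_linD(1)[OF lhom_JM_at_e(2)[OF N that(1)] that(2)] .
  interpret quotient_coordinates cscale ?V ?W "at_e N"
  proof (intro quotient_coordinates.intro quotient_coordinates_axioms.intro cscale.vector_space_axioms
      hom_module_abelian_group[OF N JM_left_module]; (unfold hom_module_simps)?)
    show "?W \<subseteq> lhom B N JM" using J_embed_lhom[OF N] by auto
    show "cscale.subspace (at_e N ` ?W)" unfolding image by (rule H_subspace[OF N])
    fix F assume F: "F \<in> lhom B N JM"
    interpret F: left_module_hom B N JM F by (rule left_module_homI[OF N JM_left_module F])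
    show "(\<lambda>x\<in>carrier N. \<rho> (fps_const c) \<odot>\<^bsub>JM\<^esub> F x) \<in> lhom B N JM" for c
      by (rule lhomI) (simp_all add: F.closed F.add F.smult J.smult_closed J.smult_r_distr N.smult_closed rho_closed
          smult_rho_commute[OF JM_left_module])
    show "at_e N (\<lambda>x\<in>carrier N. \<rho> (fps_const c) \<odot>\<^bsub>JM\<^esub> F x) = cscale c (at_e N F)" for c
    proof (rule ext)
      fix x
      show "at_e N (\<lambda>x\<in>carrier N. \<rho> (fps_const c) \<odot>\<^bsub>JM\<^esub> F x) x = cscale c (at_e N F) x"
      proof (cases "x \<in> corner_part e N")
        case True
        then have x: "x \<in> carrier N" by (rule corner_partD)
        have "(\<rho> (fps_const c) \<odot>\<^bsub>JM\<^esub> F x) e = \<rho> (fps_const c) \<odot>\<^bsub>M\<^esub> F x e"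
          using e_corner JM_D(4)[OF F.closed[OF x] e_corner, of "fps_const c"] rho_central[OF e_closed, of "fps_const c"]
          by (simp add: J_module_simps(4))
        then show ?thesis using True x cl[OF F True] by (simp add: at_e_def ext_apply cscale_def M.scal)
      qed (simp add: at_e_def ext_def cscale_def)
    qed
    show "at_e N (\<lambda>x\<in>carrier N. F x \<oplus>\<^bsub>JM\<^esub> G x) = at_e N F + at_e N G" if G: "G \<in> lhom B N JM" for G
    proof (rule ext)
      fix x
      show "at_e N (\<lambda>x\<in>carrier N. F x \<oplus>\<^bsub>JM\<^esub> G x) x = (at_e N F + at_e N G) x"
      proof (cases "x \<in> corner_part e N")
        case True
        then have x: "x \<in> carrier N" by (rule corner_partD)
        show ?thesis using True x cl[OF F True] cl[OF G True] e_corner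
          by (simp add: at_e_def ext_apply M.add J_module_simps(3))
      qed (simp add: at_e_def ext_def)
    qed
  next
    show "inj_on (at_e N) (lhom B N JM)"
    proof (rule inj_onI)
      fix F G assume F: "F \<in> lhom B N JM" and G: "G \<in> lhom B N JM" and eq: "at_e N F = at_e N G"
      have ee: "F x e = G x e" if x: "x \<in> corner_part e N" for x
        using fun_cong[OF eq, of x] x xi_inj[OF cl[OF F x] cl[OF G x]] by (simp add: at_e_def ext_apply)
      show "F = G"
      proof (rule lhom_eqI[OF F G])
        fix x assume x: "x \<in> carrier N"
        show "F x = G x"
        proof (rule extensionalityI[of _ "corner B e"])
          show "F x \<in> extensional (corner B e)" "G x \<in> extensional (corner B e)"
            using lhom_closed[OF F x] lhom_closed[OF G x] by (simp_all add: JM_carrier)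
          fix b assume b: "b \<in> corner B e"
          have "b \<odot>\<^bsub>N\<^esub> x \<in> corner_part e N"
            using corner_part_closed(4)[OF N _ _ x] b by (simp add: corner_iff)
          then show "F x b = G x b" using lhom_JM_at_e(1)[OF N F x b] lhom_JM_at_e(1)[OF N G x b] ee by simp
        qed
      qed
    qed
  qed
  have "codim cscale (at_e N ` carrier ?V) (at_e N ` ?W) k"
    unfolding hom_module_simps at_e_image[OF N] image by (rule k[unfolded kdim_def])
  from cdim_quot_module[OF this] show ?thesis unfolding kappa_def .
qed

end

section \<open>Mutation\<close>

context corner_module
begin

text \<open>W is a summand of the R-free module T, hence R-projective. The images under r of the
  basis of T generate W, and lifting them to V while keeping the coordinates of s w gives the
  R-linear section.\<close>

lemma summand_section:
  assumes T: "T \<in> CM B \<rho>" and WT: "is_summand B W T" and W: "left_module B W" and V: "left_module B V"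
    and g: "g \<in> lhom B V W" "g ` carrier V = carrier W"
  shows "\<exists>\<sigma>. (\<forall>w\<in>carrier W. \<sigma> w \<in> carrier V \<and> g (\<sigma> w) = w) \<and>
    (\<forall>w\<in>carrier W. \<forall>w'\<in>carrier W. \<sigma> (w \<oplus>\<^bsub>W\<^esub> w') = \<sigma> w \<oplus>\<^bsub>V\<^esub> \<sigma> w') \<and>
    (\<forall>w\<in>carrier W. \<forall>a. \<sigma> (\<rho> a \<odot>\<^bsub>W\<^esub> w) = \<rho> a \<odot>\<^bsub>V\<^esub> \<sigma> w)"
    and "\<exists>d w. rho_generated W d w"
proof -
  interpret W: left_module B W by fact
  interpret V: left_module B V by fact
  interpret g: left_module_hom B V W g by (rule left_module_homI[OF V W g(1)])
  obtain dT \<xi>T where "module_coordinates B \<rho> T dT \<xi>T" using CM_coordinates[OF T] by blast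
  then interpret T: module_coordinates B \<rho> T dT \<xi>T .
  interpret T: corner_module B \<rho> e n ex ey T dT \<xi>T by unfold_locales
  have LT: "left_module B T" using T by (simp add: CM_def)
  obtain s r where s: "s \<in> lhom B W T" and r: "r \<in> lhom B T W" and rs: "\<And>w. w \<in> carrier W \<Longrightarrow> r (s w) = w"
    using WT by (auto simp: is_summand_def)
  interpret s: left_module_hom B W T s by (rule left_module_homI[OF W LT s])
  interpret r: left_module_hom B T W r by (rule left_module_homI[OF LT W r])
  define b where "b l = r (T.\<eta> (unit_vec l))" for l
  have u: "T.\<eta> (unit_vec l) \<in> carrier T" if "l < dT" for l
    using that by (intro T.eta_closed) (auto simp: unit_vec_def vecs_def)
  have b: "b l \<in> carrier W" if "l < dT" for l unfolding b_def by (rule r.closed[OF u[OF that]])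
  have exp: "finsum W (\<lambda>l. \<rho> (\<xi>T (s w) l) \<odot>\<^bsub>W\<^esub> b l) {..<dT} = w" if w: "w \<in> carrier W" for w
  proof -
    have "finsum W (\<lambda>l. \<rho> (\<xi>T (s w) l) \<odot>\<^bsub>W\<^esub> b l) {..<dT} =
        finsum W (\<lambda>l. r (\<rho> (\<xi>T (s w) l) \<odot>\<^bsub>T\<^esub> T.\<eta> (unit_vec l))) {..<dT}"
      by (rule W.M.finsum_cong')
        (use u in \<open>auto simp: b_def r.smult rho_closed intro!: r.closed left_module.smult_closed[OF LT]\<close>)
    also have "\<dots> = r (finsum T (\<lambda>l. \<rho> (\<xi>T (s w) l) \<odot>\<^bsub>T\<^esub> T.\<eta> (unit_vec l)) {..<dT})"
      by (rule r.finsum[symmetric]) (use left_module.smult_closed[OF LT rho_closed u] in auto)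
    also have "\<dots> = w" using T.expand[OF s.closed[OF w]] rs[OF w] by simp
    finally show ?thesis .
  qed
  then show "\<exists>d w. rho_generated W d w"
    unfolding rho_generated_def using b by (intro exI[of _ dT] exI[of _ b]) (metis)
  have "\<exists>v\<in>carrier V. g v = b l" if "l < dT" for l using b[OF that] g(2) by (metis imageE)
  then obtain v where v: "\<And>l. l < dT \<Longrightarrow> v l \<in> carrier V" "\<And>l. l < dT \<Longrightarrow> g (v l) = b l" by metis
  define \<sigma> where "\<sigma> w = finsum V (\<lambda>l. \<rho> (\<xi>T (s w) l) \<odot>\<^bsub>V\<^esub> v l) {..<dT}" for w
  have cl: "(\<lambda>l. \<rho> (c l) \<odot>\<^bsub>V\<^esub> v l) \<in> {..<dT} \<rightarrow> carrier V" for c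
    using v by (auto intro!: V.smult_closed rho_closed)
  have scl: "\<sigma> w \<in> carrier V" for w unfolding \<sigma>_def by (rule V.M.finsum_closed[OF cl])
  have "g (\<sigma> w) = w" if w: "w \<in> carrier W" for w
  proof -
    have "g (\<sigma> w) = finsum W (\<lambda>l. g (\<rho> (\<xi>T (s w) l) \<odot>\<^bsub>V\<^esub> v l)) {..<dT}"
      unfolding \<sigma>_def by (rule g.finsum[OF _ cl]) simp
    also have "\<dots> = finsum W (\<lambda>l. \<rho> (\<xi>T (s w) l) \<odot>\<^bsub>W\<^esub> b l) {..<dT}"
      by (rule W.M.finsum_cong') (use v b in \<open>auto simp: g.smult rho_closed intro!: W.smult_closed\<close>)
    finally show ?thesis using exp[OF w] by simp
  qed
  moreover have "\<sigma> (w \<oplus>\<^bsub>W\<^esub> w') = \<sigma> w \<oplus>\<^bsub>V\<^esub> \<sigma> w'" if w: "w \<in> carrier W" "w' \<in> carrier W" for w w'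
  proof -
    have "\<sigma> (w \<oplus>\<^bsub>W\<^esub> w') = finsum V (\<lambda>l. \<rho> (\<xi>T (s w) l) \<odot>\<^bsub>V\<^esub> v l \<oplus>\<^bsub>V\<^esub> \<rho> (\<xi>T (s w') l) \<odot>\<^bsub>V\<^esub> v l) {..<dT}"
      unfolding \<sigma>_def
      by (rule V.M.finsum_cong')
        (use v w in \<open>auto simp: s.add T.add s.closed rho_add V.smult_l_distr rho_closed V.smult_closed\<close>)
    then show ?thesis unfolding \<sigma>_def using V.M.finsum_addf[OF cl cl] by simp
  qed
  moreover have "\<sigma> (\<rho> a \<odot>\<^bsub>W\<^esub> w) = \<rho> a \<odot>\<^bsub>V\<^esub> \<sigma> w" if w: "w \<in> carrier W" for w a
  proof -
    have "\<sigma> (\<rho> a \<odot>\<^bsub>W\<^esub> w) = finsum V (\<lambda>l. \<rho> a \<odot>\<^bsub>V\<^esub> (\<rho> (\<xi>T (s w) l) \<odot>\<^bsub>V\<^esub> v l)) {..<dT}"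
      unfolding \<sigma>_def
      by (rule V.M.finsum_cong')
        (use v w in \<open>auto simp: s.smult T.scal scal_apply s.closed rho_mult V.smult_assoc rho_closed V.smult_closed\<close>)
    then show ?thesis unfolding \<sigma>_def using V.smult_finsum[OF _ rho_closed cl] by simp
  qed
  ultimately show "\<exists>\<sigma>. (\<forall>w\<in>carrier W. \<sigma> w \<in> carrier V \<and> g (\<sigma> w) = w) \<and>
    (\<forall>w\<in>carrier W. \<forall>w'\<in>carrier W. \<sigma> (w \<oplus>\<^bsub>W\<^esub> w') = \<sigma> w \<oplus>\<^bsub>V\<^esub> \<sigma> w') \<and>
    (\<forall>w\<in>carrier W. \<forall>a. \<sigma> (\<rho> a \<odot>\<^bsub>W\<^esub> w) = \<rho> a \<odot>\<^bsub>V\<^esub> \<sigma> w)"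
    using scl by (intro exI[of _ \<sigma>]) simp
qed

lemma kdim_summand:
  assumes "T \<in> CM B \<rho>" "is_summand B W T" "left_module B W"
  shows "\<exists>k. kdim W k"
proof -
  interpret W: left_module B W by fact
  have "(\<lambda>x\<in>carrier W. x) ` carrier W = carrier W" by auto
  from summand_section(2)[OF assms assms(3) lhom_id[OF assms(3)] this]
  show ?thesis using kdim_exists[OF assms(3)] by blast
qed

text \<open>The extension hypothesis says precisely that restriction along f maps H V onto H U, the
  case of equality in the dimension count.\<close>

lemma kdim_short_exact:
  assumes ses: "short_exact B U V W f g" and W: "T \<in> CM B \<rho>" "is_summand B W T"
    and U: "kdim U kU" and kW: "kdim W kW"
  shows "kdim V kV \<Longrightarrow> kU + kW \<le> kV"
    and "(\<And>u. u \<in> lhom B U M \<Longrightarrow> \<exists>u'\<in>lhom B V M. \<forall>a\<in>carrier U. u' (f a) = u a) \<Longrightarrow> kdim V (kU + kW)"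
proof -
  note S = short_exactD[OF ses]
  obtain \<sigma> where \<sigma>: "\<forall>w\<in>carrier W. \<sigma> w \<in> carrier V \<and> g (\<sigma> w) = w"
    "\<forall>w\<in>carrier W. \<forall>w'\<in>carrier W. \<sigma> (w \<oplus>\<^bsub>W\<^esub> w') = \<sigma> w \<oplus>\<^bsub>V\<^esub> \<sigma> w'"
    "\<forall>w\<in>carrier W. \<forall>a. \<sigma> (\<rho> a \<odot>\<^bsub>W\<^esub> w) = \<rho> a \<odot>\<^bsub>V\<^esub> \<sigma> w"
    using summand_section(1)[OF W S(3,2,5,7)] by blast
  let ?p = "\<lambda>\<psi> u. if u \<in> corner_part e U then \<psi> (f u) else 0"
  interpret Q: quotient_sequence cscale cscale cscale "L U" "H U" "L V" "H V" "L W" "H W"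
    ?p "\<lambda>\<psi> v. if v \<in> corner_part e V then \<psi> (g v) else 0"
    by (rule quotient_sequence_short_exact[OF ses]) (use \<sigma> in auto)
  show "kdim V kV \<Longrightarrow> kU + kW \<le> kV"
    using U kW unfolding kdim_def by (rule Q.codim_le)
  assume ext: "\<And>u. u \<in> lhom B U M \<Longrightarrow> \<exists>u'\<in>lhom B V M. \<forall>a\<in>carrier U. u' (f a) = u a"
  have "H U \<subseteq> ?p ` H V"
  proof
    fix \<psi> assume "\<psi> \<in> H U"
    then obtain u where u: "u \<in> lhom B U M" "\<psi> = ext U u" by (auto simp: H_def)
    obtain u' where u': "u' \<in> lhom B V M" "\<forall>a\<in>carrier U. u' (f a) = u a" using ext[OF u(1)] by blast
    have fV: "f a \<in> corner_part e V" if "a \<in> corner_part e U" for a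
      using lhom_closed[OF S(4) corner_partD(1)[OF that]] lhom_smult[OF S(4) e_closed corner_partD(1)[OF that]]
        corner_partD(2)[OF that] by (simp add: corner_part_def)
    have "\<psi> = ?p (ext V u')"
      unfolding u(2) using u'(2) by (auto simp: fun_eq_iff ext_def fV corner_partD(1))
    then show "\<psi> \<in> ?p ` H V" using H_I[OF u'(1)] by blast
  qed
  then have "?p ` H V = H U" using Q.pH by blast
  then show "kdim V (kU + kW)" using U kW unfolding kdim_def by (intro Q.codim_add)
qed

text \<open>Adding one summand gives a split sequence, where maps extend along the retraction. The
  empty sum is zero, so there all R-linear maps are B-linear.\<close>

lemma kdim_dsum:
  assumes T: "T \<in> CM B \<rho>"
    and F: "\<And>i. i \<in> I \<Longrightarrow> left_module B (F i)" "\<And>i. i \<in> I \<Longrightarrow> is_summand B (F i) T" "\<And>i. i \<in> I \<Longrightarrow> kdim (F i) (k i)"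
    and I: "finite I"
  shows "kdim (dsum I F) (\<Sum>i\<in>I. k i)"
  using I F
proof (induction I rule: finite_induct)
  case empty
  have D: "left_module B (dsum {} F)" using B.ring_axioms by (intro dsum_left_module) auto
  interpret D: left_module B "dsum {} F" by (rule D)
  have "L (dsum {} F) \<subseteq> H (dsum {} F)"
  proof
    fix \<psi> assume \<psi>: "\<psi> \<in> L (dsum {} F)"
    then obtain \<mu> where \<mu>: "corner_lin (dsum {} F) \<mu>" "\<psi> = ext (dsum {} F) \<mu>" by (auto simp: L_def)
    show "\<psi> \<in> H (dsum {} F)"
    proof (rule L_divisible[OF D \<psi>])
      fix x j q assume x: "x \<in> corner_part e (dsum {} F)"
      have "x = \<zero>\<^bsub>dsum {} F\<^esub>" using corner_partD(1)[OF x] by (simp add: fun_eq_iff)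
      then have "\<mu> x = \<zero>\<^bsub>M\<^esub>" using corner_lin_zero[OF D \<mu>(1)] by simp
      then show "fps_nth (\<psi> x j) q = 0" using x by (simp add: \<mu>(2) ext_apply xi_zero)
    qed
  qed
  then have "codim cscale (L (dsum {} F)) (H (dsum {} F)) 0"
    unfolding codim_def spans_mod_def indep_mod_def by auto
  then show ?case by (simp add: kdim_def)
next
  case (insert a I)
  let ?J = "insert a I"
  have D: "left_module B (dsum I F)" "left_module B (dsum ?J F)"
    using B.ring_axioms insert.prems(1) by (auto intro!: dsum_left_module)
  interpret D: left_module B "dsum I F" by (rule D)
  interpret E: left_module B "dsum ?J F" by (rule D)
  have Fa: "left_module B (F a)" using insert.prems(1) by simp
  interpret Fa: left_module B "F a" by (rule Fa)
  have z: "abelian_monoid (F i)" if "i \<in> ?J" for i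
    using left_module.axioms(2)[OF insert.prems(1)[OF that]] by (rule abelian_group.axioms)
  let ?f = "\<lambda>x\<in>carrier (dsum I F). \<lambda>i\<in>?J. if i = a then \<zero>\<^bsub>F a\<^esub> else x i"
  let ?g = "\<lambda>y\<in>carrier (dsum ?J F). y a"
  let ?r = "\<lambda>y\<in>carrier (dsum ?J F). restrict y I"
  have fx: "(\<lambda>i\<in>?J. if i = a then \<zero>\<^bsub>F a\<^esub> else x i) \<in> carrier (dsum ?J F)" if "x \<in> carrier (dsum I F)" for x
    using that by auto
  have f: "?f \<in> lhom B (dsum I F) (dsum ?J F)"
  proof (rule lhomI[OF fx])
    fix x assume x: "x \<in> carrier (dsum I F)"
    show "x \<oplus>\<^bsub>dsum I F\<^esub> y \<in> carrier (dsum I F) \<and> (\<lambda>i\<in>?J. if i = a then \<zero>\<^bsub>F a\<^esub> else (x \<oplus>\<^bsub>dsum I F\<^esub> y) i) =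
        (\<lambda>i\<in>?J. if i = a then \<zero>\<^bsub>F a\<^esub> else x i) \<oplus>\<^bsub>dsum ?J F\<^esub> (\<lambda>i\<in>?J. if i = a then \<zero>\<^bsub>F a\<^esub> else y i)"
      if "y \<in> carrier (dsum I F)" for y
      using D.M.a_closed[OF x that] by (auto intro!: restrict_ext)
    show "b \<odot>\<^bsub>dsum I F\<^esub> x \<in> carrier (dsum I F) \<and> (\<lambda>i\<in>?J. if i = a then \<zero>\<^bsub>F a\<^esub> else (b \<odot>\<^bsub>dsum I F\<^esub> x) i) =
        b \<odot>\<^bsub>dsum ?J F\<^esub> (\<lambda>i\<in>?J. if i = a then \<zero>\<^bsub>F a\<^esub> else x i)" if b: "b \<in> carrier B" for b
      using D.smult_closed[OF b x] b by (auto simp: Fa.smult_zero intro!: restrict_ext)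
  qed
  have g: "?g \<in> lhom B (dsum ?J F) (F a)"
    by (rule dsum_proj) (use B.ring_axioms insert.prems(1) in auto)
  have r: "?r \<in> lhom B (dsum ?J F) (dsum I F)"
  proof (rule lhomI)
    fix y assume y: "y \<in> carrier (dsum ?J F)"
    show "restrict y I \<in> carrier (dsum I F)" using y by auto
    show "y \<oplus>\<^bsub>dsum ?J F\<^esub> z \<in> carrier (dsum ?J F) \<and>
        restrict (y \<oplus>\<^bsub>dsum ?J F\<^esub> z) I = restrict y I \<oplus>\<^bsub>dsum I F\<^esub> restrict z I" if "z \<in> carrier (dsum ?J F)" for z
      using E.M.a_closed[OF y that] by (auto intro!: restrict_ext)
    show "b \<odot>\<^bsub>dsum ?J F\<^esub> y \<in> carrier (dsum ?J F) \<and> restrict (b \<odot>\<^bsub>dsum ?J F\<^esub> y) I = b \<odot>\<^bsub>dsum I F\<^esub> restrict y I"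
      if b: "b \<in> carrier B" for b
      using E.smult_closed[OF b y] by (auto intro!: restrict_ext)
  qed
  have rf: "?r (?f x) = x" if x: "x \<in> carrier (dsum I F)" for x
  proof -
    have "restrict (\<lambda>i\<in>?J. if i = a then \<zero>\<^bsub>F a\<^esub> else x i) I = x"
      using x insert.hyps(2) by (auto simp: PiE_iff intro!: extensionalityI[of _ I])
    then show ?thesis using fx[OF x] x by (simp del: dsum_simps)
  qed
  have ses: "short_exact B (dsum I F) (dsum ?J F) (F a) ?f ?g"
    unfolding short_exact_def
  proof (intro conjI D Fa f g)
    show "inj_on ?f (carrier (dsum I F))" by (rule inj_on_inverseI[of _ ?r]) (rule rf)
    show "?f ` carrier (dsum I F) = {y \<in> carrier (dsum ?J F). ?g y = \<zero>\<^bsub>F a\<^esub>}"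
    proof (intro equalityI subsetI)
      fix y assume "y \<in> ?f ` carrier (dsum I F)"
      then obtain x where x: "x \<in> carrier (dsum I F)" "y = (\<lambda>i\<in>?J. if i = a then \<zero>\<^bsub>F a\<^esub> else x i)"
        by (auto simp del: dsum_simps)
      show "y \<in> {y \<in> carrier (dsum ?J F). ?g y = \<zero>\<^bsub>F a\<^esub>}" using fx[OF x(1)] unfolding x(2)[symmetric]
        by (simp add: x(2) del: dsum_simps)
    next
      fix y assume "y \<in> {y \<in> carrier (dsum ?J F). ?g y = \<zero>\<^bsub>F a\<^esub>}"
      then have y: "y \<in> carrier (dsum ?J F)" "y a = \<zero>\<^bsub>F a\<^esub>" by (auto simp del: dsum_simps)
      have ry: "restrict y I \<in> carrier (dsum I F)" using y(1) by auto
      have "y = (\<lambda>i\<in>?J. if i = a then \<zero>\<^bsub>F a\<^esub> else restrict y I i)"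
        using y by (auto simp: PiE_iff intro!: extensionalityI[of _ ?J])
      then have "y = ?f (restrict y I)" using ry by (simp del: dsum_simps)
      then show "y \<in> ?f ` carrier (dsum I F)" using ry by blast
    qed
    show "?g ` carrier (dsum ?J F) = carrier (F a)"
    proof (intro equalityI subsetI)
      fix w assume w: "w \<in> carrier (F a)"
      have i: "dsum_incl ?J F a w \<in> carrier (dsum ?J F)"
        by (rule lhom_closed[OF dsum_incl_lhom[where F = F] w]) (use insert.prems(1) in auto)
      then have "?g (dsum_incl ?J F a w) = w" using w by (simp add: dsum_incl_def del: dsum_simps)
      then show "w \<in> ?g ` carrier (dsum ?J F)" using i by (metis imageI)
    qed (use lhom_closed[OF g] in auto)
  qed
  have "kdim (dsum ?J F) ((\<Sum>i\<in>I. k i) + k a)"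
  proof (rule kdim_short_exact(2)[OF ses T])
    show "is_summand B (F a) T" "kdim (F a) (k a)" using insert.prems by auto
    show "kdim (dsum I F) (\<Sum>i\<in>I. k i)" using insert.IH insert.prems by simp
    show "\<exists>u'\<in>lhom B (dsum ?J F) M. \<forall>x\<in>carrier (dsum I F). u' (?f x) = u x" if u: "u \<in> lhom B (dsum I F) M" for u
    proof (intro bexI ballI)
      show "compose (carrier (dsum ?J F)) u ?r \<in> lhom B (dsum ?J F) M" by (rule lhom_compose[OF r u D(2)])
      fix x assume x: "x \<in> carrier (dsum I F)"
      have "compose (carrier (dsum ?J F)) u ?r (?f x) = u (?r (?f x))"
        by (rule compose_eq) (rule lhom_closed[OF f x])
      then show "compose (carrier (dsum ?J F)) u ?r (?f x) = u x" unfolding rf[OF x] .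
    qed
  qed
  then show ?case using insert.hyps by (simp add: add.commute)
qed

lemma kdim_multiples:
  assumes T: "T \<in> CM B \<rho>" and J: "finite J"
    and F: "\<And>j. j \<in> J \<Longrightarrow> left_module B (F j)" "\<And>j. j \<in> J \<Longrightarrow> is_summand B (F j) T" "\<And>j. j \<in> J \<Longrightarrow> kdim (F j) (k j)"
  shows "kdim (multiples J q F) (\<Sum>j\<in>J. q j * k j)"
proof -
  have "kdim (multiples J q F) (\<Sum>i\<in>(SIGMA j:J. {..<q j}). k (fst i))"
    unfolding multiples_def by (rule kdim_dsum[OF T]) (use J F in auto)
  also have "(\<Sum>i\<in>(SIGMA j:J. {..<q j}). k (fst i)) = (\<Sum>j\<in>J. \<Sum>l<q j. k j)"
    using J by (subst sum.Sigma) (auto simp: case_prod_beta)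
  finally show ?thesis by simp
qed

end

text \<open>The map u is extended through T first, as U is a summand of T: lift to Y, extend the
  lift from U to V, and return to M. The first move uses Ext(T, X) = 0, the second Ext(S, Y) = 0; T
  and S may differ, as each end of an exchange sequence belongs to its own cluster tilting
  object.\<close>

lemma extend_by_presentation:
  fixes B :: "'b ring"
  assumes pres: "short_exact B X Y M f g" and ses: "short_exact B U V W f' g'"
    and T: "left_module B T" "is_summand B U T" "ext_vanishes B 1 T X"
    and S: "left_module B S" "is_summand B W S" "ext_vanishes B 1 S Y"
    and u: "u \<in> lhom B U M"
  shows "\<exists>u'\<in>lhom B V M. \<forall>a\<in>carrier U. u' (f' a) = u a"
proof -
  note P = short_exactD[OF pres] and E = short_exactD[OF ses]
  obtain s r where s: "s \<in> lhom B U T" and r: "r \<in> lhom B T U" and rs: "\<And>x. x \<in> carrier U \<Longrightarrow> r (s x) = x"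
    using T(2) by (auto simp: is_summand_def)
  obtain h where h: "h \<in> lhom B T Y" "\<forall>x\<in>carrier T. g (h x) = compose (carrier T) u r x"
    using ext_vanishes_lift[OF T(3,1) pres lhom_compose[OF r u T(1)]] by blast
  obtain v where v: "v \<in> lhom B V Y" "\<forall>a\<in>carrier U. v (f' a) = compose (carrier U) h s a"
    using ext_vanishes_extend[OF S(3,1) P(2) ses S(2) lhom_compose[OF s h(1) E(1)]] by blast
  have "compose (carrier V) g v (f' a) = u a" if a: "a \<in> carrier U" for a
  proof -
    have "compose (carrier V) g v (f' a) = g (h (s a))"
      using v(2) a lhom_closed[OF E(4) a] by (simp add: compose_eq)
    also have "\<dots> = u (r (s a))" using h(2) lhom_closed[OF s a] by (simp add: compose_eq)
    finally show ?thesis using rs[OF a] by simp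
  qed
  then show ?thesis using lhom_compose[OF v(1) P(5) E(2)] by blast
qed

theorem theorem12p9:
  fixes k n star :: nat
    and D B :: "'d ring"
    and \<phi> :: "(path \<Rightarrow> complex fps) set \<Rightarrow> 'd"
    and S :: "'d set"
    and \<rho> :: "complex fps \<Rightarrow> 'd"
    and e :: 'd
    and T T' Tstar T0 T1 :: "('d, univ) module"
    and Q0 :: "'q set"
    and m :: "'q \<Rightarrow> nat"
    and Ts :: "'q \<Rightarrow> ('d, univ) module"
    and i :: 'q
    and M :: "('d, 'm) module"
    and f :: "univ \<Rightarrow> univ"
    and g :: "univ \<Rightarrow> 'm"
  assumes "0 < k" and "k < n" and "star < n"
    and "is_localisation (C_alg k n) (C_scalar k n fps_X) D \<phi>"
    and "order_over_C k n D \<phi> S"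
    and "B = D\<lparr>carrier := S\<rparr>"
    and "\<rho> = (\<lambda>r. \<phi> (C_scalar k n r))"
    and "e = \<phi> (C_idem k n star)"
    and rigid: "ext_vanishes (C_alg k n) 1 (ring_as_module \<phi> B) (ring_as_module \<phi> B)"
    and "cluster_tilting B \<rho> T"
    and "decomposition B T Q0 m Ts"
    and "i \<in> Q0" and "\<not> fg_projective B (Ts i)"
    and "mutation B \<rho> T Q0 m Ts i T' Tstar"
    and "M \<in> CM B \<rho>"
    and "generic_presentation B T T1 T0 M f g"
  shows "kappa_vec B \<rho> e Q0 (Ts(i := Tstar)) M =
         tropical_mutation Q0 (arrows B \<rho> T Ts) i (kappa_vec B \<rho> e Q0 Ts M)"
proof -
  obtain ex ey where "corner_order B \<rho> e n ex ey"
    using order_over_C_corner_order[OF assms(1-6)] unfolding assms(7,8) by blast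
  then interpret corner_order B \<rho> e n ex ey .
  obtain dM \<xi> where "module_coordinates B \<rho> M dM \<xi>" using CM_coordinates[OF assms(15)] by blast
  then interpret M: module_coordinates B \<rho> M dM \<xi> .
  interpret corner_module B \<rho> e n ex ey M dM \<xi> by unfold_locales
  have ct: "cluster_tilting B \<rho> T" "cluster_tilting B \<rho> T'"
    and dec: "decomposition B T Q0 m Ts" "decomposition B T' Q0 m (Ts(i := Tstar))"
    and i: "i \<in> Q0"
    using assms(10-12,14) by (auto simp: mutation_def)
  have CM: "T \<in> CM B \<rho>" "T' \<in> CM B \<rho>" using ct by (auto simp: cluster_tilting_def GP_def)
  then have LM: "left_module B T" "left_module B T'" by (auto simp: CM_def)
  note DT = decomposition_summand[OF B.ring_axioms LM(1) dec(1)]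
  note DT' = decomposition_summand[OF B.ring_axioms LM(2) dec(2)]
  have star: "is_summand B Tstar T'" "left_module B Tstar" using DT'(1,2)[OF i] by simp_all
  have rest: "is_summand B (Ts j) T'" if "j \<in> Q0" "j \<noteq> i" for j using DT'(1)[OF that(1)] that(2) by simp
  have extT: "ext_vanishes B 1 T X" if "X \<in> addcat B T" for X using ct(1) that by (auto simp: cluster_tilting_def)
  have extT': "ext_vanishes B 1 T' X" if "X \<in> addcat B T'" for X using ct(2) that by (auto simp: cluster_tilting_def)
  define \<kappa> where "\<kappa> j = kappa B \<rho> e (Ts j) M" for j
  define \<kappa>' where "\<kappa>' = kappa B \<rho> e Tstar M"
  have kj: "kdim (Ts j) (\<kappa> j)" if "j \<in> Q0" for j
    using kdim_summand[OF CM(1) DT(1,2)[OF that]] kappa_kdim[OF DT(2)[OF that]] unfolding \<kappa>_def by metis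
  have ks: "kdim Tstar \<kappa>'"
    using kdim_summand[OF CM(2) star] kappa_kdim[OF star(2)] unfolding \<kappa>'_def by metis
  have fin: "finite Q0" using dec(1) by (simp add: decomposition_def)
  let ?a = "arrows B \<rho> T Ts"
  let ?E = "multiples Q0 (\<lambda>j. ?a i j) Ts" and ?F = "multiples Q0 (\<lambda>j. ?a j i) Ts"
  have kE: "kdim ?E (\<Sum>j\<in>Q0. ?a i j * \<kappa> j)" and kF: "kdim ?F (\<Sum>j\<in>Q0. ?a j i * \<kappa> j)"
    by (intro kdim_multiples[OF CM(1) fin] DT(1,2) kj; assumption)+
  obtain fE gE where E: "short_exact B Tstar ?E (Ts i) fE gE" using assms(14) by (auto simp: mutation_def)
  obtain fF gF where F: "short_exact B (Ts i) ?F Tstar fF gF" using assms(14) by (auto simp: mutation_def)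
  have T10: "T1 \<in> addcat B T" "T0 \<in> addcat B T" and pres: "short_exact B T1 T0 M f g"
    using assms(16) by (auto simp: generic_presentation_def)
  \<comment> \<open>The splitting over R is obtained from T for the first sequence, which ends in
    \<open>T_i\<close>, and from T' for the second, which ends in \<open>T_i^*\<close>.\<close>
  have le: "\<kappa>' + \<kappa> i \<le> (\<Sum>j\<in>Q0. ?a i j * \<kappa> j)" "\<kappa> i + \<kappa>' \<le> (\<Sum>j\<in>Q0. ?a j i * \<kappa> j)"
    using kdim_short_exact(1)[OF E CM(1) DT(1)[OF i] ks kj[OF i] kE]
      kdim_short_exact(1)[OF F CM(2) star(1) kj[OF i] ks kF] by auto
  have "indecomposable B (Ts i)" using dec(1) i by (simp add: decomposition_def)
  then have "\<not> is_summand B (Ts i) T1 \<or> \<not> is_summand B (Ts i) T0"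
    using assms(16) DT(1)[OF i] by (auto simp: generic_presentation_def)
  then have eq: "\<kappa>' + \<kappa> i = (\<Sum>j\<in>Q0. ?a i j * \<kappa> j) \<or> \<kappa> i + \<kappa>' = (\<Sum>j\<in>Q0. ?a j i * \<kappa> j)"
  proof
    \<comment> \<open>The sub-object of this sequence, \<open>T_i^*\<close>, belongs to T', so
      lifting its maps needs T1 in add T'; extension to the middle term uses T, to which
      \<open>T_i\<close> belongs, and T0.\<close>
    assume not: "\<not> is_summand B (Ts i) T1"
    have "T1 \<in> addcat B T'" by (rule addcat_remove[OF T10(1) CM(1) dec(1) not LM(2) rest])
    from extend_by_presentation[OF pres E LM(2) star(1) extT'[OF this] LM(1) DT(1)[OF i] extT[OF T10(2)]]
    have "kdim ?E (\<kappa>' + \<kappa> i)" by (intro kdim_short_exact(2)[OF E CM(1) DT(1)[OF i] ks kj[OF i]])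
    then show ?thesis using kdim_unique[OF short_exactD(2)[OF E] _ kE] by blast
  next
    \<comment> \<open>The ends are exchanged: maps from \<open>T_i\<close> lift because T1 is in add
      T, while extending the lift tests \<open>T_i^*\<close> against T0, which therefore must lie in
      add T'.\<close>
    assume not: "\<not> is_summand B (Ts i) T0"
    have "T0 \<in> addcat B T'" by (rule addcat_remove[OF T10(2) CM(1) dec(1) not LM(2) rest])
    from extend_by_presentation[OF pres F LM(1) DT(1)[OF i] extT[OF T10(1)] LM(2) star(1) extT'[OF this]]
    have "kdim ?F (\<kappa> i + \<kappa>')" by (intro kdim_short_exact(2)[OF F CM(2) star(1) kj[OF i] ks])
    then show ?thesis using kdim_unique[OF short_exactD(2)[OF F] _ kF] by blast
  qed
  have sums: "(\<Sum>j\<in>Q0. int (?a i j) * int (\<kappa> j)) = int (\<Sum>j\<in>Q0. ?a i j * \<kappa> j)"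
    "(\<Sum>j\<in>Q0. int (?a j i) * int (\<kappa> j)) = int (\<Sum>j\<in>Q0. ?a j i * \<kappa> j)" by simp_all
  \<comment> \<open>Both sums bound the same number from above and one of them equals it, so it is
    their minimum.\<close>
  have main: "int \<kappa>' = min (\<Sum>j\<in>Q0. int (?a i j) * int (\<kappa> j)) (\<Sum>j\<in>Q0. int (?a j i) * int (\<kappa> j)) - int (\<kappa> i)"
    unfolding sums using le eq by linarith
  show ?thesis
  proof
    fix j
    show "kappa_vec B \<rho> e Q0 (Ts(i := Tstar)) M j =
         tropical_mutation Q0 (arrows B \<rho> T Ts) i (kappa_vec B \<rho> e Q0 Ts M) j"
      using main i by (simp add: kappa_vec_def tropical_mutation_def \<kappa>_def \<kappa>'_def)
  qed
qed

end
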